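(* Let $K$ be an arbitrary field. The standard equations for ruled cubic surfaces $S/K$ (in $\mathbb{P}^3$, with homogeneous coordinates $t_1,t_2,t_3,t_4$), which are not cones, are the following; this gives the classification of such surfaces over $K$. (1) $t_3t_1^2+t_4t_2^2=0$. If $\mathrm{char}\,K=2$, then there are no twists. For $\mathrm{char}\,K\neq2$ the twists are $t_3(t_1t_2)+t_4(at_1^2+t_2^2)=0$ with $a\in K^*$ not a square. (2) $t_3t_1t_2+t_4t_1^2+t_2^3=0$ (there are no twists). (3) $t_3t_1^2+t_4(t_2^2+t_1t_2)=0$ if $\mathrm{char}\,K=2$ (there are no twists).
   Context: A ruled cubic surface $S/K$ is a (reduced, irreducible) surface of degree $3$ in $\mathbb{P}^3$, defined over $K$, which is the union of a $1$-parameter family of lines. A standard equation is a normal form for the equation of $S$ obtained by a linear change of the homogeneous coordinates over $K$. A twist of one of these surfaces is another form of it over $K$: a surface over $K$ that is not equivalent to it by a linear change of coordinates over $K$, but becomes so over an algebraic closure of $K$.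
   Formalization: In characteristic 2 the claims that (1) and (3) have no twists are stated only for perfect K; for imperfect K they fail: if a is not a square, t3t1^2+at3^3+t4t2^2 is a twist of (1) and t1t2t3+t4(at1^2+t2^2) is a twist of (3). *)

theory Defs
  imports
    "HOL-Analysis.Analysis"
    "HOL-Library.Poly_Mapping"
    "HOL-Computational_Algebra.Computational_Algebra"
    "HOL-Algebra.Algebraic_Closure_Type"
begin

section \<open>Polynomials and linear changes of coordinates\<close>

text \<open>A polynomial in variables indexed by \<open>'n\<close> maps exponent vectors to coefficients;
  addition, multiplication and irreducibility come from the ring structure on
  finitely supported functions.\<close>

type_synonym ('n, 'a) mpoly = "('n \<Rightarrow>\<^sub>0 nat) \<Rightarrow>\<^sub>0 'a"

definition const_poly :: "'a \<Rightarrow> ('n, 'a::zero) mpoly" where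
  "const_poly c = Poly_Mapping.single 0 c"

definition var_poly :: "'n \<Rightarrow> ('n, 'a::zero_neq_one) mpoly" where
  "var_poly i = Poly_Mapping.single (Poly_Mapping.single i 1) 1"

text \<open>Substitution of \<open>x i\<close> for the \<open>i\<close>-th variable, the coefficients being mapped by \<open>\<phi>\<close>.\<close>

definition subst_poly ::
    "('a::zero \<Rightarrow> 'b) \<Rightarrow> ('n::finite \<Rightarrow> 'b) \<Rightarrow> ('n, 'a) mpoly \<Rightarrow> 'b::comm_semiring_1" where
  "subst_poly \<phi> x f =
     (\<Sum>m\<in>Poly_Mapping.keys f. \<phi> (Poly_Mapping.lookup f m) * (\<Prod>i\<in>UNIV. x i ^ Poly_Mapping.lookup m i))"

definition eval_poly :: "('n::finite, 'a::comm_semiring_1) mpoly \<Rightarrow> 'a ^ 'n \<Rightarrow> 'a" where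
  "eval_poly f x = subst_poly (\<lambda>c. c) (\<lambda>i. x $ i) f"

definition homogeneous_poly :: "nat \<Rightarrow> ('n::finite, 'a::zero) mpoly \<Rightarrow> bool" where
  "homogeneous_poly d f \<longleftrightarrow>
     (\<forall>m\<in>Poly_Mapping.keys f. (\<Sum>i\<in>UNIV. Poly_Mapping.lookup m i) = d)"

definition ac_poly :: "('n, 'a::field) mpoly \<Rightarrow> ('n, 'a alg_closure) mpoly" where
  "ac_poly f = Poly_Mapping.map to_ac f"

definition lin_subst :: "'a::comm_semiring_1 ^ 'n ^ 'n \<Rightarrow> ('n::finite, 'a) mpoly \<Rightarrow> ('n, 'a) mpoly" where
  "lin_subst A f =
     subst_poly const_poly (\<lambda>i. \<Sum>j\<in>UNIV. const_poly (A $ i $ j) * var_poly j) f"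

text \<open>Equations of the same surface differ by a nonzero constant factor, hence the scalar \<open>c\<close>.\<close>

definition lin_equiv :: "('n::finite, 'a::field) mpoly \<Rightarrow> ('n, 'a) mpoly \<Rightarrow> bool" where
  "lin_equiv f g \<longleftrightarrow>
     (\<exists>(A :: 'a ^ 'n ^ 'n) c. invertible A \<and> c \<noteq> 0 \<and> g = const_poly c * lin_subst A f)"


section \<open>Projective sets\<close>

text \<open>A subset of projective space is represented by the set of all nonzero vectors
  on its points; a single point is therefore a line through the origin without the origin.\<close>

definition proj_closed :: "('a::field ^ 'n::finite) set \<Rightarrow> bool" where
  "proj_closed C \<longleftrightarrow>
     (\<exists>F. (\<forall>f\<in>F. \<exists>d. homogeneous_poly d f) \<and> C = {x. x \<noteq> 0 \<and> (\<forall>f\<in>F. eval_poly f x = 0)})"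

definition proj_irreducible :: "('a::field ^ 'n::finite) set \<Rightarrow> bool" where
  "proj_irreducible C \<longleftrightarrow> proj_closed C \<and> C \<noteq> {} \<and>
     (\<forall>Y Z. proj_closed Y \<and> proj_closed Z \<and> C = Y \<union> Z \<longrightarrow> C = Y \<or> C = Z)"

definition is_proj_point :: "('a::field ^ 'n::finite) set \<Rightarrow> bool" where
  "is_proj_point C \<longleftrightarrow> (\<exists>x. x \<noteq> 0 \<and> C = {c *s x | c. c \<noteq> 0})"

text \<open>An irreducible closed set of Krull dimension one.\<close>

definition proj_curve :: "('a::field ^ 'n::finite) set \<Rightarrow> bool" where
  "proj_curve C \<longleftrightarrow> proj_irreducible C \<and> \<not> is_proj_point C \<and>
     (\<forall>Y. proj_irreducible Y \<and> Y \<subset> C \<longrightarrow> is_proj_point Y)"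

text \<open>Pluecker vector of the line through \<open>u\<close> and \<open>v\<close>, with the redundant coordinates
  \<open>p\<^sub>i\<^sub>j = - p\<^sub>j\<^sub>i\<close>, \<open>p\<^sub>i\<^sub>i = 0\<close> kept. It is nonzero exactly if \<open>u\<close> and \<open>v\<close>
  are linearly independent.\<close>

definition pluecker :: "'a::field ^ 4 \<Rightarrow> 'a ^ 4 \<Rightarrow> 'a ^ (4 \<times> 4)" where
  "pluecker u v = (\<chi> ij. u $ fst ij * v $ snd ij - u $ snd ij * v $ fst ij)"


section \<open>Ruled cubic surfaces\<close>

text \<open>A surface over \<open>K\<close> is given by its equation; its points, lines and irreducibility
  are understood over an algebraic closure.\<close>

definition surface_points :: "(4, 'a::field) mpoly \<Rightarrow> ('a alg_closure ^ 4) set" where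
  "surface_points f = {x. x \<noteq> 0 \<and> eval_poly (ac_poly f) x = 0}"

text \<open>Irreducibility of the equation makes the surface reduced as well. For surfaces
  that are not cones, irreducibility over \<open>K\<close> would amount to the same: an irreducible cubic
  form that becomes reducible over the algebraic closure is there a product of three linear
  forms, which have a common zero.\<close>

definition cubic_surface :: "(4, 'a::field) mpoly \<Rightarrow> bool" where
  "cubic_surface f \<longleftrightarrow> homogeneous_poly 3 f \<and> Factorial_Ring.irreducible (ac_poly f)"

text \<open>A one-parameter family of lines is a curve \<open>C\<close> in the Grassmannian of lines.\<close>

definition ruled :: "(4, 'a::field) mpoly \<Rightarrow> bool" where
  "ruled f \<longleftrightarrow>
     (\<exists>C. proj_curve C \<and> (\<forall>p\<in>C. \<exists>u v. p = pluecker u v) \<and>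
        surface_points f =
          {x. x \<noteq> 0 \<and> (\<exists>u v a b. pluecker u v \<in> C \<and> x = a *s u + b *s v)})"

definition cone :: "(4, 'a::field) mpoly \<Rightarrow> bool" where
  "cone f \<longleftrightarrow>
     (\<exists>v. v \<noteq> 0 \<and>
        (\<forall>x\<in>surface_points f. \<forall>a b. a *s x + b *s v \<noteq> 0 \<longrightarrow> a *s x + b *s v \<in> surface_points f))"

definition ruled_cubic_noncone :: "(4, 'a::field) mpoly \<Rightarrow> bool" where
  "ruled_cubic_noncone f \<longleftrightarrow> cubic_surface f \<and> ruled f \<and> \<not> cone f"

definition is_twist :: "(4, 'a::field) mpoly \<Rightarrow> (4, 'a) mpoly \<Rightarrow> bool" where
  "is_twist s f \<longleftrightarrow> \<not> lin_equiv s f \<and> lin_equiv (ac_poly s) (ac_poly f)"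


section \<open>The standard equations\<close>

text \<open>The index type has the four elements \<open>1, 2, 3, 4\<close> (where \<open>4 = 0\<close>).\<close>

abbreviation (input) t1 :: "(4, 'a::field) mpoly" where "t1 \<equiv> var_poly 1"
abbreviation (input) t2 :: "(4, 'a::field) mpoly" where "t2 \<equiv> var_poly 2"
abbreviation (input) t3 :: "(4, 'a::field) mpoly" where "t3 \<equiv> var_poly 3"
abbreviation (input) t4 :: "(4, 'a::field) mpoly" where "t4 \<equiv> var_poly 4"

definition std1 :: "(4, 'a::field) mpoly" where
  "std1 = t3 * t1^2 + t4 * t2^2"

definition std1_twist :: "'a \<Rightarrow> (4, 'a::field) mpoly" where
  "std1_twist a = t3 * (t1 * t2) + t4 * (const_poly a * t1^2 + t2^2)"

definition std2 :: "(4, 'a::field) mpoly" where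
  "std2 = t3 * t1 * t2 + t4 * t1^2 + t2^3"

definition std3 :: "(4, 'a::field) mpoly" where
  "std3 = t3 * t1^2 + t4 * (t2^2 + t1 * t2)"

text \<open>If \<open>K\<close> has characteristic 2 and \<open>a \<in> K\<close> is not a square, then
  \<open>std1_twist a\<close> is a twist of \<open>std3\<close>, and \<open>std1 + a t\<^sub>3\<^sup>3\<close> is a twist of \<open>std1\<close>.
  The absence of twists of \<open>std1\<close> and \<open>std3\<close> in characteristic 2 therefore needs
  \<open>K\<close> to be perfect.\<close>

definition standard_equations :: "(4, 'a::field) mpoly set" where
  "standard_equations = (if CHAR('a) = 2 then {std1, std2, std3} else {std1, std2})"

end

theory Submission
  imports Defs
begin

text \<open>Over the algebraic closure, a line along which a cubic surface is smooth is isolated among the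
  lines on the surface. So every line of the ruling contains a singular point, and if the surface is
  not a cone, there are infinitely many of these points. An irreducible cubic that is not a cone and has
  three singular points not on a line has only finitely many, so here they lie on a line, which is then
  double. The equation therefore amounts to a pencil of binary quadratic forms, which has only the
  three given normal forms. Conversely, each normal form is ruled by the lines that a twisted
  cubic in Pluecker space parametrises.

  For the twists, let a cubic over \<open>K\<close> arise from a normal form by a matrix \<open>A\<close> over the closure. In
  characteristic different from 2 the Hessian, and in characteristic 2 the kernel of the alternating
  form obtained by full polarisation, show that some rows of \<open>A\<close> are defined over \<open>K\<close> up to scalar
  factors or a quadratic extension. After a change of coordinates over \<open>K\<close> these rows are explicit, and
  the coefficients of the cubic determine the rest.\<close>

text \<open>Two obstacles shape the proof: all characteristics are treated together, and
  \<open>K\<close> may be finite or imperfect. Over an imperfect field the elements of the closure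
  fixed by all automorphisms over \<open>K\<close> need not lie in \<open>K\<close>, so there is no
  Galois descent here: an element is shown to lie in \<open>K\<close> by expressing it through
  coefficients of the given cubic. As 2 and 3 may vanish, cubic forms are not turned into symmetric
  tensors, singular points are described by expansions along lines, and polarisation is done by
  inclusion and exclusion. Polynomials over the infinite closure are determined by their values, so
  most of the work concerns functions. A smooth line is isolated because its deformations inside the
  surface are governed by two binary quadratic forms, the normal derivatives along the line. Their
  resultant vanishes only if they have a common zero, and that is a singular point. The Hessian
  determinants of the first two normal forms are 16 (t1 t2)^2 and 4 t1^4, so they single out the
  rows of \<open>A\<close> belonging to t1 and t2. Both are 0 in characteristic 2, which is why
  polarisation takes over there.\<close>

no_notation fps_nth (infixl "$" 75)

section \<open>Evaluation of polynomials\<close>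

text \<open>Evaluation, linear substitution and restriction to a line are all instances of
  \<open>subst_poly\<close>. Each respects sums and products because its coefficient map does, so
  this is proved once for an arbitrary such map.\<close>

locale coeff_hom =
  fixes \<phi> :: "'a::comm_semiring_1 \<Rightarrow> 'b::comm_semiring_1"
  assumes hom_0 [simp]: "\<phi> 0 = 0" and hom_1 [simp]: "\<phi> 1 = 1"
    and hom_add: "\<phi> (a + b) = \<phi> a + \<phi> b" and hom_mult: "\<phi> (a * b) = \<phi> a * \<phi> b"
begin

lemma hom_sum: "\<phi> (sum f S) = (\<Sum>i\<in>S. \<phi> (f i))"
  by (induction S rule: infinite_finite_induct) (auto simp: hom_add)

lemma hom_power: "\<phi> (a ^ n) = \<phi> a ^ n"
  by (induction n) (auto simp: hom_mult)

lemma hom_prod: "\<phi> (prod f S) = (\<Prod>i\<in>S. \<phi> (f i))"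
  by (induction S rule: infinite_finite_induct) (auto simp: hom_mult)

end

lemma poly_mapping_sum_single:
  "(\<Sum>m\<in>Poly_Mapping.keys f. Poly_Mapping.single m (Poly_Mapping.lookup f m)) = f"
  by (rule poly_mapping_eqI)
     (auto simp: lookup_sum lookup_single when_def in_keys_iff sum.delta[OF finite_keys] if_distrib
           cong: if_cong)

context coeff_hom
begin

text \<open>Cancellation can shrink the support of a sum of polynomials; a common larger index set
  avoids following the supports.\<close>

lemma subst_poly_superset:
  assumes "finite S" "Poly_Mapping.keys f \<subseteq> S"
  shows "subst_poly \<phi> x f =
    (\<Sum>m\<in>S. \<phi> (Poly_Mapping.lookup f m) * (\<Prod>i\<in>UNIV. x i ^ Poly_Mapping.lookup m i))"
  unfolding subst_poly_def
  by (rule sum.mono_neutral_left) (use assms in \<open>auto simp: in_keys_iff\<close>)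

lemma subst_poly_add: "subst_poly \<phi> x (f + g) = subst_poly \<phi> x f + subst_poly \<phi> x g"
proof -
  let ?S = "Poly_Mapping.keys f \<union> Poly_Mapping.keys g"
  have "subst_poly \<phi> x (f + g) =
    (\<Sum>m\<in>?S. \<phi> (Poly_Mapping.lookup (f + g) m) * (\<Prod>i\<in>UNIV. x i ^ Poly_Mapping.lookup m i))"
    by (rule subst_poly_superset) (simp_all add: Poly_Mapping.keys_add)
  then show ?thesis
    by (simp add: subst_poly_superset[where S = ?S] lookup_add hom_add algebra_simps sum.distrib)
qed

lemma subst_poly_0 [simp]: "subst_poly \<phi> x 0 = 0"
  by (simp add: subst_poly_def)

lemma subst_poly_sum: "subst_poly \<phi> x (sum f S) = (\<Sum>i\<in>S. subst_poly \<phi> x (f i))"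
  by (induction S rule: infinite_finite_induct) (auto simp: subst_poly_add)

lemma subst_poly_single:
  "subst_poly \<phi> x (Poly_Mapping.single m c) = \<phi> c * (\<Prod>i\<in>UNIV. x i ^ Poly_Mapping.lookup m i)"
  by (subst subst_poly_superset[where S = "{m}"]) (auto simp: in_keys_iff lookup_single when_def)

lemma subst_poly_mult: "subst_poly \<phi> x (f * g) = subst_poly \<phi> x f * subst_poly \<phi> x g"
proof -
  let ?s = "\<lambda>f m. Poly_Mapping.single m (Poly_Mapping.lookup f m)"
  let ?F = "Poly_Mapping.keys f" and ?G = "Poly_Mapping.keys g"
  have "f * g = (\<Sum>m\<in>?F. \<Sum>n\<in>?G. ?s f m * ?s g n)"
    by (simp add: sum_product[symmetric] poly_mapping_sum_single)
  then have "subst_poly \<phi> x (f * g) = (\<Sum>m\<in>?F. \<Sum>n\<in>?G. subst_poly \<phi> x (?s f m * ?s g n))"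
    by (simp add: subst_poly_sum)
  also have "\<dots> = (\<Sum>m\<in>?F. \<Sum>n\<in>?G. subst_poly \<phi> x (?s f m) * subst_poly \<phi> x (?s g n))"
    by (simp add: mult_single subst_poly_single lookup_add hom_mult power_add prod.distrib mult_ac)
  also have "\<dots> = subst_poly \<phi> x (\<Sum>m\<in>?F. ?s f m) * subst_poly \<phi> x (\<Sum>n\<in>?G. ?s g n)"
    by (simp add: sum_product subst_poly_sum)
  finally show ?thesis by (simp add: poly_mapping_sum_single)
qed

lemma subst_poly_1 [simp]: "subst_poly \<phi> x 1 = 1"
  using subst_poly_single[of x 0 1] by simp

lemma subst_poly_const [simp]: "subst_poly \<phi> x (const_poly c) = \<phi> c"
  by (simp add: const_poly_def subst_poly_single)

lemma subst_poly_var [simp]: "subst_poly \<phi> x (var_poly i) = x i"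
proof -
  have "(\<Prod>j\<in>UNIV. x j ^ Poly_Mapping.lookup (Poly_Mapping.single i 1) j)
    = (\<Prod>j\<in>UNIV. if j = i then x j else 1)"
    by (intro prod.cong) (auto simp: lookup_single when_def)
  then show ?thesis by (simp add: var_poly_def subst_poly_single)
qed

lemma coeff_hom_subst_poly: "coeff_hom (subst_poly \<phi> x)"
  by unfold_locales (auto simp: subst_poly_add subst_poly_mult)

end

lemma (in coeff_hom) hom_subst_poly:
  "\<phi> (subst_poly \<psi> x f) = subst_poly (\<lambda>c. \<phi> (\<psi> c)) (\<lambda>i. \<phi> (x i)) f"
  by (simp add: subst_poly_def hom_sum hom_mult hom_prod hom_power)

lemma coeff_hom_id: "coeff_hom (\<lambda>c. c)"
  by unfold_locales auto

lemma coeff_hom_const: "coeff_hom const_poly"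
  by unfold_locales (auto simp: const_poly_def single_add mult_single)

lemma coeff_hom_to_ac: "coeff_hom to_ac"
  by unfold_locales auto

lemma coeff_hom_eval: "coeff_hom (\<lambda>f. eval_poly f x)"
  unfolding eval_poly_def by (rule coeff_hom.coeff_hom_subst_poly[OF coeff_hom_id])

lemma eval_poly_add [simp]: "eval_poly (f + g) x = eval_poly f x + eval_poly g x"
  by (rule coeff_hom.hom_add[OF coeff_hom_eval])

lemma eval_poly_mult [simp]: "eval_poly (f * g) x = eval_poly f x * eval_poly g x"
  by (rule coeff_hom.hom_mult[OF coeff_hom_eval])

lemma eval_poly_0 [simp]: "eval_poly 0 x = 0"
  by (rule coeff_hom.hom_0[OF coeff_hom_eval])

lemma eval_poly_1 [simp]: "eval_poly 1 x = 1"
  by (rule coeff_hom.hom_1[OF coeff_hom_eval])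

lemma eval_poly_power [simp]: "eval_poly (f ^ n) x = eval_poly f x ^ n"
  by (rule coeff_hom.hom_power[OF coeff_hom_eval])

lemma eval_poly_sum [simp]: "eval_poly (sum f S) x = (\<Sum>i\<in>S. eval_poly (f i) x)"
  by (rule coeff_hom.hom_sum[OF coeff_hom_eval])

lemma eval_poly_const [simp]: "eval_poly (const_poly c) x = c"
  unfolding eval_poly_def by (rule coeff_hom.subst_poly_const[OF coeff_hom_id])

lemma eval_poly_var [simp]: "eval_poly (var_poly i) x = x $ i"
  unfolding eval_poly_def by (rule coeff_hom.subst_poly_var[OF coeff_hom_id])

lemma eval_poly_uminus [simp]:
  fixes f :: "('n::finite, 'a::comm_ring_1) mpoly"
  shows "eval_poly (- f) x = - eval_poly f x"
proof -
  have "eval_poly (- f) x + eval_poly f x = 0"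
    unfolding eval_poly_add[symmetric] by simp
  then show ?thesis by (simp add: eq_neg_iff_add_eq_0)
qed

lemma eval_poly_diff [simp]:
  fixes f :: "('n::finite, 'a::comm_ring_1) mpoly"
  shows "eval_poly (f - g) x = eval_poly f x - eval_poly g x"
  using eval_poly_add[of f "- g" x] by simp

lemma eval_lin_subst [simp]: "eval_poly (lin_subst A f) x = eval_poly f (A *v x)"
proof -
  have "eval_poly (lin_subst A f) x = subst_poly (\<lambda>c. c) (\<lambda>i. \<Sum>j\<in>UNIV. A $ i $ j * x $ j) f"
    unfolding lin_subst_def
    by (subst coeff_hom.hom_subst_poly[OF coeff_hom_eval]) simp
  then show ?thesis by (simp add: eval_poly_def matrix_vector_mult_def)
qed

section \<open>Extension of scalars to the algebraic closure\<close>

lemma lookup_ac_poly: "Poly_Mapping.lookup (ac_poly f) m = to_ac (Poly_Mapping.lookup f m)"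
  unfolding ac_poly_def by transfer (auto simp: when_def)

lemma coeff_hom_ac_poly: "coeff_hom (ac_poly :: ('n, 'a::field) mpoly \<Rightarrow> _)"
proof
  fix f g :: "('n, 'a) mpoly"
  show add: "ac_poly (f + g) = ac_poly f + ac_poly g" for f g :: "('n, 'a) mpoly"
    by (rule poly_mapping_eqI) (simp add: lookup_ac_poly lookup_add)
  show zero: "ac_poly 0 = 0" by (rule poly_mapping_eqI) (simp add: lookup_ac_poly)
  show "ac_poly 1 = 1" by (rule poly_mapping_eqI) (simp add: lookup_ac_poly lookup_one when_def)
  have sum: "ac_poly (sum h S) = (\<Sum>i\<in>S. ac_poly (h i))" for h :: "_ \<Rightarrow> ('n, 'a) mpoly" and S
    by (induction S rule: infinite_finite_induct) (auto simp: add zero)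
  have single: "ac_poly (Poly_Mapping.single m c) = Poly_Mapping.single m (to_ac c)"
    for m :: "'n \<Rightarrow>\<^sub>0 nat" and c :: 'a
    by (simp add: ac_poly_def)
  let ?s = "\<lambda>f m. Poly_Mapping.single m (Poly_Mapping.lookup f m)"
  let ?F = "Poly_Mapping.keys f" and ?G = "Poly_Mapping.keys g"
  have "f * g = (\<Sum>m\<in>?F. \<Sum>n\<in>?G. ?s f m * ?s g n)"
    by (simp add: sum_product[symmetric] poly_mapping_sum_single)
  then have "ac_poly (f * g) = (\<Sum>m\<in>?F. \<Sum>n\<in>?G. ac_poly (?s f m) * ac_poly (?s g n))"
    by (simp add: sum mult_single single)
  also have "\<dots> = ac_poly (\<Sum>m\<in>?F. ?s f m) * ac_poly (\<Sum>n\<in>?G. ?s g n)"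
    by (simp add: sum_product sum)
  finally show "ac_poly (f * g) = ac_poly f * ac_poly g" by (simp add: poly_mapping_sum_single)
qed

lemmas ac_poly_hom [simp] =
  coeff_hom.hom_0[OF coeff_hom_ac_poly] coeff_hom.hom_1[OF coeff_hom_ac_poly]
  coeff_hom.hom_add[OF coeff_hom_ac_poly] coeff_hom.hom_mult[OF coeff_hom_ac_poly]
  coeff_hom.hom_power[OF coeff_hom_ac_poly] coeff_hom.hom_sum[OF coeff_hom_ac_poly]

lemma ac_poly_const [simp]: "ac_poly (const_poly c) = const_poly (to_ac c)"
  by (simp add: ac_poly_def const_poly_def)

lemma ac_poly_var [simp]: "ac_poly (var_poly i) = var_poly i"
  by (simp add: ac_poly_def var_poly_def)

lemma ac_poly_eq_iff: "ac_poly f = ac_poly g \<longleftrightarrow> f = g"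
  by (metis lookup_ac_poly poly_mapping_eqI to_ac_eq_iff)

lemma subst_poly_ac_poly:
  "subst_poly \<phi> x (ac_poly f) = subst_poly (\<lambda>c. \<phi> (to_ac c)) x f"
proof -
  have "Poly_Mapping.keys (ac_poly f) = Poly_Mapping.keys f"
    by (auto simp: in_keys_iff lookup_ac_poly)
  then show ?thesis by (simp add: subst_poly_def lookup_ac_poly)
qed

definition ac_vec :: "'a::field ^ 'n \<Rightarrow> 'a alg_closure ^ 'n" where
  "ac_vec x = (\<chi> i. to_ac (x $ i))"

definition ac_mat :: "'a::field ^ 'n ^ 'm \<Rightarrow> 'a alg_closure ^ 'n ^ 'm" where
  "ac_mat A = (\<chi> i j. to_ac (A $ i $ j))"

lemma ac_vec_nth [simp]: "ac_vec x $ i = to_ac (x $ i)"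
  by (simp add: ac_vec_def)

lemma ac_mat_nth [simp]: "ac_mat A $ i $ j = to_ac (A $ i $ j)"
  by (simp add: ac_mat_def)

lemma ac_vec_fun [simp]: "($) (ac_vec x) = (\<lambda>i. to_ac (x $ i))"
  by auto

lemma eval_ac_poly_ac_vec: "eval_poly (ac_poly f) (ac_vec x) = to_ac (eval_poly f x)"
  unfolding eval_poly_def subst_poly_ac_poly
  by (simp add: coeff_hom.hom_subst_poly[OF coeff_hom_to_ac])

lemma ac_poly_lin_subst: "ac_poly (lin_subst A f) = lin_subst (ac_mat A) (ac_poly f)"
  unfolding lin_subst_def subst_poly_ac_poly
  by (subst coeff_hom.hom_subst_poly[OF coeff_hom_ac_poly]) simp

lemma ac_mat_mult: "ac_mat (A ** B) = ac_mat A ** ac_mat B"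
  by (simp add: vec_eq_iff matrix_matrix_mult_def to_ac_sum)

lemma invertible_ac_mat:
  assumes "invertible A" shows "invertible (ac_mat A)"
proof -
  obtain B where "A ** B = mat 1" "B ** A = mat 1" using assms by (auto simp: invertible_def)
  moreover have "ac_mat (mat 1) = mat 1" by (simp add: vec_eq_iff mat_def)
  ultimately show ?thesis unfolding invertible_def by (metis ac_mat_mult)
qed

lemma lin_equiv_ac_poly:
  assumes "lin_equiv f g" shows "lin_equiv (ac_poly f) (ac_poly g)"
proof -
  obtain A c where "invertible A" "c \<noteq> 0" "g = const_poly c * lin_subst A f"
    using assms by (auto simp: lin_equiv_def)
  then have "invertible (ac_mat A)" "to_ac c \<noteq> 0"
    "ac_poly g = const_poly (to_ac c) * lin_subst (ac_mat A) (ac_poly f)"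
    by (simp_all add: invertible_ac_mat ac_poly_lin_subst)
  then show ?thesis unfolding lin_equiv_def by blast
qed

subsection \<open>Homogeneous polynomials\<close>

lemma eval_homogeneous:
  assumes "homogeneous_poly d f"
  shows "eval_poly f (c *s x) = c ^ d * eval_poly f x"
proof -
  have "eval_poly f (c *s x) = (\<Sum>m\<in>Poly_Mapping.keys f. Poly_Mapping.lookup f m *
      (c ^ (\<Sum>i\<in>UNIV. Poly_Mapping.lookup m i) * (\<Prod>i\<in>UNIV. x $ i ^ Poly_Mapping.lookup m i)))"
    by (simp add: eval_poly_def subst_poly_def power_mult_distrib prod.distrib power_sum)
  also have "\<dots> = (\<Sum>m\<in>Poly_Mapping.keys f. Poly_Mapping.lookup f m *
      (c ^ d * (\<Prod>i\<in>UNIV. x $ i ^ Poly_Mapping.lookup m i)))"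
    using assms by (intro sum.cong) (auto simp: homogeneous_poly_def)
  finally show ?thesis by (simp add: eval_poly_def subst_poly_def sum_distrib_left mult_ac)
qed

lemma homogeneous_add: "homogeneous_poly d f \<Longrightarrow> homogeneous_poly d g \<Longrightarrow> homogeneous_poly d (f + g)"
  unfolding homogeneous_poly_def using Poly_Mapping.keys_add[of f g] by (meson UnE subsetD)

lemma homogeneous_mult:
  assumes "homogeneous_poly d f" "homogeneous_poly e g"
  shows "homogeneous_poly (d + e) (f * g)"
  unfolding homogeneous_poly_def
proof
  fix m assume "m \<in> Poly_Mapping.keys (f * g)"
  then obtain a b where "m = a + b" "a \<in> Poly_Mapping.keys f" "b \<in> Poly_Mapping.keys g"
    using keys_mult by blast
  with assms show "(\<Sum>i\<in>UNIV. Poly_Mapping.lookup m i) = d + e"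
    by (simp add: homogeneous_poly_def lookup_add sum.distrib)
qed

lemma homogeneous_0 [simp]: "homogeneous_poly d 0"
  by (simp add: homogeneous_poly_def)

lemma homogeneous_sum: "(\<And>i. i \<in> S \<Longrightarrow> homogeneous_poly d (f i)) \<Longrightarrow> homogeneous_poly d (sum f S)"
  by (induction S rule: infinite_finite_induct) (auto intro: homogeneous_add)

lemma homogeneous_const [simp]: "homogeneous_poly 0 (const_poly c)"
  by (auto simp: homogeneous_poly_def const_poly_def in_keys_iff lookup_single when_def split: if_splits)

lemma homogeneous_1 [simp]: "homogeneous_poly 0 1"
  by (auto simp: homogeneous_poly_def)

lemma homogeneous_var [simp]: "homogeneous_poly (Suc 0) (var_poly i)"
proof -
  have "(\<Sum>j\<in>UNIV. Poly_Mapping.lookup (Poly_Mapping.single i (Suc 0)) j) = Suc 0"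
    by (simp add: lookup_single when_def)
  then show ?thesis by (simp add: homogeneous_poly_def var_poly_def)
qed

lemma homogeneous_power: "homogeneous_poly d f \<Longrightarrow> homogeneous_poly (d * n) (f ^ n)"
proof (induction n)
  case 0
  then show ?case by simp
next
  case (Suc n)
  then show ?case using homogeneous_mult[of d f "d * n" "f ^ n"] by simp
qed

lemma homogeneous_prod:
  "(\<And>i. i \<in> S \<Longrightarrow> homogeneous_poly (d i) (f i)) \<Longrightarrow> homogeneous_poly (sum d S) (prod f S)"
proof (induction S rule: infinite_finite_induct)
  case (insert i S)
  then show ?case using homogeneous_mult[of "d i" "f i" "sum d S" "prod f S"] by simp
qed auto

lemma homogeneous_lin_subst:
  assumes "homogeneous_poly d f"
  shows "homogeneous_poly d (lin_subst A f)"
  unfolding lin_subst_def subst_poly_def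
proof (rule homogeneous_sum)
  fix m assume m: "m \<in> Poly_Mapping.keys f"
  let ?l = "\<lambda>i. \<Sum>j\<in>UNIV. const_poly (A $ i $ j) * var_poly j"
  have l: "homogeneous_poly 1 (?l i)" for i
    by (rule homogeneous_sum) (use homogeneous_mult[OF homogeneous_const homogeneous_var] in simp)
  have "homogeneous_poly (\<Sum>i\<in>UNIV. 1 * Poly_Mapping.lookup m i) (\<Prod>i\<in>UNIV. ?l i ^ Poly_Mapping.lookup m i)"
    by (rule homogeneous_prod) (rule homogeneous_power[OF l])
  with m assms have "homogeneous_poly d (\<Prod>i\<in>UNIV. ?l i ^ Poly_Mapping.lookup m i)"
    by (simp add: homogeneous_poly_def)
  from homogeneous_mult[OF homogeneous_const this]
  show "homogeneous_poly d (const_poly (Poly_Mapping.lookup f m) * (\<Prod>i\<in>UNIV. ?l i ^ Poly_Mapping.lookup m i))"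
    by simp
qed

lemma homogeneous_ac_poly [simp]: "homogeneous_poly d (ac_poly f) \<longleftrightarrow> homogeneous_poly d f"
  by (auto simp: homogeneous_poly_def in_keys_iff lookup_ac_poly)

subsection \<open>Polynomials over infinite fields are functions\<close>

text \<open>Over a finite field the product of all \<open>X - a\<close>, increased by 1, is a
  nonconstant polynomial without a root.\<close>

lemma infinite_UNIV_alg_closed: "infinite (UNIV :: 'a::alg_closed_field set)"
proof
  assume fin: "finite (UNIV :: 'a set)"
  define p where "p = (\<Prod>a\<in>(UNIV::'a set). [:-a, 1:]) + 1"
  have "Polynomial.degree (\<Prod>a\<in>(UNIV::'a set). [:-a, 1:]) = card (UNIV :: 'a set)"
    by (subst degree_prod_eq_sum_degree) auto
  moreover have "card (UNIV :: 'a set) > 0" using fin by (simp add: card_gt_0_iff)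
  ultimately have "Polynomial.degree p > 0"
    unfolding p_def by (subst degree_add_eq_left) auto
  then obtain x where "poly p x = 0" using alg_closed_imp_poly_has_root by blast
  moreover have "poly p x = 1" unfolding p_def using fin by (simp add: poly_prod)
  ultimately show False by simp
qed

lemma poly_eqI_infinite:
  fixes p q :: "'a::idom poly"
  assumes "infinite S" "\<And>x. x \<in> S \<Longrightarrow> poly p x = poly q x"
  shows "p = q"
proof (rule ccontr)
  assume "p \<noteq> q"
  then have "finite {x. poly (p - q) x = 0}" by (intro poly_roots_finite) auto
  moreover have "S \<subseteq> {x. poly (p - q) x = 0}" using assms by auto
  ultimately show False using assms(1) finite_subset by blast
qed

lemma prod_4: "prod f (UNIV::4 set) = f 1 * f 2 * f 3 * f 4"
  unfolding UNIV_4 by (simp add: ac_simps)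

lemma mpoly4_eqI:
  fixes f g :: "(4, 'a::alg_closed_field) mpoly"
  assumes eq: "\<And>x. eval_poly f x = eval_poly g x"
  shows "f = g"
proof (rule ccontr)
  assume "f \<noteq> g"
  define h where "h = f - g"
  let ?H = "Poly_Mapping.keys h"
  have h0: "h \<noteq> 0" using \<open>f \<noteq> g\<close> by (simp add: h_def)
  \<comment> \<open>Kronecker substitution: distinct exponent vectors go to distinct powers of one variable.\<close>
  define N where "N = Suc (Max (\<Union>m\<in>?H. range (Poly_Mapping.lookup m)))"
  have N: "Poly_Mapping.lookup m i < N" if "m \<in> ?H" for m i
    unfolding N_def using that by (intro le_imp_less_Suc Max_ge) auto
  define e where "e m = Poly_Mapping.lookup m 1 + N * (Poly_Mapping.lookup m 2 + N *
    (Poly_Mapping.lookup m 3 + N * Poly_Mapping.lookup m 4))" for m :: "4 \<Rightarrow>\<^sub>0 nat"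
  \<comment> \<open>Uniqueness of digits in base \<open>N\<close>, applied three times to read off
    all four exponents from \<open>e m\<close>.\<close>
  have dec: "a = c \<and> b = d" if "a < N" "c < N" "a + N * b = c + N * d" for a b c d :: nat
  proof -
    have "(a + N * b) mod N = a" "(c + N * d) mod N = c" using that(1,2) by simp_all
    with that show ?thesis by auto
  qed
  have inj: "inj_on e ?H"
  proof (rule inj_onI)
    fix m n assume m: "m \<in> ?H" and n: "n \<in> ?H" and eq: "e m = e n"
    note N = N[OF m] N[OF n]
    have 1: "Poly_Mapping.lookup m 1 = Poly_Mapping.lookup n 1 \<and>
      Poly_Mapping.lookup m 2 + N * (Poly_Mapping.lookup m 3 + N * Poly_Mapping.lookup m 4)
      = Poly_Mapping.lookup n 2 + N * (Poly_Mapping.lookup n 3 + N * Poly_Mapping.lookup n 4)"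
      using eq unfolding e_def by (intro dec N)
    then have 2: "Poly_Mapping.lookup m 2 = Poly_Mapping.lookup n 2 \<and>
      Poly_Mapping.lookup m 3 + N * Poly_Mapping.lookup m 4
      = Poly_Mapping.lookup n 3 + N * Poly_Mapping.lookup n 4"
      by (intro dec N) simp
    then have "Poly_Mapping.lookup m 3 = Poly_Mapping.lookup n 3 \<and>
      Poly_Mapping.lookup m 4 = Poly_Mapping.lookup n 4"
      by (intro dec N) simp
    with 1 2 show "m = n"
      by (intro poly_mapping_eqI) (metis exhaust_4)
  qed
  define p where "p = (\<Sum>m\<in>?H. Polynomial.monom (Poly_Mapping.lookup h m) (e m))"
  have "poly p t = eval_poly h (\<chi> i. if i = 1 then t else if i = 2 then t ^ N
    else if i = 3 then t ^ (N * N) else t ^ (N * N * N))" for t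
  proof -
    have "t ^ e m = (\<Prod>i\<in>UNIV. (\<chi> i. if i = 1 then t else if i = 2 then t ^ N
        else if i = 3 then t ^ (N * N) else t ^ (N * N * N)) $ i ^ Poly_Mapping.lookup m i)"
      for m :: "4 \<Rightarrow>\<^sub>0 nat"
    proof -
      have "e m = Poly_Mapping.lookup m 1 + N * Poly_Mapping.lookup m 2 +
        (N * N) * Poly_Mapping.lookup m 3 + (N * N * N) * Poly_Mapping.lookup m 4"
        by (simp add: e_def algebra_simps)
      then show ?thesis by (simp add: prod_4 power_add power_mult)
    qed
    then show ?thesis
      by (simp add: p_def poly_sum poly_monom eval_poly_def subst_poly_def)
  qed
  then have "poly p t = poly 0 t" for t using eq by (simp add: h_def)
  then have p0: "p = 0" using infinite_UNIV_alg_closed by (intro poly_eqI_infinite[of UNIV]) auto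
  obtain m where m: "m \<in> ?H" using h0 by (metis all_not_in_conv keys_eq_empty)
  have "Polynomial.coeff p (e m) = (\<Sum>n\<in>?H. if n = m then Poly_Mapping.lookup h n else 0)"
    unfolding p_def coeff_sum using inj m by (intro sum.cong) (auto simp: inj_on_eq_iff)
  also have "\<dots> = Poly_Mapping.lookup h m" using m by simp
  finally show False using m p0 by (simp add: in_keys_iff)
qed

lemma mpoly4_eq_iff:
  fixes f g :: "(4, 'a::alg_closed_field) mpoly"
  shows "f = g \<longleftrightarrow> (\<forall>x. eval_poly f x = eval_poly g x)"
  using mpoly4_eqI by auto

section \<open>Cubic forms in four variables\<close>

definition vec4 :: "'a \<Rightarrow> 'a \<Rightarrow> 'a \<Rightarrow> 'a \<Rightarrow> 'a ^ 4" where
  "vec4 a b c d = (\<chi> i. if i = 1 then a else if i = 2 then b else if i = 3 then c else d)"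

lemma vec4_nth [simp]:
  "vec4 a b c d $ 1 = a" "vec4 a b c d $ 2 = b" "vec4 a b c d $ 3 = c" "vec4 a b c d $ 4 = d"
  by (simp_all add: vec4_def)

lemma vec4_eq_iff: "x = y \<longleftrightarrow> x $ 1 = y $ 1 \<and> x $ 2 = y $ 2 \<and> x $ 3 = y $ 3 \<and> x $ (4::4) = y $ 4"
  by (simp add: vec_eq_iff forall_4)

lemma mult_vec_nth_4: "(A *v x) $ i = A $ i $ 1 * x $ 1 + A $ i $ 2 * x $ 2 + A $ i $ 3 * x $ 3 + A $ i $ (4::4) * x $ 4"
  by (simp add: matrix_vector_mult_def sum_4)

lemma invertible_iff_ker: "invertible (A :: 'a::field ^ 'n ^ 'n) \<longleftrightarrow> (\<forall>x. A *v x = 0 \<longrightarrow> x = 0)"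
  by (metis invertible_left_inverse matrix_left_invertible_ker)

lemma invertible_inverse:
  assumes "invertible (A :: 'a::field ^ 'n ^ 'n)"
  obtains B where "invertible B" "A ** B = mat 1" "B ** A = mat 1"
    "\<And>x. A *v (B *v x) = x" "\<And>x. B *v (A *v x) = x"
  using assms unfolding invertible_def
  by (metis matrix_vector_mul_assoc matrix_vector_mul_lid)

lemma invertible_mult:
  fixes A B :: "'a::field ^ 'n ^ 'n"
  assumes "invertible A" "invertible B" shows "invertible (A ** B)"
  unfolding invertible_iff_ker
proof (intro allI impI)
  fix x assume "(A ** B) *v x = 0"
  then have "A *v (B *v x) = 0" by (simp only: matrix_vector_mul_assoc)
  then have "B *v x = 0" using assms(1) unfolding invertible_iff_ker by blast
  then show "x = 0" using assms(2) unfolding invertible_iff_ker by blast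
qed

lemma matrix_vector_axpy: "(A :: 'a::field ^ 'n ^ 'm) *v (x + t *s y) = A *v x + t *s (A *v y)"
  by (simp add: matrix_vector_right_distrib matrix_vector_mult_scaleR vector_scalar_commute)

text \<open>Linear equivalence for functions. Over the closure it agrees with
  \<open>lin_equiv\<close>, because there a polynomial is determined by its values; normal forms can
  then be compared by computing with values only.\<close>

definition feq :: "('a::field ^ 4 \<Rightarrow> 'a) \<Rightarrow> ('a ^ 4 \<Rightarrow> 'a) \<Rightarrow> bool" where
  "feq F G \<longleftrightarrow> (\<exists>A c. invertible A \<and> c \<noteq> 0 \<and> (\<forall>x. G x = c * F (A *v x)))"

lemma feqI:
  assumes "\<And>x. A *v x = 0 \<Longrightarrow> x = 0" "c \<noteq> 0" "\<And>x. G x = c * F (A *v x)"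
  shows "feq F G"
  using assms unfolding feq_def invertible_iff_ker by blast

lemma feq_refl: "feq F F"
  unfolding feq_def
  by (rule exI[of _ "mat 1"], rule exI[of _ 1]) (auto simp: invertible_def)

lemma feq_trans:
  assumes "feq F G" "feq G H" shows "feq F H"
proof -
  obtain A c B d where "invertible A" "c \<noteq> 0" "\<And>x. G x = c * F (A *v x)"
    "invertible B" "d \<noteq> 0" "\<And>x. H x = d * G (B *v x)"
    using assms unfolding feq_def by metis
  then have "invertible (A ** B)" "d * c \<noteq> 0" "\<And>x. H x = (d * c) * F ((A ** B) *v x)"
    by (simp_all add: invertible_mult matrix_vector_mul_assoc[symmetric])
  then show ?thesis unfolding feq_def by blast
qed

lemma feq_sym:
  assumes "feq F G" shows "feq G F"
proof -
  obtain A c where A: "invertible A" "c \<noteq> 0" "\<And>x. G x = c * F (A *v x)"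
    using assms unfolding feq_def by metis
  obtain B where "invertible B" "\<And>x. A *v (B *v x) = x" using invertible_inverse[OF A(1)] by metis
  with A have "\<And>x. F x = (1 / c) * G (B *v x)" "1 / c \<noteq> 0" by simp_all
  with \<open>invertible B\<close> show ?thesis unfolding feq_def by blast
qed

lemma lin_equiv_iff_feq:
  fixes f g :: "(4, 'a::alg_closed_field) mpoly"
  shows "lin_equiv f g \<longleftrightarrow> feq (eval_poly f) (eval_poly g)"
  unfolding lin_equiv_def feq_def mpoly4_eq_iff by simp

text \<open>\<open>K\<close> may be finite, so an identity between polynomials over \<open>K\<close>
  has to be tested at points of the closure, while the matrix and the scalar remain over
  \<open>K\<close>.\<close>

lemma lin_equiv_iff_ac:
  fixes f g :: "(4, 'a::field) mpoly"
  shows "lin_equiv f g \<longleftrightarrow> (\<exists>A c. invertible A \<and> c \<noteq> 0 \<and>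
    (\<forall>x. eval_poly (ac_poly g) x = to_ac c * eval_poly (ac_poly f) (ac_mat A *v x)))"
proof -
  have "g = const_poly c * lin_subst A f \<longleftrightarrow>
    (\<forall>x. eval_poly (ac_poly g) x = to_ac c * eval_poly (ac_poly f) (ac_mat A *v x))" for A c
  proof -
    have "g = const_poly c * lin_subst A f \<longleftrightarrow> ac_poly g = ac_poly (const_poly c * lin_subst A f)"
      by (rule ac_poly_eq_iff[symmetric])
    then show ?thesis by (simp add: mpoly4_eq_iff ac_poly_lin_subst)
  qed
  then show ?thesis by (simp add: lin_equiv_def)
qed

lemma ac_mat_1: "ac_mat (mat 1) = mat 1"
  by (simp add: vec_eq_iff mat_def)

lemma ac_mat_mv: "ac_mat A *v ac_vec x = ac_vec (A *v x)"
  by (simp add: vec_eq_iff matrix_vector_mult_def to_ac_sum)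

lemma lin_equiv_trans:
  fixes f g h :: "(4, 'a::field) mpoly"
  assumes "lin_equiv f g" "lin_equiv g h" shows "lin_equiv f h"
proof -
  obtain A c B d where "invertible A" "c \<noteq> 0"
    "\<And>x. eval_poly (ac_poly g) x = to_ac c * eval_poly (ac_poly f) (ac_mat A *v x)"
    "invertible B" "d \<noteq> 0"
    "\<And>x. eval_poly (ac_poly h) x = to_ac d * eval_poly (ac_poly g) (ac_mat B *v x)"
    using assms unfolding lin_equiv_iff_ac by metis
  then have "invertible (A ** B)" "d * c \<noteq> 0"
    "\<And>x. eval_poly (ac_poly h) x = to_ac (d * c) * eval_poly (ac_poly f) (ac_mat (A ** B) *v x)"
    by (simp_all add: invertible_mult matrix_vector_mul_assoc[symmetric] ac_mat_mult)
  then show ?thesis unfolding lin_equiv_iff_ac by blast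
qed

lemma lin_equiv_sym:
  fixes f g :: "(4, 'a::field) mpoly"
  assumes "lin_equiv f g" shows "lin_equiv g f"
proof -
  obtain A c where A: "invertible A" "c \<noteq> 0"
    "\<And>x. eval_poly (ac_poly g) x = to_ac c * eval_poly (ac_poly f) (ac_mat A *v x)"
    using assms unfolding lin_equiv_iff_ac by metis
  obtain B where B: "invertible B" "A ** B = mat 1" using invertible_inverse[OF A(1)] by metis
  have "ac_mat A *v (ac_mat B *v x) = x" for x :: "'a alg_closure ^ 4"
  proof -
    have "ac_mat A ** ac_mat B = (mat 1 :: 'a alg_closure ^ 4 ^ 4)"
      unfolding ac_mat_mult[symmetric] B(2) by (simp add: vec_eq_iff mat_def)
    then show ?thesis by (simp add: matrix_vector_mul_assoc)
  qed
  with A have "\<And>x. eval_poly (ac_poly f) x = to_ac (1 / c) * eval_poly (ac_poly g) (ac_mat B *v x)"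
    "1 / c \<noteq> 0" by simp_all
  with B(1) show ?thesis unfolding lin_equiv_iff_ac by blast
qed

text \<open>One coefficient for each of the twenty monomials: only the entries of \<open>c\<close>
  with weakly increasing indices occur. A symmetric coefficient array would require division by 2
  and 3.\<close>

definition cub :: "(4 \<Rightarrow> 4 \<Rightarrow> 4 \<Rightarrow> 'a) \<Rightarrow> 'a::comm_semiring_1 ^ 4 \<Rightarrow> 'a" where
  "cub c x =
     c 1 1 1 * x$1^3 + c 1 1 2 * x$1^2 * x$2 + c 1 1 3 * x$1^2 * x$3 + c 1 1 4 * x$1^2 * x$4 +
     c 1 2 2 * x$1 * x$2^2 + c 1 2 3 * x$1 * x$2 * x$3 + c 1 2 4 * x$1 * x$2 * x$4 +
     c 1 3 3 * x$1 * x$3^2 + c 1 3 4 * x$1 * x$3 * x$4 + c 1 4 4 * x$1 * x$4^2 +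
     c 2 2 2 * x$2^3 + c 2 2 3 * x$2^2 * x$3 + c 2 2 4 * x$2^2 * x$4 +
     c 2 3 3 * x$2 * x$3^2 + c 2 3 4 * x$2 * x$3 * x$4 + c 2 4 4 * x$2 * x$4^2 +
     c 3 3 3 * x$3^3 + c 3 3 4 * x$3^2 * x$4 + c 3 4 4 * x$3 * x$4^2 + c 4 4 4 * x$4^3"

definition cub_poly :: "(4 \<Rightarrow> 4 \<Rightarrow> 4 \<Rightarrow> 'a) \<Rightarrow> (4, 'a::comm_semiring_1) mpoly" where
  "cub_poly c = cub (\<lambda>i j k. const_poly (c i j k)) (\<chi> i. var_poly i)"

lemma eval_cub_poly [simp]: "eval_poly (cub_poly c) x = cub c x"
  by (simp add: cub_poly_def cub_def)

lemma ac_cub_poly [simp]: "ac_poly (cub_poly c) = cub_poly (\<lambda>i j k. to_ac (c i j k))"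
  by (simp add: cub_poly_def cub_def)

lemma cub_add: "cub c x + cub d x = cub (\<lambda>i j k. c i j k + d i j k) x"
  by (simp add: cub_def algebra_simps)

lemma const_poly_add: "const_poly (a + b :: 'a::comm_semiring_1) = const_poly a + const_poly b"
  by (rule coeff_hom.hom_add[OF coeff_hom_const])

lemma const_poly_0 [simp]: "const_poly (0 :: 'a::comm_semiring_1) = 0"
  by (rule coeff_hom.hom_0[OF coeff_hom_const])

lemma var_poly_power: "var_poly i ^ n = Poly_Mapping.single (Poly_Mapping.single i n) (1::'a::comm_semiring_1)"
proof (induction n)
  case (Suc n)
  then show ?case
    by (simp add: var_poly_def mult_single Poly_Mapping.single_add[symmetric])
qed simp

lemma single_eq_product:
  fixes a :: "'a::comm_semiring_1"
  shows "Poly_Mapping.single m a = const_poly a * var_poly 1 ^ Poly_Mapping.lookup m 1 *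
    var_poly 2 ^ Poly_Mapping.lookup m 2 * var_poly 3 ^ Poly_Mapping.lookup m 3 *
    var_poly (4::4) ^ Poly_Mapping.lookup m 4"
proof -
  have "m = Poly_Mapping.single 1 (Poly_Mapping.lookup m 1) + Poly_Mapping.single 2 (Poly_Mapping.lookup m 2) +
    Poly_Mapping.single 3 (Poly_Mapping.lookup m 3) + Poly_Mapping.single 4 (Poly_Mapping.lookup m 4)"
    by (rule poly_mapping_eqI) (use exhaust_4 in \<open>auto simp: lookup_add lookup_single when_def\<close>)
  then show ?thesis
    unfolding var_poly_power const_poly_def mult_single by (simp only: add_0_left mult_1_right)
qed

lemma cub_poly_mono:
  fixes a :: "'a::comm_semiring_1"
    assumes "p + q + r + s = 3" 
  shows "\<exists>c. const_poly a * var_poly 1 ^ p * var_poly 2 ^ q * var_poly 3 ^ r * var_poly (4::4) ^ s = cub_poly c"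
proof -
  \<comment> \<open>The witness is the coefficient array supported at a single index triple.\<close>
  have w: "\<exists>c. const_poly a * var_poly 1 ^ p * var_poly 2 ^ q * var_poly 3 ^ r * var_poly (4::4) ^ s = cub_poly c"
    if "cub (\<lambda>i' j' k'. if i' = i \<and> j' = j \<and> k' = k then const_poly a else 0) (\<chi> i. var_poly i)
      = const_poly a * var_poly 1 ^ p * var_poly 2 ^ q * var_poly 3 ^ r * var_poly (4::4) ^ s" for i j k
    by (rule exI[of _ "\<lambda>i' j' k'. if i' = i \<and> j' = j \<and> k' = k then a else 0"])
       (simp add: cub_poly_def that[symmetric] if_distrib[of const_poly] cong: if_cong)
  have "p = 0 \<or> p = 1 \<or> p = 2 \<or> p = 3" "q = 0 \<or> q = 1 \<or> q = 2 \<or> q = 3" 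
     "r = 0 \<or> r = 1 \<or> r = 2 \<or> r = 3" "s = 3 - p - q - r" using assms by auto
  then consider
    "p = 3 \<and> q = 0 \<and> r = 0 \<and> s = 0" | "p = 2 \<and> q = 1 \<and> r = 0 \<and> s = 0"
  | "p = 2 \<and> q = 0 \<and> r = 1 \<and> s = 0" | "p = 2 \<and> q = 0 \<and> r = 0 \<and> s = 1"
  | "p = 1 \<and> q = 2 \<and> r = 0 \<and> s = 0" | "p = 1 \<and> q = 1 \<and> r = 1 \<and> s = 0"
  | "p = 1 \<and> q = 1 \<and> r = 0 \<and> s = 1" | "p = 1 \<and> q = 0 \<and> r = 2 \<and> s = 0"
  | "p = 1 \<and> q = 0 \<and> r = 1 \<and> s = 1" | "p = 1 \<and> q = 0 \<and> r = 0 \<and> s = 2"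
  | "p = 0 \<and> q = 3 \<and> r = 0 \<and> s = 0" | "p = 0 \<and> q = 2 \<and> r = 1 \<and> s = 0"
  | "p = 0 \<and> q = 2 \<and> r = 0 \<and> s = 1" | "p = 0 \<and> q = 1 \<and> r = 2 \<and> s = 0"
  | "p = 0 \<and> q = 1 \<and> r = 1 \<and> s = 1" | "p = 0 \<and> q = 1 \<and> r = 0 \<and> s = 2"
  | "p = 0 \<and> q = 0 \<and> r = 3 \<and> s = 0" | "p = 0 \<and> q = 0 \<and> r = 2 \<and> s = 1"
  | "p = 0 \<and> q = 0 \<and> r = 1 \<and> s = 2" | "p = 0 \<and> q = 0 \<and> r = 0 \<and> s = 3"
    using assms by (elim disjE; simp)
  then show ?thesis
  proof cases
    case 1 show ?thesis by (rule w[of 1 1 1]) (simp add: cub_def 1 mult_ac)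
  next case 2 show ?thesis by (rule w[of 1 1 2]) (simp add: cub_def 2 mult_ac)
  next case 3 show ?thesis by (rule w[of 1 1 3]) (simp add: cub_def 3 mult_ac)
  next case 4 show ?thesis by (rule w[of 1 1 4]) (simp add: cub_def 4 mult_ac)
  next case 5 show ?thesis by (rule w[of 1 2 2]) (simp add: cub_def 5 mult_ac)
  next case 6 show ?thesis by (rule w[of 1 2 3]) (simp add: cub_def 6 mult_ac)
  next case 7 show ?thesis by (rule w[of 1 2 4]) (simp add: cub_def 7 mult_ac)
  next case 8 show ?thesis by (rule w[of 1 3 3]) (simp add: cub_def 8 mult_ac)
  next case 9 show ?thesis by (rule w[of 1 3 4]) (simp add: cub_def 9 mult_ac)
  next case 10 show ?thesis by (rule w[of 1 4 4]) (simp add: cub_def 10 mult_ac)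
  next case 11 show ?thesis by (rule w[of 2 2 2]) (simp add: cub_def 11 mult_ac)
  next case 12 show ?thesis by (rule w[of 2 2 3]) (simp add: cub_def 12 mult_ac)
  next case 13 show ?thesis by (rule w[of 2 2 4]) (simp add: cub_def 13 mult_ac)
  next case 14 show ?thesis by (rule w[of 2 3 3]) (simp add: cub_def 14 mult_ac)
  next case 15 show ?thesis by (rule w[of 2 3 4]) (simp add: cub_def 15 mult_ac)
  next case 16 show ?thesis by (rule w[of 2 4 4]) (simp add: cub_def 16 mult_ac)
  next case 17 show ?thesis by (rule w[of 3 3 3]) (simp add: cub_def 17 mult_ac)
  next case 18 show ?thesis by (rule w[of 3 3 4]) (simp add: cub_def 18 mult_ac)
  next case 19 show ?thesis by (rule w[of 3 4 4]) (simp add: cub_def 19 mult_ac)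
  next case 20 show ?thesis by (rule w[of 4 4 4]) (simp add: cub_def 20 mult_ac)
  qed
qed

lemma single_cubic:
  fixes a :: "'a::comm_semiring_1" and m :: "4 \<Rightarrow>\<^sub>0 nat"
  assumes "(\<Sum>i\<in>UNIV. Poly_Mapping.lookup m i) = 3"
  shows "\<exists>c. Poly_Mapping.single m a = cub_poly c"
  using cub_poly_mono[of "Poly_Mapping.lookup m 1" "Poly_Mapping.lookup m 2" "Poly_Mapping.lookup m 3"
      "Poly_Mapping.lookup m 4" a] assms
  by (simp add: single_eq_product sum_4)
lemma homogeneous_3_cub:
  fixes f :: "(4, 'a::comm_semiring_1) mpoly"
  assumes "homogeneous_poly 3 f"
  obtains c where "f = cub_poly c"
proof -
  have "\<exists>c. (\<Sum>m\<in>S. Poly_Mapping.single m (Poly_Mapping.lookup f m)) = cub_poly c"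
    if "finite S" "S \<subseteq> Poly_Mapping.keys f" for S
    using that
  proof (induction S rule: finite_induct)
    case empty
    show ?case by (rule exI[of _ "\<lambda>i j k. 0"]) (simp add: cub_poly_def cub_def)
  next
    case (insert m S)
    then obtain c where c: "(\<Sum>m\<in>S. Poly_Mapping.single m (Poly_Mapping.lookup f m)) = cub_poly c" by auto
    obtain d where d: "Poly_Mapping.single m (Poly_Mapping.lookup f m) = cub_poly d"
      using single_cubic[of m] insert.prems assms by (force simp: homogeneous_poly_def)
    have "cub_poly d + cub_poly c = cub_poly (\<lambda>i j k. d i j k + c i j k)"
      by (simp add: cub_poly_def cub_add const_poly_add)
    with insert c d show ?case by auto
  qed
  from this[of "Poly_Mapping.keys f"] that show ?thesis
    by (auto simp: poly_mapping_sum_single)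
qed

text \<open>\<open>polar c x y\<close> is the linear coefficient of \<open>cub c (x + t y)\<close> in \<open>t\<close>.\<close>

definition polar :: "(4 \<Rightarrow> 4 \<Rightarrow> 4 \<Rightarrow> 'a) \<Rightarrow> 'a::idom ^ 4 \<Rightarrow> 'a ^ 4 \<Rightarrow> 'a" where
  "polar c x y =
     (3 * c 1 1 1 * x$1^2 + 2 * c 1 1 2 * x$1 * x$2 + 2 * c 1 1 3 * x$1 * x$3 + 2 * c 1 1 4 * x$1 * x$4 +
      c 1 2 2 * x$2^2 + c 1 2 3 * x$2 * x$3 + c 1 2 4 * x$2 * x$4 + c 1 3 3 * x$3^2 +
      c 1 3 4 * x$3 * x$4 + c 1 4 4 * x$4^2) * y$1 +
     (c 1 1 2 * x$1^2 + 2 * c 1 2 2 * x$1 * x$2 + c 1 2 3 * x$1 * x$3 + c 1 2 4 * x$1 * x$4 +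
      3 * c 2 2 2 * x$2^2 + 2 * c 2 2 3 * x$2 * x$3 + 2 * c 2 2 4 * x$2 * x$4 + c 2 3 3 * x$3^2 +
      c 2 3 4 * x$3 * x$4 + c 2 4 4 * x$4^2) * y$2 +
     (c 1 1 3 * x$1^2 + c 1 2 3 * x$1 * x$2 + 2 * c 1 3 3 * x$1 * x$3 + c 1 3 4 * x$1 * x$4 +
      c 2 2 3 * x$2^2 + 2 * c 2 3 3 * x$2 * x$3 + c 2 3 4 * x$2 * x$4 + 3 * c 3 3 3 * x$3^2 +
      2 * c 3 3 4 * x$3 * x$4 + c 3 4 4 * x$4^2) * y$3 +
     (c 1 1 4 * x$1^2 + c 1 2 4 * x$1 * x$2 + c 1 3 4 * x$1 * x$3 + 2 * c 1 4 4 * x$1 * x$4 +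
      c 2 2 4 * x$2^2 + c 2 3 4 * x$2 * x$3 + 2 * c 2 4 4 * x$2 * x$4 + c 3 3 4 * x$3^2 +
      2 * c 3 4 4 * x$3 * x$4 + 3 * c 4 4 4 * x$4^2) * y$4"

lemma cub_line:
  "cub c (x + t *s y) = cub c x + t * polar c x y + t^2 * polar c y x + t^3 * cub c y"
  unfolding cub_def polar_def vector_add_component vector_smult_component
  by Groebner_Basis.algebra

text \<open>Vanishing of \<open>F\<close> and of its differential at \<open>x\<close>, phrased for
  cubic functions without derivatives: the restriction to every line through \<open>x\<close> starts
  in degree 2. In this form the notion is visibly invariant under linear changes. For a cubic form
  the zero vector satisfies it as well.\<close>

definition sing :: "('a::field ^ 4 \<Rightarrow> 'a) \<Rightarrow> 'a ^ 4 \<Rightarrow> bool" where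
  "sing F x \<longleftrightarrow> (\<forall>y. \<exists>q r. \<forall>t. F (x + t *s y) = t^2 * q + t^3 * r)"

lemma cubic_poly_eqD:
  fixes a b c d p q :: "'a::alg_closed_field"
  assumes "\<And>t. a + t * b + t^2 * c + t^3 * d = t^2 * p + t^3 * q"
  shows "a = 0" "b = 0"
proof -
  have "[:a, b, c, d:] = [:0, 0, p, q:]"
    using infinite_UNIV_alg_closed
  proof (rule poly_eqI_infinite)
    fix t show "poly [:a, b, c, d:] t = poly [:0, 0, p, q:] t"
      using assms[of t] by (simp add: algebra_simps power2_eq_square power3_eq_cube)
  qed
  then show "a = 0" "b = 0" by auto
qed

lemma sing_cub_iff:
  fixes x :: "'a::alg_closed_field ^ 4"
  shows "sing (cub c) x \<longleftrightarrow> cub c x = 0 \<and> (\<forall>y. polar c x y = 0)"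
proof
  assume "sing (cub c) x"
  then have "\<forall>y. \<exists>q r. \<forall>t. cub c x + t * polar c x y + t^2 * polar c y x + t^3 * cub c y = t^2 * q + t^3 * r"
    by (simp add: sing_def cub_line)
  then show "cub c x = 0 \<and> (\<forall>y. polar c x y = 0)"
    by (meson cubic_poly_eqD)
next
  assume "cub c x = 0 \<and> (\<forall>y. polar c x y = 0)"
  then show "sing (cub c) x" unfolding sing_def cub_line by auto
qed

lemma sing_transform:
  assumes A: "invertible A" "k \<noteq> 0" and G: "\<And>x. G x = k * F (A *v x)"
  shows "sing G x \<longleftrightarrow> sing F (A *v x)"
proof
  obtain B where B: "\<And>x. A *v (B *v x) = x" using invertible_inverse[OF A(1)] by metis
  assume s: "sing G x"
  show "sing F (A *v x)"
    unfolding sing_def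
  proof
    fix y
    obtain q r where "\<forall>t. G (x + t *s (B *v y)) = t^2 * q + t^3 * r"
      using s unfolding sing_def by metis
    then have "F (A *v x + t *s y) = t^2 * (q / k) + t^3 * (r / k)" for t
      using A(2) G[of "x + t *s (B *v y)"] by (simp add: matrix_vector_axpy B field_simps)
    then show "\<exists>q r. \<forall>t. F (A *v x + t *s y) = t^2 * q + t^3 * r" by blast
  qed
next
  assume s: "sing F (A *v x)"
  show "sing G x"
    unfolding sing_def
  proof
    fix y
    obtain q r where "\<forall>t. F (A *v x + t *s (A *v y)) = t^2 * q + t^3 * r"
      using s unfolding sing_def by metis
    then have "G (x + t *s y) = t^2 * (k * q) + t^3 * (k * r)" for t
      unfolding G matrix_vector_axpy by (simp only: distrib_left mult.left_commute)
    then show "\<exists>q r. \<forall>t. G (x + t *s y) = t^2 * q + t^3 * r" by blast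
  qed
qed

text \<open>After a linear change the function depends on three coordinates only. For a cubic form
  this makes the surface a cone with vertex \<open>v\<close>, and it can be read off from an
  explicit equation.\<close>

definition degenerate :: "('a::field ^ 4 \<Rightarrow> 'a) \<Rightarrow> bool" where
  "degenerate F \<longleftrightarrow> (\<exists>v. v \<noteq> 0 \<and> (\<forall>x t. F (x + t *s v) = F x))"

lemma degenerate_transform:
  assumes A: "invertible A" and G: "\<And>x. G x = k * F (A *v x)" and F: "degenerate F"
  shows "degenerate G"
proof -
  obtain B where B: "\<And>x. A *v (B *v x) = x" using invertible_inverse[OF A(1)] by metis
  obtain v where v: "v \<noteq> 0" "\<And>x t. F (x + t *s v) = F x" using F by (auto simp: degenerate_def)
  have "B *v v \<noteq> 0" using B[of v] v(1) by force
  moreover have "G (x + t *s (B *v v)) = G x" for x t by (simp add: G matrix_vector_axpy B v(2))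
  ultimately show ?thesis unfolding degenerate_def by blast
qed

lemma feq_degenerate:
  assumes "feq F G" "degenerate F" shows "degenerate G"
proof -
  obtain A k where "invertible A" "\<And>x. G x = k * F (A *v x)"
    using assms(1) unfolding feq_def by metis
  from degenerate_transform[OF this assms(2)] show ?thesis .
qed

text \<open>For a cubic form this is the full polarisation.\<close>

definition tri :: "('a::field ^ 4 \<Rightarrow> 'a) \<Rightarrow> 'a ^ 4 \<Rightarrow> 'a ^ 4 \<Rightarrow> 'a ^ 4 \<Rightarrow> 'a" where
  "tri F x y z = F (x + y + z) - F (x + y) - F (y + z) - F (x + z) + F x + F y + F z"

lemma tri_transform:
  assumes "\<And>x. G x = k * F (A *v x)"
  shows "tri G x y z = k * tri F (A *v x) (A *v y) (A *v z)"
  unfolding tri_def assms matrix_vector_right_distrib by (simp only: distrib_left right_diff_distrib)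

subsection \<open>The standard cubics as functions\<close>

definition F1 :: "'a::field ^ 4 \<Rightarrow> 'a" where "F1 x = x$3 * x$1^2 + x$4 * x$2^2"
definition F2 :: "'a::field ^ 4 \<Rightarrow> 'a" where "F2 x = x$3 * x$1 * x$2 + x$4 * x$1^2 + x$2^3"
definition F3 :: "'a::field ^ 4 \<Rightarrow> 'a" where "F3 x = x$3 * x$1^2 + x$4 * (x$2^2 + x$1 * x$2)"

lemma eval_std [simp]:
  "eval_poly std1 x = F1 x" "eval_poly std2 x = F2 x" "eval_poly std3 x = F3 x"
  "eval_poly (std1_twist a) x = x$3 * (x$1 * x$2) + x$4 * (a * x$1^2 + x$2^2)"
  by (simp_all add: std1_def std2_def std3_def std1_twist_def F1_def F2_def F3_def)

lemma ac_std [simp]: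
  "ac_poly std1 = std1" "ac_poly std2 = std2" "ac_poly std3 = std3"
  "ac_poly (std1_twist a) = std1_twist (to_ac a)"
  by (simp_all add: std1_def std2_def std3_def std1_twist_def)

section \<open>Cubics that are singular along a line\<close>

lemma binary_quadratic_root:
  fixes a b c :: "'a::alg_closed_field"
  obtains s t where "(s, t) \<noteq> (0, 0)" "a * s^2 + b * s * t + c * t^2 = 0"
proof (cases "a = 0")
  case True
  then show ?thesis using that[of 1 0] by simp
next
  case False
  have "Polynomial.degree [:c, b, a:] > 0" using False by simp
  then obtain s where "poly [:c, b, a:] s = 0" using alg_closed_imp_poly_has_root by blast
  then have "a * s^2 + b * s * 1 + c * 1^2 = 0" by (simp add: algebra_simps power2_eq_square)
  then show ?thesis using that[of s 1] by simp
qed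

lemma alg_closed_root:
  fixes a :: "'a::alg_closed_field"
  assumes "n > 0" obtains r where "r ^ n = a"
  using nth_root_exists[OF assms] by metis

text \<open>Square roots of \<open>a\<close> and \<open>c\<close> are chosen independently, and then
  only a sign has to be adjusted. In characteristic 2 the hypothesis says \<open>b = 0\<close>, so
  the statement covers that case too.\<close>

lemma discriminant_0_square:
  fixes a b c :: "'a::alg_closed_field"
  assumes disc: "b^2 = 4 * a * c"
  obtains p q where "a = p^2" "b = 2 * p * q" "c = q^2"
proof -
  obtain p where p: "p^2 = a" using alg_closed_root[of 2 a] by auto
  obtain q where q: "q^2 = c" using alg_closed_root[of 2 c] by auto
  have "(b - 2 * p * q) * (b + 2 * p * q) = 0"
    using disc p q by Groebner_Basis.algebra
  then consider "b = 2 * p * q" | "b = 2 * p * (- q)"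
    by (auto simp: add_eq_0_iff2)
  then show ?thesis
    by cases (rule that[of p q], use p q in simp_all, rule that[of p "-q"], use p q in simp_all)
qed

text \<open>Vanishing at the origin stands in for the factors being nonunits. It is evident for the
  factorisations that occur and is preserved by linear changes.\<close>

definition reducible_fun :: "('a::field ^ 4 \<Rightarrow> 'a) \<Rightarrow> bool" where
  "reducible_fun F \<longleftrightarrow> (\<exists>(a :: (4, 'a) mpoly) b. (\<forall>x. F x = eval_poly a x * eval_poly b x) \<and>
     eval_poly a 0 = 0 \<and> eval_poly b 0 = 0)"

lemma feq_reducible_fun:
  assumes "feq F G" "reducible_fun F" shows "reducible_fun G"
proof -
  obtain A c where A: "\<And>x. G x = c * F (A *v x)" using assms(1) unfolding feq_def by metis
  obtain a b where ab: "\<And>x. F x = eval_poly a x * eval_poly b x" "eval_poly a 0 = 0" "eval_poly b 0 = 0"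
    using assms(2) unfolding reducible_fun_def by metis
  have "\<forall>x. G x = eval_poly (const_poly c * lin_subst A a) x * eval_poly (lin_subst A b) x"
    by (simp add: A ab)
  moreover have "eval_poly (const_poly c * lin_subst A a) 0 = 0" "eval_poly (lin_subst A b) 0 = 0"
    by (simp_all add: ab)
  ultimately show ?thesis unfolding reducible_fun_def by blast
qed

lemma irreducible_not_reducible_fun:
  fixes g :: "(4, 'a::alg_closed_field) mpoly"
  assumes "Factorial_Ring.irreducible g" shows "\<not> reducible_fun (eval_poly g)"
proof
  assume "reducible_fun (eval_poly g)"
  then obtain a b where ab: "\<And>x. eval_poly g x = eval_poly a x * eval_poly b x"
    "eval_poly a 0 = 0" "eval_poly b 0 = 0" unfolding reducible_fun_def by metis
  have nonunit: "\<not> h dvd 1" if "eval_poly h 0 = 0" for h :: "(4, 'a) mpoly"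
  proof
    assume "h dvd 1"
    then obtain k where "1 = h * k" by (auto simp: dvd_def)
    then have "eval_poly 1 (0 :: 'a ^ 4) = eval_poly h 0 * eval_poly k 0" by (metis eval_poly_mult)
    then show False using that by simp
  qed
  have "g = a * b" using ab(1) by (simp add: mpoly4_eq_iff)
  then show False using Factorial_Ring.irreducibleD[OF assms, of a b] nonunit ab(2,3) by blast
qed

text \<open>The general cubic form that is singular along the line t1 = t2 = 0: the coefficients of
  t3 and t4 are binary quadratic forms in t1, t2, which span the pencil, and a binary cubic form
  remains.\<close>

definition pencil :: "'a::field \<Rightarrow> 'a \<Rightarrow> 'a \<Rightarrow> 'a \<Rightarrow> 'a \<Rightarrow> 'a \<Rightarrow> 'a \<Rightarrow> 'a \<Rightarrow> 'a \<Rightarrow> 'a \<Rightarrow> 'a ^ 4 \<Rightarrow> 'a" where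
  "pencil a1 a2 a3 b1 b2 b3 c1 c2 c3 c4 x =
     x$3 * (a1 * x$1^2 + a2 * x$1 * x$2 + a3 * x$2^2) +
     x$4 * (b1 * x$1^2 + b2 * x$1 * x$2 + b3 * x$2^2) +
     (c1 * x$1^3 + c2 * x$1^2 * x$2 + c3 * x$1 * x$2^2 + c4 * x$2^3)"

lemma pencil_subst34:
  assumes det: "p * s - q * r \<noteq> 0"
  shows "feq (pencil a1 a2 a3 b1 b2 b3 c1 c2 c3 c4)
    (pencil (p * a1 + r * b1) (p * a2 + r * b2) (p * a3 + r * b3)
       (q * a1 + s * b1) (q * a2 + s * b2) (q * a3 + s * b3) c1 c2 c3 c4)"
proof (rule feqI[where c = 1 and A = "vec4 (vec4 1 0 0 0) (vec4 0 1 0 0) (vec4 0 0 p q) (vec4 0 0 r s)"])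
  fix x :: "'a ^ 4"
  assume "vec4 (vec4 1 0 0 0) (vec4 0 1 0 0) (vec4 0 0 p q) (vec4 0 0 r s) *v x = 0"
  then have x: "x$1 = 0" "x$2 = 0" "p * x$3 + q * x$4 = 0" "r * x$3 + s * x$4 = 0"
    by (auto simp: vec4_eq_iff mult_vec_nth_4)
  have "(p * s - q * r) * x$3 = 0" "(p * s - q * r) * x$4 = 0"
    using x by Groebner_Basis.algebra+
  with det x show "x = 0" by (simp add: vec4_eq_iff)
qed (simp_all add: pencil_def mult_vec_nth_4 algebra_simps)

lemma pencil_subst12:
  assumes det: "p * s - q * r \<noteq> 0"
  shows "\<exists>b1' b2' b3' c1' c2' c3' c4'. feq (pencil a1 a2 a3 b1 b2 b3 c1 c2 c3 c4)
    (pencil (a1 * p^2 + a2 * p * r + a3 * r^2) (2 * a1 * p * q + a2 * (p * s + q * r) + 2 * a3 * r * s)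
       (a1 * q^2 + a2 * q * s + a3 * s^2) b1' b2' b3' c1' c2' c3' c4')"
proof (intro exI, rule feqI[where c = 1 and A = "vec4 (vec4 p q 0 0) (vec4 r s 0 0) (vec4 0 0 1 0) (vec4 0 0 0 1)"])
  fix x :: "'a ^ 4"
  assume "vec4 (vec4 p q 0 0) (vec4 r s 0 0) (vec4 0 0 1 0) (vec4 0 0 0 1) *v x = 0"
  then have x: "x$3 = 0" "x$4 = 0" "p * x$1 + q * x$2 = 0" "r * x$1 + s * x$2 = 0"
    by (auto simp: vec4_eq_iff mult_vec_nth_4)
  have "(p * s - q * r) * x$1 = 0" "(p * s - q * r) * x$2 = 0"
    using x by Groebner_Basis.algebra+
  with det x show "x = 0" by (simp add: vec4_eq_iff)
next
  fix x :: "'a ^ 4"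
  show "pencil (a1 * p^2 + a2 * p * r + a3 * r^2) (2 * a1 * p * q + a2 * (p * s + q * r) + 2 * a3 * r * s)
       (a1 * q^2 + a2 * q * s + a3 * s^2)
       (b1 * p^2 + b2 * p * r + b3 * r^2) (2 * b1 * p * q + b2 * (p * s + q * r) + 2 * b3 * r * s)
       (b1 * q^2 + b2 * q * s + b3 * s^2)
       (c1 * p^3 + c2 * p^2 * r + c3 * p * r^2 + c4 * r^3)
       (3 * c1 * p^2 * q + c2 * (2 * p * q * r + p^2 * s) + c3 * (q * r^2 + 2 * p * r * s) + 3 * c4 * r^2 * s)
       (3 * c1 * p * q^2 + c2 * (q^2 * r + 2 * p * q * s) + c3 * (p * s^2 + 2 * q * r * s) + 3 * c4 * r * s^2)
       (c1 * q^3 + c2 * q^2 * s + c3 * q * s^2 + c4 * s^3) x =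
     1 * pencil a1 a2 a3 b1 b2 b3 c1 c2 c3 c4
       (vec4 (vec4 p q 0 0) (vec4 r s 0 0) (vec4 0 0 1 0) (vec4 0 0 0 1) *v x)"
    unfolding pencil_def mult_vec_nth_4 vec4_nth by Groebner_Basis.algebra
qed simp

text \<open>On the members of the pencil the discriminant is itself a binary quadratic form, so some
  member has discriminant 0 and is the square of a linear form. That form is nonzero by
  nondegeneracy, and a change of t1, t2 turns it into t1.\<close>

lemma pencil_with_square:
  fixes a1 :: "'a::alg_closed_field"
  assumes nd: "\<not> degenerate (pencil a1 a2 a3 b1 b2 b3 c1 c2 c3 c4)"
  obtains b1' b2' b3' c1' c2' c3' c4' where
    "feq (pencil 1 0 0 b1' b2' b3' c1' c2' c3' c4') (pencil a1 a2 a3 b1 b2 b3 c1 c2 c3 c4)"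
proof -
  obtain l m where lm: "(l, m) \<noteq> (0, 0)"
    and disc: "(a2^2 - 4 * a1 * a3) * l^2 + (2 * a2 * b2 - 4 * a1 * b3 - 4 * b1 * a3) * l * m + (b2^2 - 4 * b1 * b3) * m^2 = 0"
    using binary_quadratic_root by metis
  from disc have "(l * a2 + m * b2)^2 = 4 * (l * a1 + m * b1) * (l * a3 + m * b3)"
    by Groebner_Basis.algebra
  then obtain p q where pq: "l * a1 + m * b1 = p^2" "l * a2 + m * b2 = 2 * p * q" "l * a3 + m * b3 = q^2"
    by (rule discriminant_0_square)
  have pq0: "(p, q) \<noteq> (0, 0)"
  proof
    assume "(p, q) = (0, 0)"
    with pq have z: "l * a1 + m * b1 = 0" "l * a2 + m * b2 = 0" "l * a3 + m * b3 = 0" by auto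
    have "pencil a1 a2 a3 b1 b2 b3 c1 c2 c3 c4 (x + t *s vec4 0 0 l m) = pencil a1 a2 a3 b1 b2 b3 c1 c2 c3 c4 x" for x t
      unfolding pencil_def vector_add_component vector_smult_component vec4_nth
      using z by Groebner_Basis.algebra
    moreover have "vec4 0 0 l m \<noteq> 0" using lm by (auto simp: vec4_eq_iff)
    ultimately show False using nd unfolding degenerate_def by blast
  qed
  obtain l' m' where det: "l * m' - l' * m \<noteq> 0"
  proof (cases "l = 0")
    case True then show ?thesis using lm that[where m' = 0 and l' = 1] by auto
  next
    case False then show ?thesis using that[where m' = 1 and l' = 0] by auto
  qed
  obtain b1' b2' b3' where 1: "feq (pencil a1 a2 a3 b1 b2 b3 c1 c2 c3 c4)
      (pencil (p^2) (2 * p * q) (q^2) b1' b2' b3' c1 c2 c3 c4)"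
    using pencil_subst34[OF det, of a1 a2 a3 b1 b2 b3 c1 c2 c3 c4] unfolding pq by blast
  \<comment> \<open>This substitution in t1, t2 carries \<open>p t1 + q t2\<close> to t1.\<close>
  obtain p' q' r' s' where det': "p' * s' - q' * r' \<noteq> 0" and 2: "p * p' + q * r' = 1" "p * q' + q * s' = 0"
  proof (cases "p = 0")
    case True
    then have "q \<noteq> 0" using pq0 by auto
    with True show ?thesis using that[where p' = 0 and q' = 1 and r' = "1 / q" and s' = 0] by auto
  next
    case False
    then show ?thesis using that[where p' = "1 / p" and q' = "- q / p" and r' = 0 and s' = 1] by auto
  qed
  have 3: "p^2 * p'^2 + 2 * p * q * p' * r' + q^2 * r'^2 = 1"
    "2 * p^2 * p' * q' + 2 * p * q * (p' * s' + q' * r') + 2 * q^2 * r' * s' = 0"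
    "p^2 * q'^2 + 2 * p * q * q' * s' + q^2 * s'^2 = 0"
    using 2 by Groebner_Basis.algebra+
  show ?thesis
    using pencil_subst12[OF det', of "p^2" "2 * p * q" "q^2" b1' b2' b3' c1 c2 c3 c4] that
    unfolding 3 using feq_sym feq_trans[OF 1] by blast
qed

text \<open>With t1^2 in the pencil, the type is decided by \<open>b2 t1 t2 + b3 t2^2\<close>, the
  other member modulo t1^2. If \<open>b3 = 0\<close> this gives \<open>F2\<close>, if only
  \<open>b2 = 0\<close> it gives \<open>F1\<close>, and otherwise \<open>F3\<close>. Completing the
  square reduces the last case to \<open>F1\<close> unless 2 vanishes. In each case the binary cubic
  remainder is absorbed into t3 and t4, up to the term t2^3 of \<open>F2\<close>.\<close>

lemma pencil_classification:
  fixes a1 :: "'a::alg_closed_field"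
  assumes F_def: "F = pencil a1 a2 a3 b1 b2 b3 c1 c2 c3 c4"
    and nd: "\<not> degenerate F" and nr: "\<not> reducible_fun F"
  shows "feq F1 F \<or> feq F2 F \<or> (CHAR('a) = 2 \<and> feq F3 F)"
proof -
  obtain b1 b2 b3 c1 c2 c3 c4 where eq: "feq (pencil 1 0 0 b1 b2 b3 c1 c2 c3 c4) F"
    using pencil_with_square nd unfolding F_def by metis
  let ?G = "pencil 1 0 0 b1 b2 b3 c1 c2 c3 c4"
  have ndG: "\<not> degenerate ?G" using feq_degenerate[OF eq] nd by blast
  have nrG: "\<not> reducible_fun ?G" using feq_reducible_fun[OF eq] nr by blast
  have "feq F1 ?G \<or> feq F2 ?G \<or> (CHAR('a) = 2 \<and> feq F3 ?G)"
  proof (cases "b3 = 0")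
    case True
    have b2: "b2 \<noteq> 0"
    proof
      assume "b2 = 0"
      \<comment> \<open>Both quadratic forms are now multiples of t1^2, so t3 and t4 enter only
        through \<open>t3 + b1 t4\<close>, which is constant in this direction.\<close>
      with True have "?G (x + t *s vec4 0 0 (- b1) 1) = ?G x" for x t
        by (simp add: pencil_def algebra_simps)
      moreover have "vec4 0 0 (- b1) 1 \<noteq> 0" by (simp add: vec4_eq_iff)
      ultimately show False using ndG unfolding degenerate_def by blast
    qed
    have c4: "c4 \<noteq> 0"
    proof
      assume c4: "c4 = 0"
      have "\<forall>x. ?G x = eval_poly (var_poly 1) x * eval_poly (var_poly 3 * var_poly 1 +
        var_poly 4 * (const_poly b1 * var_poly 1 + const_poly b2 * var_poly 2) +
        (const_poly c1 * var_poly 1 ^ 2 + const_poly c2 * var_poly 1 * var_poly 2 + const_poly c3 * var_poly 2 ^ 2)) x"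
        using True c4 by (simp add: pencil_def algebra_simps power2_eq_square power3_eq_cube)
      moreover have "eval_poly (var_poly 1) (0::'a^4) = 0" "eval_poly (var_poly 3 * var_poly 1 +
        var_poly 4 * (const_poly b1 * var_poly 1 + const_poly b2 * var_poly 2) +
        (const_poly c1 * var_poly 1 ^ 2 + const_poly c2 * var_poly 1 * var_poly 2 + const_poly c3 * var_poly 2 ^ 2)) (0::'a^4) = 0"
        by simp_all
      ultimately show False using nrG unfolding reducible_fun_def by blast
    qed
    obtain k where k: "k^3 = c4" using alg_closed_root[of 3 c4] by auto
    with c4 have k0: "k \<noteq> 0" by auto
    have "feq F2 ?G"
    \<comment> \<open>Scaling t2 by the cube root \<open>k\<close> normalises t2^3. The terms
      divisible by t1^2 go into the fourth row and the remaining multiples of \<open>t1 t2\<close>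
      into the third.\<close>
    proof (rule feqI[where c = 1 and A = "vec4 (vec4 1 0 0 0) (vec4 0 k 0 0) (vec4 0 (c3/k) 0 (b2/k)) (vec4 c1 c2 1 b1)"])
      fix x :: "'a ^ 4"
      assume "vec4 (vec4 1 0 0 0) (vec4 0 k 0 0) (vec4 0 (c3/k) 0 (b2/k)) (vec4 c1 c2 1 b1) *v x = 0"
      then show "x = 0" using k0 b2 by (auto simp: vec4_eq_iff mult_vec_nth_4)
    qed (use k0 True in \<open>simp_all add: pencil_def F2_def mult_vec_nth_4 k[symmetric] field_simps power2_eq_square power3_eq_cube\<close>)
    then show ?thesis by blast
  next
    case b3: False
    show ?thesis
    proof (cases "b2 = 0")
      case True
      have "feq F1 ?G"
      proof (rule feqI[where c = 1 and A = "vec4 (vec4 1 0 0 0) (vec4 0 1 0 0) (vec4 c1 c2 1 b1) (vec4 c3 c4 0 b3)"])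
        fix x :: "'a ^ 4"
        assume "vec4 (vec4 1 0 0 0) (vec4 0 1 0 0) (vec4 c1 c2 1 b1) (vec4 c3 c4 0 b3) *v x = 0"
        then show "x = 0" using b3 by (auto simp: vec4_eq_iff mult_vec_nth_4)
      qed (use True in \<open>simp_all add: pencil_def F1_def mult_vec_nth_4 algebra_simps power2_eq_square power3_eq_cube\<close>)
      then show ?thesis by blast
    next
      case b2: False
      define th where "th = b2 / b3"
      have th: "th \<noteq> 0" "b2 = th * b3" using b2 b3 by (auto simp: th_def)
      \<comment> \<open>Multiplying \<open>e t1 + c4 t2\<close> by \<open>t2^2 + th t1 t2\<close>
        gives the coefficient \<open>e + c4 th\<close> at t1 t2^2, which has to be
        \<open>c3\<close>.\<close>
      define e where "e = c3 - c4 * th"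
      let ?A = "vec4 (vec4 th 0 0 0) (vec4 0 1 0 0) (vec4 (c1/th^2) ((c2 - e * th)/th^2) (1/th^2) (b1/th^2)) (vec4 e c4 0 b3)"
      have F3: "feq F3 ?G"
      proof (rule feqI[where c = 1 and A = ?A])
        fix x :: "'a ^ 4"
        assume "?A *v x = 0"
        then show "x = 0" using b3 th by (auto simp: vec4_eq_iff mult_vec_nth_4)
      next
        fix x :: "'a ^ 4"
        have "(?A *v x) $ 3 * (th * x$1)^2 = (c1 * x$1 + (c2 - e * th) * x$2 + x$3 + b1 * x$4) * x$1^2"
          using th by (simp add: mult_vec_nth_4 field_simps)
        then show "?G x = 1 * F3 (?A *v x)"
          by (simp add: F3_def mult_vec_nth_4[of _ _ 1] mult_vec_nth_4[of _ _ 2] mult_vec_nth_4[of _ _ 4])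
             (simp add: pencil_def th(2) e_def algebra_simps power2_eq_square power3_eq_cube)
      qed simp
      show ?thesis
      proof (cases "CHAR('a) = 2")
        case True
        with F3 show ?thesis by blast
      next
        case False
        have "(2::'a) \<noteq> 0"
        proof
          assume "(2::'a) = 0"
          then have "of_nat 2 = (0::'a)" by simp
          then have "CHAR('a) dvd 2" by (simp only: of_nat_eq_0_iff_char_dvd)
          with False show False by (metis CHAR_not_1' One_nat_def dvd_antisym prime_nat_iff two_is_prime_nat)
        qed
        then obtain h :: 'a where h: "2 * h = 1" by (metis divide_self_if times_divide_eq_right mult_1_right)
        \<comment> \<open>Completing the square:
          \<open>t2^2 + t1 t2 = (t2 + h t1)^2 - h^2 t1^2\<close>, the last term being moved into the
          coefficient of t1^2.\<close>
        let ?B = "vec4 (vec4 1 0 0 0) (vec4 h 1 0 0) (vec4 0 0 1 (- (h * h))) (vec4 0 0 0 1)"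
        have "feq F1 (F3 :: 'a ^ 4 \<Rightarrow> 'a)"
        proof (rule feqI[where c = 1 and A = ?B])
          fix x :: "'a ^ 4"
          assume "?B *v x = 0"
          then show "x = 0" by (auto simp: vec4_eq_iff mult_vec_nth_4)
        next
          fix x :: "'a ^ 4"
          show "F3 x = 1 * F1 (?B *v x)"
            unfolding F1_def F3_def mult_vec_nth_4 vec4_nth using h by Groebner_Basis.algebra
        qed simp
        then show ?thesis using F3 feq_trans by blast
      qed
    qed
  qed
  then show ?thesis using feq_trans[OF _ eq] by blast
qed

subsection \<open>Infinitely many singular points\<close>

text \<open>Homogeneity supplies the coefficients of the transformed cubic without computing
  them.\<close>

lemma cub_subst: "\<exists>c'. \<forall>x. cub c (A *v x) = cub c' (x :: 'a::comm_ring_1 ^ 4)"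
proof -
  have h: "homogeneous_poly (Suc 0 + (Suc 0 + Suc 0)) (const_poly a * var_poly i * var_poly j * var_poly k)"
    for a :: 'a and i j k :: 4
    using homogeneous_mult[OF homogeneous_mult[OF homogeneous_mult[OF homogeneous_const homogeneous_var] homogeneous_var] homogeneous_var]
    by simp
  have "homogeneous_poly 3 (cub_poly c)"
    unfolding cub_poly_def cub_def
    by (intro homogeneous_add)
       (use h in \<open>simp_all add: power2_eq_square power3_eq_cube mult.assoc numeral_3_eq_3\<close>)
  from homogeneous_lin_subst[OF this, of A] obtain c' where "lin_subst A (cub_poly c) = cub_poly c'"
    by (rule homogeneous_3_cub)
  then have "eval_poly (lin_subst A (cub_poly c)) x = cub c' x" for x by simp
  then show ?thesis by auto
qed

section \<open>Completing vectors to a basis\<close>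

lemma ex_not_in_span:
  fixes S :: "('a::field ^ 4) set"
  assumes "finite S" "card S < 4" shows "\<exists>z. z \<notin> vec.span S"
proof (rule ccontr)
  assume "\<nexists>z. z \<notin> vec.span S"
  then have "vec.span S = UNIV" by auto
  then have "vec.dim (UNIV :: ('a ^ 4) set) \<le> card S" using assms vec.dim_le_card by blast
  then show False using assms(2) by (simp only: vec_dim_card) simp
qed

definition cols4 :: "'a::field ^ 4 \<Rightarrow> 'a ^ 4 \<Rightarrow> 'a ^ 4 \<Rightarrow> 'a ^ 4 \<Rightarrow> 'a ^ 4 ^ 4" where
  "cols4 a b c d = transpose (vec4 a b c d)"

lemma cols4_mult: "cols4 a b c d *v x = x$1 *s a + x$2 *s b + x$3 *s c + x$4 *s d"
  by (simp add: vec4_eq_iff mult_vec_nth_4 cols4_def transpose_def mult.commute)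

lemma smult_solve:
  fixes z :: "'a::field ^ 'n"
  assumes "p + d *s z = 0" "d \<noteq> 0" shows "z = (- 1 / d) *s p"
proof -
  have "z $ i = (- 1 / d) * p $ i" for i
  proof -
    have "p $ i + d * z $ i = 0" using assms(1) by (metis vector_add_component vector_smult_component zero_index)
    then have "d * z $ i = - p $ i" by (simp add: eq_neg_iff_add_eq_0 add.commute)
    then show ?thesis using assms(2) by (simp add: field_simps)
  qed
  then show ?thesis by (simp add: vec_eq_iff)
qed

lemma independent_extend:
  fixes u v w :: "'a::field ^ 4"
  assumes ind: "\<And>a b c. a *s u + b *s v + c *s w = 0 \<Longrightarrow> a = 0 \<and> b = 0 \<and> c = 0"
    and z: "\<And>a b c. z \<noteq> a *s u + b *s v + c *s w"
  shows "invertible (cols4 u v w z)"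
  unfolding invertible_iff_ker cols4_mult
proof (intro allI impI)
  fix x :: "'a ^ 4" assume x: "x$1 *s u + x$2 *s v + x$3 *s w + x$4 *s z = 0"
  have "x$4 = 0"
  proof (rule ccontr)
    assume n: "x$4 \<noteq> 0"
    have "z = (- 1 / x$4 * x$1) *s u + (- 1 / x$4 * x$2) *s v + (- 1 / x$4 * x$3) *s w"
      unfolding vector_smult_assoc[symmetric] vector_add_ldistrib[symmetric] by (rule smult_solve[OF x n])
    with z show False by blast
  qed
  with x ind[of "x$1" "x$2" "x$3"] show "x = 0" by (simp add: vec4_eq_iff)
qed

lemma ex_invertible_3:
  fixes u v w :: "'a::field ^ 4"
  assumes "\<And>a b c. a *s u + b *s v + c *s w = 0 \<Longrightarrow> a = 0 \<and> b = 0 \<and> c = 0"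
  obtains z where "invertible (cols4 u v w z)"
proof -
  have "card {u, v, w} < 4" by (simp add: card_insert_if)
  then obtain z where z: "z \<notin> vec.span {u, v, w}" using ex_not_in_span[of "{u, v, w}"] by auto
  have "z \<noteq> a *s u + b *s v + c *s w" for a b c
    using z by (metis insertCI vec.span_add vec.span_base vec.span_scale)
  from that[OF independent_extend[OF assms this]] show ?thesis .
qed

text \<open>The given vectors become columns 3 and 4 because a double line is to be moved to t1 = t2
  = 0.\<close>

lemma ex_invertible_2:
  fixes u v :: "'a::field ^ 4"
  assumes ind: "\<And>a b. a *s u + b *s v = 0 \<Longrightarrow> a = 0 \<and> b = 0"
  obtains w z where "invertible (cols4 w z u v)"
proof -
  have "card {u, v} < 4" by (simp add: card_insert_if)
  then obtain w where w: "w \<notin> vec.span {u, v}" using ex_not_in_span[of "{u, v}"] by auto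
  have w': "w \<noteq> a *s u + b *s v" for a b
    using w by (metis insertCI vec.span_add vec.span_base vec.span_scale)
  have ind3: "a = 0 \<and> b = 0 \<and> c = 0" if "a *s u + b *s v + c *s w = 0" for a b c
  proof -
    have "c = 0"
    proof (rule ccontr)
      assume n: "c \<noteq> 0"
      have "w = (- 1 / c * a) *s u + (- 1 / c * b) *s v"
        unfolding vector_smult_assoc[symmetric] vector_add_ldistrib[symmetric] by (rule smult_solve[OF that n])
      with w' show False by blast
    qed
    with that ind[of a b] show ?thesis by simp
  qed
  obtain z where z: "invertible (cols4 u v w z)" by (rule ex_invertible_3[OF ind3])
  have "invertible (cols4 w z u v)"
    unfolding invertible_iff_ker
  proof (intro allI impI)
    fix x :: "'a ^ 4" assume "cols4 w z u v *v x = 0"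
    moreover have "cols4 w z u v *v x = cols4 u v w z *v vec4 (x$3) (x$4) (x$1) (x$2)"
      by (simp add: cols4_mult add_ac)
    ultimately have "cols4 u v w z *v vec4 (x$3) (x$4) (x$1) (x$2) = 0" by simp
    then have "vec4 (x$3) (x$4) (x$1) (x$2) = 0" using z unfolding invertible_iff_ker by blast
    then show "x = 0" by (simp add: vec4_eq_iff)
  qed
  with that show ?thesis .
qed

text \<open>Finiteness of a set of projective points in terms of representing vectors. The factor
  \<open>k = 0\<close> accommodates the zero vector, which satisfies \<open>sing\<close> for every
  cubic form.\<close>

definition fin_lines :: "('a::field ^ 'n \<Rightarrow> bool) \<Rightarrow> bool" where
  "fin_lines P \<longleftrightarrow> (\<exists>S. finite S \<and> (\<forall>x. P x \<longrightarrow> (\<exists>s\<in>S. \<exists>k. x = k *s s)))"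

lemma fin_lines_transform:
  fixes A :: "'a::field ^ 'n ^ 'n"
  assumes "invertible A" "fin_lines (\<lambda>x. P (A *v x))" shows "fin_lines P"
proof -
  obtain S where S: "finite S" "\<And>x. P (A *v x) \<Longrightarrow> \<exists>s\<in>S. \<exists>k. x = k *s s"
    using assms(2) unfolding fin_lines_def by metis
  obtain B where B: "\<And>x. A *v (B *v x) = x" using invertible_inverse[OF assms(1)] by metis
  have "\<exists>s\<in>(*v) A ` S. \<exists>k. x = k *s s" if "P x" for x :: "'a ^ 'n"
  proof -
    have "P (A *v (B *v x))" using that B by simp
    from S(2)[OF this] obtain s k where "s \<in> S" "B *v x = k *s s" by blast
    then have "x = k *s (A *v s)" by (metis B vector_scalar_commute)
    with \<open>s \<in> S\<close> show ?thesis by blast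
  qed
  with S(1) show ?thesis unfolding fin_lines_def by (intro exI[of _ "(*v) A ` S"]) auto
qed

lemma sing_cub_scale:
  fixes x :: "'a::alg_closed_field ^ 4"
  assumes "sing (cub c) x" shows "sing (cub c) (k *s x)"
proof -
  have "cub c (k *s x) = k^3 * cub c x"
    unfolding cub_def vector_smult_component by Groebner_Basis.algebra
  moreover have "polar c (k *s x) y = k^2 * polar c x y" for y
    unfolding polar_def vector_smult_component by Groebner_Basis.algebra
  ultimately show ?thesis using assms by (simp add: sing_cub_iff)
qed

text \<open>At a coordinate vector, the value and the partial derivatives are, up to integer
  factors, the coefficients of the monomials divisible by the square of that coordinate. The pure
  cube is supplied by the value, so that characteristic 3 is no exception.\<close>

lemma sing_axis:
  fixes c :: "4 \<Rightarrow> 4 \<Rightarrow> 4 \<Rightarrow> 'a::alg_closed_field"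
  shows "sing (cub c) (vec4 1 0 0 0) \<longleftrightarrow> c 1 1 1 = 0 \<and> c 1 1 2 = 0 \<and> c 1 1 3 = 0 \<and> c 1 1 4 = 0"
    "sing (cub c) (vec4 0 1 0 0) \<longleftrightarrow> c 1 2 2 = 0 \<and> c 2 2 2 = 0 \<and> c 2 2 3 = 0 \<and> c 2 2 4 = 0"
    "sing (cub c) (vec4 0 0 1 0) \<longleftrightarrow> c 1 3 3 = 0 \<and> c 2 3 3 = 0 \<and> c 3 3 3 = 0 \<and> c 3 3 4 = 0"
    "sing (cub c) (vec4 0 0 0 1) \<longleftrightarrow> c 1 4 4 = 0 \<and> c 2 4 4 = 0 \<and> c 3 4 4 = 0 \<and> c 4 4 4 = 0"
proof -
  have all: "(\<forall>y :: 'a ^ 4. a1 * y$1 + a2 * y$2 + a3 * y$3 + a4 * y$4 = 0) \<longleftrightarrow> a1 = 0 \<and> a2 = 0 \<and> a3 = 0 \<and> a4 = 0"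
    for a1 a2 a3 a4
  proof
    assume y: "\<forall>y :: 'a ^ 4. a1 * y$1 + a2 * y$2 + a3 * y$3 + a4 * y$4 = 0"
    show "a1 = 0 \<and> a2 = 0 \<and> a3 = 0 \<and> a4 = 0"
      using y[rule_format, of "vec4 1 0 0 0"] y[rule_format, of "vec4 0 1 0 0"]
        y[rule_format, of "vec4 0 0 1 0"] y[rule_format, of "vec4 0 0 0 1"] by simp
  qed simp
  show "sing (cub c) (vec4 1 0 0 0) \<longleftrightarrow> c 1 1 1 = 0 \<and> c 1 1 2 = 0 \<and> c 1 1 3 = 0 \<and> c 1 1 4 = 0"
    "sing (cub c) (vec4 0 1 0 0) \<longleftrightarrow> c 1 2 2 = 0 \<and> c 2 2 2 = 0 \<and> c 2 2 3 = 0 \<and> c 2 2 4 = 0"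
    "sing (cub c) (vec4 0 0 1 0) \<longleftrightarrow> c 1 3 3 = 0 \<and> c 2 3 3 = 0 \<and> c 3 3 3 = 0 \<and> c 3 3 4 = 0"
    "sing (cub c) (vec4 0 0 0 1) \<longleftrightarrow> c 1 4 4 = 0 \<and> c 2 4 4 = 0 \<and> c 3 4 4 = 0 \<and> c 4 4 4 = 0"
    unfolding sing_cub_iff cub_def polar_def by (auto simp: all)
qed

text \<open>Along the line t1 = t2 = 0 each partial derivative is a binary quadratic form, and three
  zeros force it to vanish. Concretely, the third point removes the monomials t1 t3 t4 and t2 t3
  t4.\<close>

lemma sing_three_collinear:
  fixes c :: "4 \<Rightarrow> 4 \<Rightarrow> 4 \<Rightarrow> 'a::alg_closed_field"
  assumes "sing (cub c) (vec4 0 0 1 0)" "sing (cub c) (vec4 0 0 0 1)" "sing (cub c) (vec4 0 0 1 1)"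
  shows "cub c = pencil (c 1 1 3) (c 1 2 3) (c 2 2 3) (c 1 1 4) (c 1 2 4) (c 2 2 4)
    (c 1 1 1) (c 1 1 2) (c 1 2 2) (c 2 2 2)"
proof -
  note z = assms(1,2)[unfolded sing_axis]
  have "polar c (vec4 0 0 1 1) (vec4 1 0 0 0) = 0" "polar c (vec4 0 0 1 1) (vec4 0 1 0 0) = 0"
    using assms(3) by (auto simp: sing_cub_iff)
  then have "c 1 3 4 = 0" "c 2 3 4 = 0" using z by (simp_all add: polar_def)
  then show ?thesis using z by (auto simp: cub_def pencil_def algebra_simps)
qed

lemma axis_line:
  "x$2 = 0 \<Longrightarrow> x$3 = 0 \<Longrightarrow> x$4 = 0 \<Longrightarrow> x = x$1 *s vec4 1 0 0 (0::'a::field)"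
  "x$1 = 0 \<Longrightarrow> x$3 = 0 \<Longrightarrow> x$4 = 0 \<Longrightarrow> x = x$2 *s vec4 0 1 0 (0::'a::field)"
  "x$1 = 0 \<Longrightarrow> x$2 = 0 \<Longrightarrow> x$4 = 0 \<Longrightarrow> x = x$3 *s vec4 0 0 1 (0::'a::field)"
  "x$1 = 0 \<Longrightarrow> x$2 = 0 \<Longrightarrow> x$3 = 0 \<Longrightarrow> x = x$4 *s vec4 0 0 0 (1::'a::field)"
  by (simp_all add: vec4_eq_iff)

text \<open>Only the four squarefree monomials survive, and irreducibility makes all their
  coefficients nonzero, since otherwise a variable divides the cubic. This is Cayley's cubic, whose
  only singular points are the four coordinate points.\<close>

lemma four_nodes_fin_lines:
  fixes c :: "4 \<Rightarrow> 4 \<Rightarrow> 4 \<Rightarrow> 'a::alg_closed_field"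
  assumes nr: "\<not> reducible_fun (cub c)"
    and s: "sing (cub c) (vec4 1 0 0 0)" "sing (cub c) (vec4 0 1 0 0)"
      "sing (cub c) (vec4 0 0 1 0)" "sing (cub c) (vec4 0 0 0 1)"
  shows "fin_lines (sing (cub c))"
proof -
  note z = s[unfolded sing_axis]
  have red: False if "\<And>x. cub c x = x $ i * (k1 * x $ a * x $ b + k2 * x $ d * x $ e + k3 * x $ g * x $ h)"
    for i a b d e g h k1 k2 k3
  proof -
    have "\<forall>x. cub c x = eval_poly (var_poly i) x * eval_poly (const_poly k1 * var_poly a * var_poly b +
      const_poly k2 * var_poly d * var_poly e + const_poly k3 * var_poly g * var_poly h) x"
      by (simp add: that)
    moreover have "eval_poly (const_poly k1 * var_poly a * var_poly b +
      const_poly k2 * var_poly d * var_poly e + const_poly k3 * var_poly g * var_poly h) (0 :: 'a ^ 4) = 0"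
      "eval_poly (var_poly i) (0 :: 'a ^ 4) = 0" by simp_all
    ultimately show False using nr unfolding reducible_fun_def by blast
  qed
  have nz: "c 1 2 3 \<noteq> 0" "c 1 2 4 \<noteq> 0" "c 1 3 4 \<noteq> 0" "c 2 3 4 \<noteq> 0"
    using red[of 4 "c 1 2 4" 1 2 "c 1 3 4" 1 3 "c 2 3 4" 2 3] red[of 3 "c 1 2 3" 1 2 "c 1 3 4" 1 4 "c 2 3 4" 2 4]
      red[of 2 "c 1 2 3" 1 3 "c 1 2 4" 1 4 "c 2 3 4" 3 4] red[of 1 "c 1 2 3" 2 3 "c 1 2 4" 2 4 "c 1 3 4" 3 4] z
    by (auto simp: cub_def algebra_simps)
  have "\<exists>s\<in>{vec4 1 0 0 0, vec4 0 1 0 0, vec4 0 0 1 0, vec4 0 0 0 1}. \<exists>k. x = k *s s"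
    if "sing (cub c) x" for x
  proof -
    have p: "polar c x (vec4 1 0 0 0) = 0" "polar c x (vec4 0 1 0 0) = 0"
      "polar c x (vec4 0 0 1 0) = 0" "polar c x (vec4 0 0 0 1) = 0" and x: "cub c x = 0"
      using that by (auto simp: sing_cub_iff)
    have d: "c 1 2 3 * x$2 * x$3 + c 1 2 4 * x$2 * x$4 + c 1 3 4 * x$3 * x$4 = 0"
      "c 1 2 3 * x$1 * x$3 + c 1 2 4 * x$1 * x$4 + c 2 3 4 * x$3 * x$4 = 0"
      "c 1 2 3 * x$1 * x$2 + c 1 3 4 * x$1 * x$4 + c 2 3 4 * x$2 * x$4 = 0"
      "c 1 2 4 * x$1 * x$2 + c 1 3 4 * x$1 * x$3 + c 2 3 4 * x$2 * x$3 = 0"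
      using p z by (simp_all add: polar_def)
    have x': "c 1 2 3 * x$1 * x$2 * x$3 + c 1 2 4 * x$1 * x$2 * x$4 + c 1 3 4 * x$1 * x$3 * x$4 + c 2 3 4 * x$2 * x$3 * x$4 = 0"
      using x z by (simp add: cub_def)
    \<comment> \<open>The product of a coordinate and the partial derivative in it contains every
      monomial of the cubic except the one without that coordinate. Comparison with
      \<open>x'\<close> isolates that one.\<close>
    have "c 2 3 4 * (x$2 * x$3 * x$4) = 0" "c 1 3 4 * (x$1 * x$3 * x$4) = 0"
      "c 1 2 4 * (x$1 * x$2 * x$4) = 0" "c 1 2 3 * (x$1 * x$2 * x$3) = 0"
      using d x' by Groebner_Basis.algebra+
    then have t: "x$2 * x$3 * x$4 = 0" "x$1 * x$3 * x$4 = 0" "x$1 * x$2 * x$4 = 0" "x$1 * x$2 * x$3 = 0"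
      using nz by auto
    then have "x$1 = 0 \<and> x$2 = 0 \<and> x$3 = 0 \<or> x$1 = 0 \<and> x$2 = 0 \<and> x$4 = 0 \<or>
      x$1 = 0 \<and> x$3 = 0 \<and> x$4 = 0 \<or> x$2 = 0 \<and> x$3 = 0 \<and> x$4 = 0"
      using d nz by auto
    then show ?thesis using axis_line[of x] by blast
  qed
  then show ?thesis unfolding fin_lines_def
    by (intro exI[of _ "{vec4 1 0 0 0, vec4 0 1 0 0, vec4 0 0 1 0, vec4 0 0 0 1}"]) auto
qed

lemma reducible_fun_transform:
  assumes "invertible A" "reducible_fun (\<lambda>x. F (A *v x))" shows "reducible_fun F"
proof -
  have "feq F (\<lambda>x. F (A *v x))" unfolding feq_def using assms(1) by (intro exI[of _ A] exI[of _ 1]) auto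
  from feq_reducible_fun[OF feq_sym[OF this] assms(2)] show ?thesis .
qed

text \<open>A further singular point off the plane t4 = 0 can be made the fourth coordinate point.
  Otherwise all singular points lie in that plane, where the partial derivatives reduce to the
  products of two coordinates times \<open>c 1 2 3\<close>; this is nonzero because t4 does not
  divide the cubic.\<close>

lemma three_nodes_fin_lines:
  fixes c :: "4 \<Rightarrow> 4 \<Rightarrow> 4 \<Rightarrow> 'a::alg_closed_field"
  assumes nr: "\<not> reducible_fun (cub c)"
    and s: "sing (cub c) (vec4 1 0 0 0)" "sing (cub c) (vec4 0 1 0 0)" "sing (cub c) (vec4 0 0 1 0)"
  shows "fin_lines (sing (cub c))"
proof (cases "\<exists>z. sing (cub c) z \<and> z$4 \<noteq> 0")
  case True
  then obtain z where z: "sing (cub c) z" "z$4 \<noteq> 0" by auto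
  let ?A = "cols4 (vec4 1 0 0 0) (vec4 0 1 0 0) (vec4 0 0 1 0) z"
  have A: "invertible ?A"
    by (rule independent_extend) (use z(2) in \<open>auto simp: vec4_eq_iff\<close>)
  obtain c' where c': "\<And>x. cub c (?A *v x) = cub c' x" using cub_subst by metis
  have tr: "sing (cub c') x \<longleftrightarrow> sing (cub c) (?A *v x)" for x
    by (rule sing_transform[OF A, of 1]) (simp_all add: c')
  have "?A *v vec4 1 0 0 0 = vec4 1 0 0 0" "?A *v vec4 0 1 0 0 = vec4 0 1 0 0"
    "?A *v vec4 0 0 1 0 = vec4 0 0 1 0" "?A *v vec4 0 0 0 1 = z" by (simp_all add: cols4_mult)
  then have "fin_lines (sing (cub c'))"
    using s z(1) nr reducible_fun_transform[OF A, of "cub c"]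
    by (intro four_nodes_fin_lines) (auto simp: tr c')
  then have "fin_lines (\<lambda>x. sing (cub c) (?A *v x))" by (simp add: tr[abs_def, symmetric])
  from fin_lines_transform[OF A this] show ?thesis .
next
  case False
  note z = s[unfolded sing_axis]
  have c0: "c 1 2 3 \<noteq> 0"
  proof
    assume "c 1 2 3 = 0"
    then have "\<forall>x. cub c x = eval_poly (var_poly 4) x * eval_poly (const_poly (c 1 2 4) * var_poly 1 * var_poly 2 +
      const_poly (c 1 3 4) * var_poly 1 * var_poly 3 + const_poly (c 2 3 4) * var_poly 2 * var_poly 3 +
      var_poly 4 * (const_poly (c 1 4 4) * var_poly 1 + const_poly (c 2 4 4) * var_poly 2 +
        const_poly (c 3 4 4) * var_poly 3 + const_poly (c 4 4 4) * var_poly 4)) x"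
      using z by (simp add: cub_def algebra_simps power2_eq_square power3_eq_cube)
    moreover have "eval_poly (var_poly 4) (0 :: 'a ^ 4) = 0" "eval_poly (const_poly (c 1 2 4) * var_poly 1 * var_poly 2 +
      const_poly (c 1 3 4) * var_poly 1 * var_poly 3 + const_poly (c 2 3 4) * var_poly 2 * var_poly 3 +
      var_poly 4 * (const_poly (c 1 4 4) * var_poly 1 + const_poly (c 2 4 4) * var_poly 2 +
        const_poly (c 3 4 4) * var_poly 3 + const_poly (c 4 4 4) * var_poly 4)) (0 :: 'a ^ 4) = 0" by simp_all
    ultimately show False using nr unfolding reducible_fun_def by blast
  qed
  have "\<exists>s\<in>{vec4 1 0 0 0, vec4 0 1 0 0, vec4 0 0 1 0}. \<exists>k. x = k *s s" if x: "sing (cub c) x" for x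
  proof -
    have x4: "x$4 = 0" using False x by auto
    have "polar c x (vec4 1 0 0 0) = 0" "polar c x (vec4 0 1 0 0) = 0" "polar c x (vec4 0 0 1 0) = 0"
      using x by (auto simp: sing_cub_iff)
    then have "x$2 * x$3 = 0" "x$1 * x$3 = 0" "x$1 * x$2 = 0"
      using z x4 c0 by (simp_all add: polar_def)
    then have "x$1 = 0 \<and> x$2 = 0 \<or> x$1 = 0 \<and> x$3 = 0 \<or> x$2 = 0 \<and> x$3 = 0" by auto
    then show ?thesis using x4 axis_line[of x] by blast
  qed
  then show ?thesis unfolding fin_lines_def
    by (intro exI[of _ "{vec4 1 0 0 0, vec4 0 1 0 0, vec4 0 0 1 0}"]) auto
qed

text \<open>Infinitely many singular points provide two independent ones, \<open>u\<close> and
  \<open>v\<close>. A third one outside their span would bring back finiteness by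
  \<open>three_nodes_fin_lines\<close>, so a third one lies on the line through them, and
  \<open>sing_three_collinear\<close> yields a pencil.\<close>

theorem cubic_classification:
  fixes c :: "4 \<Rightarrow> 4 \<Rightarrow> 4 \<Rightarrow> 'a::alg_closed_field"
  assumes nr: "\<not> reducible_fun (cub c)" and nd: "\<not> degenerate (cub c)"
    and inf: "\<not> fin_lines (sing (cub c))"
  shows "feq F1 (cub c) \<or> feq F2 (cub c) \<or> (CHAR('a) = 2 \<and> feq F3 (cub c))"
proof -
  have ex: "\<exists>x. sing (cub c) x \<and> (\<forall>s\<in>S. \<forall>k. x \<noteq> k *s s)" if "finite S" for S
    using inf that unfolding fin_lines_def by blast
  obtain u where u: "sing (cub c) u" "\<And>k. u \<noteq> k *s (0 :: 'a ^ 4)" using ex[of "{0}"] by auto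
  obtain v where v: "sing (cub c) v" "\<And>k. v \<noteq> k *s u" using ex[of "{u}"] by auto
  have ind2: "a = 0 \<and> b = 0" if "a *s u + b *s v = 0" for a b
  proof -
    have "b = 0"
    proof (rule ccontr)
      assume n: "b \<noteq> 0"
      have "v = (- 1 / b * a) *s u"
        unfolding vector_smult_assoc[symmetric] by (rule smult_solve[OF that n])
      with v(2) show False by blast
    qed
    with that u(2)[of 1] show ?thesis by auto
  qed
  show ?thesis
  proof (cases "\<exists>w. sing (cub c) w \<and> (\<forall>a b. w \<noteq> a *s u + b *s v)")
    case True
    then obtain w where w: "sing (cub c) w" "\<And>a b. w \<noteq> a *s u + b *s v" by blast
    have ind3: "a = 0 \<and> b = 0 \<and> d = 0" if "a *s u + b *s v + d *s w = 0" for a b d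
    proof -
      have "d = 0"
      proof (rule ccontr)
        assume n: "d \<noteq> 0"
        have "w = (- 1 / d * a) *s u + (- 1 / d * b) *s v"
          unfolding vector_smult_assoc[symmetric] vector_add_ldistrib[symmetric] by (rule smult_solve[OF that n])
        with w(2) show False by blast
      qed
      with that ind2[of a b] show ?thesis by simp
    qed
    obtain z where A: "invertible (cols4 u v w z)" by (rule ex_invertible_3[OF ind3])
    let ?A = "cols4 u v w z"
    obtain c' where c': "\<And>x. cub c (?A *v x) = cub c' x" using cub_subst by metis
    have tr: "sing (cub c') x \<longleftrightarrow> sing (cub c) (?A *v x)" for x
      by (rule sing_transform[OF A, of 1]) (simp_all add: c')
    have "?A *v vec4 1 0 0 0 = u" "?A *v vec4 0 1 0 0 = v" "?A *v vec4 0 0 1 0 = w"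
      by (simp_all add: cols4_mult)
    then have "fin_lines (sing (cub c'))"
      using u(1) v(1) w(1) nr reducible_fun_transform[OF A, of "cub c"]
      by (intro three_nodes_fin_lines) (auto simp: tr c')
    then have "fin_lines (\<lambda>x. sing (cub c) (?A *v x))" by (simp add: tr[abs_def, symmetric])
    from fin_lines_transform[OF A this] inf show ?thesis by blast
  next
    case False
    have "finite {u, v}" by simp
    from ex[OF this] obtain w where w: "sing (cub c) w" "\<And>k. w \<noteq> k *s u" "\<And>k. w \<noteq> k *s v" by blast
    obtain a b where ab: "w = a *s u + b *s v" using False w(1) by blast
    have nz: "a \<noteq> 0" "b \<noteq> 0" using w(2)[of a] w(3)[of b] ab by auto
    have ind2': "p = 0 \<and> q = 0" if "p *s (a *s u) + q *s (b *s v) = 0" for p q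
      using ind2[of "p * a" "q * b"] that nz by (simp add: vector_smult_assoc)
    \<comment> \<open>Rescaling \<open>u\<close> and \<open>v\<close> makes the third singular point
      the sum of the last two columns, that is the image of (0, 0, 1, 1).\<close>
    obtain w' z where A: "invertible (cols4 w' z (a *s u) (b *s v))" by (rule ex_invertible_2[OF ind2'])
    let ?A = "cols4 w' z (a *s u) (b *s v)"
    obtain c' where c': "\<And>x. cub c (?A *v x) = cub c' x" using cub_subst by metis
    have tr: "sing (cub c') x \<longleftrightarrow> sing (cub c) (?A *v x)" for x
      by (rule sing_transform[OF A, of 1]) (simp_all add: c')
    have "?A *v vec4 0 0 1 0 = a *s u" "?A *v vec4 0 0 0 1 = b *s v" "?A *v vec4 0 0 1 1 = w"
      by (simp_all add: cols4_mult ab)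
    then have s: "sing (cub c') (vec4 0 0 1 0)" "sing (cub c') (vec4 0 0 0 1)" "sing (cub c') (vec4 0 0 1 1)"
      using u(1) v(1) w(1) by (simp_all add: tr sing_cub_scale)
    have eq: "feq (cub c') (cub c)"
    proof (rule feq_sym)
      have "cub c' x = 1 * cub c (?A *v x)" for x by (simp add: c')
      then show "feq (cub c) (cub c')" unfolding feq_def using A one_neq_zero by blast
    qed
    have "\<not> degenerate (cub c')" "\<not> reducible_fun (cub c')"
      using feq_degenerate[OF eq] nd feq_reducible_fun[OF eq] nr by blast+
    then have "feq F1 (cub c') \<or> feq F2 (cub c') \<or> (CHAR('a) = 2 \<and> feq F3 (cub c'))"
      by (rule pencil_classification[OF sing_three_collinear[OF s]])
    then show ?thesis using feq_trans[OF _ eq] by blast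
  qed
qed

section \<open>Projective sets\<close>

text \<open>Closed sets are described by homogeneous polynomial functions, which are built from
  closure properties; the polynomials themselves are never written down.\<close>

definition hpoly :: "nat \<Rightarrow> ('a::field ^ 'n::finite \<Rightarrow> 'a) \<Rightarrow> bool" where
  "hpoly d h \<longleftrightarrow> (\<exists>f. homogeneous_poly d f \<and> (\<forall>x. eval_poly f x = h x))"

lemma hpoly_const: "hpoly 0 (\<lambda>x. c)"
  unfolding hpoly_def by (intro exI[of _ "const_poly c"]) auto

lemma hpoly_nth: "hpoly (Suc 0) (\<lambda>x. x $ i)"
  unfolding hpoly_def by (intro exI[of _ "var_poly i"]) auto

lemma hpoly_mult: "hpoly d f \<Longrightarrow> hpoly e g \<Longrightarrow> n = d + e \<Longrightarrow> hpoly n (\<lambda>x. f x * g x)"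
  unfolding hpoly_def by (metis eval_poly_mult homogeneous_mult)

lemma hpoly_add: "hpoly d f \<Longrightarrow> hpoly d g \<Longrightarrow> hpoly d (\<lambda>x. f x + g x)"
  unfolding hpoly_def by (metis eval_poly_add homogeneous_add)

lemma hpoly_cmult: "hpoly d f \<Longrightarrow> hpoly d (\<lambda>x. c * f x)"
  by (rule hpoly_mult[OF hpoly_const]) auto

lemma hpoly_diff: "hpoly d f \<Longrightarrow> hpoly d g \<Longrightarrow> hpoly d (\<lambda>x. f x - g x)"
  using hpoly_add[of d f "\<lambda>x. (-1) * g x", OF _ hpoly_cmult] by simp

lemma hpoly_0: "hpoly d (\<lambda>x. 0)"
  unfolding hpoly_def by (intro exI[of _ 0]) auto

lemma hpoly_sum: "(\<And>i. i \<in> S \<Longrightarrow> hpoly d (f i)) \<Longrightarrow> hpoly d (\<lambda>x. \<Sum>i\<in>S. f i x)"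
  by (induction S rule: infinite_finite_induct) (auto intro: hpoly_0 hpoly_add)

lemma hpoly_scale: "hpoly d h \<Longrightarrow> h (c *s x) = c ^ d * h x"
  unfolding hpoly_def using eval_homogeneous by metis

lemma proj_closed_zeros:
  assumes "\<And>h. h \<in> H \<Longrightarrow> \<exists>d. hpoly d h"
  shows "proj_closed {x. x \<noteq> 0 \<and> (\<forall>h\<in>H. h x = 0)}"
proof -
  have "\<forall>h\<in>H. \<exists>f. (\<exists>d. homogeneous_poly d f) \<and> (\<forall>x. eval_poly f x = h x)"
    using assms unfolding hpoly_def by metis
  then obtain p where p: "\<forall>h\<in>H. (\<exists>d. homogeneous_poly d (p h)) \<and> (\<forall>x. eval_poly (p h) x = h x)"
    by (auto dest!: bchoice)
  show ?thesis unfolding proj_closed_def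
    by (rule exI[of _ "p ` H"]) (use p in auto)
qed

lemma proj_closedE:
  assumes "proj_closed C"
  obtains H where "\<forall>h\<in>H. \<exists>d. hpoly d h" "C = {x. x \<noteq> 0 \<and> (\<forall>h\<in>H. h x = 0)}"
proof -
  obtain F where F: "\<forall>f\<in>F. \<exists>d. homogeneous_poly d f" "C = {x. x \<noteq> 0 \<and> (\<forall>f\<in>F. eval_poly f x = 0)}"
    using assms unfolding proj_closed_def by blast
  show ?thesis
  proof (rule that[of "eval_poly ` F"])
    show "\<forall>h\<in>eval_poly ` F. \<exists>d. hpoly d h" unfolding hpoly_def using F(1) by blast
  qed (use F(2) in auto)
qed

lemma proj_closed_scale:
  assumes "proj_closed C" "x \<in> C" "c \<noteq> 0" shows "c *s x \<in> C"
  using assms by (elim proj_closedE) (force simp: hpoly_scale)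

lemma proj_closed_Int:
  assumes "proj_closed C" "proj_closed D" shows "proj_closed (C \<inter> D)"
proof -
  obtain H where H: "\<forall>h\<in>H. \<exists>d. hpoly d h" "C = {x. x \<noteq> 0 \<and> (\<forall>h\<in>H. h x = 0)}"
    by (rule proj_closedE[OF assms(1)])
  obtain K where K: "\<forall>h\<in>K. \<exists>d. hpoly d h" "D = {x. x \<noteq> 0 \<and> (\<forall>h\<in>K. h x = 0)}"
    by (rule proj_closedE[OF assms(2)])
  have "C \<inter> D = {x. x \<noteq> 0 \<and> (\<forall>h\<in>H \<union> K. h x = 0)}" using H(2) K(2) by auto
  with proj_closed_zeros[of "H \<union> K"] H(1) K(1) show ?thesis by auto
qed

lemma proj_closed_Un:
  assumes "proj_closed C" "proj_closed D" shows "proj_closed (C \<union> D)"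
proof -
  obtain H where H: "\<forall>h\<in>H. \<exists>d. hpoly d h" "C = {x. x \<noteq> 0 \<and> (\<forall>h\<in>H. h x = 0)}"
    by (rule proj_closedE[OF assms(1)])
  obtain K where K: "\<forall>h\<in>K. \<exists>d. hpoly d h" "D = {x. x \<noteq> 0 \<and> (\<forall>h\<in>K. h x = 0)}"
    by (rule proj_closedE[OF assms(2)])
  let ?P = "{\<lambda>x. h x * k x | h k. h \<in> H \<and> k \<in> K}"
  have P: "\<exists>d. hpoly d p" if "p \<in> ?P" for p
    using that H(1) K(1) hpoly_mult by blast
  have iff: "(\<forall>p\<in>?P. p x = 0) \<longleftrightarrow> (\<forall>h\<in>H. h x = 0) \<or> (\<forall>k\<in>K. k x = 0)" for x
  proof
    assume a: "\<forall>p\<in>?P. p x = 0"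
    show "(\<forall>h\<in>H. h x = 0) \<or> (\<forall>k\<in>K. k x = 0)"
    proof (rule disjCI)
      assume "\<not> (\<forall>k\<in>K. k x = 0)"
      then obtain k where k: "k \<in> K" "k x \<noteq> 0" by blast
      show "\<forall>h\<in>H. h x = 0"
      proof
        fix h assume "h \<in> H"
        with k(1) have "(\<lambda>x. h x * k x) \<in> ?P" by blast
        with a have "h x * k x = 0" by fast
        with k(2) show "h x = 0" by simp
      qed
    qed
  qed auto
  have eq: "C \<union> D = {x. x \<noteq> 0 \<and> (\<forall>p\<in>?P. p x = 0)}"
    unfolding set_eq_iff H(2) K(2) Un_iff mem_Collect_eq iff by blast
  show ?thesis unfolding eq by (rule proj_closed_zeros) (rule P)
qed

lemma proj_closed_empty: "proj_closed {}"
  using proj_closed_zeros[of "{\<lambda>x. 1}"] hpoly_const[of 1] by auto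

lemma proj_closed_UN:
  assumes "finite S" "\<And>s. s \<in> S \<Longrightarrow> proj_closed (D s)" shows "proj_closed (\<Union>s\<in>S. D s)"
  using assms by (induction S rule: finite_induct) (auto simp: proj_closed_empty proj_closed_Un)

lemma proj_irreducible_UN:
  assumes "proj_irreducible C" "finite S" "\<And>s. s \<in> S \<Longrightarrow> proj_closed (D s)" "C \<subseteq> (\<Union>s\<in>S. D s)"
  shows "\<exists>s\<in>S. C \<subseteq> D s"
  using assms(2,1,3,4)
proof (induction S rule: finite_induct)
  case empty
  then show ?case by (auto simp: proj_irreducible_def)
next
  case (insert s S)
  have cl: "proj_closed (C \<inter> D s)" "proj_closed (C \<inter> (\<Union>s\<in>S. D s))"
    using insert.prems insert.hyps by (auto intro!: proj_closed_Int proj_closed_UN simp: proj_irreducible_def)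
  have "C = (C \<inter> D s) \<union> (C \<inter> (\<Union>s\<in>S. D s))" using insert.prems(3) by blast
  with cl insert.prems(1) have "C = C \<inter> D s \<or> C = C \<inter> (\<Union>s\<in>S. D s)"
    unfolding proj_irreducible_def by metis
  then consider "C \<subseteq> D s" | "C \<subseteq> (\<Union>s\<in>S. D s)" by blast
  then show ?case
  proof cases
    case 2
    with insert.IH insert.prems have "\<exists>s\<in>S. C \<subseteq> D s" by blast
    then show ?thesis by blast
  qed blast
qed

lemma linear_hpoly:
  assumes "Vector_Spaces.linear (*s) (*s) N"
  shows "hpoly (Suc 0) (\<lambda>x. N x $ i)"
proof -
  have "N x $ i = (\<Sum>j\<in>UNIV. matrix N $ i $ j * x $ j)" for x
  proof -
    have "(matrix N *v x) $ i = (\<Sum>j\<in>UNIV. matrix N $ i $ j * x $ j)"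
      by (simp add: matrix_vector_mult_def)
    then show ?thesis by (simp only: matrix_works[OF assms])
  qed
  then show ?thesis by (simp add: hpoly_sum hpoly_cmult hpoly_nth)
qed

section \<open>Lines and Pluecker vectors\<close>

lemma pluecker_nth [simp]: "pluecker u v $ (i, j) = u $ i * v $ j - u $ j * v $ i"
  by (simp add: pluecker_def)

text \<open>The exterior product of the vector \<open>s\<close> with the bivector \<open>p\<close>
  is zero. For the Pluecker vector of a line this says that \<open>s\<close> lies on the line. It is
  linear in \<open>p\<close>, so the lines through a point form a closed set.\<close>

definition incident :: "'a::field ^ 4 \<Rightarrow> 'a ^ (4 \<times> 4) \<Rightarrow> bool" where
  "incident s p \<longleftrightarrow> (\<forall>i j k. s $ i * p $ (j, k) + s $ j * p $ (k, i) + s $ k * p $ (i, j) = 0)"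

lemma incident_span: "incident (a *s u + b *s v) (pluecker u v)"
  by (simp add: incident_def algebra_simps)

text \<open>With a nonzero Pluecker coordinate at \<open>(i, j)\<close>, the relation for
  \<open>i\<close>, \<open>j\<close>, \<open>k\<close> is Cramer's rule for the coordinate
  \<open>s $ k\<close>.\<close>

lemma incident_imp_span:
  assumes "incident s (pluecker u v)" "pluecker u v \<noteq> 0"
  obtains a b where "s = a *s u + b *s v"
proof -
  obtain i j where ij: "pluecker u v $ (i, j) \<noteq> 0" using assms(2) by (auto simp: vec_eq_iff)
  define d where "d = pluecker u v $ (i, j)"
  have "s $ k = ((s$i * v$j - s$j * v$i) / d) * u $ k + ((s$j * u$i - s$i * u$j) / d) * v $ k" for k
  proof -
    have "s $ i * pluecker u v $ (j, k) + s $ j * pluecker u v $ (k, i) + s $ k * d = 0"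
      using assms(1) by (simp add: incident_def d_def)
    then have "s $ k * d = (s$i * v$j - s$j * v$i) * u $ k + (s$j * u$i - s$i * u$j) * v $ k"
      unfolding pluecker_nth by Groebner_Basis.algebra
    moreover have "d \<noteq> 0" using ij by (simp add: d_def)
    ultimately have "s $ k = ((s$i * v$j - s$j * v$i) * u $ k + (s$j * u$i - s$i * u$j) * v $ k) / d"
      by (metis nonzero_mult_div_cancel_right)
    then show ?thesis by (simp add: add_divide_distrib)
  qed
  then have "s = ((s$i * v$j - s$j * v$i) / d) *s u + ((s$j * u$i - s$i * u$j) / d) *s v"
    unfolding vec_eq_iff vector_add_component vector_smult_component by blast
  with that show ?thesis .
qed

lemma proj_closed_incident: "proj_closed {p. p \<noteq> 0 \<and> incident s p}"
proof -
  let ?H = "{\<lambda>p. s $ i * p $ (j, k) + s $ j * p $ (k, i) + s $ k * p $ (i, j) | i j k. True}"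
  have "proj_closed {p. p \<noteq> 0 \<and> (\<forall>h\<in>?H. h p = 0)}"
  proof (rule proj_closed_zeros)
    fix h assume "h \<in> ?H"
    then obtain i j k where "h = (\<lambda>p. s $ i * p $ (j, k) + s $ j * p $ (k, i) + s $ k * p $ (i, j))" by blast
    then have "hpoly (Suc 0) h" by (simp only:) (intro hpoly_add hpoly_cmult hpoly_nth)
    then show "\<exists>d. hpoly d h" ..
  qed
  moreover have "(\<forall>h\<in>?H. h p = 0) \<longleftrightarrow> incident s p" for p
    unfolding incident_def by fast
  ultimately show ?thesis by (simp only:)
qed

lemma pluecker_smult_add:
  "pluecker (a *s u + b *s v) (c *s u + d *s v) = (a * d - b * c) *s pluecker u v"
  unfolding vec_eq_iff by (auto simp: algebra_simps)

lemma pluecker_0_dependent: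
  assumes "pluecker u v \<noteq> 0" "a *s u + b *s v = 0" shows "a = 0 \<and> b = 0"
proof -
  obtain i j where ij: "u $ i * v $ j - u $ j * v $ i \<noteq> 0" using assms(1) by (auto simp: vec_eq_iff)
  have "a * u $ i + b * v $ i = 0" "a * u $ j + b * v $ j = 0"
    using assms(2) by (metis vector_add_component vector_smult_component zero_index)+
  then have "a * (u $ i * v $ j - u $ j * v $ i) = 0" "b * (u $ i * v $ j - u $ j * v $ i) = 0"
    by Groebner_Basis.algebra+
  with ij show ?thesis by simp
qed

section \<open>Lines on a cubic surface\<close>

text \<open>The resultant of two binary quadratic forms.\<close>

definition res2 :: "'a::comm_ring_1 \<Rightarrow> 'a \<Rightarrow> 'a \<Rightarrow> 'a \<Rightarrow> 'a \<Rightarrow> 'a \<Rightarrow> 'a" where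
  "res2 a0 a1 a2 b0 b1 b2 = (a0 * b2 - a2 * b0)^2 - (a0 * b1 - a1 * b0) * (a1 * b2 - a2 * b1)"

text \<open>The hypotheses are the four coefficients of
  \<open>(n1 s + n2 t) a + (n3 s + n4 t) b = 0\<close> for the binary forms \<open>a\<close> and
  \<open>b\<close>. The matrix of this linear system is their Sylvester matrix, with determinant
  \<open>res2\<close> up to sign.\<close>

lemma res2_syzygy:
  fixes a0 :: "'a::field"
  assumes "n1 * a0 + n3 * b0 = 0" "n1 * a1 + n2 * a0 + n3 * b1 + n4 * b0 = 0"
    "n1 * a2 + n2 * a1 + n3 * b2 + n4 * b1 = 0" "n2 * a2 + n4 * b2 = 0"
  shows "n1 * res2 a0 a1 a2 b0 b1 b2 = 0" "n2 * res2 a0 a1 a2 b0 b1 b2 = 0"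
    "n3 * res2 a0 a1 a2 b0 b1 b2 = 0" "n4 * res2 a0 a1 a2 b0 b1 b2 = 0"
  using assms unfolding res2_def by Groebner_Basis.algebra+

text \<open>Both coefficient vectors annihilate \<open>(r, -q, p)\<close>, and
  \<open>q^2 = p r\<close> says that this vector is proportional to some
  \<open>(s^2, s t, t^2)\<close>. If it is zero, the two forms are proportional and any root of a
  nonzero one will do.\<close>

lemma res2_common_root:
  fixes a0 :: "'a::alg_closed_field"
  assumes "res2 a0 a1 a2 b0 b1 b2 = 0"
  obtains s t where "(s, t) \<noteq> (0, 0)" "a0 * s^2 + a1 * s * t + a2 * t^2 = 0" "b0 * s^2 + b1 * s * t + b2 * t^2 = 0"
proof -
  define p q r where "p = a0 * b1 - a1 * b0" and "q = a0 * b2 - a2 * b0" and "r = a1 * b2 - a2 * b1"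
  have res: "q^2 = p * r" using assms by (simp add: res2_def p_def q_def r_def)
  consider "p \<noteq> 0" | "r \<noteq> 0" | "p = 0" "q = 0" "r = 0" using res by fastforce
  then show ?thesis
  proof cases
    case 1
    have "p * (a0 * q^2 - a1 * q * p + a2 * p^2) = 0" "p * (b0 * q^2 - b1 * q * p + b2 * p^2) = 0"
      using res unfolding p_def q_def r_def by Groebner_Basis.algebra+
    with 1 have "a0 * q^2 + a1 * q * (- p) + a2 * (- p)^2 = 0" "b0 * q^2 + b1 * q * (- p) + b2 * (- p)^2 = 0"
      by simp_all
    then show ?thesis using that[of q "- p"] 1 by auto
  next
    case 2
    have "r * (a0 * r^2 - a1 * r * q + a2 * q^2) = 0" "r * (b0 * r^2 - b1 * r * q + b2 * q^2) = 0"
      using res unfolding p_def q_def r_def by Groebner_Basis.algebra+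
    with 2 have "a0 * r^2 + a1 * r * (- q) + a2 * (- q)^2 = 0" "b0 * r^2 + b1 * r * (- q) + b2 * (- q)^2 = 0"
      by simp_all
    then show ?thesis using that[of r "- q"] 2 by auto
  next
    case 3
    show ?thesis
    proof (cases "a0 = 0 \<and> a1 = 0 \<and> a2 = 0")
      case True
      obtain s t where "(s, t) \<noteq> (0, 0)" "b0 * s^2 + b1 * s * t + b2 * t^2 = 0"
        using binary_quadratic_root by metis
      with True that show ?thesis by simp
    next
      case False
      obtain s t where st: "(s, t) \<noteq> (0, 0)" "a0 * s^2 + a1 * s * t + a2 * t^2 = 0"
        using binary_quadratic_root by metis
      have "a0 * (b0 * s^2 + b1 * s * t + b2 * t^2) = 0" "a1 * (b0 * s^2 + b1 * s * t + b2 * t^2) = 0"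
        "a2 * (b0 * s^2 + b1 * s * t + b2 * t^2) = 0"
        using 3 st(2) unfolding p_def q_def r_def by Groebner_Basis.algebra+
      with False have "b0 * s^2 + b1 * s * t + b2 * t^2 = 0" by auto
      with st that show ?thesis by blast
    qed
  qed
qed

text \<open>Restricts to \<open>cub c\<close> on the diagonal; a symmetric such form would need division by 6.\<close>

definition trilin :: "(4 \<Rightarrow> 4 \<Rightarrow> 4 \<Rightarrow> 'a) \<Rightarrow> 'a::field ^ 4 \<Rightarrow> 'a ^ 4 \<Rightarrow> 'a ^ 4 \<Rightarrow> 'a" where
  "trilin c x y z =
     c 1 1 1 * x$1 * y$1 * z$1 + c 1 1 2 * x$1 * y$1 * z$2 + c 1 1 3 * x$1 * y$1 * z$3 + c 1 1 4 * x$1 * y$1 * z$4 +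
     c 1 2 2 * x$1 * y$2 * z$2 + c 1 2 3 * x$1 * y$2 * z$3 + c 1 2 4 * x$1 * y$2 * z$4 +
     c 1 3 3 * x$1 * y$3 * z$3 + c 1 3 4 * x$1 * y$3 * z$4 + c 1 4 4 * x$1 * y$4 * z$4 +
     c 2 2 2 * x$2 * y$2 * z$2 + c 2 2 3 * x$2 * y$2 * z$3 + c 2 2 4 * x$2 * y$2 * z$4 +
     c 2 3 3 * x$2 * y$3 * z$3 + c 2 3 4 * x$2 * y$3 * z$4 + c 2 4 4 * x$2 * y$4 * z$4 +
     c 3 3 3 * x$3 * y$3 * z$3 + c 3 3 4 * x$3 * y$3 * z$4 + c 3 4 4 * x$3 * y$4 * z$4 + c 4 4 4 * x$4 * y$4 * z$4"

lemma trilin_linear: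
  "trilin c (x + x') y z = trilin c x y z + trilin c x' y z" "trilin c x (y + y') z = trilin c x y z + trilin c x y' z"
  "trilin c x y (z + z') = trilin c x y z + trilin c x y z'"
  "trilin c (k *s x) y z = k * trilin c x y z" "trilin c x (k *s y) z = k * trilin c x y z" "trilin c x y (k *s z) = k * trilin c x y z"
  unfolding trilin_def vector_add_component vector_smult_component by Groebner_Basis.algebra+

lemma cub_eq_trilin: "cub c x = trilin c x x x"
  by (simp add: cub_def trilin_def power2_eq_square power3_eq_cube mult.assoc)

lemma polar_eq_trilin: "polar c x y = trilin c y x x + trilin c x y x + trilin c x x y"
  unfolding polar_def trilin_def by Groebner_Basis.algebra

lemma hpoly_trilin:
  assumes "\<And>i. hpoly d (\<lambda>p. f p $ i)" "\<And>i. hpoly e (\<lambda>p. g p $ i)" "\<And>i. hpoly k (\<lambda>p. h p $ i)" "n = d + e + k"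
  shows "hpoly n (\<lambda>p. trilin c (f p) (g p) (h p))"
  unfolding trilin_def assms(4) using assms(1-3)
  by (intro hpoly_add hpoly_mult[OF hpoly_mult[OF hpoly_cmult _ refl] _ refl])

lemma cubic_coeffs_0:
  fixes e0 :: "'a::alg_closed_field"
  assumes "\<And>s t. e0 * s^3 + e1 * s^2 * t + e2 * s * t^2 + e3 * t^3 = 0"
  shows "e0 = 0" "e1 = 0" "e2 = 0" "e3 = 0"
proof -
  have "[:e0, e1, e2, e3:] = 0"
    using infinite_UNIV_alg_closed
  proof (rule poly_eqI_infinite)
    fix t show "poly [:e0, e1, e2, e3:] t = poly 0 t"
      using assms[of 1 t] by (simp add: algebra_simps power2_eq_square power3_eq_cube)
  qed
  then show "e0 = 0" "e1 = 0" "e2 = 0" "e3 = 0" by auto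
qed

text \<open>A line \<open>\<ell>\<close> on the surface along which the surface is smooth is isolated among all lines on the
  surface: writing a nearby line as a graph over \<open>\<ell>\<close> turns the four equations for lying on the
  surface into a homogeneous linear system for its coordinates (with coefficients depending on the
  line), whose determinant is a form in the Pluecker coordinates not vanishing at \<open>\<ell>\<close>.\<close>

lemma smooth_line_isolated:
  fixes c :: "4 \<Rightarrow> 4 \<Rightarrow> 4 \<Rightarrow> 'a::alg_closed_field"
  assumes p0: "pluecker u0 v0 \<noteq> 0"
    and l0: "\<And>s t. cub c (s *s u0 + t *s v0) = 0"
    and smooth: "\<And>s t. (s, t) \<noteq> (0, 0) \<Longrightarrow> \<not> sing (cub c) (s *s u0 + t *s v0)"
  obtains h where "hpoly 8 h" "h (pluecker u0 v0) \<noteq> 0"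
    "\<forall>u v. (\<forall>s t. cub c (s *s u + t *s v) = 0) \<longrightarrow>
      h (pluecker u v) = 0 \<or> (\<exists>k. pluecker u v = k *s pluecker u0 v0)"
proof -
  have ind: "a = 0 \<and> b = 0" if "a *s u0 + b *s v0 = 0" for a b
    using pluecker_0_dependent[OF p0 that] .
  obtain w1 w2 where A: "invertible (cols4 w1 w2 u0 v0)" by (rule ex_invertible_2[OF ind])
  obtain B where B: "cols4 w1 w2 u0 v0 *v (B *v x) = x" "B *v (cols4 w1 w2 u0 v0 *v x) = x" for x
    using invertible_inverse[OF A] by metis
  define y where "y i x = (B *v x) $ i" for i x
  have y_lin: "y i (s *s x + t *s z) = s * y i x + t * y i z" for i s t x z
    by (simp add: y_def matrix_vector_right_distrib vector_scalar_commute)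
  have y_expand: "x = y 1 x *s w1 + y 2 x *s w2 + y 3 x *s u0 + y 4 x *s v0" for x
    using B(1)[of x] by (simp add: cols4_mult y_def)
  have y0: "y 3 u0 = 1" "y 4 u0 = 0" "y 3 v0 = 0" "y 4 v0 = 1"
    using B(2)[of "vec4 0 0 1 0"] B(2)[of "vec4 0 0 0 1"] by (simp_all add: cols4_mult y_def)
  \<comment> \<open>Contracting a Pluecker vector with the coordinate functions \<open>y 4\<close>
    and \<open>y 3\<close> gives the points where its line meets the planes \<open>y 4 = 0\<close>
    and \<open>y 3 = 0\<close>. \<open>P\<close> is the Pluecker coordinate of index (3, 4) in the
    basis \<open>w1\<close>, \<open>w2\<close>, \<open>u0\<close>, \<open>v0\<close>. So
    \<open>U p\<close> and \<open>V p\<close> are \<open>P p\<close> times \<open>u0\<close> and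
    \<open>v0\<close>, up to components along \<open>w1\<close> and \<open>w2\<close>.\<close>
  define U where "U p = (\<chi> i. \<Sum>j\<in>UNIV. B $ 4 $ j * p $ (i, j))" for p :: "'a ^ (4 \<times> 4)"
  define V where "V p = (\<chi> i. \<Sum>j\<in>UNIV. - B $ 3 $ j * p $ (i, j))" for p :: "'a ^ (4 \<times> 4)"
  define P where "P p = y 3 (U p)" for p
  have UV: "U (pluecker u v) = y 4 v *s u + (- y 4 u) *s v"
    "V (pluecker u v) = (- y 3 v) *s u + y 3 u *s v" for u v
    by (simp_all add: vec_eq_iff U_def V_def y_def sum_4 mult_vec_nth_4 algebra_simps)
  have hU: "hpoly (Suc 0) (\<lambda>p. U p $ i)" and hV: "hpoly (Suc 0) (\<lambda>p. V p $ i)" for i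
    unfolding U_def V_def vec_lambda_beta by (intro hpoly_sum hpoly_cmult hpoly_nth)+
  have hP: "hpoly (Suc 0) P"
    unfolding P_def y_def mult_vec_nth_4 by (intro hpoly_add hpoly_cmult hU)
  have hc: "hpoly 0 (\<lambda>p. x $ i)" for x :: "'a ^ 4" and i by (rule hpoly_const)
  \<comment> \<open>These are the coefficients at \<open>s^2\<close>, \<open>s t\<close> and
    \<open>t^2\<close> of the expression in \<open>ea\<close> below, which arises when the points
    \<open>s U + t V\<close> and \<open>P (s u0 + t v0)\<close> are compared.\<close>
  define a0 where "a0 w p = trilin c w (U p) (U p) + P p * trilin c u0 w (U p) + P p * P p * trilin c u0 u0 w" for w p
  define a1 where "a1 w p = trilin c w (U p) (V p) + trilin c w (V p) (U p) + P p * (trilin c u0 w (V p) + trilin c v0 w (U p)) +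
    P p * P p * (trilin c u0 v0 w + trilin c v0 u0 w)" for w p
  define a2 where "a2 w p = trilin c w (V p) (V p) + P p * trilin c v0 w (V p) + P p * P p * trilin c v0 v0 w" for w p
  define h where "h p = res2 (a0 w1 p) (a1 w1 p) (a2 w1 p) (a0 w2 p) (a1 w2 p) (a2 w2 p)" for p
  have q: "hpoly 2 (\<lambda>p. trilin c w (f p) (g p))"
    if "\<And>i. hpoly (Suc 0) (\<lambda>p. f p $ i)" "\<And>i. hpoly (Suc 0) (\<lambda>p. g p $ i)" for f g w
    by (rule hpoly_trilin[OF hc that]) simp
  have l: "hpoly (Suc 0) (\<lambda>p. trilin c v w (f p))"
    if "\<And>i. hpoly (Suc 0) (\<lambda>p. f p $ i)" for f v w
    by (rule hpoly_trilin[OF hc hc that]) simp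
  have Pl: "hpoly 2 (\<lambda>p. P p * f p)" if "hpoly (Suc 0) f" for f
    by (rule hpoly_mult[OF hP that]) simp
  have PPc: "hpoly 2 (\<lambda>p. P p * P p * k)" for k
    by (rule hpoly_mult[OF hpoly_mult[OF hP hP refl] hpoly_const]) simp
  have ha0: "hpoly 2 (a0 w)" for w
    unfolding a0_def by (intro hpoly_add q Pl PPc l hU hV)
  have ha1: "hpoly 2 (a1 w)" for w
    unfolding a1_def by (intro hpoly_add q Pl PPc l hU hV)
  have ha2: "hpoly 2 (a2 w)" for w
    unfolding a2_def by (intro hpoly_add q Pl PPc l hU hV)
  note ha = ha0 ha1 ha2
  \<comment> \<open>\<open>res2\<close> has degree 4 in coefficients that are quadratic in
    \<open>p\<close>.\<close>
  have h8: "hpoly 8 h"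
    unfolding h_def res2_def power2_eq_square
    by (intro hpoly_diff hpoly_mult[of 4 _ 4] hpoly_mult[of 2 _ 2] ha; simp)
  have expand: "cub c (s *s U p + t *s V p) =
      (s * y 1 (U p) + t * y 1 (V p)) * (a0 w1 p * s^2 + a1 w1 p * s * t + a2 w1 p * t^2) +
      (s * y 2 (U p) + t * y 2 (V p)) * (a0 w2 p * s^2 + a1 w2 p * s * t + a2 w2 p * t^2)"
    if UV0: "y 4 (U p) = 0" "y 3 (V p) = 0" "y 4 (V p) = P p" for p s t
  proof -
    define z where "z = s *s U p + t *s V p"
    define z0 where "z0 = P p *s (s *s u0 + t *s v0)"
    define m where "m = y 1 z *s w1 + y 2 z *s w2"
    have "y 3 z = s * P p" "y 4 z = t * P p" unfolding z_def y_lin UV0 P_def by simp_all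
    then have "z = m + ((s * P p) *s u0 + (t * P p) *s v0)"
      using y_expand[of z] by (simp only: m_def add.assoc)
    then have "z = m + z0"
      by (simp only: z0_def vector_add_ldistrib vector_smult_assoc mult.commute)
    \<comment> \<open>Telescoping: in \<open>z = m + z0\<close> the arguments are replaced one at a
      time. The last term vanishes because \<open>z0\<close> lies on the given line.\<close>
    then have "trilin c z z z = trilin c m z z + trilin c z0 m z + trilin c z0 z0 m + trilin c z0 z0 z0"
      by (metis (no_types, lifting) add.assoc trilin_linear(1,2,3))
    also have "trilin c z0 z0 z0 = 0"
      unfolding z0_def trilin_linear(4-6) using l0[of s t] by (simp only: cub_eq_trilin mult_zero_right)
    finally have "cub c z = trilin c m z z + trilin c z0 m z + trilin c z0 z0 m" by (simp add: cub_eq_trilin)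
    also have "\<dots> = y 1 z * (trilin c w1 z z + trilin c z0 w1 z + trilin c z0 z0 w1) + y 2 z * (trilin c w2 z z + trilin c z0 w2 z + trilin c z0 z0 w2)"
      unfolding m_def trilin_linear by Groebner_Basis.algebra
    finally have e: "cub c z = \<dots>" .
    have ea: "trilin c w z z + trilin c z0 w z + trilin c z0 z0 w = a0 w p * s^2 + a1 w p * s * t + a2 w p * t^2" for w
      unfolding z_def z0_def trilin_linear a0_def a1_def a2_def by Groebner_Basis.algebra
    have ey: "y i z = s * y i (U p) + t * y i (V p)" for i unfolding z_def y_lin ..
    show ?thesis using e unfolding ea ey unfolding z_def .
  qed
  have hv: "h (pluecker u v) = 0 \<or> (\<exists>k. pluecker u v = k *s pluecker u0 v0)"
    if l: "\<And>s t. cub c (s *s u + t *s v) = 0" for u v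
  proof -
    let ?p = "pluecker u v"
    have UV0: "y 4 (U ?p) = 0" "y 3 (V ?p) = 0" "y 4 (V ?p) = P ?p"
      unfolding P_def UV y_lin by (simp_all add: algebra_simps)
    have on: "cub c (s *s U ?p + t *s V ?p) = 0" for s t
    proof -
      have "s *s U ?p + t *s V ?p = (s * y 4 v - t * y 3 v) *s u + (- s * y 4 u + t * y 3 u) *s v"
        unfolding UV by (simp add: vec_eq_iff algebra_simps)
      then show ?thesis by (simp only: l)
    qed
    have e: "(y 1 (U ?p) * a0 w1 ?p + y 2 (U ?p) * a0 w2 ?p) * s^3 +
      (y 1 (U ?p) * a1 w1 ?p + y 1 (V ?p) * a0 w1 ?p + y 2 (U ?p) * a1 w2 ?p + y 2 (V ?p) * a0 w2 ?p) * s^2 * t +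
      (y 1 (U ?p) * a2 w1 ?p + y 1 (V ?p) * a1 w1 ?p + y 2 (U ?p) * a2 w2 ?p + y 2 (V ?p) * a1 w2 ?p) * s * t^2 +
      (y 1 (V ?p) * a2 w1 ?p + y 2 (V ?p) * a2 w2 ?p) * t^3 = 0" for s t
      using on[of s t] unfolding expand[OF UV0] by Groebner_Basis.algebra
    note z = res2_syzygy[OF cubic_coeffs_0[OF e]]
    show ?thesis
    proof (cases "h ?p = 0")
      case False
      then have n: "y 1 (U ?p) = 0" "y 1 (V ?p) = 0" "y 2 (U ?p) = 0" "y 2 (V ?p) = 0"
        using z unfolding h_def by auto
      have U: "U ?p = P ?p *s u0" and V: "V ?p = P ?p *s v0"
        using y_expand[of "U ?p"] y_expand[of "V ?p"] n UV0 by (simp_all add: P_def)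
      \<comment> \<open>If \<open>P\<close> vanished, so would \<open>U\<close> and
        \<open>V\<close>, hence all the quadratic coefficients and with them
        \<open>h\<close>.\<close>
      have P0: "P ?p \<noteq> 0"
      proof
        assume "P ?p = 0"
        with U V have "U ?p = 0 *s u0" "V ?p = 0 *s u0" by simp_all
        then have "a0 w ?p = 0" "a1 w ?p = 0" "a2 w ?p = 0" for w
          using \<open>P ?p = 0\<close> unfolding a0_def a1_def a2_def by (simp_all only: trilin_linear) simp_all
        with False show False by (simp add: h_def res2_def)
      qed
      have "pluecker (U ?p) (V ?p) = P ?p *s ?p"
        unfolding UV pluecker_smult_add unfolding P_def UV y_lin by (simp add: algebra_simps)
      moreover have "pluecker (U ?p) (V ?p) = (P ?p * P ?p) *s pluecker u0 v0"
        unfolding U V by (simp add: vec_eq_iff algebra_simps)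
      ultimately have "P ?p *s ?p = P ?p *s (P ?p *s pluecker u0 v0)" by (simp add: vector_smult_assoc)
      then have "?p = P ?p *s pluecker u0 v0" using P0 by (simp add: vec_eq_iff)
      then show ?thesis by blast
    qed auto
  qed
  have h0: "h (pluecker u0 v0) \<noteq> 0"
  proof
    let ?p = "pluecker u0 v0"
    assume h0: "h ?p = 0"
    have U: "U ?p = u0" "V ?p = v0" "P ?p = 1" by (simp_all add: UV y0 P_def)
    obtain s t where st: "(s, t) \<noteq> (0, 0)"
      and r: "a0 w1 ?p * s^2 + a1 w1 ?p * s * t + a2 w1 ?p * t^2 = 0"
        "a0 w2 ?p * s^2 + a1 w2 ?p * s * t + a2 w2 ?p * t^2 = 0"
      using res2_common_root[OF h0[unfolded h_def]] by metis
    define z where "z = s *s u0 + t *s v0"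
    \<comment> \<open>On the given line itself \<open>P\<close> is 1, and the two forms are the
      derivatives of the cubic in the directions \<open>w1\<close> and \<open>w2\<close>. At a
      common zero the cubic is therefore singular, because the derivatives along the line vanish
      anyway.\<close>
    have pw: "polar c z w = a0 w ?p * s^2 + a1 w ?p * s * t + a2 w ?p * t^2" for w
      unfolding polar_eq_trilin z_def trilin_linear a0_def a1_def a2_def U by Groebner_Basis.algebra
    have line: "polar c z x = 0" if "x = a *s u0 + b *s v0" for x a b
    proof (rule cubic_poly_eqD(2))
      fix k
      have "cub c (z + k *s x) = 0"
        using l0[of "s + k * a" "t + k * b"] unfolding that z_def
        by (simp add: vector_add_ldistrib vector_sadd_rdistrib vector_smult_assoc add_ac)
      then show "cub c z + k * polar c z x + k^2 * polar c x z + k^3 * cub c x = k^2 * 0 + k^3 * 0"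
        by (simp add: cub_line)
    qed
    have "polar c z x = 0" for x
    proof -
      have add: "polar c z (x + x') = polar c z x + polar c z x'" "polar c z (k *s x) = k * polar c z x" for x x' k
        unfolding polar_eq_trilin trilin_linear by Groebner_Basis.algebra+
      have "polar c z w1 = 0" "polar c z w2 = 0" unfolding pw by (fact r)+
      moreover have "polar c z u0 = 0" "polar c z v0 = 0" by (rule line[of _ 1 0], simp) (rule line[of _ 0 1], simp)
      ultimately show ?thesis by (subst y_expand[of x]) (simp add: add)
    qed
    moreover have "cub c z = 0" unfolding z_def by (rule l0)
    ultimately have "sing (cub c) z" by (simp add: sing_cub_iff)
    with smooth[OF st] show False unfolding z_def by blast
  qed
  from that[OF h8 h0] hv show ?thesis by blast
qed

section \<open>From the ruling to infinitely many singular points\<close>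

lemma proj_closed_multiples: "proj_closed {p. p \<noteq> 0 \<and> (\<forall>i j. q $ i * p $ j - q $ j * p $ i = 0)}"
proof -
  let ?H = "\<Union>i j. {\<lambda>p. q $ i * p $ j - q $ j * p $ i}"
  have "proj_closed {p. p \<noteq> 0 \<and> (\<forall>h\<in>?H. h p = 0)}"
  proof (rule proj_closed_zeros)
    fix h assume "h \<in> ?H"
    then obtain i j where "h = (\<lambda>p. q $ i * p $ j - q $ j * p $ i)" by blast
    then have "hpoly (Suc 0) h" by (simp only:) (intro hpoly_diff hpoly_cmult hpoly_nth)
    then show "\<exists>d. hpoly d h" ..
  qed
  moreover have "(\<forall>h\<in>?H. h p = 0) \<longleftrightarrow> (\<forall>i j. q $ i * p $ j - q $ j * p $ i = 0)" for p
    by simp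
  ultimately show ?thesis by (simp only:)
qed

lemma proportional:
  fixes q :: "'a::field ^ 'n"
  assumes "q \<noteq> 0" "\<And>i j. q $ i * p $ j - q $ j * p $ i = 0" obtains k where "p = k *s q"
proof -
  obtain i where i: "q $ i \<noteq> 0" using assms(1) by (auto simp: vec_eq_iff)
  have "p $ j = (p $ i / q $ i) * q $ j" for j
  proof -
    have "q $ i * p $ j = q $ j * p $ i" using assms(2)[of i j] by (simp only: right_minus_eq)
    then have "p $ j = (q $ j * p $ i) / q $ i" using i by (metis nonzero_mult_div_cancel_left)
    then show ?thesis by (simp add: mult.commute)
  qed
  then have "p = (p $ i / q $ i) *s q" unfolding vec_eq_iff vector_smult_component by blast
  with that show ?thesis .
qed

lemma alg_closure_cub:
  assumes "homogeneous_poly 3 (f :: (4, 'a::field) mpoly)"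
  obtains c where "eval_poly (ac_poly f) = cub c" "ac_poly f = cub_poly c"
proof -
  have "homogeneous_poly 3 (ac_poly f)" using assms by simp
  then obtain c where "ac_poly f = cub_poly c" by (rule homogeneous_3_cub)
  moreover from this have "eval_poly (ac_poly f) = cub c" by auto
  ultimately show ?thesis using that by blast
qed

text \<open>Irreducibility of \<open>C\<close> is used twice. A smooth line of the ruling would be
  isolated in \<open>C\<close>, so that \<open>C\<close> would be a point. If the singular points
  were finite in number, \<open>C\<close> would be covered by the finitely many closed conditions of
  passing through one of them, and so all lines would pass through the same point and the surface
  would be a cone.\<close>

theorem ruled_cubic_singular:
  fixes f :: "(4, 'a::field) mpoly"
  assumes ruled: "ruled f" and hom: "homogeneous_poly 3 f" and ncone: "\<not> cone f"
  shows "\<not> fin_lines (sing (eval_poly (ac_poly f)))"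
proof
  assume "fin_lines (sing (eval_poly (ac_poly f)))"
  then obtain S where S: "finite S" "\<And>x. sing (eval_poly (ac_poly f)) x \<Longrightarrow> \<exists>s\<in>S. \<exists>k. x = k *s s"
    unfolding fin_lines_def by metis
  obtain c where c': "eval_poly (ac_poly f) = cub c" by (rule alg_closure_cub[OF hom])
  note c = fun_cong[OF c']
  from ruled obtain C where CC: "proj_curve C \<and> (\<forall>p\<in>C. \<exists>u v. p = pluecker u v) \<and>
      surface_points f = {x. x \<noteq> 0 \<and> (\<exists>u v a b. pluecker u v \<in> C \<and> x = a *s u + b *s v)}"
    unfolding ruled_def by (rule exE)
  note C = CC[THEN conjunct1] bspec[OF CC[THEN conjunct2, THEN conjunct1]] CC[THEN conjunct2, THEN conjunct2]
  have irr: "proj_irreducible C" and npt: "\<not> is_proj_point C" and cl: "proj_closed C"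
    using C(1) by (auto simp: proj_curve_def proj_irreducible_def)
  have nz: "p \<noteq> 0" if "p \<in> C" for p using that cl unfolding proj_closed_def by auto
  have on: "cub c (a *s u + b *s v) = 0" if "pluecker u v \<in> C" for u v a b
  proof (cases "a *s u + b *s v = 0")
    case True
    then show ?thesis by (simp add: cub_def)
  next
    case False
    with that have "a *s u + b *s v \<in> surface_points f" unfolding C(3) by blast
    then show ?thesis by (simp add: surface_points_def c)
  qed
  have sing_pt: "\<exists>s t. (s, t) \<noteq> (0, 0) \<and> sing (cub c) (s *s u0 + t *s v0)" if p0: "pluecker u0 v0 \<in> C" for u0 v0
  proof (rule ccontr)
    assume "\<not> ?thesis"
    then have smooth: "\<And>s t. (s, t) \<noteq> (0, 0) \<Longrightarrow> \<not> sing (cub c) (s *s u0 + t *s v0)" by blast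
    obtain h where h: "hpoly 8 h" "h (pluecker u0 v0) \<noteq> 0"
      "\<forall>u v. (\<forall>s t. cub c (s *s u + t *s v) = 0) \<longrightarrow>
        h (pluecker u v) = 0 \<or> (\<exists>k. pluecker u v = k *s pluecker u0 v0)"
      by (rule smooth_line_isolated[OF nz[OF p0] on[OF p0] smooth])
    define q where "q = pluecker u0 v0"
    let ?D = "\<lambda>b. if b then {p. p \<noteq> 0 \<and> (\<forall>k\<in>{h}. k p = 0)}
      else {p. p \<noteq> 0 \<and> (\<forall>i j. q $ i * p $ j - q $ j * p $ i = 0)}"
    have "proj_closed (?D b)" for b
    proof (cases b)
      case True
      have "proj_closed {p. p \<noteq> 0 \<and> (\<forall>k\<in>{h}. k p = 0)}" by (rule proj_closed_zeros) (use h(1) in auto)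
      with True show ?thesis by simp
    next
      case False
      then show ?thesis using proj_closed_multiples[of q] by simp
    qed
    \<comment> \<open>Isolation splits \<open>C\<close> into the zeros of \<open>h\<close> and the
      single point \<open>q\<close>. The first set omits \<open>q\<close>, so irreducibility leaves
      only the second.\<close>
    moreover have "C \<subseteq> (\<Union>b\<in>UNIV. ?D b)"
    proof
      fix p assume p: "p \<in> C"
      then obtain u v where uv: "p = pluecker u v" using C(2) by blast
      have "h p = 0 \<or> (\<exists>k. p = k *s pluecker u0 v0)" using h(3) on p unfolding uv by blast
      then show "p \<in> (\<Union>b\<in>UNIV. ?D b)"
      proof
        assume "h p = 0"
        then have "p \<in> ?D True" using nz[OF p] by simp
        then show ?thesis by blast
      next
        assume "\<exists>k. p = k *s pluecker u0 v0"
        then have "p \<in> ?D False" using nz[OF p] by (auto simp: q_def[symmetric])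
        then show ?thesis by blast
      qed
    qed
    ultimately obtain b where b: "C \<subseteq> ?D b"
      using proj_irreducible_UN[OF irr, of "UNIV :: bool set" ?D] by auto
    show False
    proof (cases b)
      case True
      with b have "C \<subseteq> ?D True" by simp
      then have "h (pluecker u0 v0) = 0" using p0 by auto
      with h(2) show False by simp
    next
      case False
      have "C = {k *s q | k. k \<noteq> 0}"
      proof (intro equalityI subsetI)
        fix p assume p: "p \<in> C"
        have "p \<in> ?D b" using b p by (rule subsetD)
        then have "q $ i * p $ j - q $ j * p $ i = 0" for i j using False by (simp only: if_False) blast
        then obtain k where k: "p = k *s q" using proportional[of q p] nz[OF p0] unfolding q_def by blast
        with nz[OF p] have "k \<noteq> 0" by auto
        with k show "p \<in> {k *s q | k. k \<noteq> 0}" by blast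
      qed (use proj_closed_scale[OF cl p0] in \<open>auto simp: q_def\<close>)
      then have "is_proj_point C" unfolding is_proj_point_def using nz[OF p0] unfolding q_def by blast
      with npt show False ..
    qed
  qed
  \<comment> \<open>The condition \<open>s \<noteq> 0\<close> discards a possible zero vector in
    \<open>S\<close>, with which every line would be incident.\<close>
  have "C \<subseteq> (\<Union>s\<in>S. {p. p \<noteq> 0 \<and> s \<noteq> 0 \<and> incident s p})"
  proof
    fix p assume p: "p \<in> C"
    then obtain u v where uv: "p = pluecker u v" using C(2) by blast
    obtain s t where st: "(s, t) \<noteq> (0, 0)" "sing (cub c) (s *s u + t *s v)"
      using sing_pt[of u v] p uv by blast
    obtain x k where x: "x \<in> S" "s *s u + t *s v = k *s x" using S(2) st(2) unfolding c' by blast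
    have "k *s x \<noteq> 0"
      using pluecker_0_dependent[of u v s t] st(1) nz[OF p] uv x(2) by auto
    then have k: "k \<noteq> 0" "x \<noteq> 0" by auto
    have "x = (1 / k) *s (k *s x)" using k by (simp add: vector_smult_assoc)
    also have "\<dots> = (s / k) *s u + (t / k) *s v"
      unfolding x(2)[symmetric] by (simp add: vector_add_ldistrib vector_smult_assoc)
    finally have "incident x p" unfolding uv using incident_span by metis
    with x(1) k nz[OF p] show "p \<in> (\<Union>s\<in>S. {p. p \<noteq> 0 \<and> s \<noteq> 0 \<and> incident s p})" by blast
  qed
  moreover have "proj_closed {p. p \<noteq> 0 \<and> s \<noteq> 0 \<and> incident s p}" for s
    using proj_closed_incident[of s] proj_closed_empty by (cases "s = 0") auto
  ultimately obtain s where s: "s \<in> S" "C \<subseteq> {p. p \<noteq> 0 \<and> s \<noteq> 0 \<and> incident s p}"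
    using proj_irreducible_UN[OF irr S(1), of "\<lambda>s. {p. p \<noteq> 0 \<and> s \<noteq> 0 \<and> incident s p}"] by auto
  have "C \<noteq> {}" using irr by (simp add: proj_irreducible_def)
  with s have s0: "s \<noteq> 0" by auto
  have "a *s x + b *s s \<in> surface_points f"
    if x: "x \<in> surface_points f" and n: "a *s x + b *s s \<noteq> 0" for x a b
  proof -
    obtain u v p q where uv: "pluecker u v \<in> C" "x = p *s u + q *s v" using x unfolding C(3) by blast
    obtain p' q' where "s = p' *s u + q' *s v"
      using incident_imp_span[of s u v] s(2) uv(1) by auto
    then have "a *s x + b *s s = (a * p + b * p') *s u + (a * q + b * q') *s v"
      using uv(2) by (simp add: vec_eq_iff algebra_simps)
    then show ?thesis using n uv(1) unfolding C(3) by blast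
  qed
  with s0 have "cone f" unfolding cone_def by blast
  with ncone show False ..
qed

lemma degenerate_imp_cone:
  fixes f :: "(4, 'a::field) mpoly"
  assumes "homogeneous_poly 3 f" "degenerate (eval_poly (ac_poly f))" shows "cone f"
proof -
  obtain v where v: "v \<noteq> 0" "\<And>x t. eval_poly (ac_poly f) (x + t *s v) = eval_poly (ac_poly f) x"
    using assms(2) unfolding degenerate_def by metis
  have "a *s x + b *s v \<in> surface_points f" if "x \<in> surface_points f" "a *s x + b *s v \<noteq> 0" for x a b
    using that eval_homogeneous[of 3 "ac_poly f" a x] assms(1) by (simp add: surface_points_def v(2))
  with v(1) show ?thesis unfolding cone_def by blast
qed

lemma eval_std_fun: "eval_poly std1 = F1" "eval_poly std2 = F2" "eval_poly std3 = F3"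
  by auto

theorem ruled_cubic_classification:
  fixes f :: "(4, 'a::field) mpoly"
  assumes "ruled_cubic_noncone f"
  shows "\<exists>s\<in>standard_equations. lin_equiv (ac_poly s) (ac_poly f)"
proof -
  have hom: "homogeneous_poly 3 f" and irr: "Factorial_Ring.irreducible (ac_poly f)"
    and r: "ruled f" "\<not> cone f"
    using assms by (auto simp: ruled_cubic_noncone_def cubic_surface_def)
  obtain c where c': "eval_poly (ac_poly f) = cub c" by (rule alg_closure_cub[OF hom])
  note c = fun_cong[OF c']
  have "feq F1 (cub c) \<or> feq F2 (cub c) \<or> (CHAR('a alg_closure) = 2 \<and> feq F3 (cub c))"
    using ruled_cubic_singular[OF r(1) hom r(2)] irreducible_not_reducible_fun[OF irr] degenerate_imp_cone[OF hom] r(2)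
    by (intro cubic_classification) (auto simp: c')
  then show ?thesis
    unfolding standard_equations_def by (auto simp: lin_equiv_iff_feq c' eval_std_fun split: if_splits)
qed

section \<open>The standard cubics are irreducible\<close>

lemma coeff_hom_pconst: "coeff_hom (\<lambda>c. [:c:])"
  by unfold_locales (auto simp: one_pCons mult.commute)

lemma vec_nth_lambda: "($) (\<chi> i. g i) = g"
  by auto

lemma coeff_hom_comp: "coeff_hom f \<Longrightarrow> coeff_hom g \<Longrightarrow> coeff_hom (\<lambda>x. f (g x))"
  by (simp add: coeff_hom_def)

lemma coeff_hom_poly: "coeff_hom (\<lambda>p. poly p x)"
  by unfold_locales auto

lemma poly_subst_eval:
  "poly (subst_poly (\<lambda>c. [:c:]) G f) t = eval_poly f (\<chi> i. poly (G i) t)"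
  unfolding eval_poly_def by (simp add: coeff_hom.hom_subst_poly[OF coeff_hom_poly] vec_nth_lambda)

text \<open>The polynomial as a univariate one in t4. The coefficients keep the type of polynomials
  in four variables although t4 no longer occurs in them. The normal forms have degree 1 in t4,
  which is what the irreducibility proof exploits.\<close>

definition poly_in_4 :: "(4, 'a::field) mpoly \<Rightarrow> (4, 'a) mpoly poly" where
  "poly_in_4 f = subst_poly (\<lambda>c. [:const_poly c:]) (\<lambda>i. if i = 4 then [:0, 1:] else [:var_poly i:]) f"

lemma coeff_hom_pconst2: "coeff_hom (\<lambda>c. [:const_poly c:])"
  by (rule coeff_hom_comp[OF coeff_hom_pconst coeff_hom_const])

lemma coeff_hom_poly_in_4: "coeff_hom poly_in_4"
  unfolding poly_in_4_def by (rule coeff_hom.coeff_hom_subst_poly[OF coeff_hom_pconst2])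

lemma poly_in_4_var: "poly_in_4 (var_poly i) = (if i = 4 then [:0, 1:] else [:var_poly i:])"
  unfolding poly_in_4_def by (rule coeff_hom.subst_poly_var[OF coeff_hom_pconst2])

lemma eval_poly_in_4:
  "eval_poly (poly (poly_in_4 f) (const_poly y)) x = eval_poly f (\<chi> i. if i = 4 then y else x $ i)"
proof -
  have h: "coeff_hom (\<lambda>p. eval_poly (poly p (const_poly y)) x)"
    by (rule coeff_hom_comp[OF coeff_hom_eval coeff_hom_poly])
  have "(\<lambda>i. eval_poly (poly (if i = 4 then [:0, 1:] else [:var_poly i:]) (const_poly y)) x)
    = (\<lambda>i. if i = 4 then y else x $ i)" by auto
  then show ?thesis
    unfolding poly_in_4_def eval_poly_def[of f] coeff_hom.hom_subst_poly[OF h] by (simp add: vec_nth_lambda)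
qed

text \<open>The degrees in t4 of the two factors add up to 1, so one of them is 0.\<close>

lemma factor_free_of_4:
  fixes a b :: "(4, 'a::alg_closed_field) mpoly"
  assumes "poly_in_4 (a * b) = [:r, q:]" "q \<noteq> 0"
  obtains a' b' where "(a', b') = (a, b) \<or> (a', b') = (b, a)"
    "\<And>x y. eval_poly a' (\<chi> i. if i = 4 then y else x $ i) = eval_poly a' x"
proof -
  have m: "poly_in_4 a * poly_in_4 b = [:r, q:]"
    using assms(1) coeff_hom.hom_mult[OF coeff_hom_poly_in_4, of a b] by simp
  with assms(2) have "poly_in_4 a \<noteq> 0" "poly_in_4 b \<noteq> 0" by auto
  then have "Polynomial.degree (poly_in_4 a) + Polynomial.degree (poly_in_4 b) = 1"
    using degree_mult_eq[of "poly_in_4 a" "poly_in_4 b"] m assms(2) by simp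
  then have "Polynomial.degree (poly_in_4 a) = 0 \<or> Polynomial.degree (poly_in_4 b) = 0" by linarith
  moreover have "eval_poly d (\<chi> i. if i = 4 then y else x $ i) = eval_poly d x"
    if deg: "Polynomial.degree (poly_in_4 d) = 0" for d x and y :: 'a
  proof -
    obtain e where "poly_in_4 d = [:e:]" using degree_eq_zeroE[OF deg] by blast
    then have e: "eval_poly d (\<chi> i. if i = 4 then y else x $ i) = eval_poly e x" for x y
      using eval_poly_in_4[of d y x] by simp
    have "(\<chi> i. if i = 4 then x $ 4 else x $ i) = x" by (simp add: vec_eq_iff)
    with e[of "x $ 4" x] e[of y x] show ?thesis by simp
  qed
  ultimately show ?thesis using that by blast
qed

text \<open>Restricted to a line from \<open>p\<close> to a point outside the zeros of
  \<open>h\<close>, the polynomial has no root and hence is constant. So \<open>a\<close> minus its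
  value at \<open>p\<close> vanishes wherever \<open>h\<close> does not, and its product with
  \<open>h\<close> is zero.\<close>

lemma unit_if_nonvanishing:
  fixes a h :: "(4, 'a::alg_closed_field) mpoly"
  assumes h: "h \<noteq> 0" and nv: "\<And>x t. eval_poly h x \<noteq> 0 \<Longrightarrow> eval_poly a (p + t *s (x - p)) \<noteq> 0"
  shows "a dvd 1"
proof -
  have eq: "eval_poly a x = eval_poly a p" if "eval_poly h x \<noteq> 0" for x
  proof -
    define P where "P = subst_poly (\<lambda>c. [:c:]) (\<lambda>i. [:p $ i, x $ i - p $ i:]) a"
    have P: "poly P t = eval_poly a (p + t *s (x - p))" for t
    proof -
      have "(\<chi> i. poly [:p $ i, x $ i - p $ i:] t) = p + t *s (x - p)" by (simp add: vec_eq_iff algebra_simps)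
      then show ?thesis unfolding P_def poly_subst_eval by simp
    qed
    have "Polynomial.degree P = 0"
    proof (rule ccontr)
      assume "Polynomial.degree P \<noteq> 0"
      then obtain t where "poly P t = 0" using alg_closed_imp_poly_has_root[of P] by auto
      with nv[OF that, of t] show False by (simp add: P)
    qed
    then obtain k where "P = [:k:]" using degree_eq_zeroE by blast
    with P[of 0] P[of 1] show ?thesis by simp
  qed
  have "(a - const_poly (eval_poly a p)) * h = 0"
    by (rule mpoly4_eqI) (use eq in auto)
  with h have a: "a = const_poly (eval_poly a p)" by simp
  obtain x where x: "eval_poly h x \<noteq> 0" using h mpoly4_eqI[of h 0] by auto
  have "eval_poly a p \<noteq> 0" using nv[OF x, of 0] by simp
  then have "a * const_poly (1 / eval_poly a p) = 1"
    by (subst a, intro mpoly4_eqI) simp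
  then show ?thesis by (metis dvd_triv_left)
qed

text \<open>If a factor free of t4 vanishes at \<open>z\<close>, then \<open>f\<close> vanishes for
  every value of t4 there, so both \<open>r\<close> and \<open>q\<close> vanish at \<open>z\<close>.
  Generic lines through \<open>p\<close> avoid these common zeros, which makes the factor a
  unit.\<close>

lemma irreducible_linear_in_4:
  fixes f q r h :: "(4, 'a::alg_closed_field) mpoly"
  assumes f: "poly_in_4 f = [:r, q:]" "q \<noteq> 0" and f0: "eval_poly f 0 = 0"
    and fqr: "\<And>x. eval_poly f x = eval_poly r x + x $ 4 * eval_poly q x"
    and qr: "\<And>x y. eval_poly q (\<chi> i. if i = 4 then y else x $ i) = eval_poly q x"
      "\<And>x y. eval_poly r (\<chi> i. if i = 4 then y else x $ i) = eval_poly r x"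
    and h: "h \<noteq> 0"
    and nv: "\<And>x t. eval_poly h x \<noteq> 0 \<Longrightarrow>
      eval_poly q (p + t *s (x - p)) \<noteq> 0 \<or> eval_poly r (p + t *s (x - p)) \<noteq> 0"
  shows "Factorial_Ring.irreducible f"
proof (rule Factorial_Ring.irreducibleI)
  show "f \<noteq> 0"
  proof
    assume "f = 0"
    then have "poly_in_4 f = 0" using coeff_hom.hom_0[OF coeff_hom_poly_in_4] by simp
    with f show False by simp
  qed
  show "\<not> f dvd 1"
  proof
    assume "f dvd 1"
    then obtain k where "1 = f * k" by (auto simp: dvd_def)
    then have "eval_poly 1 (0 :: 'a ^ 4) = eval_poly f 0 * eval_poly k 0" by (metis eval_poly_mult)
    then show False using f0 by simp
  qed
  fix a b assume ab: "f = a * b"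
  obtain a' b' where a': "(a', b') = (a, b) \<or> (a', b') = (b, a)"
    "\<And>x y. eval_poly a' (\<chi> i. if i = 4 then y else x $ i) = eval_poly a' x"
    using factor_free_of_4[of a b r q] f unfolding ab by blast
  have fab: "eval_poly f x = eval_poly a' x * eval_poly b' x" for x using a'(1) ab by auto
  have "a' dvd 1"
  proof (rule unit_if_nonvanishing[OF h])
    fix x t assume x: "eval_poly h x \<noteq> 0"
    show "eval_poly a' (p + t *s (x - p)) \<noteq> 0"
    proof
      define z where "z = p + t *s (x - p)"
      assume "eval_poly a' (p + t *s (x - p)) = 0"
      then have "eval_poly f (\<chi> i. if i = 4 then y else z $ i) = 0" for y
        unfolding fab a'(2) z_def by simp
      then have y: "eval_poly r z + y * eval_poly q z = 0" for y unfolding fqr qr by simp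
      from y[of 0] y[of 1] have "eval_poly r z = 0" "eval_poly q z = 0" by auto
      with nv[OF x, of t] show False unfolding z_def by simp
    qed
  qed
  with a'(1) show "a dvd 1 \<or> b dvd 1" by auto
qed

lemmas poly_in_4_simps = coeff_hom.hom_add[OF coeff_hom_poly_in_4] coeff_hom.hom_mult[OF coeff_hom_poly_in_4]
  coeff_hom.hom_power[OF coeff_hom_poly_in_4] poly_in_4_var

lemma mpoly4_neq_0I: "eval_poly f x \<noteq> 0 \<Longrightarrow> f \<noteq> (0 :: (4, 'a::field) mpoly)"
  by auto

text \<open>In each case \<open>p\<close> is a point with nonzero \<open>q\<close>, and
  \<open>h\<close> singles out endpoints for which the line from \<open>p\<close> misses the common
  zeros of \<open>q\<close> and \<open>r\<close>.\<close>

lemma irreducible_std: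
  "Factorial_Ring.irreducible (std1 :: (4, 'a::alg_closed_field) mpoly)"
  "Factorial_Ring.irreducible (std2 :: (4, 'a::alg_closed_field) mpoly)"
  "Factorial_Ring.irreducible (std3 :: (4, 'a::alg_closed_field) mpoly)"
proof -
  show "Factorial_Ring.irreducible (std1 :: (4, 'a) mpoly)"
  proof (rule irreducible_linear_in_4[where q = "var_poly 2 ^ 2" and r = "var_poly 3 * var_poly 1 ^ 2"
        and h = "var_poly 1 * var_poly 3" and p = "vec4 0 1 0 0"])
    show "poly_in_4 std1 = [:var_poly 3 * var_poly 1 ^ 2, var_poly 2 ^ 2 :: (4, 'a) mpoly:]"
      by (simp add: std1_def poly_in_4_simps power2_eq_square)
    show "var_poly 2 ^ 2 \<noteq> (0 :: (4, 'a) mpoly)" by (rule mpoly4_neq_0I[of _ "vec4 1 1 1 1"]) simp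
    show "var_poly 1 * var_poly 3 \<noteq> (0 :: (4, 'a) mpoly)" by (rule mpoly4_neq_0I[of _ "vec4 1 1 1 1"]) simp
  next
    fix x :: "'a ^ 4" and t assume "eval_poly (var_poly 1 * var_poly 3) x \<noteq> 0"
    then show "eval_poly (var_poly 2 ^ 2) (vec4 0 1 0 0 + t *s (x - vec4 0 1 0 0)) \<noteq> 0 \<or>
      eval_poly (var_poly 3 * var_poly 1 ^ 2) (vec4 0 1 0 0 + t *s (x - vec4 0 1 0 0)) \<noteq> 0"
      by (cases "t = 0") auto
  qed (simp_all add: F1_def)
  show "Factorial_Ring.irreducible (std2 :: (4, 'a) mpoly)"
  proof (rule irreducible_linear_in_4[where q = "var_poly 1 ^ 2" and r = "var_poly 3 * var_poly 1 * var_poly 2 + var_poly 2 ^ 3"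
        and h = "var_poly 2" and p = "vec4 1 0 0 0"])
    show "poly_in_4 std2 = [:var_poly 3 * var_poly 1 * var_poly 2 + var_poly 2 ^ 3, var_poly 1 ^ 2 :: (4, 'a) mpoly:]"
      by (simp add: std2_def poly_in_4_simps power2_eq_square power3_eq_cube)
    show "var_poly 1 ^ 2 \<noteq> (0 :: (4, 'a) mpoly)" by (rule mpoly4_neq_0I[of _ "vec4 1 1 1 1"]) simp
    show "var_poly 2 \<noteq> (0 :: (4, 'a) mpoly)" by (rule mpoly4_neq_0I[of _ "vec4 1 1 1 1"]) simp
  next
    fix x :: "'a ^ 4" and t assume "eval_poly (var_poly 2) x \<noteq> 0"
    then show "eval_poly (var_poly 1 ^ 2) (vec4 1 0 0 0 + t *s (x - vec4 1 0 0 0)) \<noteq> 0 \<or>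
      eval_poly (var_poly 3 * var_poly 1 * var_poly 2 + var_poly 2 ^ 3) (vec4 1 0 0 0 + t *s (x - vec4 1 0 0 0)) \<noteq> 0"
      by (cases "t = 0"; cases "1 + t * (x $ 1 - 1) = 0") auto
  qed (simp_all add: F2_def)
  show "Factorial_Ring.irreducible (std3 :: (4, 'a) mpoly)"
  proof (rule irreducible_linear_in_4[where q = "var_poly 2 ^ 2 + var_poly 1 * var_poly 2" and r = "var_poly 3 * var_poly 1 ^ 2"
        and h = "var_poly 1 * var_poly 3" and p = "vec4 0 1 0 0"])
    show "poly_in_4 std3 = [:var_poly 3 * var_poly 1 ^ 2, var_poly 2 ^ 2 + var_poly 1 * var_poly 2 :: (4, 'a) mpoly:]"
      by (simp add: std3_def poly_in_4_simps power2_eq_square)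
    show "var_poly 2 ^ 2 + var_poly 1 * var_poly 2 \<noteq> (0 :: (4, 'a) mpoly)"
      by (rule mpoly4_neq_0I[of _ "vec4 0 1 0 0"]) simp
    show "var_poly 1 * var_poly 3 \<noteq> (0 :: (4, 'a) mpoly)" by (rule mpoly4_neq_0I[of _ "vec4 1 1 1 1"]) simp
  next
    fix x :: "'a ^ 4" and t assume "eval_poly (var_poly 1 * var_poly 3) x \<noteq> 0"
    then show "eval_poly (var_poly 2 ^ 2 + var_poly 1 * var_poly 2) (vec4 0 1 0 0 + t *s (x - vec4 0 1 0 0)) \<noteq> 0 \<or>
      eval_poly (var_poly 3 * var_poly 1 ^ 2) (vec4 0 1 0 0 + t *s (x - vec4 0 1 0 0)) \<noteq> 0"
      by (cases "t = 0") auto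
  qed (simp_all add: F3_def)
qed

lemma lin_subst_dvd_1:
  fixes a :: "(4, 'a::alg_closed_field) mpoly"
  assumes "lin_subst B a dvd 1" "\<And>x. B *v (A *v x) = x" shows "a dvd 1"
proof -
  obtain k where k: "1 = lin_subst B a * k" using assms(1) by (auto simp: dvd_def)
  have "1 = a * lin_subst A k"
  proof (rule mpoly4_eqI)
    fix x
    have "eval_poly 1 (A *v x) = eval_poly (lin_subst B a * k) (A *v x)" by (simp only: k[symmetric])
    then show "eval_poly 1 x = eval_poly (a * lin_subst A k) x" by (simp add: assms(2))
  qed
  then show ?thesis by (metis dvd_triv_left)
qed

lemma irreducible_lin_equiv:
  fixes f g :: "(4, 'a::alg_closed_field) mpoly"
  assumes irr: "Factorial_Ring.irreducible f" and eq: "lin_equiv f g"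
  shows "Factorial_Ring.irreducible g"
proof -
  obtain A c where A: "invertible A" "c \<noteq> 0" "g = const_poly c * lin_subst A f"
    using eq unfolding lin_equiv_def by blast
  obtain B where B: "\<And>x. A *v (B *v x) = x" "\<And>x. B *v (A *v x) = x" using invertible_inverse[OF A(1)] by metis
  show ?thesis
  proof (rule Factorial_Ring.irreducibleI)
    have f: "f = const_poly (1 / c) * lin_subst B g" using A(2) by (simp add: mpoly4_eq_iff A(3) B)
    show "g \<noteq> 0"
    proof
      assume "g = 0"
      then have "f = 0" using f by (simp add: mpoly4_eq_iff)
      with irr show False by (simp add: Factorial_Ring.irreducible_def)
    qed
    have fu: "\<not> f dvd 1" using irr by (simp add: Factorial_Ring.irreducible_def)
    show "\<not> g dvd 1"
    proof
      assume "g dvd 1"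
      then have "lin_subst A f dvd 1" unfolding A(3) by (rule dvd_mult_right)
      then show False using lin_subst_dvd_1[OF _ B(1)] fu by blast
    qed
    fix a b assume ab: "g = a * b"
    have "f = (const_poly (1 / c) * lin_subst B a) * lin_subst B b"
      unfolding f ab by (simp add: mpoly4_eq_iff)
    then have "const_poly (1 / c) * lin_subst B a dvd 1 \<or> lin_subst B b dvd 1"
      using Factorial_Ring.irreducibleD[OF irr] by blast
    then have "lin_subst B a dvd 1 \<or> lin_subst B b dvd 1" using dvd_mult_right by blast
    then show "a dvd 1 \<or> b dvd 1" using lin_subst_dvd_1[OF _ B(2)] by blast
  qed
qed

section \<open>Linear images of the twisted cubic\<close>

definition upoly :: "('a::field \<Rightarrow> 'a) \<Rightarrow> bool" where "upoly g \<longleftrightarrow> (\<exists>p. \<forall>t. poly p t = g t)"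

lemma upoly_comp:
  assumes "hpoly d h" "\<And>i. upoly (\<lambda>t. G t $ i)" shows "upoly (\<lambda>t. h (G t))"
proof -
  obtain f where f: "\<And>x. eval_poly f x = h x" using assms(1) unfolding hpoly_def by blast
  obtain P where P: "\<And>i t. poly (P i) t = G t $ i" using assms(2) unfolding upoly_def by metis
  have "poly (subst_poly (\<lambda>c. [:c:]) P f) t = h (G t)" for t
    unfolding poly_subst_eval by (simp add: P f)
  then show ?thesis unfolding upoly_def by blast
qed

definition tc :: "'a::field \<Rightarrow> 'a \<Rightarrow> 'a ^ 4" where "tc s t = vec4 (s^3) (s^2 * t) (s * t^2) (t^3)"

lemma upoly_zero:
  fixes g :: "'a::alg_closed_field \<Rightarrow> 'a"
  assumes "upoly g" "infinite {t. g t = 0}" shows "g t = 0"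
proof -
  obtain p where p: "\<And>t. poly p t = g t" using assms(1) unfolding upoly_def by blast
  have "p = 0" by (rule poly_eqI_infinite[OF assms(2)]) (simp add: p)
  with p[of t] show ?thesis by simp
qed

lemma linearI:
  assumes "\<And>x y. N (x + y) = N x + N y" "\<And>c x. N (c *s x) = c *s N x"
  shows "Vector_Spaces.linear (*s) (*s) (N :: 'a::field ^ 'n \<Rightarrow> 'a ^ 'm)"
  unfolding Vector_Spaces.linear_iff by (intro conjI allI vec.vector_space_axioms assms)

text \<open>A curve given as a linear image of the twisted cubic. The linear left inverse
  \<open>M\<close> makes its equations explicit: \<open>x = N (M x)\<close> together with the
  equations of the twisted cubic for \<open>M x\<close>.\<close>

locale twisted_cubic =
  fixes N :: "'a::alg_closed_field ^ 4 \<Rightarrow> 'a ^ 'n::finite" and M :: "'a ^ 'n \<Rightarrow> 'a ^ 4"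
  assumes N_lin: "Vector_Spaces.linear (*s) (*s) N" and M_lin: "Vector_Spaces.linear (*s) (*s) M"
    and MN: "\<And>s t. M (N (tc s t)) = tc s t"
begin

lemma N: "hpoly (Suc 0) (\<lambda>x. N x $ i)"
  by (rule linear_hpoly[OF N_lin])

lemma M: "hpoly (Suc 0) (\<lambda>x. M x $ i)"
  by (rule linear_hpoly[OF M_lin])

definition C :: "('a ^ 'n) set" where "C = {N (tc s t) | s t. (s, t) \<noteq> (0, 0)}"

lemma C_mem: "(s, t) \<noteq> (0, 0) \<Longrightarrow> N (tc s t) \<in> C"
  unfolding C_def by blast

lemma N_scale: "N (k *s x) = k *s N x"
  by (simp add: vec_eq_iff hpoly_scale[OF N])

lemma M_0: "M 0 = 0"
proof -
  have "M (0 *s 0) $ i = 0" for i by (subst hpoly_scale[OF M]) simp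
  then show ?thesis by (simp add: vec_eq_iff)
qed

lemma tc_0_iff: "tc s t = (0 :: 'a ^ 4) \<longleftrightarrow> s = 0 \<and> t = 0"
  by (auto simp: tc_def vec4_eq_iff)

lemma C_nonzero: "x \<in> C \<Longrightarrow> x \<noteq> 0"
  unfolding C_def using MN M_0 tc_0_iff by (smt (verit) mem_Collect_eq prod.inject)

lemma tc_cases:
  assumes "(s, t) \<noteq> (0, 0)"
  obtains k u where "k \<noteq> 0" "tc s t = k *s tc 1 u" | k where "k \<noteq> 0" "tc s t = k *s tc 0 (1::'a)" "s = 0"
proof (cases "s = 0")
  case True
  then show ?thesis using assms that(2)[of "t^3"] by (auto simp: tc_def vec4_eq_iff)
next
  case False
  then show ?thesis using that(1)[of "s^3" "t / s"]
    by (simp add: tc_def vec4_eq_iff power3_eq_cube power2_eq_square)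
qed

text \<open>In the chart \<open>s = 1\<close> the form becomes a univariate polynomial with
  infinitely many zeros. The remaining point \<open>s = 0\<close> is reached in the chart
  \<open>t = 1\<close>, where the form already vanishes for all \<open>s \<noteq> 0\<close>.\<close>

lemma vanish_on_C:
  assumes h: "hpoly d h" and inf: "infinite {t. h (N (tc 1 t)) = 0}" and x: "x \<in> C"
  shows "h x = 0"
proof -
  have tc: "\<exists>p. \<forall>t. poly p t = tc 1 t $ i" "\<exists>p. \<forall>t. poly p t = tc t 1 $ i" for i
    using exhaust_4[of i]
    by (auto simp: tc_def intro: exI[of _ "[:1:]"] exI[of _ "[:0,1:]"] exI[of _ "[:0,0,1:]"] exI[of _ "[:0,0,0,1:]"]
        simp: power2_eq_square power3_eq_cube)
  have up: "upoly (\<lambda>t. h (N (tc 1 t)))" "upoly (\<lambda>s. h (N (tc s 1)))"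
    by (rule upoly_comp[OF h upoly_comp[OF N]], simp add: upoly_def tc)+
  have 1: "h (N (tc 1 t)) = 0" for t by (rule upoly_zero[OF up(1) inf])
  have s: "h (N (k *s y)) = k ^ d * h (N y)" for k y by (simp add: N_scale hpoly_scale[OF h])
  have "{s. s \<noteq> 0} \<subseteq> {s. h (N (tc s 1)) = 0}"
  proof
    fix s :: 'a assume "s \<in> {s. s \<noteq> 0}"
    then have "tc s 1 = s^3 *s tc 1 (1 / s)"
      by (simp add: tc_def vec4_eq_iff power3_eq_cube power2_eq_square)
    then show "s \<in> {s. h (N (tc s 1)) = 0}" by (simp add: s 1)
  qed
  moreover have "infinite {s::'a. s \<noteq> 0}"
  proof
    assume "finite {s::'a. s \<noteq> 0}"
    then have "finite (insert 0 {s::'a. s \<noteq> 0})" by simp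
    moreover have "insert 0 {s::'a. s \<noteq> 0} = UNIV" by auto
    ultimately show False using infinite_UNIV_alg_closed[where 'a = 'a] by simp
  qed
  ultimately have 2: "h (N (tc 0 1)) = 0"
    by (intro upoly_zero[OF up(2)]) (use finite_subset in blast)
  obtain a b where ab: "x = N (tc a b)" "(a, b) \<noteq> (0, 0)" using x unfolding C_def by blast
  from ab(2) show ?thesis by (cases rule: tc_cases) (auto simp: ab(1) s 1 2)
qed

text \<open>A closed set contains the curve or meets its chart in finitely many points. Both
  irreducibility and dimension one follow from this dichotomy.\<close>

lemma C_subset:
  assumes "proj_closed Y" "infinite {t. N (tc 1 t) \<in> Y}" shows "C \<subseteq> Y"
proof -
  obtain H where H: "\<forall>h\<in>H. \<exists>d. hpoly d h" "Y = {x. x \<noteq> 0 \<and> (\<forall>h\<in>H. h x = 0)}"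
    by (rule proj_closedE[OF assms(1)])
  show ?thesis
  proof
    fix x assume x: "x \<in> C"
    have "h x = 0" if h: "h \<in> H" for h
    proof -
      obtain d where d: "hpoly d h" using H(1) h by blast
      have "{t. N (tc 1 t) \<in> Y} \<subseteq> {t. h (N (tc 1 t)) = 0}" using h unfolding H(2) by blast
      with assms(2) have "infinite {t. h (N (tc 1 t)) = 0}" using finite_subset by blast
      from vanish_on_C[OF d this x] show ?thesis .
    qed
    with C_nonzero[OF x] show "x \<in> Y" unfolding H(2) by blast
  qed
qed

text \<open>The quadratic equations are the minors of the matrix with rows (q1, q2, q3) and (q2, q3,
  q4), which cut out the twisted cubic. A cube root of the first or the last coordinate recovers the
  parameters.\<close>

lemma closed_C: "proj_closed C"
proof -
  let ?H = "range (\<lambda>i x. x $ i - N (M x) $ i) \<union> {\<lambda>x. M x $ 1 * M x $ 3 - M x $ 2 * M x $ 2,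
    \<lambda>x. M x $ 1 * M x $ 4 - M x $ 2 * M x $ 3, \<lambda>x. M x $ 2 * M x $ 4 - M x $ 3 * M x $ 3}"
  have NM: "hpoly (Suc 0) (\<lambda>x. N (M x) $ i)" for i
    using linear_hpoly[OF Vector_Spaces.linear_compose[OF M_lin N_lin]] by simp
  have cl: "proj_closed {x. x \<noteq> 0 \<and> (\<forall>h\<in>?H. h x = 0)}"
  proof (rule proj_closed_zeros)
    fix h assume "h \<in> ?H"
    then consider i where "h = (\<lambda>x. x $ i - N (M x) $ i)"
      | "h = (\<lambda>x. M x $ 1 * M x $ 3 - M x $ 2 * M x $ 2)" | "h = (\<lambda>x. M x $ 1 * M x $ 4 - M x $ 2 * M x $ 3)"
      | "h = (\<lambda>x. M x $ 2 * M x $ 4 - M x $ 3 * M x $ 3)" by blast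
    then show "\<exists>d. hpoly d h"
    proof cases
      case 1
      then show ?thesis using hpoly_diff[OF hpoly_nth NM] by blast
    qed (use hpoly_diff[OF hpoly_mult[OF M M refl] hpoly_mult[OF M M refl]] in blast)+
  qed
  have H: "(\<forall>h\<in>?H. h x = 0) \<longleftrightarrow> (\<forall>i. x $ i - N (M x) $ i = 0) \<and>
    M x $ 1 * M x $ 3 - M x $ 2 * M x $ 2 = 0 \<and> M x $ 1 * M x $ 4 - M x $ 2 * M x $ 3 = 0 \<and>
    M x $ 2 * M x $ 4 - M x $ 3 * M x $ 3 = 0" for x
    unfolding ball_Un by simp
  have mem: "x \<in> C \<longleftrightarrow> x \<noteq> 0 \<and> (\<forall>h\<in>?H. h x = 0)" for x
    unfolding H
  proof
    assume x: "x \<in> C"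
    then obtain s t where st: "x = N (tc s t)" unfolding C_def by blast
    have "x $ i - N (M x) $ i = 0" for i unfolding st MN by simp
    moreover have "M x = tc s t" unfolding st by (rule MN)
    ultimately show "x \<noteq> 0 \<and> (\<forall>i. x $ i - N (M x) $ i = 0) \<and>
      M x $ 1 * M x $ 3 - M x $ 2 * M x $ 2 = 0 \<and> M x $ 1 * M x $ 4 - M x $ 2 * M x $ 3 = 0 \<and>
      M x $ 2 * M x $ 4 - M x $ 3 * M x $ 3 = 0"
      using C_nonzero[OF x] by (auto simp: tc_def power2_eq_square power3_eq_cube)
  next
    assume a: "x \<noteq> 0 \<and> (\<forall>i. x $ i - N (M x) $ i = 0) \<and>
      M x $ 1 * M x $ 3 - M x $ 2 * M x $ 2 = 0 \<and> M x $ 1 * M x $ 4 - M x $ 2 * M x $ 3 = 0 \<and>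
      M x $ 2 * M x $ 4 - M x $ 3 * M x $ 3 = 0"
    define q where "q = M x"
    have "x $ i = N q $ i" for i using a by (simp only: q_def right_minus_eq)
    then have x: "x = N q" unfolding vec_eq_iff by blast
    have m: "q$1 * q$3 - q$2 * q$2 = 0" "q$1 * q$4 - q$2 * q$3 = 0" "q$2 * q$4 - q$3 * q$3 = 0"
      using a unfolding q_def by blast+
    have "\<exists>s t. q = tc s t"
    proof (cases "q$1 = 0")
      case True
      with m have "q$2 = 0" "q$3 = 0" by auto
      obtain t where "t^3 = q$4" using alg_closed_root[of 3 "q$4"] by auto
      with True \<open>q$2 = 0\<close> \<open>q$3 = 0\<close> have "q = tc 0 t" by (simp add: tc_def vec4_eq_iff)
      then show ?thesis by blast
    next
      case False
      obtain s where s: "s^3 = q$1" using alg_closed_root[of 3 "q$1"] by auto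
      with False have s0: "s \<noteq> 0" by auto
      define t where "t = q$2 / s^2"
      have q2: "q$2 = s^2 * t" using s0 by (simp add: t_def)
      have "s^3 * (q$3 - s * t^2) = 0" "s^3 * (q$4 - t^3) = 0"
        using m(1,2) unfolding s[symmetric] q2 by Groebner_Basis.algebra+
      with s0 have "q = tc s t" by (simp add: tc_def vec4_eq_iff s q2 False)
      then show ?thesis by blast
    qed
    then obtain s t where "q = tc s t" by blast
    moreover have "(s, t) \<noteq> (0, 0)"
    proof
      assume "(s, t) = (0, 0)"
      then have "q = 0 *s 0" using \<open>q = tc s t\<close> by (simp add: tc_def vec4_eq_iff)
      then have "x = N (0 *s 0)" by (simp only: x)
      then have "x = 0" unfolding N_scale by simp
      with a show False by blast
    qed
    ultimately show "x \<in> C" unfolding C_def x by blast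
  qed
  have "C = {x. x \<noteq> 0 \<and> (\<forall>h\<in>?H. h x = 0)}"
    unfolding set_eq_iff mem_Collect_eq mem by blast
  with cl show ?thesis by (simp only:)
qed

lemma not_point: "\<not> is_proj_point C"
proof
  assume "is_proj_point C"
  then obtain x where x: "C = {c *s x | c. c \<noteq> 0}" unfolding is_proj_point_def by blast
  have "N (tc 1 0) \<in> C" "N (tc 0 1) \<in> C" by (simp_all add: C_mem)
  then obtain c d where cd: "N (tc 1 0) = c *s x" "N (tc 0 1) = d *s x" "c \<noteq> 0" "d \<noteq> 0" unfolding x by auto
  then have "N (tc 1 0) = N ((c / d) *s tc 0 1)" unfolding N_scale by (simp add: vector_smult_assoc)
  then have "tc 1 0 = M (N ((c / d) *s tc 0 1))" using MN[of 1 0] by simp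
  also have "\<dots> = (c / d) *s tc 0 1"
    unfolding N_scale using hpoly_scale[OF M] by (simp add: vec_eq_iff MN)
  finally show False by (simp add: tc_def vec4_eq_iff)
qed

lemma proj_curve_C: "proj_curve C"
proof -
  have irr: "proj_irreducible C"
    unfolding proj_irreducible_def
  proof (intro conjI allI impI)
    show "proj_closed C" by (rule closed_C)
    show "C \<noteq> {}" using C_mem[of 1 0] by auto
    fix Y Z assume YZ: "proj_closed Y \<and> proj_closed Z \<and> C = Y \<union> Z"
    have "{t. N (tc 1 t) \<in> Y} \<union> {t. N (tc 1 t) \<in> Z} = UNIV"
      using YZ C_mem[of 1] by auto
    then have "infinite {t. N (tc 1 t) \<in> Y} \<or> infinite {t. N (tc 1 t) \<in> Z}"
      using infinite_UNIV_alg_closed by (metis finite_UnI)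
    then show "C = Y \<or> C = Z" using C_subset YZ by blast
  qed
  have "is_proj_point Y" if Y: "proj_irreducible Y" "Y \<subset> C" for Y
  proof -
    have cl: "proj_closed Y" "Y \<noteq> {}" using Y(1) by (auto simp: proj_irreducible_def)
    \<comment> \<open>A proper closed subset of the curve meets the chart in finitely many points,
      so it is covered by finitely many projective points. Irreducibility leaves one of
      them.\<close>
    have fin: "finite {t. N (tc 1 t) \<in> Y}" using C_subset[OF cl(1)] Y(2) by blast
    let ?S = "insert (N (tc 0 1)) ((\<lambda>t. N (tc 1 t)) ` {t. N (tc 1 t) \<in> Y})"
    let ?D = "\<lambda>q. {p. p \<noteq> 0 \<and> (\<forall>i j. q $ i * p $ j - q $ j * p $ i = 0)}"
    have "Y \<subseteq> (\<Union>q\<in>?S. ?D q)"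
    proof
      fix x assume x: "x \<in> Y"
      then have xC: "x \<in> C" using Y(2) by blast
      then obtain s t where st: "x = N (tc s t)" "(s, t) \<noteq> (0, 0)" unfolding C_def by blast
      from st(2) show "x \<in> (\<Union>q\<in>?S. ?D q)"
      proof (cases rule: tc_cases)
        case (1 k u)
        then have xk: "x = k *s N (tc 1 u)" by (simp add: st N_scale)
        then have "N (tc 1 u) = (1 / k) *s x" using 1(1) by (simp add: vector_smult_assoc)
        then have "N (tc 1 u) \<in> Y" using proj_closed_scale[OF cl(1) x, of "1 / k"] 1(1) by simp
        moreover have "x \<in> ?D (N (tc 1 u))" using C_nonzero[OF xC] by (simp add: xk)
        ultimately show ?thesis by blast
      next
        case (2 k)
        then have xk: "x = k *s N (tc 0 1)" by (simp add: st N_scale)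
        then have "x \<in> ?D (N (tc 0 1))" using C_nonzero[OF xC] by simp
        then show ?thesis by blast
      qed
    qed
    then have "\<exists>q\<in>?S. Y \<subseteq> ?D q"
    proof (rule proj_irreducible_UN[OF Y(1), rotated 2])
      show "finite ?S" by (intro finite.insertI finite_imageI fin)
      show "proj_closed (?D q)" for q by (rule proj_closed_multiples)
    qed
    then obtain q where qS: "q \<in> ?S" and q: "Y \<subseteq> ?D q" by blast
    have "q \<in> C" using qS by (auto simp: C_mem)
    then have q0: "q \<noteq> 0" by (rule C_nonzero)
    have multiple: "\<exists>k. k \<noteq> 0 \<and> y = k *s q" if y: "y \<in> Y" for y
    proof -
      have "y \<in> ?D q" using q y by (rule subsetD)
      then have y0: "y \<noteq> 0" and yq: "\<And>i j. q $ i * y $ j - q $ j * y $ i = 0" by simp_all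
      obtain k where "y = k *s q" using proportional[OF q0 yq] by blast
      with y0 show ?thesis by auto
    qed
    obtain x where x: "x \<in> Y" using cl(2) by blast
    obtain k where k: "k \<noteq> 0" "x = k *s q" using multiple[OF x] by blast
    have x0: "x \<noteq> 0" using k q0 by simp
    have "Y = {c *s x | c. c \<noteq> 0}"
    proof (intro equalityI subsetI)
      fix y assume "y \<in> Y"
      then obtain l where "l \<noteq> 0" "y = l *s q" using multiple by blast
      then have "y = (l / k) *s x" "l / k \<noteq> 0" using k by (simp_all add: vector_smult_assoc)
      then show "y \<in> {c *s x | c. c \<noteq> 0}" by blast
    qed (use proj_closed_scale[OF cl(1) x] in auto)
    then show ?thesis unfolding is_proj_point_def using x0 by blast
  qed
  with irr not_point show ?thesis unfolding proj_curve_def by blast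
qed

end

section \<open>The standard cubics are ruled\<close>

text \<open>The Pluecker vector with given coordinates \<open>p\<^sub>1\<^sub>3, p\<^sub>1\<^sub>4, p\<^sub>2\<^sub>3, p\<^sub>2\<^sub>4, p\<^sub>3\<^sub>4\<close> and \<open>p\<^sub>1\<^sub>2 = 0\<close>.\<close>

definition pl5 :: "'a::field \<Rightarrow> 'a \<Rightarrow> 'a \<Rightarrow> 'a \<Rightarrow> 'a \<Rightarrow> 'a ^ (4 \<times> 4)" where
  "pl5 p13 p14 p23 p24 p34 = (\<chi> ij.
     if ij = (1, 3) then p13 else if ij = (3, 1) then - p13 else
     if ij = (1, 4) then p14 else if ij = (4, 1) then - p14 else
     if ij = (2, 3) then p23 else if ij = (3, 2) then - p23 else
     if ij = (2, 4) then p24 else if ij = (4, 2) then - p24 else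
     if ij = (3, 4) then p34 else if ij = (4, 3) then - p34 else 0)"

lemma pl5_nth: "pl5 p13 p14 p23 p24 p34 $ ij = (
     if ij = (1, 3) then p13 else if ij = (3, 1) then - p13 else
     if ij = (1, 4) then p14 else if ij = (4, 1) then - p14 else
     if ij = (2, 3) then p23 else if ij = (3, 2) then - p23 else
     if ij = (2, 4) then p24 else if ij = (4, 2) then - p24 else
     if ij = (3, 4) then p34 else if ij = (4, 3) then - p34 else 0)"
  by (simp add: pl5_def)

lemma forall_4x4: "(\<forall>ij :: 4 \<times> 4. P ij) \<longleftrightarrow>
  (P (1,1) \<and> P (1,2) \<and> P (1,3) \<and> P (1,4)) \<and> (P (2,1) \<and> P (2,2) \<and> P (2,3) \<and> P (2,4)) \<and>
  (P (3,1) \<and> P (3,2) \<and> P (3,3) \<and> P (3,4)) \<and> (P (4,1) \<and> P (4,2) \<and> P (4,3) \<and> P (4,4))"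
  by (simp add: split_paired_All forall_4)

lemma pluecker_eq_pl5I:
  assumes "u$1 * v$2 - u$2 * v$1 = 0" "u$1 * v$3 - u$3 * v$1 = p13" "u$1 * v$4 - u$4 * v$1 = p14"
    "u$2 * v$3 - u$3 * v$2 = p23" "u$2 * v$4 - u$4 * v$2 = p24" "u$3 * v$4 - u$4 * v$3 = p34"
  shows "pluecker u v = pl5 p13 p14 p23 p24 p34"
  unfolding vec_eq_iff forall_4x4 pl5_nth pluecker_nth assms[symmetric] using assms(1) by simp

text \<open>The exterior square of \<open>B\<close>, acting on Pluecker vectors.\<close>

definition ext2 :: "'a::field ^ 4 ^ 4 \<Rightarrow> 'a ^ (4 \<times> 4) \<Rightarrow> 'a ^ (4 \<times> 4)" where
  "ext2 B p = (\<chi> ij. \<Sum>k\<in>UNIV. \<Sum>l\<in>UNIV. B $ fst ij $ k * B $ snd ij $ l * p $ (k, l))"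

lemma ext2_pluecker: "ext2 B (pluecker u v) = pluecker (B *v u) (B *v v)"
proof -
  have "ext2 B (pluecker u v) $ (a, b) = pluecker (B *v u) (B *v v) $ (a, b)" for a b
  proof -
    have "ext2 B (pluecker u v) $ (a, b) =
      (\<Sum>k\<in>UNIV. \<Sum>l\<in>UNIV. (B $ a $ k * u $ k) * (B $ b $ l * v $ l) - (B $ a $ k * v $ k) * (B $ b $ l * u $ l))"
      by (simp add: ext2_def algebra_simps)
    also have "\<dots> = (B *v u) $ a * (B *v v) $ b - (B *v v) $ a * (B *v u) $ b"
      by (simp only: sum_subtractf sum_product[symmetric] matrix_vector_mult_def vec_lambda_beta)
    finally show ?thesis by (simp only: pluecker_nth mult.commute)
  qed
  then show ?thesis unfolding vec_eq_iff split_paired_All by blast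
qed

lemma linear_ext2: "Vector_Spaces.linear (*s) (*s) (ext2 B)"
  by (rule linearI) (simp_all add: ext2_def vec_eq_iff sum.distrib sum_distrib_left algebra_simps)

text \<open>It suffices to parametrise the lines on a normal form \<open>G\<close>: the exterior
  square of a coordinate change is linear and invertible, so it carries the curve of lines to
  another linear image of the twisted cubic.\<close>

lemma ruledI:
  fixes f :: "(4, 'k::field) mpoly" and G :: "'k alg_closure ^ 4 \<Rightarrow> 'k alg_closure"
  assumes eq: "feq G (eval_poly (ac_poly f))"
    and N: "Vector_Spaces.linear (*s) (*s) N" and M: "Vector_Spaces.linear (*s) (*s) M"
    and MN: "\<And>s t. M (N (tc s t)) = tc s t"
    and uv: "\<And>s t. (s, t) \<noteq> (0, 0) \<Longrightarrow> N (tc s t) = pluecker (u s t) (v s t)"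
    and on: "\<And>s t a b. (s, t) \<noteq> (0, 0) \<Longrightarrow> G (a *s u s t + b *s v s t) = 0"
    and cover: "\<And>y. G y = 0 \<Longrightarrow> \<exists>s t a b. (s, t) \<noteq> (0, 0) \<and> y = a *s u s t + b *s v s t"
  shows "ruled f"
proof -
  obtain A c where A: "invertible A" "c \<noteq> 0" "\<And>x. eval_poly (ac_poly f) x = c * G (A *v x)"
    using eq unfolding feq_def by metis
  obtain B where B: "\<And>x. A *v (B *v x) = x" "\<And>x. B *v (A *v x) = x" using invertible_inverse[OF A(1)] by metis
  define N' where "N' x = ext2 B (N x)" for x
  define M' where "M' x = M (ext2 A x)" for x
  have uv': "N' (tc s t) = pluecker (B *v u s t) (B *v v s t)" if "(s, t) \<noteq> (0, 0)" for s t
    unfolding N'_def uv[OF that] ext2_pluecker ..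
  have lin: "Vector_Spaces.linear (*s) (*s) N'" "Vector_Spaces.linear (*s) (*s) M'"
    using Vector_Spaces.linear_compose[OF N linear_ext2] Vector_Spaces.linear_compose[OF linear_ext2 M]
    unfolding N'_def M'_def comp_def by blast+
  have MN': "M' (N' (tc s t)) = tc s t" for s t
  proof (cases "(s, t) = (0, 0)")
    case True
    have tc0: "tc s t = 0 *s 0" using True by (simp add: tc_def vec4_eq_iff)
    have sc: "L (k *s x) = k *s L x" if "Vector_Spaces.linear (*s) (*s) L"
      for L :: "'k alg_closure ^ 'n \<Rightarrow> 'k alg_closure ^ 'm" and k x
      using that unfolding Vector_Spaces.linear_iff by blast
    show ?thesis unfolding tc0 sc[OF lin(1)] sc[OF lin(2)] by simp
  next
    case False
    show ?thesis unfolding uv'[OF False] M'_def ext2_pluecker B uv[OF False, symmetric] by (rule MN)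
  qed
  interpret twisted_cubic N' M' by (rule twisted_cubic.intro[OF lin MN'])
  have "surface_points f = {x. x \<noteq> 0 \<and> (\<exists>u v a b. pluecker u v \<in> C \<and> x = a *s u + b *s v)}"
  proof (intro set_eqI equalityI subsetI; (elim CollectE conjE exE)?)
    fix x assume "x \<in> surface_points f"
    then have x: "x \<noteq> 0" "G (A *v x) = 0" using A(2,3) by (auto simp: surface_points_def)
    obtain s t a b where st: "(s, t) \<noteq> (0, 0)" "A *v x = a *s u s t + b *s v s t" using cover[OF x(2)] by blast
    have "x = B *v (a *s u s t + b *s v s t)" using B(2)[of x] st(2) by simp
    also have "\<dots> = a *s (B *v u s t) + b *s (B *v v s t)"
      by (simp add: matrix_vector_right_distrib vector_scalar_commute)
    finally have "x = a *s (B *v u s t) + b *s (B *v v s t)" .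
    moreover have "pluecker (B *v u s t) (B *v v s t) \<in> C" using C_mem[OF st(1)] uv'[OF st(1)] by simp
    ultimately show "x \<in> {x. x \<noteq> 0 \<and> (\<exists>u v a b. pluecker u v \<in> C \<and> x = a *s u + b *s v)}" using x(1) by blast
  next
    fix x u1 v1 a b assume x: "x \<noteq> 0" "x = a *s u1 + b *s v1" and p: "pluecker u1 v1 \<in> C"
    obtain s t where st: "pluecker u1 v1 = N' (tc s t)" "(s, t) \<noteq> (0, 0)" using p unfolding C_def by blast
    have "incident x (N' (tc s t))" unfolding st(1)[symmetric] x(2) by (rule incident_span)
    then have "incident x (pluecker (B *v u s t) (B *v v s t))" unfolding uv'[OF st(2)] .
    moreover have "pluecker (B *v u s t) (B *v v s t) \<noteq> 0"
      using C_nonzero[OF p] unfolding st(1) uv'[OF st(2)] .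
    ultimately obtain a' b' where "x = a' *s (B *v u s t) + b' *s (B *v v s t)" by (rule incident_imp_span)
    then have "A *v x = a' *s u s t + b' *s v s t"
      by (simp add: matrix_vector_right_distrib vector_scalar_commute B)
    then have "G (A *v x) = 0" using on[OF st(2)] by simp
    then show "x \<in> surface_points f" using x(1) by (simp add: surface_points_def A(3))
  qed
  moreover have "\<forall>p\<in>C. \<exists>u v. p = pluecker u v" unfolding C_def using uv' by blast
  ultimately show ?thesis unfolding ruled_def using proj_curve_C by blast
qed

lemma linear_pl5:
  assumes "\<And>x y. a (x + y) = a x + a y" "\<And>c x. a (c *s x) = c * a x"
    "\<And>x y. b (x + y) = b x + b y" "\<And>c x. b (c *s x) = c * b x"
    "\<And>x y. d (x + y) = d x + d y" "\<And>c x. d (c *s x) = c * d x"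
    "\<And>x y. e (x + y) = e x + e y" "\<And>c x. e (c *s x) = c * e x"
    "\<And>x y. g (x + y) = g x + g y" "\<And>c x. g (c *s x) = c * g x"
  shows "Vector_Spaces.linear (*s) (*s) (\<lambda>x :: 'a::field ^ 4. pl5 (a x) (b x) (d x) (e x) (g x))"
  by (rule linearI) (simp_all add: vec_eq_iff pl5_nth assms)

text \<open>In the plane where t1 : t2 = s : t the equation, apart from the double line, reduces to
  \<open>t3 s^2 + t4 t^2 = 0\<close>. This is the line joining (s, t, 0, 0) to the point (0, 0, t^2,
  -s^2) of the double line.\<close>

lemma ruled_F1:
  fixes f :: "(4, 'k::field) mpoly"
  assumes "feq F1 (eval_poly (ac_poly f))" shows "ruled f"
proof (rule ruledI[OF assms, where N = "\<lambda>q. pl5 (q$3) (- q$1) (q$4) (- q$2) 0"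
      and M = "\<lambda>p. vec4 (- p $ (1, 4)) (- p $ (2, 4)) (p $ (1, 3)) (p $ (2, 3))"
      and u = "\<lambda>s t. vec4 s t 0 0" and v = "\<lambda>s t. vec4 0 0 (t^2) (- (s^2))"])
  fix y :: "'k alg_closure ^ 4" assume y: "F1 y = 0"
  show "\<exists>s t a b. (s, t) \<noteq> (0, 0) \<and> y = a *s vec4 s t 0 0 + b *s vec4 0 0 (t^2) (- (s^2))"
  proof (cases "y$1 = 0 \<and> y$2 = 0")
    case True
    \<comment> \<open>Every point of the double line lies on a line of the family; its parameters
      are found by taking roots.\<close>
    obtain s where s: "s^2 = - y$4" using alg_closed_root[of 2 "- y$4"] by auto
    obtain t where t: "t^2 = y$3" using alg_closed_root[of 2 "y$3"] by auto
    show ?thesis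
    proof (cases "(s, t) = (0, 0)")
      case z: True
      then have "y = 0 *s vec4 1 0 0 0 + 0 *s vec4 0 0 (0^2) (- (1^2))"
        using True s t by (auto simp: vec4_eq_iff)
      then show ?thesis by (intro exI[of _ 1] exI[of _ 0] exI[of _ 0] exI[of _ 0]) simp
    next
      case False
      have "y = 0 *s vec4 s t 0 0 + 1 *s vec4 0 0 (t^2) (- (s^2))"
        using True s t by (simp add: vec4_eq_iff)
      with False show ?thesis by blast
    qed
  next
    case False
    define s t where "s = y$1" and "t = y$2"
    have st: "(s, t) \<noteq> (0, 0)" using False by (auto simp: s_def t_def)
    have eq: "y$3 * s^2 + y$4 * t^2 = 0" using y by (simp add: F1_def s_def t_def)
    obtain b where b: "y$3 = b * t^2" "y$4 = - (b * s^2)"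
    proof (cases "t = 0")
      case True
      then show ?thesis using st eq that[of "- y$4 / s^2"] by auto
    next
      case False
      have "y$4 = - (y$3 / t^2 * s^2)" using eq False by (simp add: field_simps eq_neg_iff_add_eq_0)
      then show ?thesis using False that[of "y$3 / t^2"] by auto
    qed
    have "y = 1 *s vec4 s t 0 0 + b *s vec4 0 0 (t^2) (- (s^2))"
      by (simp add: vec4_eq_iff b s_def[symmetric] t_def[symmetric])
    with st show ?thesis by blast
  qed
next
  fix s t :: "'k alg_closure"
  show "pl5 (tc s t $ 3) (- tc s t $ 1) (tc s t $ 4) (- tc s t $ 2) 0 = pluecker (vec4 s t 0 0) (vec4 0 0 (t^2) (- (s^2)))"
    by (rule pluecker_eq_pl5I[symmetric]) (simp_all add: tc_def power2_eq_square power3_eq_cube)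
qed (simp_all add: linear_pl5 linearI vec4_eq_iff pl5_nth tc_def F1_def power2_eq_square power3_eq_cube algebra_simps)

text \<open>As for \<open>F1\<close>, with \<open>t^2\<close> replaced by \<open>t^2 + s t\<close>;
  the points of the double line now lead to a quadratic equation for \<open>t\<close>.\<close>

lemma ruled_F3:
  fixes f :: "(4, 'k::field) mpoly"
  assumes "feq F3 (eval_poly (ac_poly f))" shows "ruled f"
proof (rule ruledI[OF assms, where N = "\<lambda>q. pl5 (q$3 + q$2) (- q$1) (q$4 + q$3) (- q$2) 0"
      and M = "\<lambda>p. vec4 (- p $ (1, 4)) (- p $ (2, 4)) (p $ (1, 3) + p $ (2, 4)) (p $ (2, 3) - p $ (1, 3) - p $ (2, 4))"
      and u = "\<lambda>s t. vec4 s t 0 0" and v = "\<lambda>s t. vec4 0 0 (t^2 + s * t) (- (s^2))"])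
  fix y :: "'k alg_closure ^ 4" assume y: "F3 y = 0"
  show "\<exists>s t a b. (s, t) \<noteq> (0, 0) \<and> y = a *s vec4 s t 0 0 + b *s vec4 0 0 (t^2 + s * t) (- (s^2))"
  proof (cases "y$1 = 0 \<and> y$2 = 0")
    case True
    obtain s where s: "s^2 = - y$4" using alg_closed_root[of 2 "- y$4"] by auto
    obtain t where t: "t^2 + s * t = y$3"
    proof -
      have "Polynomial.degree [:- y$3, s, 1:] > 0" by simp
      then obtain t where "poly [:- y$3, s, 1:] t = 0" using alg_closed_imp_poly_has_root by blast
      then have "t^2 + s * t = y$3" by (simp add: algebra_simps power2_eq_square eq_neg_iff_add_eq_0[symmetric])
      then show ?thesis using that by blast
    qed
    show ?thesis
    proof (cases "(s, t) = (0, 0)")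
      case z: True
      then have "y = 0 *s vec4 1 0 0 0 + 0 *s vec4 0 0 (0^2 + 1 * 0) (- (1^2))"
        using True s t by (auto simp: vec4_eq_iff)
      then show ?thesis by (intro exI[of _ 1] exI[of _ 0] exI[of _ 0] exI[of _ 0]) simp
    next
      case False
      have "y = 0 *s vec4 s t 0 0 + 1 *s vec4 0 0 (t^2 + s * t) (- (s^2))"
        using True s t by (simp add: vec4_eq_iff)
      with False show ?thesis by blast
    qed
  next
    case False
    define s t where "s = y$1" and "t = y$2"
    have st: "(s, t) \<noteq> (0, 0)" using False by (auto simp: s_def t_def)
    have eq: "y$3 * s^2 + y$4 * (t^2 + s * t) = 0" using y by (simp add: F3_def s_def t_def)
    obtain b where b: "y$3 = b * (t^2 + s * t)" "y$4 = - (b * s^2)"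
    proof (cases "s = 0")
      case True
      then show ?thesis using st eq that[of "y$3 / t^2"] by auto
    next
      case False
      have "y$3 * s^2 = - (y$4 * (t^2 + s * t))" using eq by (simp only: eq_neg_iff_add_eq_0)
      then have "y$3 = - y$4 / s^2 * (t^2 + s * t)" using False by (simp add: field_simps)
      then show ?thesis using False that[of "- y$4 / s^2"] by auto
    qed
    have "y = 1 *s vec4 s t 0 0 + b *s vec4 0 0 (t^2 + s * t) (- (s^2))"
      by (simp add: vec4_eq_iff b s_def[symmetric] t_def[symmetric])
    with st show ?thesis by blast
  qed
next
  fix s t :: "'k alg_closure"
  show "pl5 (tc s t $ 3 + tc s t $ 2) (- tc s t $ 1) (tc s t $ 4 + tc s t $ 3) (- tc s t $ 2) 0 =
    pluecker (vec4 s t 0 0) (vec4 0 0 (t^2 + s * t) (- (s^2)))"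
    by (rule pluecker_eq_pl5I[symmetric]) (simp_all add: tc_def power2_eq_square power3_eq_cube algebra_simps)
qed (simp_all add: linear_pl5 linearI vec4_eq_iff pl5_nth tc_def F3_def power2_eq_square power3_eq_cube algebra_simps)

text \<open>Here the residual line in the plane t1 : t2 = s : t tends to the double line itself as
  \<open>s\<close> tends to 0. The spanning vectors contain a division by \<open>s\<close>, although
  the Pluecker vector is polynomial. At \<open>s = 0\<close> the double line is therefore spanned by
  vectors chosen to give the coordinate \<open>t^3\<close> at (3, 4).\<close>

lemma ruled_F2:
  fixes f :: "(4, 'k::field) mpoly"
  assumes "feq F2 (eval_poly (ac_poly f))" shows "ruled f"
proof (rule ruledI[OF assms, where N = "\<lambda>q. pl5 (q$1) (- q$2) (q$2) (- q$3) (q$4)"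
      and M = "\<lambda>p. vec4 (p $ (1, 3)) (- p $ (1, 4)) (- p $ (2, 4)) (p $ (3, 4))"
      and u = "\<lambda>s t. if s = 0 then vec4 0 0 1 0 else vec4 (s^2) (s * t) 0 (- (t^3) / s)"
      and v = "\<lambda>s t. if s = 0 then vec4 0 0 0 (t^3) else vec4 0 0 s (- t)"])
  fix y :: "'k alg_closure ^ 4" assume y: "F2 y = 0"
  show "\<exists>s t a b. (s, t) \<noteq> (0, 0) \<and> y = a *s (if s = 0 then vec4 0 0 1 0 else vec4 (s^2) (s * t) 0 (- (t^3) / s))
    + b *s (if s = 0 then vec4 0 0 0 (t^3) else vec4 0 0 s (- t))"
  proof (cases "y$1 = 0")
    case True
    with y have "y$2 = 0" by (simp add: F2_def)
    with True have "y = y$3 *s vec4 0 0 1 0 + y$4 *s vec4 0 0 0 (1^3)" by (simp add: vec4_eq_iff)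
    then show ?thesis by (intro exI[of _ 0] exI[of _ 1] exI[of _ "y$3"] exI[of _ "y$4"]) simp
  next
    case False
    define s t where "s = y$1" and "t = y$2"
    have s: "s \<noteq> 0" using False by (simp add: s_def)
    have "s * (y$3 * t + y$4 * s + t^3 / s) = y$3 * s * t + y$4 * s^2 + t^3"
      using s by (simp add: distrib_left power2_eq_square mult_ac)
    also have "\<dots> = 0" using y by (simp add: F2_def s_def t_def)
    finally have "s * (y$3 * t + y$4 * s + t^3 / s) = 0" .
    then have "y$3 * t + y$4 * s + t^3 / s = 0" using s by simp
    then have "y$4 * s = - (t^3 / s) - y$3 * t" by (simp add: algebra_simps eq_neg_iff_add_eq_0)
    then have "y$4 = (1 / s) * (- (t^3) / s) + (y$3 / s) * (- t)" using s by (simp add: field_simps)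
    then have "y = (1 / s) *s vec4 (s^2) (s * t) 0 (- (t^3) / s) + (y$3 / s) *s vec4 0 0 s (- t)"
      using s by (simp add: vec4_eq_iff s_def[symmetric] t_def[symmetric] power2_eq_square)
    with s show ?thesis by (intro exI[of _ s] exI[of _ t] exI[of _ "1 / s"] exI[of _ "y$3 / s"]) simp
  qed
next
  fix s t :: "'k alg_closure"
  show "pl5 (tc s t $ 1) (- tc s t $ 2) (tc s t $ 2) (- tc s t $ 3) (tc s t $ 4) =
    pluecker (if s = 0 then vec4 0 0 1 0 else vec4 (s^2) (s * t) 0 (- (t^3) / s))
      (if s = 0 then vec4 0 0 0 (t^3) else vec4 0 0 s (- t))"
    by (rule pluecker_eq_pl5I[symmetric]) (simp_all add: tc_def power2_eq_square power3_eq_cube)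
next
  fix s t a b :: "'k alg_closure" assume "(s, t) \<noteq> (0, 0)"
  show "F2 (a *s (if s = 0 then vec4 0 0 1 0 else vec4 (s^2) (s * t) 0 (- (t^3) / s)) +
    b *s (if s = 0 then vec4 0 0 0 (t^3) else vec4 0 0 s (- t))) = 0"
    by (auto simp: F2_def field_simps power2_eq_square power3_eq_cube)
qed (simp_all add: linear_pl5 linearI vec4_eq_iff pl5_nth tc_def power2_eq_square power3_eq_cube algebra_simps)

section \<open>The standard cubics are not cones\<close>

text \<open>A vertex is carried to the coordinates of the normal form and tested there against
  explicit points. In the applications, points of the double line show that its first two
  coordinates are 0, and two further points remove the others.\<close>

lemma not_coneI:
  fixes f :: "(4, 'k::field) mpoly"
  assumes eq: "feq G (eval_poly (ac_poly f))" and G0: "G 0 = 0"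
    and nv: "\<And>w. (\<And>y a b. y \<noteq> 0 \<Longrightarrow> G y = 0 \<Longrightarrow> G (a *s y + b *s w) = 0) \<Longrightarrow> w = 0"
  shows "\<not> cone f"
proof
  assume "cone f"
  then obtain v where v: "v \<noteq> 0"
    "\<And>x a b. x \<in> surface_points f \<Longrightarrow> a *s x + b *s v \<noteq> 0 \<Longrightarrow> a *s x + b *s v \<in> surface_points f"
    unfolding cone_def by blast
  obtain A c where A: "invertible A" "c \<noteq> 0" "\<And>x. eval_poly (ac_poly f) x = c * G (A *v x)"
    using eq unfolding feq_def by metis
  obtain B where B: "\<And>x. A *v (B *v x) = x" "\<And>x. B *v (A *v x) = x" using invertible_inverse[OF A(1)] by metis
  have "A *v v = 0"
  proof (rule nv)
    fix y a b assume y: "y \<noteq> 0" "G y = 0"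
    have By: "B *v y \<in> surface_points f"
      using y B(1)[of y] A by (auto simp: surface_points_def)
    have eq: "a *s y + b *s (A *v v) = A *v (a *s (B *v y) + b *s v)"
      by (simp add: matrix_vector_right_distrib vector_scalar_commute B)
    show "G (a *s y + b *s (A *v v)) = 0"
    proof (cases "a *s (B *v y) + b *s v = 0")
      case True
      then show ?thesis unfolding eq using G0 by simp
    next
      case False
      from v(2)[OF By False] show ?thesis unfolding eq using A(2,3) by (simp add: surface_points_def)
    qed
  qed
  then show False using B(2)[of v] v(1) by simp
qed

lemma not_cone_F1:
  fixes f :: "(4, 'k::field) mpoly"
  assumes "feq F1 (eval_poly (ac_poly f))" shows "\<not> cone f"
proof (rule not_coneI[OF assms])
  fix w :: "'k alg_closure ^ 4"
  assume w: "\<And>y a b. y \<noteq> 0 \<Longrightarrow> F1 y = 0 \<Longrightarrow> F1 (a *s y + b *s w) = 0"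
  have "F1 (0 *s vec4 0 0 1 0 + 1 *s w) = 0" "F1 (1 *s vec4 0 0 1 0 + 1 *s w) = 0" "F1 (1 *s vec4 0 0 0 1 + 1 *s w) = 0"
    by (rule w; simp add: F1_def vec4_eq_iff)+
  then have w12: "w$1 = 0" "w$2 = 0" by (simp_all add: F1_def algebra_simps add_eq_0_iff)
  have "F1 (1 *s vec4 1 0 0 0 + 1 *s w) = 0" "F1 (1 *s vec4 0 1 0 0 + 1 *s w) = 0"
    by (rule w; simp add: F1_def vec4_eq_iff)+
  then show "w = 0" using w12 by (simp add: F1_def vec4_eq_iff)
qed (simp add: F1_def)

lemma not_cone_F2:
  fixes f :: "(4, 'k::field) mpoly"
  assumes "feq F2 (eval_poly (ac_poly f))" shows "\<not> cone f"
proof (rule not_coneI[OF assms])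
  fix w :: "'k alg_closure ^ 4"
  assume w: "\<And>y a b. y \<noteq> 0 \<Longrightarrow> F2 y = 0 \<Longrightarrow> F2 (a *s y + b *s w) = 0"
  have 1: "F2 (0 *s vec4 0 0 0 1 + 1 *s w) = 0" "F2 (1 *s vec4 0 0 0 1 + 1 *s w) = 0"
    by (rule w; simp add: F2_def vec4_eq_iff)+
  then have "w$1^2 = 0" by (simp add: F2_def algebra_simps add_eq_0_iff)
  then have w1: "w$1 = 0" by simp
  with 1 have w2: "w$2 = 0" by (simp add: F2_def)
  have "F2 (1 *s vec4 1 0 0 0 + 1 *s w) = 0" "F2 (1 *s vec4 1 1 (-1) 0 + 1 *s w) = 0"
    by (rule w; simp add: F2_def vec4_eq_iff)+
  then show "w = 0" using w1 w2 by (simp add: F2_def vec4_eq_iff)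
qed (simp add: F2_def)

lemma not_cone_F3:
  fixes f :: "(4, 'k::field) mpoly"
  assumes "feq F3 (eval_poly (ac_poly f))" shows "\<not> cone f"
proof (rule not_coneI[OF assms])
  fix w :: "'k alg_closure ^ 4"
  assume w: "\<And>y a b. y \<noteq> 0 \<Longrightarrow> F3 y = 0 \<Longrightarrow> F3 (a *s y + b *s w) = 0"
  have 1: "F3 (0 *s vec4 0 0 1 0 + 1 *s w) = 0" "F3 (1 *s vec4 0 0 1 0 + 1 *s w) = 0" "F3 (1 *s vec4 0 0 0 1 + 1 *s w) = 0"
    by (rule w; simp add: F3_def vec4_eq_iff)+
  then have "w$1^2 = 0" by (simp add: F3_def algebra_simps add_eq_0_iff)
  then have w1: "w$1 = 0" by simp
  with 1 have "w$4 * w$2^2 = 0" "(1 + w$4) * w$2^2 = 0" by (simp_all add: F3_def)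
  then have "w$2^2 = 0" by Groebner_Basis.algebra
  then have w2: "w$2 = 0" by simp
  have "F3 (1 *s vec4 1 0 0 0 + 1 *s w) = 0" "F3 (1 *s vec4 0 1 0 0 + 1 *s w) = 0"
    by (rule w; simp add: F3_def vec4_eq_iff)+
  then show "w = 0" using w1 w2 by (simp add: F3_def vec4_eq_iff)
qed (simp add: F3_def)

lemma homogeneous_std:
  "homogeneous_poly 3 (std1 :: (4, 'a::field) mpoly)" "homogeneous_poly 3 (std2 :: (4, 'a) mpoly)"
  "homogeneous_poly 3 (std3 :: (4, 'a) mpoly)"
proof -
  have 3: "homogeneous_poly 3 (a * b * c)"
    if "homogeneous_poly 1 a" "homogeneous_poly 1 b" "homogeneous_poly 1 c" for a b c :: "(4, 'a) mpoly"
    using homogeneous_mult[OF homogeneous_mult[OF that(1,2)] that(3)] by (simp add: numeral_3_eq_3)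
  have v: "homogeneous_poly 1 (var_poly i :: (4, 'a) mpoly)" for i using homogeneous_var by simp
  show "homogeneous_poly 3 (std1 :: (4, 'a) mpoly)" "homogeneous_poly 3 (std2 :: (4, 'a) mpoly)"
    "homogeneous_poly 3 (std3 :: (4, 'a) mpoly)"
    unfolding std1_def std2_def std3_def power2_eq_square power3_eq_cube distrib_left mult.assoc[symmetric]
    by (intro homogeneous_add 3 v)+
qed

theorem std_ruled_cubic_noncone:
  fixes s f :: "(4, 'k::field) mpoly"
  assumes s: "s \<in> {std1, std2, std3}" and eq: "lin_equiv (ac_poly s) (ac_poly f)"
  shows "ruled_cubic_noncone f"
proof -
  have irr: "Factorial_Ring.irreducible (ac_poly f)"
    by (rule irreducible_lin_equiv[OF _ eq]) (use s irreducible_std in auto)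
  obtain A c where "ac_poly f = const_poly c * lin_subst A (ac_poly s)"
    using eq unfolding lin_equiv_def by blast
  moreover have "homogeneous_poly 3 s" using s homogeneous_std by auto
  then have "homogeneous_poly (0 + 3) (const_poly c * lin_subst A (ac_poly s))"
    by (intro homogeneous_mult homogeneous_const homogeneous_lin_subst) simp
  ultimately have "homogeneous_poly 3 (ac_poly f)" by simp
  then have hom: "homogeneous_poly 3 f" by simp
  have "feq F1 (eval_poly (ac_poly f)) \<or> feq F2 (eval_poly (ac_poly f)) \<or> feq F3 (eval_poly (ac_poly f))"
    using s eq by (auto simp: lin_equiv_iff_feq eval_std_fun)
  then have "ruled f \<and> \<not> cone f"
    using ruled_F1 ruled_F2 ruled_F3 not_cone_F1 not_cone_F2 not_cone_F3 by metis
  with irr hom show ?thesis by (simp add: ruled_cubic_noncone_def cubic_surface_def)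
qed

section \<open>The standard cubics are pairwise inequivalent\<close>

text \<open>The invariant is a direction outside the double line that lies in the tangent cone at
  every point of it, that is, a common zero of the pencil of quadratic forms. For \<open>F2\<close>
  the direction t1 = 0 is one, whereas the pencils of \<open>F1\<close> and \<open>F3\<close> have
  no common zero.\<close>

lemma feq_tangent_direction:
  fixes F G :: "'a::alg_closed_field ^ 4 \<Rightarrow> 'a"
  assumes eq: "feq F G" and x: "\<not> sing F x" "\<And>m t. sing F m \<Longrightarrow> F (m + t *s x) = t^3 * F x"
  shows "\<exists>x. \<not> sing G x \<and> (\<forall>m t. sing G m \<longrightarrow> G (m + t *s x) = t^3 * G x)"
proof -
  obtain A c where A: "invertible A" "c \<noteq> 0" "\<And>x. G x = c * F (A *v x)" using eq unfolding feq_def by metis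
  obtain B where B: "\<And>x. A *v (B *v x) = x" using invertible_inverse[OF A(1)] by metis
  have s: "sing G y \<longleftrightarrow> sing F (A *v y)" for y by (rule sing_transform[of A c G F, OF A])
  have "G (m + t *s (B *v x)) = t^3 * G (B *v x)" if "sing G m" for m t
    using x(2)[of "A *v m" t] that unfolding s A(3) by (simp add: matrix_vector_axpy B)
  moreover have "\<not> sing G (B *v x)" unfolding s B by (rule x(1))
  ultimately show ?thesis by blast
qed

lemma sing_F1I: "m$1 = 0 \<Longrightarrow> m$2 = 0 \<Longrightarrow> sing F1 m"
  unfolding sing_def
  by (rule allI, rule_tac x = "m$3 * y$1^2 + m$4 * y$2^2" in exI, rule_tac x = "F1 y" in exI)
     (simp add: F1_def algebra_simps power2_eq_square power3_eq_cube)

lemma sing_F3I: "m$1 = 0 \<Longrightarrow> m$2 = 0 \<Longrightarrow> sing F3 m"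
  unfolding sing_def
  by (rule allI, rule_tac x = "m$3 * y$1^2 + m$4 * (y$2^2 + y$1 * y$2)" in exI, rule_tac x = "F3 y" in exI)
     (simp add: F3_def algebra_simps power2_eq_square power3_eq_cube)

lemma sing_F2D:
  fixes m :: "'a::alg_closed_field ^ 4"
  assumes "sing F2 m" shows "m$1 = 0" "m$2 = 0"
proof -
  obtain q r where "\<And>t. F2 (m + t *s vec4 0 0 0 1) = t^2 * q + t^3 * r" using assms unfolding sing_def by metis
  then have "F2 m + t * m$1^2 + t^2 * 0 + t^3 * 0 = t^2 * q + t^3 * r" for t
    by (simp add: F2_def algebra_simps)
  from cubic_poly_eqD[OF this] have "m$1^2 = 0" "F2 m = 0" by auto
  then show "m$1 = 0" "m$2 = 0" by (auto simp: F2_def)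
qed

lemma not_feq_F2:
  shows "\<not> feq F2 (F1 :: 'a::alg_closed_field ^ 4 \<Rightarrow> 'a)" "\<not> feq F2 (F3 :: 'a ^ 4 \<Rightarrow> 'a)"
proof -
  have x: "\<not> sing F2 (vec4 0 1 0 0 :: 'a ^ 4)" using sing_F2D(2)[of "vec4 0 1 0 0"] by auto
  have x': "F2 (m + t *s vec4 0 1 0 0) = t^3 * F2 (vec4 0 1 0 0)" if "sing F2 m" for m :: "'a ^ 4" and t
    using sing_F2D[OF that] by (simp add: F2_def)
  show "\<not> feq F2 (F1 :: 'a ^ 4 \<Rightarrow> 'a)"
  proof
    assume "feq F2 (F1 :: 'a ^ 4 \<Rightarrow> 'a)"
    from feq_tangent_direction[OF this x x'] obtain y :: "'a ^ 4" where y: "\<not> sing F1 y"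
      "\<And>m t. sing F1 m \<Longrightarrow> F1 (m + t *s y) = t^3 * F1 y" by blast
    have "F1 (vec4 0 0 1 0 + 1 *s y) = 1^3 * F1 y" "F1 (vec4 0 0 0 1 + 1 *s y) = 1^3 * F1 y"
      by (rule y(2), rule sing_F1I; simp)+
    then have "y$1 = 0" "y$2 = 0" by (simp_all add: F1_def algebra_simps)
    with y(1) sing_F1I show False by blast
  qed
  show "\<not> feq F2 (F3 :: 'a ^ 4 \<Rightarrow> 'a)"
  proof
    assume "feq F2 (F3 :: 'a ^ 4 \<Rightarrow> 'a)"
    from feq_tangent_direction[OF this x x'] obtain y :: "'a ^ 4" where y: "\<not> sing F3 y"
      "\<And>m t. sing F3 m \<Longrightarrow> F3 (m + t *s y) = t^3 * F3 y" by blast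
    have e: "F3 (vec4 0 0 1 0 + 1 *s y) = 1^3 * F3 y" "F3 (vec4 0 0 0 1 + 1 *s y) = 1^3 * F3 y"
      by (rule y(2), rule sing_F3I; simp)+
    from e(1) have y1: "y$1 = 0" by (simp add: F3_def algebra_simps)
    from e(2) have "y$2^2 = 0" unfolding F3_def using y1 by (simp add: algebra_simps)
    with y1 y(1) sing_F3I show False by auto
  qed
qed

lemma CHAR_2_iff: "CHAR('a::field) = 2 \<longleftrightarrow> (2::'a) = 0"
proof
  assume "CHAR('a) = 2"
  then have "of_nat 2 = (0::'a)" using of_nat_CHAR[where 'a = 'a] by simp
  then show "(2::'a) = 0" by simp
next
  assume "(2::'a) = 0"
  then have "of_nat 2 = (0::'a)" by simp
  then have "CHAR('a) dvd 2" by (simp only: of_nat_eq_0_iff_char_dvd)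
  then show "CHAR('a) = 2" by (metis CHAR_not_1' One_nat_def dvd_antisym prime_nat_iff two_is_prime_nat)
qed

text \<open>Every monomial of \<open>F1\<close> contains the square of a variable, so its
  polarisation is divisible by 2.\<close>

lemma tri_F1_char_2:
  assumes "(2::'a::field) = 0" shows "tri F1 x y (z :: 'a ^ 4) = 0"
proof -
  have "tri F1 x y z = 2 * (x$3 * y$1 * z$1 + y$3 * x$1 * z$1 + z$3 * x$1 * y$1 +
    (x$4 * y$2 * z$2 + y$4 * x$2 * z$2 + z$4 * x$2 * y$2))"
    unfolding tri_def F1_def vector_add_component by Groebner_Basis.algebra
  then show ?thesis using assms by simp
qed

text \<open>The squarefree monomial t1 t2 t4 gives \<open>F3\<close> a nonzero polarisation, while
  that of \<open>F1\<close> vanishes.\<close>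

lemma not_feq_F1_F3:
  assumes "(2::'a::field) = 0" shows "\<not> feq F1 (F3 :: 'a ^ 4 \<Rightarrow> 'a)"
proof
  assume "feq F1 (F3 :: 'a ^ 4 \<Rightarrow> 'a)"
  then obtain A c where eq: "\<And>x :: 'a ^ 4. F3 x = c * F1 (A *v x)" unfolding feq_def by metis
  from tri_transform[of F3 c F1 A, OF eq] have "tri F3 x y z = 0" for x y z :: "'a ^ 4"
    by (simp add: tri_F1_char_2[OF assms])
  from this[of "vec4 1 0 0 0" "vec4 0 1 0 0" "vec4 0 0 0 1"] show False
    by (simp add: tri_def F3_def)
qed

theorem standard_equations_inequivalent:
  fixes s s' :: "(4, 'k::field) mpoly"
  assumes "s \<in> standard_equations" "s' \<in> standard_equations" "s \<noteq> s'"
  shows "\<not> lin_equiv (ac_poly s) (ac_poly s')"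
proof -
  have 12: "\<not> feq F2 (F1 :: 'k alg_closure ^ 4 \<Rightarrow> _)" "\<not> feq F1 (F2 :: 'k alg_closure ^ 4 \<Rightarrow> _)"
    using not_feq_F2(1) feq_sym by blast+
  have 23: "\<not> feq F2 (F3 :: 'k alg_closure ^ 4 \<Rightarrow> _)" "\<not> feq F3 (F2 :: 'k alg_closure ^ 4 \<Rightarrow> _)"
    using not_feq_F2(2) feq_sym by blast+
  have 13: "\<not> feq F1 (F3 :: 'k alg_closure ^ 4 \<Rightarrow> _)" "\<not> feq F3 (F1 :: 'k alg_closure ^ 4 \<Rightarrow> _)"
    if "CHAR('k) = 2"
  proof -
    have "CHAR('k alg_closure) = 2" using that by simp
    then have "(2 :: 'k alg_closure) = 0" by (simp only: CHAR_2_iff)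
    from not_feq_F1_F3[OF this] show "\<not> feq F1 (F3 :: 'k alg_closure ^ 4 \<Rightarrow> _)" "\<not> feq F3 (F1 :: 'k alg_closure ^ 4 \<Rightarrow> _)"
      using feq_sym by blast+
  qed
  show ?thesis
    using assms 12 23 13 unfolding standard_equations_def lin_equiv_iff_feq
    by (auto simp: eval_std_fun split: if_splits)
qed

section \<open>Rationality over the ground field\<close>

text \<open>Rational means lying in the ground field, viewed inside its closure.\<close>

definition rat :: "'k::field alg_closure \<Rightarrow> bool" where "rat x \<longleftrightarrow> x \<in> range to_ac"

lemma rat_to_ac [simp]: "rat (to_ac x)" by (simp add: rat_def)

lemma ratE: assumes "rat x" obtains y where "x = to_ac y" using assms by (auto simp: rat_def)

lemma rat_0 [simp]: "rat 0" and rat_1 [simp]: "rat 1" and rat_numeral [simp]: "rat (numeral n)"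
  using rat_to_ac[of 0] rat_to_ac[of 1] rat_to_ac[of "numeral n"] by simp_all

lemma rat_add: "rat x \<Longrightarrow> rat y \<Longrightarrow> rat (x + y)"
  by (elim ratE) (metis rat_to_ac to_ac_add)

lemma rat_diff: "rat x \<Longrightarrow> rat y \<Longrightarrow> rat (x - y)"
  by (elim ratE) (metis rat_to_ac to_ac_diff)

lemma rat_minus: "rat x \<Longrightarrow> rat (- x)"
  by (elim ratE) (metis rat_to_ac to_ac_minus)

lemma rat_mult: "rat x \<Longrightarrow> rat y \<Longrightarrow> rat (x * y)"
  by (elim ratE) (metis rat_to_ac to_ac_mult)

lemma rat_divide: "rat x \<Longrightarrow> rat y \<Longrightarrow> rat (x / y)"
  by (elim ratE) (metis rat_to_ac to_ac_divide)

lemma rat_power: "rat x \<Longrightarrow> rat (x ^ n)"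
  by (elim ratE) (metis rat_to_ac to_ac_power)

lemma rat_of_int: "rat (of_int n)"
  using rat_to_ac[of "of_int n"] by simp

lemma rat_sum: "(\<And>i. i \<in> S \<Longrightarrow> rat (g i)) \<Longrightarrow> rat (sum g S)"
  by (induction S rule: infinite_finite_induct) (auto intro: rat_add)

lemmas rat_intros = rat_0 rat_1 rat_numeral rat_add rat_diff rat_minus rat_mult rat_divide rat_power

lemma rat_cancel_left: "rat (c * x) \<Longrightarrow> rat c \<Longrightarrow> c \<noteq> 0 \<Longrightarrow> rat x"
  using rat_divide[of "c * x" c] by simp

definition ratv :: "'k::field alg_closure ^ 'n \<Rightarrow> bool" where "ratv x \<longleftrightarrow> (\<forall>i. rat (x $ i))"

lemma ratv_vec4 [simp]: "ratv (vec4 a b c d) \<longleftrightarrow> rat a \<and> rat b \<and> rat c \<and> rat d"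
  by (simp add: ratv_def forall_4)

lemma ratvE:
  assumes "ratv x" obtains v where "x = ac_vec v"
proof -
  have "x $ i = to_ac (of_ac (x $ i))" for i
    using assms to_ac_of_ac[of "x $ i"] by (simp add: ratv_def rat_def)
  then have "x = ac_vec (\<chi> i. of_ac (x $ i))" unfolding vec_eq_iff ac_vec_nth vec_lambda_beta by blast
  with that show ?thesis .
qed

lemma rat_eval: "ratv x \<Longrightarrow> rat (eval_poly (ac_poly f) x)"
  by (elim ratvE) (simp add: eval_ac_poly_ac_vec)

definition ratp :: "'k::field alg_closure poly \<Rightarrow> bool" where
  "ratp p \<longleftrightarrow> (\<forall>i. rat (Polynomial.coeff p i))"

lemma ratp_add: "ratp p \<Longrightarrow> ratp q \<Longrightarrow> ratp (p + q)"
  by (simp add: ratp_def rat_add)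

lemma ratp_mult: "ratp p \<Longrightarrow> ratp q \<Longrightarrow> ratp (p * q)"
  unfolding ratp_def coeff_mult by (auto intro: rat_sum rat_mult)

lemma ratp_pCons: "rat a \<Longrightarrow> ratp p \<Longrightarrow> ratp (pCons a p)"
  by (auto simp: ratp_def coeff_pCons split: nat.splits)

lemma ratp_0: "ratp 0" and ratp_1: "ratp 1"
  by (auto simp: ratp_def)

lemma ratp_sum: "(\<And>i. i \<in> S \<Longrightarrow> ratp (g i)) \<Longrightarrow> ratp (sum g S)"
  by (induction S rule: infinite_finite_induct) (auto intro: ratp_add simp: ratp_0)

lemma ratp_prod: "(\<And>i. i \<in> S \<Longrightarrow> ratp (g i)) \<Longrightarrow> ratp (prod g S)"
  by (induction S rule: infinite_finite_induct) (auto intro: ratp_mult simp: ratp_1)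

lemma ratp_power: "ratp p \<Longrightarrow> ratp (p ^ n)"
  by (induction n) (auto intro: ratp_mult simp: ratp_1)

lemma ratp_of_int: "ratp (of_int n)"
  by (auto simp: ratp_def of_int_poly coeff_pCons rat_of_int split: nat.splits)

lemma ratp_det: "(\<And>i j. ratp (E $ i $ j)) \<Longrightarrow> ratp (det E)"
  unfolding det_def by (intro ratp_sum ratp_mult ratp_of_int ratp_prod)

text \<open>The restriction to a rational line has rational coefficients, and over the infinite
  closure these are determined by the values. Hence any expansion found by calculation exhibits
  rational quantities; most descent arguments below start here.\<close>

lemma rat_line:
  assumes x: "ratv x" and v: "ratv v"
    and eq: "\<And>t. eval_poly (ac_poly f) (x + t *s v) = p + t * q + t^2 * r + t^3 * u"
  shows "rat p" "rat q" "rat r" "rat u"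
proof -
  define P where "P = subst_poly (\<lambda>c. [:c:]) (\<lambda>i. [:x $ i, v $ i:]) (ac_poly f)"
  have "ratp P"
    unfolding P_def subst_poly_def lookup_ac_poly using x v unfolding ratv_def
    by (intro ratp_sum ratp_mult ratp_prod ratp_power) (auto intro!: ratp_pCons ratp_0)
  moreover have "P = [:p, q, r, u:]"
    using infinite_UNIV_alg_closed
  proof (rule poly_eqI_infinite)
    fix t
    have "(\<chi> i. poly [:x $ i, v $ i:] t) = x + t *s v" by (simp add: vec_eq_iff)
    then have "poly P t = eval_poly (ac_poly f) (x + t *s v)" unfolding P_def poly_subst_eval by simp
    also have "\<dots> = poly [:p, q, r, u:] t"
      unfolding eq by (simp add: algebra_simps power2_eq_square power3_eq_cube)
    finally show "poly P t = poly [:p, q, r, u:] t" .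
  qed
  ultimately have "rat (Polynomial.coeff [:p, q, r, u:] i)" for i by (simp add: ratp_def)
  from this[of 0] this[of 1] this[of 2] this[of 3] show "rat p" "rat q" "rat r" "rat u"
    by (simp_all add: numeral_2_eq_2 numeral_3_eq_3)
qed

lemma rat_tri: "ratv x \<Longrightarrow> ratv y \<Longrightarrow> ratv z \<Longrightarrow> rat (tri (eval_poly (ac_poly f)) x y z)"
  unfolding tri_def
  by (intro rat_add rat_diff rat_eval) (auto simp: ratv_def intro: rat_add)

text \<open>Invertibility of \<open>Q\<close> comes for free: a kernel vector would be a direction
  along which \<open>f\<close> is constant, contrary to nondegeneracy.\<close>

lemma lin_equivI_rat:
  fixes s f :: "(4, 'k::field) mpoly"
  assumes Q: "\<And>i. ratv (Q $ i)" and k: "rat k" "k \<noteq> 0"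
    and eq: "\<And>x. eval_poly (ac_poly f) x = k * eval_poly (ac_poly s) (Q *v x)"
    and nd: "\<not> degenerate (eval_poly (ac_poly f))"
  shows "lin_equiv s f"
proof -
  define P where "P = (\<chi> i j. of_ac (Q $ i $ j))"
  have "Q $ i $ j = to_ac (of_ac (Q $ i $ j))" for i j
    using Q[of i] to_ac_of_ac[of "Q $ i $ j"] by (simp add: ratv_def rat_def)
  then have QP: "Q = ac_mat P" unfolding vec_eq_iff ac_mat_nth P_def vec_lambda_beta by blast
  obtain c where c: "k = to_ac c" using k(1) by (rule ratE)
  have "invertible P"
    unfolding invertible_iff_ker
  proof (intro allI impI)
    fix v assume "P *v v = 0"
    then have z: "Q *v ac_vec v = 0" unfolding QP ac_mat_mv by (simp add: vec_eq_iff)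
    have "eval_poly (ac_poly f) (x + t *s ac_vec v) = eval_poly (ac_poly f) x" for x t
      unfolding eq matrix_vector_axpy z by simp
    with nd have "ac_vec v = 0" unfolding degenerate_def by blast
    then show "v = 0" by (simp add: vec_eq_iff)
  qed
  then show ?thesis unfolding lin_equiv_iff_ac using eq k(2) unfolding QP c by auto
qed

text \<open>The first two rows of \<open>R\<close> are rational linear forms that become the new t1
  and t2. Rows of \<open>A\<close> that are combinations of them thereby become sparse.\<close>

lemma change_coords:
  fixes f :: "(4, 'k::field) mpoly" and R :: "'k ^ 4 ^ 4" and A :: "'k alg_closure ^ 4 ^ 4"
  assumes A: "invertible A" "\<And>x. eval_poly (ac_poly f) x = G (A *v x)" and R: "invertible R"
  obtains f' A' where "lin_equiv f f'" "invertible A'" "\<forall>x. eval_poly (ac_poly f') x = G (A' *v x)"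
    "A = A' ** ac_mat R"
    "\<forall>i k1 k2. A $ i = k1 *s ac_vec (R $ 1) + k2 *s ac_vec (R $ 2) \<longrightarrow> A' $ i = vec4 k1 k2 0 0"
proof -
  obtain P where P: "invertible P" "R ** P = mat 1" "P ** R = mat 1" using invertible_inverse[OF R] by metis
  define A' where "A' = A ** ac_mat P"
  have "lin_equiv f (lin_subst P f)"
    unfolding lin_equiv_def
    by (rule exI[of _ P], rule exI[of _ 1]) (use P(1) in \<open>simp add: const_poly_def\<close>)
  moreover have "invertible A'" unfolding A'_def by (intro invertible_mult A(1) invertible_ac_mat P(1))
  moreover have "\<forall>x. eval_poly (ac_poly (lin_subst P f)) x = G (A' *v x)"
    unfolding A'_def matrix_vector_mul_assoc[symmetric] by (simp add: ac_poly_lin_subst A(2))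
  moreover have "A = A' ** ac_mat R"
    unfolding A'_def matrix_mul_assoc[symmetric] ac_mat_mult[symmetric] P(3) ac_mat_1 by simp
  moreover have "A' $ i = vec4 k1 k2 0 0" if i: "A $ i = k1 *s ac_vec (R $ 1) + k2 *s ac_vec (R $ 2)" for i k1 k2
  proof -
    have RP: "(\<Sum>l\<in>UNIV. to_ac (R $ m $ l) * to_ac (P $ l $ j)) = (if m = j then 1 else 0)" for m j
    proof -
      have "(R ** P) $ m $ j = (if m = j then 1 else 0)" unfolding P(2) by (simp add: mat_def)
      then have "to_ac ((R ** P) $ m $ j) = (if m = j then 1 else 0)" by simp
      then show ?thesis by (simp add: matrix_matrix_mult_def to_ac_sum)
    qed
    have "A' $ i $ j = k1 * (\<Sum>l\<in>UNIV. to_ac (R $ 1 $ l) * to_ac (P $ l $ j)) +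
      k2 * (\<Sum>l\<in>UNIV. to_ac (R $ 2 $ l) * to_ac (P $ l $ j))" for j
      by (simp add: A'_def matrix_matrix_mult_def i algebra_simps sum.distrib sum_distrib_left)
    then have "A' $ i $ j = k1 * (if 1 = j then 1 else 0) + k2 * (if 2 = j then 1 else 0)" for j
      unfolding RP .
    then show ?thesis by (simp add: vec4_eq_iff)
  qed
  ultimately show ?thesis using that by blast
qed

lemma invertible_rows:
  fixes u v :: "'a::field ^ 4"
  assumes "\<And>a b. a *s u + b *s v = 0 \<Longrightarrow> a = 0 \<and> b = 0"
  obtains R :: "'a ^ 4 ^ 4" where "invertible R" "R $ 1 = u" "R $ 2 = v"
proof -
  obtain w z where wz: "invertible (cols4 w z u v)" by (rule ex_invertible_2[OF assms])
  have "invertible (vec4 u v w z)"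
  proof -
    have "det (transpose (vec4 u v w z)) \<noteq> 0"
    proof -
      have "invertible (cols4 u v w z)"
        unfolding invertible_iff_ker
      proof (intro allI impI)
        fix x :: "'a ^ 4" assume "cols4 u v w z *v x = 0"
        moreover have "cols4 u v w z *v x = cols4 w z u v *v vec4 (x$3) (x$4) (x$1) (x$2)"
          by (simp add: cols4_mult add_ac)
        ultimately have "cols4 w z u v *v vec4 (x$3) (x$4) (x$1) (x$2) = 0" by simp
        then have "vec4 (x$3) (x$4) (x$1) (x$2) = 0" using wz unfolding invertible_iff_ker by blast
        then show "x = 0" by (simp add: vec4_eq_iff)
      qed
      then show ?thesis by (simp add: cols4_def invertible_det_nz)
    qed
    then show ?thesis by (simp add: invertible_det_nz det_transpose)
  qed
  with that show ?thesis by simp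
qed

lemma invertible_row:
  fixes u :: "'a::field ^ 4"
  assumes "u \<noteq> 0" obtains R :: "'a ^ 4 ^ 4" where "invertible R" "R $ 1 = u"
proof -
  obtain z where z: "z \<notin> vec.span {u}" using ex_not_in_span[of "{u}"] by auto
  have ind: "a = 0 \<and> b = 0" if ab: "a *s u + b *s z = 0" for a b
  proof -
    have "b = 0"
    proof (rule ccontr)
      assume n: "b \<noteq> 0"
      have "z = (- 1 / b * a) *s u"
        unfolding vector_smult_assoc[symmetric] by (rule smult_solve[OF ab n])
      with z show False by (metis insertI1 vec.span_base vec.span_scale)
    qed
    with ab assms show ?thesis by simp
  qed
  obtain R :: "'a ^ 4 ^ 4" where "invertible R" "R $ 1 = u" "R $ 2 = z"
    by (rule invertible_rows[OF ind])
  with that show ?thesis by blast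
qed

lemma invertible_row_nonzero:
  fixes A :: "'a::field ^ 4 ^ 4" assumes "invertible A" shows "A $ i \<noteq> 0"
proof
  assume z: "A $ i = 0"
  obtain B where "\<And>x. A *v (B *v x) = x" using invertible_inverse[OF assms] by metis
  from arg_cong[OF this[of "axis i 1"], of "\<lambda>x. x $ i"] show False
    by (simp add: mult_vec_nth_4 z)
qed

text \<open>If all minors of two rows vanished, so would the determinant of the values of these rows
  at any two vectors; at the preimages of the corresponding unit vectors it is 1.\<close>

lemma invertible_minor_nonzero:
  fixes A :: "'a::field ^ 4 ^ 4" assumes "invertible A" "i \<noteq> j"
  obtains k l where "A $ i $ k * A $ j $ l - A $ i $ l * A $ j $ k \<noteq> 0"
proof -
  obtain B where B: "\<And>x. A *v (B *v x) = x" using invertible_inverse[OF assms(1)] by metis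
  define x y where "x = B *v axis i 1" and "y = B *v axis j 1"
  have e: "(A *v x) $ i = 1" "(A *v y) $ j = 1" "(A *v y) $ i = 0"
    unfolding x_def y_def B using assms(2) by (simp_all add: axis_def)
  have "\<exists>k l. A $ i $ k * A $ j $ l - A $ i $ l * A $ j $ k \<noteq> 0"
  proof (rule ccontr)
    assume "\<not> ?thesis"
    then have z: "A $ i $ k * A $ j $ l - A $ i $ l * A $ j $ k = 0" for k l by blast
    have "(A *v x) $ i * (A *v y) $ j - (A *v y) $ i * (A *v x) $ j = 0"
      unfolding mult_vec_nth_4
      using z[of 1 2] z[of 1 3] z[of 1 4] z[of 2 3] z[of 2 4] z[of 3 4] by Groebner_Basis.algebra
    with e show False by simp
  qed
  with that show ?thesis by blast
qed

lemma det_4: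
  "det (A::'a::idom^4^4) =
    A$1$1 * A$2$2 * A$3$3 * A$4$4 - A$1$1 * A$2$2 * A$3$4 * A$4$3 - A$1$1 * A$2$3 * A$3$2 * A$4$4
    + A$1$1 * A$2$3 * A$3$4 * A$4$2 + A$1$1 * A$2$4 * A$3$2 * A$4$3 - A$1$1 * A$2$4 * A$3$3 * A$4$2
    - A$1$2 * A$2$1 * A$3$3 * A$4$4 + A$1$2 * A$2$1 * A$3$4 * A$4$3 + A$1$2 * A$2$3 * A$3$1 * A$4$4
    - A$1$2 * A$2$3 * A$3$4 * A$4$1 - A$1$2 * A$2$4 * A$3$1 * A$4$3 + A$1$2 * A$2$4 * A$3$3 * A$4$1
    + A$1$3 * A$2$1 * A$3$2 * A$4$4 - A$1$3 * A$2$1 * A$3$4 * A$4$2 - A$1$3 * A$2$2 * A$3$1 * A$4$4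
    + A$1$3 * A$2$2 * A$3$4 * A$4$1 + A$1$3 * A$2$4 * A$3$1 * A$4$2 - A$1$3 * A$2$4 * A$3$2 * A$4$1
    - A$1$4 * A$2$1 * A$3$2 * A$4$3 + A$1$4 * A$2$1 * A$3$3 * A$4$2 + A$1$4 * A$2$2 * A$3$1 * A$4$3
    - A$1$4 * A$2$2 * A$3$3 * A$4$1 - A$1$4 * A$2$3 * A$3$1 * A$4$2 + A$1$4 * A$2$3 * A$3$2 * A$4$1"
proof -
  have f1234: "finite {2, 3, 4::4}" "1 \<notin> {2, 3, 4::4}" by auto
  have f234: "finite {3, 4::4}" "2 \<notin> {3, 4::4}" by auto
  have f34: "finite {4::4}" "3 \<notin> {4::4}" by auto
  show ?thesis
    unfolding det_def UNIV_4
    unfolding sum_over_permutations_insert[OF f1234]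
    unfolding sum_over_permutations_insert[OF f234]
    unfolding sum_over_permutations_insert[OF f34]
    unfolding permutes_sing
    by (simp add: sign_swap_id permutation_swap_id sign_compose sign_id swap_id_eq permutation_compose
        Transposition.transpose_def algebra_simps)
qed

section \<open>Twists of the second standard cubic\<close>

definition diag4 :: "'a::field \<Rightarrow> 'a \<Rightarrow> 'a \<Rightarrow> 'a \<Rightarrow> 'a ^ 4 ^ 4" where
  "diag4 a b c d = vec4 (vec4 a 0 0 0) (vec4 0 b 0 0) (vec4 0 0 c 0) (vec4 0 0 0 d)"

lemma diag4_mult: "(diag4 a b c d ** A) *v x = vec4 (a * (A *v x)$1) (b * (A *v x)$2) (c * (A *v x)$3) (d * (A *v x)$4)"
  unfolding matrix_vector_mul_assoc[symmetric] by (simp add: diag4_def vec4_eq_iff mult_vec_nth_4)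

lemma invertible_diag4:
  fixes A :: "'a::field ^ 4 ^ 4"
  assumes "a \<noteq> 0" "b \<noteq> 0" "c \<noteq> 0" "d \<noteq> 0" "invertible A" shows "invertible (diag4 a b c d ** A)"
proof (rule invertible_mult[OF _ assms(5)])
  show "invertible (diag4 a b c d)"
    unfolding invertible_iff_ker using assms(1-4) by (auto simp: diag4_def vec4_eq_iff mult_vec_nth_4)
qed

lemma feq_F1_absorb:
  assumes "feq F1 F" obtains A where "invertible A" "\<forall>x. F x = F1 (A *v x)"
proof -
  obtain A c where A: "invertible A" "c \<noteq> 0" "\<And>x. F x = c * F1 (A *v x)" using assms unfolding feq_def by metis
  have "\<forall>x. F x = F1 ((diag4 1 1 c c ** A) *v x)"
    unfolding diag4_mult A(3) by (simp add: F1_def algebra_simps)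
  moreover have "invertible (diag4 1 1 c c ** A)" using A by (intro invertible_diag4) auto
  ultimately show ?thesis using that by blast
qed

lemma feq_F3_absorb:
  assumes "feq F3 F" obtains A where "invertible A" "\<forall>x. F x = F3 (A *v x)"
proof -
  obtain A c where A: "invertible A" "c \<noteq> 0" "\<And>x. F x = c * F3 (A *v x)" using assms unfolding feq_def by metis
  have "\<forall>x. F x = F3 ((diag4 1 1 c c ** A) *v x)"
    unfolding diag4_mult A(3) by (simp add: F3_def algebra_simps)
  moreover have "invertible (diag4 1 1 c c ** A)" using A by (intro invertible_diag4) auto
  ultimately show ?thesis using that by blast
qed

text \<open>\<open>F2\<close> is weighted homogeneous: with weights 0, 1, 2, 3 for the four
  variables all monomials have weight 3. So a cube root of the scalar absorbs it.\<close>

lemma feq_F2_absorb: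
  fixes F :: "'a::alg_closed_field ^ 4 \<Rightarrow> 'a"
  assumes "feq F2 F" obtains A where "invertible A" "\<forall>x. F x = F2 (A *v x)"
proof -
  obtain A c where A: "invertible A" "c \<noteq> 0" "\<And>x. F x = c * F2 (A *v x)" using assms unfolding feq_def by metis
  obtain k where k: "k^3 = c" using alg_closed_root[of 3 c] by auto
  with A(2) have k0: "k \<noteq> 0" by auto
  have "\<forall>x. F x = F2 ((diag4 1 k (k^2) c ** A) *v x)"
    unfolding diag4_mult A(3) k[symmetric] by (simp add: F2_def algebra_simps power2_eq_square power3_eq_cube)
  moreover have "invertible (diag4 1 k (k^2) c ** A)" using A k0 by (intro invertible_diag4) auto
  ultimately show ?thesis using that by blast
qed

lemma not_degenerate_std:
  "\<not> degenerate (F1 :: 'k::field alg_closure ^ 4 \<Rightarrow> _)" "\<not> degenerate (F2 :: 'k alg_closure ^ 4 \<Rightarrow> _)"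
  "\<not> degenerate (F3 :: 'k alg_closure ^ 4 \<Rightarrow> _)"
  using degenerate_imp_cone[OF homogeneous_std(1), where 'a = 'k] not_cone_F1[of "std1 :: (4, 'k) mpoly"]
    degenerate_imp_cone[OF homogeneous_std(2), where 'a = 'k] not_cone_F2[of "std2 :: (4, 'k) mpoly"]
    degenerate_imp_cone[OF homogeneous_std(3), where 'a = 'k] not_cone_F3[of "std3 :: (4, 'k) mpoly"]
  by (auto simp: eval_std_fun feq_refl)

lemma not_degenerate_comp:
  assumes "invertible A" "\<And>x. F x = G (A *v x)" "\<not> degenerate G" shows "\<not> degenerate F"
proof -
  have "feq G F" unfolding feq_def using assms(1,2) by (intro exI[of _ A] exI[of _ 1]) auto
  from feq_degenerate[OF feq_sym[OF this]] assms(3) show ?thesis by blast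
qed

lemma rows_independent:
  fixes A :: "'a::field ^ 4 ^ 4"
  assumes "invertible A" "i \<noteq> j" "p *s A $ i + q *s A $ j = 0" shows "p = 0" "q = 0"
proof -
  obtain k l where kl: "A $ i $ k * A $ j $ l - A $ i $ l * A $ j $ k \<noteq> 0"
    using invertible_minor_nonzero[OF assms(1,2)] by metis
  have "p * A $ i $ k + q * A $ j $ k = 0" "p * A $ i $ l + q * A $ j $ l = 0"
    using assms(3) by (metis vector_add_component vector_smult_component zero_index)+
  then have "p * (A $ i $ k * A $ j $ l - A $ i $ l * A $ j $ k) = 0" "q * (A $ i $ k * A $ j $ l - A $ i $ l * A $ j $ k) = 0"
    by Groebner_Basis.algebra+
  with kl show "p = 0" "q = 0" by simp_all
qed

text \<open>Once the first two rows involve only t1 and t2, the cubic is \<open>b2^3 t2^3\<close>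
  plus a multiple of \<open>t1 t2\<close> plus a multiple of t1^2. After division by
  \<open>b2^3\<close> the linear cofactors are read off from its coefficients and serve as the
  rational third and fourth rows.\<close>

lemma twist_F2_normal:
  fixes f :: "(4, 'k::field) mpoly"
  assumes A: "invertible A" and eq: "\<And>x. eval_poly (ac_poly f) x = F2 (A *v x)"
    and A1: "A $ 1 = vec4 a1 0 0 0" and A2: "A $ 2 = vec4 b1 b2 0 0"
  shows "lin_equiv std2 f"
proof -
  obtain r1 r2 r3 r4 s1 s2 s3 s4 where A3: "A $ 3 = vec4 r1 r2 r3 r4" and A4: "A $ 4 = vec4 s1 s2 s3 s4"
    by (metis vec4_eq_iff vec4_nth)
  note rows = mult_vec_nth_4 A1 A2 A3 A4 vec4_nth vector_add_component vector_smult_component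
  have b2: "b2 \<noteq> 0"
  proof
    assume "b2 = 0"
    then have "(- b1) *s A $ 1 + a1 *s A $ 2 = 0" by (simp add: A1 A2 vec4_eq_iff)
    from rows_independent(2)[OF A _ this] have "a1 = 0" by simp
    then show False using invertible_row_nonzero[OF A, of 1] A1 by (simp add: vec4_eq_iff)
  qed
  have 12: "eval_poly (ac_poly f) (vec4 1 0 0 0 + t *s vec4 0 1 0 0) = (r1 * a1 * b1 + s1 * a1^2 + b1^3) +
    t * (r2 * a1 * b1 + r1 * a1 * b2 + s2 * a1^2 + 3 * b1^2 * b2) + t^2 * (r2 * a1 * b2 + 3 * b1 * b2^2) + t^3 * b2^3" for t
    unfolding eq F2_def rows by Groebner_Basis.algebra
  have 13: "eval_poly (ac_poly f) (vec4 1 0 0 0 + t *s vec4 0 0 1 0) = (r1 * a1 * b1 + s1 * a1^2 + b1^3) +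
    t * (r3 * a1 * b1 + s3 * a1^2) + t^2 * 0 + t^3 * 0" for t
    unfolding eq F2_def rows by Groebner_Basis.algebra
  have 14: "eval_poly (ac_poly f) (vec4 1 0 0 0 + t *s vec4 0 0 0 1) = (r1 * a1 * b1 + s1 * a1^2 + b1^3) +
    t * (r4 * a1 * b1 + s4 * a1^2) + t^2 * 0 + t^3 * 0" for t
    unfolding eq F2_def rows by Groebner_Basis.algebra
  have 123: "eval_poly (ac_poly f) (vec4 1 1 0 0 + t *s vec4 0 0 1 0) =
    ((r1 + r2) * a1 * (b1 + b2) + (s1 + s2) * a1^2 + (b1 + b2)^3) +
    t * (r3 * a1 * b2 + (r3 * a1 * b1 + s3 * a1^2)) + t^2 * 0 + t^3 * 0" for t
    unfolding eq F2_def rows by Groebner_Basis.algebra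
  have 124: "eval_poly (ac_poly f) (vec4 1 1 0 0 + t *s vec4 0 0 0 1) =
    ((r1 + r2) * a1 * (b1 + b2) + (s1 + s2) * a1^2 + (b1 + b2)^3) +
    t * (r4 * a1 * b2 + (r4 * a1 * b1 + s4 * a1^2)) + t^2 * 0 + t^3 * 0" for t
    unfolding eq F2_def rows by Groebner_Basis.algebra
  note rat12 = rat_line[OF _ _ 12, simplified]
  note rat13 = rat_line(2)[OF _ _ 13, simplified] and rat14 = rat_line(2)[OF _ _ 14, simplified]
  have rat3: "rat (r3 * a1 * b2)" and rat4: "rat (r4 * a1 * b2)"
    using rat_diff[OF rat_line(2)[OF _ _ 123, simplified] rat13] rat_diff[OF rat_line(2)[OF _ _ 124, simplified] rat14]
    by simp_all
  define k where "k = b2^3"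
  have k: "k \<noteq> 0" "rat k" using b2 rat12(4) by (simp_all add: k_def)
  define p2 p3 p4 where "p2 = (r2 * a1 * b2 + 3 * b1 * b2^2) / k" and "p3 = r3 * a1 * b2 / k" and "p4 = r4 * a1 * b2 / k"
  define q1 q2 q3 q4 where "q1 = (r1 * a1 * b1 + s1 * a1^2 + b1^3) / k"
    and "q2 = (r2 * a1 * b1 + r1 * a1 * b2 + s2 * a1^2 + 3 * b1^2 * b2) / k"
    and "q3 = (r3 * a1 * b1 + s3 * a1^2) / k" and "q4 = (r4 * a1 * b1 + s4 * a1^2) / k"
  have kpq: "k * p2 = r2 * a1 * b2 + 3 * b1 * b2^2" "k * p3 = r3 * a1 * b2" "k * p4 = r4 * a1 * b2"
    "k * q1 = r1 * a1 * b1 + s1 * a1^2 + b1^3" "k * q2 = r2 * a1 * b1 + r1 * a1 * b2 + s2 * a1^2 + 3 * b1^2 * b2"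
    "k * q3 = r3 * a1 * b1 + s3 * a1^2" "k * q4 = r4 * a1 * b1 + s4 * a1^2"
    using k(1) by (simp_all add: p2_def p3_def p4_def q1_def q2_def q3_def q4_def)
  have rpq: "rat p2" "rat p3" "rat p4" "rat q1" "rat q2" "rat q3" "rat q4"
    unfolding p2_def p3_def p4_def q1_def q2_def q3_def q4_def
    by (intro rat_divide k rat12 rat13 rat14 rat3 rat4)+
  \<comment> \<open>The third row has entry 0 at t1 because the monomial t1^2 t2 is assigned to the
    fourth row, through \<open>q2\<close>.\<close>
  let ?Q = "vec4 (vec4 1 0 0 0) (vec4 0 1 0 0) (vec4 0 p2 p3 p4) (vec4 q1 q2 q3 q4)"
  show ?thesis
  proof (rule lin_equivI_rat[of ?Q k])
    show "ratv (?Q $ i)" for i using exhaust_4[of i] rpq by auto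
    show "eval_poly (ac_poly f) x = k * eval_poly (ac_poly std2) (?Q *v x)" for x
      unfolding eq ac_std eval_std F2_def rows using kpq k_def by Groebner_Basis.algebra
    show "\<not> degenerate (eval_poly (ac_poly f))" by (rule not_degenerate_comp[OF A eq not_degenerate_std(2)])
  qed (use k in simp_all)
qed

text \<open>An element that satisfies a nontrivial quadratic equation and has a rational cube is
  rational in characteristic 3. Reducing the cube modulo the quadratic leaves a linear relation,
  unless \<open>Q^2 = R\<close>, and then the quadratic is the square of
  \<open>b + Q\<close>.\<close>

lemma quadratic_char_3:
  fixes b :: "'k::field alg_closure"
  assumes p: "rat p" "rat q" "rat r" and three: "(3 :: 'k alg_closure) = 0"
    and b: "rat (b^3)" "p * b^2 = q * b - r"
  shows "rat b \<or> (p = 0 \<and> q = 0 \<and> r = 0)"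
proof (cases "p = 0")
  case True
  show ?thesis
  proof (cases "q = 0")
    case False
    then have "b = r / q" using b(2) True by (simp add: field_simps)
    then show ?thesis using rat_divide[OF p(3,2)] by simp
  qed (use True b in auto)
next
  case False
  define Q R where "Q = q / p" and "R = r / p"
  have QR: "rat Q" "rat R" using p by (simp_all add: Q_def R_def rat_divide)
  have b2: "b^2 = Q * b - R" using b(2) False by (simp add: Q_def R_def field_simps)
  then have b3: "b^3 = (Q^2 - R) * b - Q * R" by Groebner_Basis.algebra
  show ?thesis
  proof (cases "Q^2 = R")
    case True
    have "(b + Q)^2 = 3 * Q * b"
      using b2 True by Groebner_Basis.algebra
    then have "(b + Q)^2 = 0" using three by simp
    then have "b = - Q" by (simp add: eq_neg_iff_add_eq_0)
    then show ?thesis using rat_minus[OF QR(1)] by simp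
  next
    case False
    have "rat ((Q^2 - R) * b)"
      using rat_add[OF b(1)[unfolded b3] rat_mult[OF QR]] by simp
    then have "rat b" by (rule rat_cancel_left) (use False QR in \<open>auto intro: rat_intros\<close>)
    then show ?thesis ..
  qed
qed

text \<open>If \<open>b\<close> and \<open>g\<close> are linear forms in three variables such that \<open>b\<^sup>3\<close> and \<open>b g\<close> have
  rational coefficients, then so has \<open>b\<close>, up to a factor.\<close>

lemma rational_common_factor:
  fixes bi :: "'k::field alg_closure"
  assumes cube: "rat (bi^3)" "rat (bj^3)" "rat (3 * bj^2 * bi)"
    and prod: "rat (bi * gi)" "rat (bj * gj)" "rat (bi * gj + bj * gi)" "rat (bi * gk + bk * gi)" "rat (bj * gk + bk * gj)"
    and nz: "bj \<noteq> 0" "gi \<noteq> 0 \<or> gj \<noteq> 0 \<or> gk \<noteq> 0"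
  shows "rat (bi / bj)"
proof (cases "(3 :: 'k alg_closure) = 0")
  case False
  have "bi / bj = (3 * bj^2 * bi) / (3 * bj^3)"
    using False nz(1) by (simp add: field_simps power2_eq_square power3_eq_cube)
  also have "rat \<dots>" by (intro rat_divide cube rat_mult rat_numeral)
  finally show ?thesis .
next
  case True
  define b where "b = bi / bj"
  have bi: "bi = b * bj" using nz(1) by (simp add: b_def)
  have b3: "rat (b^3)" unfolding b_def power_divide by (intro rat_divide cube)
  \<comment> \<open>The ratio \<open>b\<close> is a root of the quadratic formed from the
    coefficients of the product of the two linear forms.\<close>
  have "(bj * gj) * b^2 = (bi * gj + bj * gi) * b - bi * gi"
    unfolding bi by Groebner_Basis.algebra
  from quadratic_char_3[OF prod(2,3,1) True b3 this] show ?thesis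
  proof
    assume "bj * gj = 0 \<and> bi * gj + bj * gi = 0 \<and> bi * gi = 0"
    then have z: "gj = 0" "gi = 0" using nz(1) by auto
    with nz(2) have "gk \<noteq> 0" by simp
    have "b = (bi * gk) / (bj * gk)" using \<open>gk \<noteq> 0\<close> nz(1) by (simp add: bi)
    then show ?thesis using rat_divide[of "bi * gk" "bj * gk"] prod(4,5) z by (simp add: b_def)
  qed (simp add: b_def)
qed

lemma mv_axis: "(A *v axis j (1::'a::field)) $ i = A $ i $ j"
  by (simp add: matrix_vector_mult_def axis_def if_distrib cong: if_cong)

lemma ratv_axis [simp]: "ratv (axis i 1)"
  by (simp add: ratv_def axis_def)

text \<open>Modulo t1 the cubic is the cube of row 2, and its coefficient at the first power of t1
  is the product of row 2 with the form \<open>g\<close>. By \<open>rational_common_factor\<close>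
  row 2 modulo t1 is rational up to a factor, so it can be taken as the new t2.\<close>

lemma twist_F2_row1:
  fixes f :: "(4, 'k::field) mpoly"
  assumes A: "invertible A" and eq: "\<And>x. eval_poly (ac_poly f) x = F2 (A *v x)"
    and A1: "A $ 1 = vec4 a1 0 0 0"
  shows "lin_equiv std2 f"
proof -
  have a1: "a1 \<noteq> 0" using invertible_row_nonzero[OF A, of 1] A1 by (auto simp: vec4_eq_iff)
  define b r s where "b = A $ 2" and "r = A $ 3" and "s = A $ 4"
  define g where "g i = a1 * r $ i + 3 * b $ 1 * b $ i" for i
  note comp = F2_def matrix_vector_right_distrib vector_add_component mv_axis vector_smult_component
    vector_scalar_commute
  have A1': "A $ 1 $ i = 0" if "i \<noteq> 1" for i using exhaust_4[of i] that A1 by auto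
  have A11: "A $ 1 $ 1 = a1" using A1 by simp
  have ij: "eval_poly (ac_poly f) (axis i 1 + t *s axis j 1) =
    b $ i ^ 3 + t * (3 * b $ i ^ 2 * b $ j) + t^2 * (3 * b $ i * b $ j ^ 2) + t^3 * b $ j ^ 3"
    if "i \<noteq> 1" "j \<noteq> 1" for i j t
    unfolding eq comp A1'[OF that(1)] A1'[OF that(2)] b_def
    by (simp add: algebra_simps power2_eq_square power3_eq_cube)
  have i1: "eval_poly (ac_poly f) (axis i 1 + t *s axis 1 1) = b $ i ^ 3 + t * (b $ i * g i) +
    t^2 * (r $ 1 * a1 * b $ i + r $ i * a1 * b $ 1 + s $ i * a1^2 + 3 * b $ i * b $ 1 ^ 2) +
    t^3 * (r $ 1 * a1 * b $ 1 + s $ 1 * a1^2 + b $ 1 ^ 3)" if "i \<noteq> 1" for i t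
    unfolding eq comp A1'[OF that] A11 b_def r_def s_def g_def by Groebner_Basis.algebra
  have ij1: "eval_poly (ac_poly f) ((axis i 1 + axis j 1) + t *s axis 1 1) = (b $ i + b $ j) ^ 3 +
    t * ((b $ i + b $ j) * (g i + g j)) +
    t^2 * (r $ 1 * a1 * (b $ i + b $ j) + (r $ i + r $ j) * a1 * b $ 1 + (s $ i + s $ j) * a1^2 + 3 * (b $ i + b $ j) * b $ 1 ^ 2) +
    t^3 * (r $ 1 * a1 * b $ 1 + s $ 1 * a1^2 + b $ 1 ^ 3)" if "i \<noteq> 1" "j \<noteq> 1" for i j t
    unfolding eq comp A1'[OF that(1)] A1'[OF that(2)] A11 b_def r_def s_def g_def by Groebner_Basis.algebra
  have rc: "rat (b $ i ^ 3)" if "i \<noteq> 1" for i using rat_line(1)[OF _ _ i1[OF that]] by simp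
  have rs: "rat (3 * b $ i ^ 2 * b $ j)" if "i \<noteq> 1" "j \<noteq> 1" for i j using rat_line(2)[OF _ _ ij[OF that]] by simp
  have rg: "rat (b $ i * g i)" if "i \<noteq> 1" for i using rat_line(2)[OF _ _ i1[OF that]] by simp
  have rx: "rat (b $ i * g j + b $ j * g i)" if "i \<noteq> 1" "j \<noteq> 1" for i j
  proof -
    have "ratv (axis i 1 + axis j 1 :: 'k alg_closure ^ 4)" by (simp add: ratv_def axis_def rat_add)
    then have "rat ((b $ i + b $ j) * (g i + g j))" using rat_line(2)[OF _ _ ij1[OF that]] by simp
    then have "rat ((b $ i + b $ j) * (g i + g j) - b $ i * g i - b $ j * g j)" by (intro rat_diff rg that)
    then show ?thesis by (simp add: algebra_simps)
  qed
  obtain j where j: "j \<noteq> 1" "b $ j \<noteq> 0"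
  proof -
    have "b $ 2 \<noteq> 0 \<or> b $ 3 \<noteq> 0 \<or> b $ 4 \<noteq> 0"
    proof (rule ccontr)
      assume "\<not> ?thesis"
      then have "(- b $ 1) *s A $ 1 + a1 *s A $ 2 = 0" by (simp add: A1 b_def[symmetric] vec4_eq_iff)
      from rows_independent(2)[OF A _ this] a1 show False by simp
    qed
    then show ?thesis using that[of 2] that[of 3] that[of 4] by auto
  qed
  have g0: "\<exists>i. i \<noteq> 1 \<and> g i \<noteq> 0"
  proof (rule ccontr)
    assume "\<not> ?thesis"
    then have z: "a1 * r $ i + 3 * b $ 1 * b $ i = 0" if "i \<noteq> 1" for i using that unfolding g_def by blast
    define x :: "'k alg_closure ^ 4" where "x = 0"
    have "a1 *s A $ 3 + (3 * b $ 1) *s A $ 2 = ((a1 * r $ 1 + 3 * b $ 1 * b $ 1) / a1) *s A $ 1"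
      using z[of 2] z[of 3] z[of 4] a1 by (simp add: A1 b_def r_def vec4_eq_iff)
    then have dep: "(A *v x) $ 3 * a1 + (3 * b $ 1) * (A *v x) $ 2 = ((a1 * r $ 1 + 3 * b $ 1 * b $ 1) / a1) * (A *v x) $ 1" for x
      unfolding mult_vec_nth_4 vec4_eq_iff vector_add_component vector_smult_component by Groebner_Basis.algebra
    obtain B where "\<And>x. A *v (B *v x) = x" using invertible_inverse[OF A] by metis
    with dep[of "B *v axis 3 1"] a1 show False by (simp add: axis_def)
  qed
  have rat_quot: "rat (b $ i / b $ j)" if "i \<noteq> 1" for i
  proof (cases "i = j")
    case False
    obtain k where k: "k \<noteq> 1" "\<And>m. m = 1 \<or> m = i \<or> m = j \<or> m = k"
    proof -
      have "\<exists>k::4. k \<noteq> 1 \<and> (\<forall>m. m = 1 \<or> m = i \<or> m = j \<or> m = k)"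
        using exhaust_4[of i] exhaust_4[of j] False \<open>i \<noteq> 1\<close> j(1) unfolding forall_4
        by (elim disjE) (auto intro: exI[of _ 2] exI[of _ 3] exI[of _ 4])
      then show ?thesis using that by blast
    qed
    show ?thesis
      by (rule rational_common_factor[where gi = "g i" and gj = "g j" and gk = "g k" and bk = "b $ k"])
         (use g0 k that j in \<open>auto intro: rc rs rg rx\<close>)
  qed (use j in simp)
  define m where "m = vec4 0 (b $ 2 / b $ j) (b $ 3 / b $ j) (b $ 4 / b $ j)"
  have "ratv m" unfolding m_def using rat_quot by simp
  then obtain m' where m': "m = ac_vec m'" by (rule ratvE)
  have bm: "b = b $ 1 *s vec4 1 0 0 0 + b $ j *s m" using j(2) by (simp add: m_def vec4_eq_iff)
  have ind: "p = 0 \<and> q = 0" if pq: "p *s vec4 1 0 0 0 + q *s m' = 0" for p q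
  proof -
    have "m' $ j \<noteq> 0"
    proof
      assume "m' $ j = 0"
      then have "m $ j = 0" by (simp add: m')
      then show False using exhaust_4[of j] j by (auto simp: m_def)
    qed
    moreover have "p * vec4 1 0 0 0 $ j + q * m' $ j = 0"
      using pq by (metis vector_add_component vector_smult_component zero_index)
    ultimately have "q = 0" using exhaust_4[of j] j(1) by auto
    with pq show ?thesis by (simp add: vec4_eq_iff)
  qed
  obtain R :: "'k ^ 4 ^ 4" where R: "invertible R" "R $ 1 = vec4 1 0 0 0" "R $ 2 = m'" by (rule invertible_rows[OF ind])
  have acR: "ac_vec (R $ 1) = vec4 1 0 0 0" "ac_vec (R $ 2) = m"
    by (simp_all add: R m' vec4_eq_iff)
  obtain f' A' where f': "lin_equiv f f'" "invertible A'" "\<forall>x. eval_poly (ac_poly f') x = F2 (A' *v x)"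
    "\<forall>i k1 k2. A $ i = k1 *s ac_vec (R $ 1) + k2 *s ac_vec (R $ 2) \<longrightarrow> A' $ i = vec4 k1 k2 0 0"
    by (rule change_coords[of A f F2, OF A eq R(1)])
  have "A $ 1 = a1 *s ac_vec (R $ 1) + 0 *s ac_vec (R $ 2)" unfolding acR A1 by (simp add: vec4_eq_iff)
  then have 1: "A' $ 1 = vec4 a1 0 0 0" using f'(4) by blast
  have "A $ 2 = b $ 1 *s ac_vec (R $ 1) + b $ j *s ac_vec (R $ 2)" unfolding acR using bm by (simp add: b_def)
  then have 2: "A' $ 2 = vec4 (b $ 1) (b $ j) 0 0" using f'(4) by blast
  have "lin_equiv std2 f'" by (rule twist_F2_normal[OF f'(2) f'(3)[rule_format] 1 2])
  then show ?thesis using lin_equiv_trans lin_equiv_sym[OF f'(1)] by blast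
qed

lemma twist_F2_proportional:
  fixes f :: "(4, 'k::field) mpoly"
  assumes A: "invertible A" and eq: "\<And>x. eval_poly (ac_poly f) x = F2 (A *v x)"
    and i: "A $ 1 $ i \<noteq> 0" "\<And>j. rat (A $ 1 $ j / A $ 1 $ i)"
  shows "lin_equiv std2 f"
proof -
  define m where "m = (\<chi> j. A $ 1 $ j / A $ 1 $ i)"
  have "ratv m" unfolding ratv_def m_def using i(2) by simp
  then obtain m' where m': "m = ac_vec m'" by (rule ratvE)
  have Am: "A $ 1 = A $ 1 $ i *s m" using i(1) by (simp add: m_def vec_eq_iff)
  have "m' \<noteq> 0"
  proof
    assume "m' = 0"
    then have "m = 0" by (simp add: m' vec_eq_iff)
    then have "A $ 1 = 0" using Am by simp
    with i(1) show False by simp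
  qed
  then obtain R :: "'k ^ 4 ^ 4" where R: "invertible R" "R $ 1 = m'" by (rule invertible_row)
  obtain f' A' where f': "lin_equiv f f'" "invertible A'" "\<forall>x. eval_poly (ac_poly f') x = F2 (A' *v x)"
    "\<forall>i k1 k2. A $ i = k1 *s ac_vec (R $ 1) + k2 *s ac_vec (R $ 2) \<longrightarrow> A' $ i = vec4 k1 k2 0 0"
    by (rule change_coords[of A f F2, OF A eq R(1)])
  have "A $ 1 = A $ 1 $ i *s ac_vec (R $ 1) + 0 *s ac_vec (R $ 2)" using Am by (simp add: R(2) m')
  then have "A' $ 1 = vec4 (A $ 1 $ i) 0 0 0" using f'(4) by blast
  then have "lin_equiv std2 f'" by (rule twist_F2_row1[OF f'(2) f'(3)[rule_format]])
  then show ?thesis using lin_equiv_trans lin_equiv_sym[OF f'(1)] by blast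
qed

subsection \<open>The Hessian\<close>

lemma poly_det: "poly (det E) t = det (\<chi> i j. poly (E $ i $ j) t)"
  by (simp add: det_def poly_sum poly_prod poly_of_int)

text \<open>The Hessian of \<open>G\<close> is a constant times the square of a quadratic form \<open>q\<close>, which in
  characteristic different from 2 forces \<open>q \<circ> A\<close> to be rational up to a factor.\<close>

lemma hessian_rational:
  fixes f :: "(4, 'k::field) mpoly" and G :: "'k alg_closure ^ 4 \<Rightarrow> 'k alg_closure"
    and S :: "'k alg_closure ^ 4 \<Rightarrow> 'k alg_closure ^ 4 ^ 4"
  assumes eq: "\<And>x. eval_poly (ac_poly f) x = G (A *v x)"
    and S: "\<And>p u v. tri G p u v = (\<Sum>i\<in>UNIV. \<Sum>j\<in>UNIV. u $ i * S p $ i $ j * v $ j)"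
    and Slin: "\<And>p q t i j. S (p + t *s q) $ i $ j = S p $ i $ j + t * S q $ i $ j"
    and detS: "\<And>p. det (S p) = k * q p ^ 2"
    and ev: "ratv e" "ratv v" and q: "\<And>t. q (A *v (e + t *s v)) = a + b * t + c * t^2"
  shows "rat (det A ^ 2 * k * a^2)" "rat (det A ^ 2 * k * (2 * a * b))" "rat (det A ^ 2 * k * (b^2 + 2 * a * c))"
proof -
  let ?F = "eval_poly (ac_poly f)"
  define T where "T x = transpose A ** S (A *v x) ** A" for x
  have triF: "tri ?F x y z = tri G (A *v x) (A *v y) (A *v z)" for x y z
    using tri_transform[of ?F 1 G A] eq by simp
  have T: "T x $ m $ n = tri ?F x (axis m 1) (axis n 1)" for x m n
  proof -
    have "T x $ m $ n = (\<Sum>j\<in>UNIV. \<Sum>i\<in>UNIV. A $ i $ m * S (A *v x) $ i $ j * A $ j $ n)"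
      by (simp add: T_def matrix_matrix_mult_def transpose_def sum_distrib_right)
    also have "\<dots> = (\<Sum>i\<in>UNIV. \<Sum>j\<in>UNIV. A $ i $ m * S (A *v x) $ i $ j * A $ j $ n)"
      by (rule sum.swap)
    finally show ?thesis unfolding triF S mv_axis .
  qed
  \<comment> \<open>The entries of \<open>T\<close> are polarisations of \<open>f\<close>, rational
    at rational vectors, so the determinant along the line is a polynomial with rational
    coefficients.\<close>
  define E where "E = (\<chi> m n. [:T e $ m $ n, T v $ m $ n:])"
  define P where "P = det E"
  have "ratp P"
    unfolding P_def
  proof (rule ratp_det)
    fix m n
    show "ratp (E $ m $ n)"
      unfolding E_def using ev by (simp add: T) (intro ratp_pCons ratp_0 rat_tri ratv_axis)
  qed
  moreover have "P = [:det A ^ 2 * k * a^2, det A ^ 2 * k * (2 * a * b), det A ^ 2 * k * (b^2 + 2 * a * c),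
    det A ^ 2 * k * (2 * b * c), det A ^ 2 * k * c^2:]"
    using infinite_UNIV_alg_closed
  proof (rule poly_eqI_infinite)
    fix t
    have lin: "T (e + t *s v) $ m $ n = T e $ m $ n + t * T v $ m $ n" for m n
    proof -
      let ?u = "A *v axis m 1" and ?w = "A *v axis n 1"
      have "T (e + t *s v) $ m $ n =
        (\<Sum>i\<in>UNIV. \<Sum>j\<in>UNIV. ?u $ i * S (A *v e) $ i $ j * ?w $ j + t * (?u $ i * S (A *v v) $ i $ j * ?w $ j))"
        unfolding T triF S matrix_vector_axpy Slin by (intro sum.cong refl) (simp add: distrib_left distrib_right mult_ac)
      then show ?thesis unfolding T triF S sum.distrib sum_distrib_left .
    qed
    have "poly P t = det (T (e + t *s v))"
      unfolding P_def poly_det E_def by (rule arg_cong[of _ _ det]) (simp add: vec_eq_iff lin)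
    also have "\<dots> = det A ^ 2 * (k * (a + b * t + c * t^2)^2)"
      unfolding T_def det_mul det_transpose detS q by (simp add: power2_eq_square)
    also have "\<dots> = poly [:det A ^ 2 * k * a^2, det A ^ 2 * k * (2 * a * b), det A ^ 2 * k * (b^2 + 2 * a * c),
      det A ^ 2 * k * (2 * b * c), det A ^ 2 * k * c^2:] t"
      unfolding poly_pCons poly_0 by Groebner_Basis.algebra
    finally show "poly P t = poly [:det A ^ 2 * k * a^2, det A ^ 2 * k * (2 * a * b), det A ^ 2 * k * (b^2 + 2 * a * c),
      det A ^ 2 * k * (2 * b * c), det A ^ 2 * k * c^2:] t" .
  qed
  ultimately have "rat (Polynomial.coeff [:det A ^ 2 * k * a^2, det A ^ 2 * k * (2 * a * b), det A ^ 2 * k * (b^2 + 2 * a * c),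
      det A ^ 2 * k * (2 * b * c), det A ^ 2 * k * c^2:] i)" for i by (simp add: ratp_def)
  from this[of 0] this[of 1] this[of 2]
  show "rat (det A ^ 2 * k * a^2)" "rat (det A ^ 2 * k * (2 * a * b))" "rat (det A ^ 2 * k * (b^2 + 2 * a * c))"
    by (simp_all add: numeral_2_eq_2)
qed

definition hess_F1 :: "'a::field ^ 4 \<Rightarrow> 'a ^ 4 ^ 4" where
  "hess_F1 p = vec4 (vec4 (2 * p$3) 0 (2 * p$1) 0) (vec4 0 (2 * p$4) 0 (2 * p$2)) (vec4 (2 * p$1) 0 0 0) (vec4 0 (2 * p$2) 0 0)"

definition hess_F2 :: "'a::field ^ 4 \<Rightarrow> 'a ^ 4 ^ 4" where
  "hess_F2 p = vec4 (vec4 (2 * p$4) (p$3) (p$2) (2 * p$1)) (vec4 (p$3) (6 * p$2) (p$1) 0) (vec4 (p$2) (p$1) 0 0) (vec4 (2 * p$1) 0 0 0)"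

lemma tri_F1: "tri F1 p u v = (\<Sum>i\<in>UNIV. \<Sum>j\<in>UNIV. u $ i * hess_F1 p $ i $ j * v $ j)"
  unfolding tri_def F1_def hess_F1_def sum_4 vec4_nth vector_add_component by Groebner_Basis.algebra

lemma tri_F2: "tri F2 p u v = (\<Sum>i\<in>UNIV. \<Sum>j\<in>UNIV. u $ i * hess_F2 p $ i $ j * v $ j)"
  unfolding tri_def F2_def hess_F2_def sum_4 vec4_nth vector_add_component by Groebner_Basis.algebra

lemma det_hess_F1: "det (hess_F1 p) = 16 * (p$1 * p$2)^2"
  unfolding det_4 hess_F1_def vec4_nth by Groebner_Basis.algebra

lemma det_hess_F2: "det (hess_F2 p) = 4 * (p$1 * p$1)^2"
  unfolding det_4 hess_F2_def vec4_nth by Groebner_Basis.algebra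

lemma hess_linear: "hess_F1 (p + t *s q) $ i $ j = hess_F1 p $ i $ j + t * hess_F1 q $ i $ j"
  "hess_F2 (p + t *s q) $ i $ j = hess_F2 p $ i $ j + t * hess_F2 q $ i $ j"
  using exhaust_4[of i] exhaust_4[of j] by (auto simp: hess_F1_def hess_F2_def algebra_simps)

text \<open>The Hessian determinant is a constant times the fourth power of row 1. The ratio of the
  first two coefficients of \<open>(a + b t)^4\<close> is \<open>4 b / a\<close>, so the entries of
  row 1 have rational ratios.\<close>

lemma twist_F2_char_not_2:
  fixes f :: "(4, 'k::field) mpoly"
  assumes A: "invertible A" and eq: "\<And>x. eval_poly (ac_poly f) x = F2 (A *v x)"
    and two: "(2 :: 'k alg_closure) \<noteq> 0"
  shows "lin_equiv std2 f"
proof -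
  obtain i where i: "A $ 1 $ i \<noteq> 0" using invertible_row_nonzero[OF A, of 1] by (auto simp: vec_eq_iff)
  have four: "(4 :: 'k alg_closure) \<noteq> 0" using two mult_eq_0_iff[of 2 "2 :: 'k alg_closure"] by simp
  define d where "d = det A ^ 2 * 4"
  have d: "d \<noteq> 0" using A four by (simp add: d_def invertible_det_nz)
  have "rat (A $ 1 $ j / A $ 1 $ i)" for j
  proof -
    let ?a = "A $ 1 $ i" and ?b = "A $ 1 $ j"
    have q: "(A *v (axis i 1 + t *s axis j 1)) $ 1 * (A *v (axis i 1 + t *s axis j 1)) $ 1
      = ?a^2 + (2 * ?a * ?b) * t + ?b^2 * t^2" for t
      unfolding matrix_vector_axpy vector_add_component vector_smult_component mv_axis by Groebner_Basis.algebra
    note h = hessian_rational[where q = "\<lambda>p. p $ 1 * p $ 1", OF eq tri_F2 hess_linear(2) det_hess_F2 ratv_axis ratv_axis q]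
    have "?b / ?a = (d * (2 * ?a^2 * (2 * ?a * ?b))) / (4 * (d * (?a^2)^2))"
      using i d four by (simp add: field_simps power2_eq_square)
    also have "rat \<dots>" using h(1,2) by (intro rat_divide rat_mult[OF rat_numeral]) (simp_all add: d_def)
    finally show ?thesis .
  qed
  from twist_F2_proportional[OF A eq i this] show ?thesis .
qed

section \<open>Characteristic 2\<close>

lemma char_2_minus:
  assumes "(2 :: 'a::field) = 0" shows "- x = (x :: 'a)"
proof -
  have "x + x = 2 * x" by simp
  then have "x + x = 0" using assms by simp
  then show ?thesis by (simp add: eq_neg_iff_add_eq_0[symmetric])
qed

lemma char_2_square_add:
  assumes "(2 :: 'a::field) = 0" shows "(x + y :: 'a)^2 = x^2 + y^2"
  using assms by (simp add: power2_sum)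

text \<open>The permanent of the 3 x 3 submatrix with rows \<open>x\<close>, \<open>y\<close>,
  \<open>z\<close> and columns \<open>i\<close>, \<open>j\<close>, \<open>k\<close>; in
  characteristic 2 it equals the determinant.\<close>

definition perm3 :: "'a::field ^ 4 \<Rightarrow> 'a ^ 4 \<Rightarrow> 'a ^ 4 \<Rightarrow> 4 \<Rightarrow> 4 \<Rightarrow> 4 \<Rightarrow> 'a" where
  "perm3 x y z i j k = x$i * y$j * z$k + x$i * y$k * z$j + x$j * y$i * z$k + x$j * y$k * z$i + x$k * y$i * z$j + x$k * y$j * z$i"

lemma tri_cub: "tri (cub c) x y z =
    c 1 2 3 * perm3 x y z 1 2 3 + c 1 2 4 * perm3 x y z 1 2 4 + c 1 3 4 * perm3 x y z 1 3 4 + c 2 3 4 * perm3 x y z 2 3 4 +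
    2 * (3 * (c 1 1 1 * x$1 * y$1 * z$1 + c 2 2 2 * x$2 * y$2 * z$2 + c 3 3 3 * x$3 * y$3 * z$3 + c 4 4 4 * x$4 * y$4 * z$4) +
      c 1 1 2 * (x$1 * y$1 * z$2 + x$1 * y$2 * z$1 + x$2 * y$1 * z$1) + c 1 1 3 * (x$1 * y$1 * z$3 + x$1 * y$3 * z$1 + x$3 * y$1 * z$1) +
      c 1 1 4 * (x$1 * y$1 * z$4 + x$1 * y$4 * z$1 + x$4 * y$1 * z$1) + c 1 2 2 * (x$2 * y$2 * z$1 + x$2 * y$1 * z$2 + x$1 * y$2 * z$2) +
      c 1 3 3 * (x$3 * y$3 * z$1 + x$3 * y$1 * z$3 + x$1 * y$3 * z$3) + c 1 4 4 * (x$4 * y$4 * z$1 + x$4 * y$1 * z$4 + x$1 * y$4 * z$4) +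
      c 2 2 3 * (x$2 * y$2 * z$3 + x$2 * y$3 * z$2 + x$3 * y$2 * z$2) + c 2 2 4 * (x$2 * y$2 * z$4 + x$2 * y$4 * z$2 + x$4 * y$2 * z$2) +
      c 2 3 3 * (x$3 * y$3 * z$2 + x$3 * y$2 * z$3 + x$2 * y$3 * z$3) + c 2 4 4 * (x$4 * y$4 * z$2 + x$4 * y$2 * z$4 + x$2 * y$4 * z$4) +
      c 3 3 4 * (x$3 * y$3 * z$4 + x$3 * y$4 * z$3 + x$4 * y$3 * z$3) + c 3 4 4 * (x$4 * y$4 * z$3 + x$4 * y$3 * z$4 + x$3 * y$4 * z$4))"
  unfolding tri_def cub_def perm3_def vector_add_component by Groebner_Basis.algebra

text \<open>The Laplace expansion of a 4 x 4 permanent with two equal rows: its terms coincide in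
  pairs, just as they cancel for a determinant.\<close>

lemma permanent_repeated_row:
  fixes a b r :: "'a::field ^ 4"
  shows "a$1 * perm3 a b r 2 3 4 + a$2 * perm3 a b r 1 3 4 + a$3 * perm3 a b r 1 2 4 + a$4 * perm3 a b r 1 2 3 =
    2 * (a$1 * a$2 * (b$3 * r$4 + b$4 * r$3) + a$1 * a$3 * (b$2 * r$4 + b$4 * r$2) + a$1 * a$4 * (b$2 * r$3 + b$3 * r$2) +
      a$2 * a$3 * (b$1 * r$4 + b$4 * r$1) + a$2 * a$4 * (b$1 * r$3 + b$3 * r$1) + a$3 * a$4 * (b$1 * r$2 + b$2 * r$1))"
  unfolding perm3_def by Groebner_Basis.algebra

lemma perm3_swap: "perm3 b a r = perm3 a b r" "perm3 r b a = perm3 a b r"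
  by (simp_all add: perm3_def fun_eq_iff algebra_simps)

text \<open>In characteristic 2 the form \<open>tri F\<close> is alternating, so it has a kernel, spanned by a
  vector that is rational because its coordinates are coefficients of \<open>F\<close>.\<close>

lemma char_2_kernel:
  fixes f :: "(4, 'k::field) mpoly" and A :: "'k alg_closure ^ 4 ^ 4"
  assumes two: "(2 :: 'k alg_closure) = 0" and hom: "homogeneous_poly 3 f" and A: "invertible A"
    and eq: "\<And>x. eval_poly (ac_poly f) x = G (A *v x)"
    and G: "\<And>x y z. tri G x y z = perm3 x y z i j k" and ijk: "i \<noteq> j" "i \<noteq> k" "j \<noteq> k"
  obtains v where "ratv v" "v \<noteq> 0" "(A *v v) $ i = 0" "(A *v v) $ j = 0" "(A *v v) $ k = 0"
proof -
  obtain d where d: "f = cub_poly d" by (rule homogeneous_3_cub[OF hom])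
  define D where "D l m n = to_ac (d l m n)" for l m n
  have "D = (\<lambda>l m n. to_ac (d l m n))" by (intro ext) (simp add: D_def)
  then have F: "eval_poly (ac_poly f) = cub D" by (intro ext) (simp add: d)
  have triF: "tri (cub D) x y z = perm3 (A *v x) (A *v y) (A *v z) i j k" for x y z
    using tri_transform[of "cub D" 1 G A] eq unfolding F G by simp
  have coeff: "D l m n = perm3 (A $ i) (A $ j) (A $ k) l m n"
    if "(l, m, n) \<in> {(1,2,3), (1,2,4), (1,3,4), (2,3,4)}" for l m n
  proof -
    have "D l m n = tri (cub D) (axis l 1) (axis m 1) (axis n 1)"
      unfolding tri_cub using that two by (auto simp: perm3_def axis_def)
    also have "\<dots> = perm3 (A $ i) (A $ j) (A $ k) l m n"
      unfolding triF by (simp add: perm3_def mv_axis algebra_simps)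
    finally show ?thesis .
  qed
  \<comment> \<open>Each coordinate is the coefficient of the squarefree monomial omitting that
    variable, which by \<open>coeff\<close> is a minor of the rows \<open>i\<close>,
    \<open>j\<close>, \<open>k\<close>. Thus \<open>v\<close> is their generalised cross product,
    signs making no difference in characteristic 2.\<close>
  define v where "v = vec4 (D 2 3 4) (D 1 3 4) (D 1 2 4) (D 1 2 3)"
  have "ratv v" by (simp add: v_def D_def)
  moreover have "v \<noteq> 0"
  proof
    assume "v = 0"
    then have z: "D 2 3 4 = 0" "D 1 3 4 = 0" "D 1 2 4 = 0" "D 1 2 3 = 0" by (auto simp: v_def vec4_eq_iff)
    obtain B where B: "\<And>x. A *v (B *v x) = x" using invertible_inverse[OF A] by metis
    \<comment> \<open>If the four squarefree coefficients vanished, the polarisation would be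
      identically 0 in characteristic 2; it takes the value 1 at the preimages of three unit
      vectors.\<close>
    have "tri (cub D) (B *v axis i 1) (B *v axis j 1) (B *v axis k 1) = 0"
      unfolding tri_cub z two by simp
    moreover have "tri (cub D) (B *v axis i 1) (B *v axis j 1) (B *v axis k 1) = 1"
      unfolding triF B using ijk by (simp add: perm3_def axis_def)
    ultimately show False by simp
  qed
  moreover have "(A *v v) $ i = 0" "(A *v v) $ j = 0" "(A *v v) $ k = 0"
  proof -
    have c: "D 2 3 4 = perm3 (A $ i) (A $ j) (A $ k) 2 3 4" "D 1 3 4 = perm3 (A $ i) (A $ j) (A $ k) 1 3 4"
      "D 1 2 4 = perm3 (A $ i) (A $ j) (A $ k) 1 2 4" "D 1 2 3 = perm3 (A $ i) (A $ j) (A $ k) 1 2 3"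
      by (rule coeff, simp)+
    show "(A *v v) $ i = 0"
      unfolding mult_vec_nth_4 v_def vec4_nth c permanent_repeated_row two by simp
    show "(A *v v) $ j = 0"
      unfolding mult_vec_nth_4 v_def vec4_nth c perm3_swap(1)[of "A $ i" "A $ j" "A $ k"] permanent_repeated_row two by simp
    show "(A *v v) $ k = 0"
      unfolding mult_vec_nth_4 v_def vec4_nth c perm3_swap(2)[of "A $ i" "A $ j" "A $ k"] permanent_repeated_row two by simp
  qed
  ultimately show ?thesis using that by blast
qed

text \<open>The system arising from \<open>s G + H = (\<alpha> t\<^sub>2 + \<beta> t\<^sub>3)\<^sup>3\<close> with \<open>s = x t\<^sub>2 + y t\<^sub>3\<close>, where the binary
  forms \<open>G\<close> and \<open>H\<close> are rational and \<open>G\<close> is a multiple of \<open>\<alpha> t\<^sub>2 + \<beta> t\<^sub>3\<close>.\<close>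

lemma char_2_cusp_system:
  fixes x :: "'k::field alg_closure"
  assumes two: "(2 :: 'k alg_closure) = 0"
    and rg: "rat g0" "rat g1" "rat g2" and rh: "rat h0" "rat h1" "rat h2" and sq: "rat (x^2)" "rat (y^2)"
    and cusp: "g0 * x + h0 = \<alpha>^3" "g0 * y + g1 * x + h1 = \<alpha>^2 * \<beta>" "g1 * y + g2 * x + h2 = \<alpha> * \<beta>^2"
    and g: "g0 = \<alpha> * \<gamma>" "g1 = \<alpha> * \<delta> + \<beta> * \<gamma>" "g2 = \<beta> * \<delta>" and nz: "g1 \<noteq> 0" "\<alpha> \<noteq> 0"
  shows "rat x" "rat y"
proof -
  define b where "b = \<beta> / \<alpha>"
  have \<beta>: "\<beta> = b * \<alpha>" using nz by (simp add: b_def)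
  \<comment> \<open>After squaring, the first two equations contain \<open>x\<close> and
    \<open>y\<close> only through their rational squares, so the square of
    \<open>b = \<beta> / \<alpha>\<close> is rational. The quadratic equation for \<open>b\<close>
    coming from the factor of \<open>G\<close> then determines \<open>b\<close> itself, since
    \<open>g1 \<noteq> 0\<close>.\<close>
  have a6: "(\<alpha>^3)^2 = g0^2 * x^2 + h0^2"
    unfolding cusp(1)[symmetric] char_2_square_add[OF two] by (simp add: power_mult_distrib)
  have "(\<alpha>^2 * \<beta>)^2 = (g0 * y)^2 + (g1 * x)^2 + h1^2"
    unfolding cusp(2)[symmetric] by (simp add: char_2_square_add[OF two])
  then have a6b2: "(\<alpha>^3)^2 * b^2 = g0^2 * y^2 + g1^2 * x^2 + h1^2"
    unfolding \<beta> by (simp add: power_mult_distrib algebra_simps power2_eq_square power3_eq_cube)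
  have "b^2 = (g0^2 * y^2 + g1^2 * x^2 + h1^2) / (g0^2 * x^2 + h0^2)"
    unfolding a6[symmetric] a6b2[symmetric] using nz by simp
  also have "rat \<dots>" by (intro rat_intros rg rh sq)
  finally have rb2: "rat (b^2)" .
  have "g0 * b^2 + g1 * b + g2 = 2 * (b * (\<alpha> * (\<delta> + b * \<gamma>)))"
    unfolding g \<beta> by Groebner_Basis.algebra
  then have g0b: "g0 * b^2 + g1 * b + g2 = 0" using two by simp
  then have "g1 * b = - (g0 * b^2 + g2)" by Groebner_Basis.algebra
  then have "b = - (g0 * b^2 + g2) / g1" using nz by (simp add: field_simps)
  also have "rat \<dots>" by (intro rat_intros rg rb2)
  finally have rb: "rat b" .
  have e2: "g0 * y + g1 * x + h1 = b * (g0 * x + h0)"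
    unfolding cusp(1,2) unfolding \<beta> by (simp add: power2_eq_square power3_eq_cube mult_ac)
  have e3: "g1 * y + g2 * x + h2 = b^2 * (g0 * x + h0)"
    unfolding cusp(1,3) unfolding \<beta> by (simp add: power2_eq_square power3_eq_cube mult_ac)
  have "g1 * (y - b * x) = b^2 * h0 - h2 + 2 * (b^2 * g0 * x)"
    using e3 g0b by Groebner_Basis.algebra
  then have "y - b * x = (b^2 * h0 - h2) / g1" using two nz by (simp add: field_simps)
  also have "rat \<dots>" by (intro rat_intros rg rb rh)
  finally have ryx: "rat (y - b * x)" .
  have "g1 * x = b * h0 - h1 - g0 * (y - b * x)"
    using e2 by Groebner_Basis.algebra
  also have "rat \<dots>" by (intro rat_diff rat_mult rb rh rg ryx)
  finally show rx: "rat x" using rg nz rat_cancel_left by blast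
  have "y = (y - b * x) + b * x" by simp
  also have "rat \<dots>" by (intro rat_add ryx rat_mult rb rx)
  finally show "rat y" .
qed

lemma binary_quadratic_0:
  assumes "\<And>s t. e0 * s^2 + e1 * s * t + e2 * t^2 = (0 :: 'a::field)"
  shows "e0 = 0" "e1 = 0" "e2 = 0"
  using assms[of 1 0] assms[of 0 1] assms[of 1 1] by auto

text \<open>Column 4 expresses that the kernel vector is the fourth unit vector. The coefficients of
  \<open>t_j^2 t4\<close> are the squares of the entries of row 1 times \<open>\<rho>\<close>, so
  the ratios \<open>x\<close> and \<open>y\<close> have rational squares. To remove the squares, the
  cubic and its derivative in t1 are restricted to the plane where row 1 vanishes.\<close>

lemma twist_F2_char_2_aux:
  fixes f :: "(4, 'k::field) mpoly"
  assumes two: "(2 :: 'k alg_closure) = 0" and hom: "homogeneous_poly 3 f"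
    and A: "invertible A" and eq: "\<And>x. eval_poly (ac_poly f) x = F2 (A *v x)"
    and col4: "A $ 1 $ 4 = 0" "A $ 2 $ 4 = 0" "A $ 3 $ 4 = 0" and a1: "A $ 1 $ 1 \<noteq> 0"
  shows "rat (A $ 1 $ 2 / A $ 1 $ 1)" "rat (A $ 1 $ 3 / A $ 1 $ 1)"
proof -
  obtain d where d: "f = cub_poly d" by (rule homogeneous_3_cub[OF hom])
  define D where "D l m n = to_ac (d l m n)" for l m n
  have "D = (\<lambda>l m n. to_ac (d l m n))" by (intro ext) (simp add: D_def)
  then have F: "eval_poly (ac_poly f) = cub D" by (intro ext) (simp add: d)
  have rD: "rat (D l m n)" for l m n by (simp add: D_def)
  define a b r \<rho> where "a = A $ 1" and "b = A $ 2" and "r = A $ 3" and "\<rho> = A $ 4 $ 4"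
  have \<rho>: "\<rho> \<noteq> 0"
  proof
    assume "\<rho> = 0"
    then have "A *v vec4 0 0 0 1 = 0" using col4 by (simp add: vec4_eq_iff mult_vec_nth_4 \<rho>_def)
    then have "vec4 0 0 0 1 = (0 :: 'k alg_closure ^ 4)" using A unfolding invertible_iff_ker by blast
    then show False by (simp add: vec4_eq_iff)
  qed
  have rsq: "rat (\<rho> * a $ j ^ 2)" for j
  proof -
    have "eval_poly (ac_poly f) (axis j 1 + t *s axis 4 1) = F2 (A *v axis j 1) + t * (\<rho> * a $ j ^ 2) + t^2 * 0 + t^3 * 0" for t
      unfolding eq F2_def matrix_vector_axpy vector_add_component vector_smult_component mv_axis
      using col4 by (simp add: a_def \<rho>_def algebra_simps)
    from rat_line(2)[OF _ _ this] show ?thesis by simp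
  qed
  define x y where "x = a $ 2 / a $ 1" and "y = a $ 3 / a $ 1"
  have a1': "a $ 1 \<noteq> 0" using a1 by (simp add: a_def)
  have "x^2 = (\<rho> * a $ 2 ^ 2) / (\<rho> * a $ 1 ^ 2)" "y^2 = (\<rho> * a $ 3 ^ 2) / (\<rho> * a $ 1 ^ 2)"
    using \<rho> a1' by (simp_all add: x_def y_def power_divide)
  then have sq: "rat (x^2)" "rat (y^2)" using rat_divide[OF rsq rsq, of 2 1] rat_divide[OF rsq rsq, of 3 1] by metis+
  have axy: "a $ 2 = a $ 1 * x" "a $ 3 = a $ 1 * y" using a1' by (simp_all add: x_def y_def)
  define \<alpha> \<beta> \<gamma>' \<delta>' where "\<alpha> = b $ 2 - b $ 1 * x" and "\<beta> = b $ 3 - b $ 1 * y"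
    and "\<gamma>' = r $ 2 - r $ 1 * x" and "\<delta>' = r $ 3 - r $ 1 * y"
  define \<gamma> \<delta> where "\<gamma> = a $ 1 * \<gamma>' + 3 * b $ 1 * \<alpha>" and "\<delta> = a $ 1 * \<delta>' + 3 * b $ 1 * \<beta>"
  \<comment> \<open>These vectors together with the fourth unit vector fill the kernel of row
    1.\<close>
  define w where "w s t = vec4 (- (x * s + y * t)) s t 0" for s t
  have Aw: "(A *v w s t) $ 1 = 0" "(A *v w s t) $ 2 = \<alpha> * s + \<beta> * t" "(A *v w s t) $ 3 = \<gamma>' * s + \<delta>' * t" for s t
    unfolding mult_vec_nth_4 w_def vec4_nth a_def[symmetric] b_def[symmetric] r_def[symmetric] axy \<alpha>_def \<beta>_def \<gamma>'_def \<delta>'_def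
    by (simp_all add: algebra_simps)
  have Fw: "cub D (w s t) = (\<alpha> * s + \<beta> * t)^3" for s t
    unfolding F[symmetric] eq F2_def Aw by simp
  have Pw: "polar D (w s t) (axis 1 1) = (\<alpha> * s + \<beta> * t) * (\<gamma> * s + \<delta> * t)" for s t
  proof -
    have "polar D (w s t) (axis 1 1) - (\<alpha> * s + \<beta> * t) * (\<gamma> * s + \<delta> * t) = 0"
    proof (rule cubic_poly_eqD(2)[where c = 0 and d = 0])
      fix u
      have "cub D (w s t + u *s axis 1 1) = F2 (A *v (w s t + u *s axis 1 1))" unfolding F[symmetric] eq ..
      also have "\<dots> = (\<alpha> * s + \<beta> * t)^3 + u * ((\<alpha> * s + \<beta> * t) * (\<gamma> * s + \<delta> * t)) +
        u^2 * (r $ 1 * a $ 1 * (\<alpha> * s + \<beta> * t) + (\<gamma>' * s + \<delta>' * t) * a $ 1 * b $ 1 + (A *v w s t) $ 4 * a $ 1 ^ 2 + 3 * (\<alpha> * s + \<beta> * t) * b $ 1 ^ 2) +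
        u^3 * (r $ 1 * a $ 1 * b $ 1 + A $ 4 $ 1 * a $ 1 ^ 2 + b $ 1 ^ 3)"
        unfolding F2_def matrix_vector_axpy vector_add_component vector_smult_component mv_axis Aw
          a_def[symmetric] b_def[symmetric] r_def[symmetric] \<gamma>_def \<delta>_def by Groebner_Basis.algebra
      finally show "0 + u * (polar D (w s t) (axis 1 1) - (\<alpha> * s + \<beta> * t) * (\<gamma> * s + \<delta> * t)) + u^2 * 0 + u^3 * 0 =
        u^2 * ((r $ 1 * a $ 1 * (\<alpha> * s + \<beta> * t) + (\<gamma>' * s + \<delta>' * t) * a $ 1 * b $ 1 + (A *v w s t) $ 4 * a $ 1 ^ 2 +
          3 * (\<alpha> * s + \<beta> * t) * b $ 1 ^ 2) - polar D (axis 1 1) (w s t)) +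
        u^3 * ((r $ 1 * a $ 1 * b $ 1 + A $ 4 $ 1 * a $ 1 ^ 2 + b $ 1 ^ 3) - cub D (axis 1 1))"
        unfolding cub_line Fw by Groebner_Basis.algebra
    qed
    then show ?thesis by simp
  qed
  have three: "(3 :: 'k alg_closure) = 1"
  proof -
    have "(3 :: 'k alg_closure) = 2 + 1" by simp
    then show ?thesis using two by simp
  qed
  have s: "- (x * s + y * t) = x * s + y * t" for s t by (rule char_2_minus[OF two])
  have s2: "(x * s + y * t)^2 = x^2 * s^2 + y^2 * t^2" for s t
    by (simp add: char_2_square_add[OF two] power_mult_distrib)
  \<comment> \<open>As even powers of \<open>x s + y t\<close> have rational coefficients, the
    restricted cubic is \<open>(x s + y t) G + H\<close> with \<open>G\<close> and \<open>H\<close>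
    rational, while by \<open>Fw\<close> it is a cube.\<close>
  define g0 g1 g2 where "g0 = D 1 1 1 * x^2 + D 1 2 2" and "g1 = D 1 2 3" and "g2 = D 1 1 1 * y^2 + D 1 3 3"
  define h0 h1 h2 h3 where "h0 = x^2 * D 1 1 2 + D 2 2 2" and "h1 = x^2 * D 1 1 3 + D 2 2 3"
    and "h2 = y^2 * D 1 1 2 + D 2 3 3" and "h3 = y^2 * D 1 1 3 + D 3 3 3"
  have "(g0 - \<alpha> * \<gamma>) * s^2 + (g1 - (\<alpha> * \<delta> + \<beta> * \<gamma>)) * s * t + (g2 - \<beta> * \<delta>) * t^2 = 0" for s t
  proof -
    have "polar D (w s t) (axis 1 1) = D 1 1 1 * (x^2 * s^2 + y^2 * t^2) + D 1 2 2 * s^2 + D 1 2 3 * s * t + D 1 3 3 * t^2"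
      unfolding polar_def w_def vec4_nth s s2 three two by (simp add: axis_def)
    with Pw[of s t] show ?thesis unfolding g0_def g1_def g2_def by Groebner_Basis.algebra
  qed
  note g = binary_quadratic_0[OF this]
  have "(g0 * x + h0 - \<alpha>^3) * s^3 + (g0 * y + g1 * x + h1 - 3 * \<alpha>^2 * \<beta>) * s^2 * t +
    (g1 * y + g2 * x + h2 - 3 * \<alpha> * \<beta>^2) * s * t^2 + (g2 * y + h3 - \<beta>^3) * t^3 = 0" for s t
  proof -
    have "cub D (w s t) = (x * s + y * t) * (D 1 1 1 * (x * s + y * t)^2 + D 1 2 2 * s^2 + D 1 2 3 * s * t + D 1 3 3 * t^2) +
      (x * s + y * t)^2 * (D 1 1 2 * s + D 1 1 3 * t) + D 2 2 2 * s^3 + D 2 2 3 * s^2 * t + D 2 3 3 * s * t^2 + D 3 3 3 * t^3"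
      unfolding cub_def w_def vec4_nth s by (simp add: algebra_simps power2_eq_square power3_eq_cube)
    with Fw[of s t] show ?thesis
      unfolding s2 g0_def g1_def g2_def h0_def h1_def h2_def h3_def by Groebner_Basis.algebra
  qed
  note c = cubic_coeffs_0[OF this]
  have cusp: "g0 * x + h0 = \<alpha>^3" "g0 * y + g1 * x + h1 = \<alpha>^2 * \<beta>" "g1 * y + g2 * x + h2 = \<alpha> * \<beta>^2" "g2 * y + h3 = \<beta>^3"
    using c three by simp_all
  have g': "g0 = \<alpha> * \<gamma>" "g1 = \<alpha> * \<delta> + \<beta> * \<gamma>" "g2 = \<beta> * \<delta>" using g by simp_all
  have rg: "rat g0" "rat g1" "rat g2" and rh: "rat h0" "rat h1" "rat h2" "rat h3"
    unfolding g0_def g1_def g2_def h0_def h1_def h2_def h3_def by (intro rat_add rat_mult rD sq)+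
  \<comment> \<open>In characteristic 2, \<open>g1\<close> is \<open>a $ 1\<close> times the
    determinant of rows 2 and 3 on the parameters of \<open>w\<close>. If it vanished,
    \<open>A\<close> would have a nonzero kernel vector.\<close>
  have g1: "g1 \<noteq> 0"
  proof
    assume "g1 = 0"
    have "\<alpha> * \<delta> + \<beta> * \<gamma> = a $ 1 * (\<alpha> * \<delta>' - \<beta> * \<gamma>') + 2 * (\<beta> * (a $ 1 * \<gamma>' + 3 * b $ 1 * \<alpha>))"
      unfolding \<gamma>_def \<delta>_def by Groebner_Basis.algebra
    with g'(2) two \<open>g1 = 0\<close> have "a $ 1 * (\<alpha> * \<delta>' - \<beta> * \<gamma>') = 0" by simp
    then have det0: "\<alpha> * \<delta>' = \<beta> * \<gamma>'" using a1' by simp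
    obtain s t where st: "(s, t) \<noteq> (0, 0)" "\<alpha> * s + \<beta> * t = 0" "\<gamma>' * s + \<delta>' * t = 0"
    proof (cases "\<alpha> = 0 \<and> \<beta> = 0")
      case True
      show ?thesis
      proof (cases "\<gamma>' = 0 \<and> \<delta>' = 0")
        case z: True
        with True that[of 1 0] show ?thesis by simp
      next
        case False
        with True that[of \<delta>' "- \<gamma>'"] show ?thesis by auto
      qed
    next
      case False
      with det0 that[of \<beta> "- \<alpha>"] show ?thesis by (auto simp: algebra_simps)
    qed
    define z where "z = w s t + (- (A *v w s t) $ 4 / \<rho>) *s vec4 0 0 0 1"
    have "A *v z = 0"
      unfolding z_def matrix_vector_axpy using st col4 \<rho>
      by (simp add: vec4_eq_iff Aw mult_vec_nth_4[of A "vec4 0 0 0 1"] \<rho>_def)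
    then have "z = 0" using A unfolding invertible_iff_ker by blast
    then show False using st(1) by (auto simp: z_def w_def vec4_eq_iff)
  qed
  have "rat x \<and> rat y"
  proof (cases "\<alpha> = 0")
    case False
    from char_2_cusp_system[OF two rg rh(1,2,3) sq cusp(1,2,3) g' g1 False] show ?thesis by blast
  next
    \<comment> \<open>The system is symmetric under exchanging \<open>s\<close> and
      \<open>t\<close>, so it can be solved from the other end; \<open>\<beta>\<close> cannot vanish
      as well.\<close>
    case True
    with g'(2) g1 have "\<beta> \<noteq> 0" by auto
    have "g2 * y + h3 = \<beta>^3" "g2 * x + g1 * y + h2 = \<beta>^2 * \<alpha>" "g1 * x + g0 * y + h1 = \<beta> * \<alpha>^2"
      "g2 = \<beta> * \<delta>" "g1 = \<beta> * \<gamma> + \<alpha> * \<delta>" "g0 = \<alpha> * \<gamma>"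
      using cusp g' by (simp_all add: algebra_simps)
    from char_2_cusp_system[OF two rg(3,2,1) rh(4,3,2) sq(2,1) this g1 \<open>\<beta> \<noteq> 0\<close>] show ?thesis by blast
  qed
  then show "rat (A $ 1 $ 2 / A $ 1 $ 1)" "rat (A $ 1 $ 3 / A $ 1 $ 1)" by (simp_all add: x_def y_def a_def)
qed

lemma tri_F2_char_2:
  assumes two: "(2 :: 'a::field) = 0" shows "tri F2 x y (z :: 'a ^ 4) = perm3 x y z 1 2 3"
proof -
  have "tri F2 x y z = perm3 x y z 1 2 3 + 2 * (x$4 * y$1 * z$1 + y$4 * x$1 * z$1 + z$4 * x$1 * y$1 + 3 * x$2 * y$2 * z$2)"
    unfolding tri_def F2_def perm3_def vector_add_component by Groebner_Basis.algebra
  then show ?thesis using two by simp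
qed

lemma tri_F3_char_2:
  assumes two: "(2 :: 'a::field) = 0" shows "tri F3 x y (z :: 'a ^ 4) = perm3 x y z 1 2 4"
proof -
  have "tri F3 x y z = perm3 x y z 1 2 4 + 2 * (x$3 * y$1 * z$1 + y$3 * x$1 * z$1 + z$3 * x$1 * y$1 +
    x$4 * y$2 * z$2 + y$4 * x$2 * z$2 + z$4 * x$2 * y$2)"
    unfolding tri_def F3_def perm3_def vector_add_component by Groebner_Basis.algebra
  then show ?thesis using two by simp
qed

text \<open>A rational change of coordinates makes the kernel vector the fourth unit vector and puts
  a nonzero entry of row 1 into the first place, as required by
  \<open>twist_F2_char_2_aux\<close>.\<close>

lemma twist_F2_char_2:
  fixes f :: "(4, 'k::field) mpoly"
  assumes two: "(2 :: 'k alg_closure) = 0" and hom: "homogeneous_poly 3 f"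
    and A: "invertible A" and eq: "\<And>x. eval_poly (ac_poly f) x = F2 (A *v x)"
  shows "lin_equiv std2 f"
proof -
  obtain v where v: "ratv v" "v \<noteq> 0" "(A *v v) $ 1 = 0" "(A *v v) $ 2 = 0" "(A *v v) $ 3 = 0"
    by (rule char_2_kernel[OF two hom A eq tri_F2_char_2[OF two]]) simp_all
  obtain v' where v': "v = ac_vec v'" using v(1) by (rule ratvE)
  obtain i where i: "A $ 1 $ i \<noteq> 0" using invertible_row_nonzero[OF A, of 1] by (auto simp: vec_eq_iff)
  have ind: "p = 0 \<and> q = 0" if pq: "p *s axis i 1 + q *s v' = 0" for p q
  proof -
    have "ac_vec (p *s axis i 1 + q *s v') = to_ac p *s axis i 1 + to_ac q *s v"
      by (simp add: v' vec_eq_iff axis_def)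
    then have z: "to_ac p *s axis i 1 + to_ac q *s v = 0" unfolding pq by (simp add: vec_eq_iff)
    have "(A *v (to_ac p *s axis i 1 + to_ac q *s v)) $ 1 = 0" unfolding z by simp
    then have "to_ac p * A $ 1 $ i = 0"
      by (simp add: matrix_vector_right_distrib vector_scalar_commute mv_axis v(3))
    with i have "p = 0" by simp
    moreover from this z v(2) have "q = 0" by auto
    ultimately show ?thesis ..
  qed
  obtain w z where "invertible (cols4 w z (axis i 1) v')" by (rule ex_invertible_2[OF ind])
  then have P: "invertible (cols4 (axis i 1) w z v')" (is "invertible ?P")
    unfolding invertible_iff_ker
  proof (intro allI impI)
    fix x :: "'k ^ 4"
    assume inv: "\<forall>x. cols4 w z (axis i 1) v' *v x = 0 \<longrightarrow> x = 0" and x: "?P *v x = 0"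
    have "?P *v x = cols4 w z (axis i 1) v' *v vec4 (x$2) (x$3) (x$1) (x$4)"
      by (simp add: cols4_mult add_ac)
    with x inv have "vec4 (x$2) (x$3) (x$1) (x$4) = 0" by simp
    then show "x = 0" by (simp add: vec4_eq_iff)
  qed
  define f' where "f' = lin_subst ?P f"
  define A' where "A' = A ** ac_mat ?P"
  have ff': "lin_equiv f f'"
    unfolding lin_equiv_def f'_def
    by (rule exI[of _ ?P], rule exI[of _ 1]) (use P in \<open>simp add: const_poly_def\<close>)
  have A'inv: "invertible A'" unfolding A'_def by (intro invertible_mult A invertible_ac_mat P)
  have eq': "eval_poly (ac_poly f') x = F2 (A' *v x)" for x
    unfolding f'_def A'_def matrix_vector_mul_assoc[symmetric] by (simp add: ac_poly_lin_subst eq)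
  have hom': "homogeneous_poly 3 f'" unfolding f'_def by (rule homogeneous_lin_subst[OF hom])
  have ac_axis: "ac_vec (axis j 1) = axis j 1" for j :: 4 by (simp add: vec_eq_iff axis_def)
  have cols: "?P *v axis 1 1 = axis i 1" "?P *v axis 4 1 = v'" by (simp_all add: cols4_mult axis_def)
  have col: "A' $ m $ j = (A *v ac_vec (?P *v axis j 1)) $ m" for m j
  proof -
    have "A' $ m $ j = (A' *v axis j 1) $ m" by (rule mv_axis[symmetric])
    also have "\<dots> = (A *v (ac_mat ?P *v ac_vec (axis j 1))) $ m"
      unfolding A'_def ac_axis by (simp add: matrix_vector_mul_assoc)
    finally show ?thesis unfolding ac_mat_mv .
  qed
  have A'14: "A' $ 1 $ 4 = 0" "A' $ 2 $ 4 = 0" "A' $ 3 $ 4 = 0"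
    unfolding col cols v'[symmetric] by (fact v)+
  have A'11: "A' $ 1 $ 1 \<noteq> 0" unfolding col cols ac_axis mv_axis by (rule i)
  note r = twist_F2_char_2_aux[OF two hom' A'inv eq' A'14 A'11]
  have "rat (A' $ 1 $ j / A' $ 1 $ 1)" for j
    using exhaust_4[of j] r A'14 A'11 by auto
  from twist_F2_proportional[OF A'inv eq' A'11 this] have "lin_equiv std2 f'" .
  then show ?thesis using lin_equiv_trans lin_equiv_sym[OF ff'] by blast
qed

lemma homogeneous_of_std_form:
  fixes s f :: "(4, 'k::field) mpoly"
  assumes "s \<in> {std1, std2, std3}" "lin_equiv (ac_poly s) (ac_poly f)" shows "homogeneous_poly 3 f"
  using std_ruled_cubic_noncone[OF assms] by (simp add: ruled_cubic_noncone_def cubic_surface_def)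

theorem no_twist_std2:
  fixes f :: "(4, 'k::field) mpoly"
  assumes "lin_equiv (ac_poly std2) (ac_poly f)" shows "lin_equiv std2 f"
proof -
  have "feq F2 (eval_poly (ac_poly f))" using assms by (simp add: lin_equiv_iff_feq eval_std_fun)
  then obtain A where A: "invertible A" "\<forall>x. eval_poly (ac_poly f) x = F2 (A *v x)" by (rule feq_F2_absorb)
  have hom: "homogeneous_poly 3 f" by (rule homogeneous_of_std_form[OF _ assms]) simp
  show ?thesis
    using twist_F2_char_2[OF _ hom A(1) A(2)[rule_format]] twist_F2_char_not_2[OF A(1) A(2)[rule_format]] by blast
qed

section \<open>Perfect ground fields of characteristic 2\<close>

lemma perfect_rat_sqrt:
  assumes "\<forall>x :: 'k::field. is_square x" "rat (x :: 'k alg_closure)"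
  shows "\<exists>y. rat y \<and> y^2 = x"
proof -
  obtain u where u: "x = to_ac u" using assms(2) by (rule ratE)
  obtain v where "u = v^2" using assms(1) by (auto simp: is_nth_power_def)
  then show ?thesis using u by (intro exI[of _ "to_ac v"]) simp
qed

lemma char_2_square_eqD:
  assumes two: "(2 :: 'a::field) = 0" and eq: "x^2 = (y :: 'a)^2" shows "x = y"
proof -
  have "(x + - y)^2 = 0" unfolding char_2_square_add[OF two] char_2_minus[OF two] eq
    using two by (simp flip: mult_2)
  then show ?thesis by simp
qed

text \<open>Square roots are unique in characteristic 2, so the root of \<open>x^2\<close> found in
  \<open>K\<close> is \<open>x\<close> itself.\<close>

lemma perfect_char_2_rat_square:
  assumes "\<forall>x :: 'k::field. is_square x" "(2 :: 'k alg_closure) = 0" "rat (x^2)"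
  shows "rat (x :: 'k alg_closure)"
  using perfect_rat_sqrt[OF assms(1,3)] char_2_square_eqD[OF assms(2)] by metis

text \<open>The rational numbers \<open>\<Lambda> j i\<close> are the coefficients of the cubic at \<open>x\<^sub>j\<^sup>2 x\<^sub>i\<close>;
  the rows 3 and 4 of \<open>A\<close>, brought to echelon form, are quotients of minors of \<open>\<Lambda>\<close>.\<close>

lemma twist_F1_char_2:
  fixes f :: "(4, 'k::field) mpoly"
  assumes two: "(2 :: 'k alg_closure) = 0" and perfect: "\<forall>x :: 'k. is_square x"
    and A: "invertible A" and eq: "\<And>x. eval_poly (ac_poly f) x = F1 (A *v x)"
  shows "lin_equiv std1 f"
proof -
  define a b r s where "a = A $ 1" and "b = A $ 2" and "r = A $ 3" and "s = A $ 4"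
  define \<Lambda> where "\<Lambda> j i = a $ j ^ 2 * r $ i + b $ j ^ 2 * s $ i" for j i
  have r\<Lambda>: "rat (\<Lambda> j i)" for i j
  proof -
    have "eval_poly (ac_poly f) (axis j 1 + t *s axis i 1) = \<Lambda> j j + t * \<Lambda> j i + t^2 * \<Lambda> i j + t^3 * \<Lambda> i i" for t
    proof -
      have "eval_poly (ac_poly f) (axis j 1 + t *s axis i 1) = \<Lambda> j j + t * \<Lambda> j i + t^2 * \<Lambda> i j + t^3 * \<Lambda> i i +
        2 * (t * a $ j * a $ i * (r $ j + t * r $ i) + t * b $ j * b $ i * (s $ j + t * s $ i))"
        unfolding eq F1_def matrix_vector_axpy vector_add_component vector_smult_component mv_axis
          a_def[symmetric] b_def[symmetric] r_def[symmetric] s_def[symmetric] \<Lambda>_def by Groebner_Basis.algebra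
      then show ?thesis using two by simp
    qed
    from rat_line(2)[OF _ _ this] show ?thesis by simp
  qed
  obtain k l where kl: "r $ k * s $ l - r $ l * s $ k \<noteq> 0"
    using invertible_minor_nonzero[OF A, of 3 4] unfolding r_def s_def by auto
  obtain m n where mn: "a $ m * b $ n - a $ n * b $ m \<noteq> 0"
    using invertible_minor_nonzero[OF A, of 1 2] unfolding a_def b_def by auto
  define \<delta> where "\<delta> = r $ k * s $ l - r $ l * s $ k"
  define \<rho> \<sigma> where "\<rho> = (\<chi> i. (r $ i * s $ l - r $ l * s $ i) / \<delta>)" and "\<sigma> = (\<chi> i. (r $ k * s $ i - r $ i * s $ k) / \<delta>)"
  define \<mu> where "\<mu> = a $ m ^ 2 * b $ n ^ 2 - a $ n ^ 2 * b $ m ^ 2"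
  have "\<mu> = (a $ m * b $ n - a $ n * b $ m)^2 + 2 * (a $ n * b $ m * (a $ m * b $ n - a $ n * b $ m))"
    unfolding \<mu>_def by Groebner_Basis.algebra
  with two mn have \<mu>: "\<mu> \<noteq> 0" by simp
  have \<delta>: "\<delta> \<noteq> 0" using kl by (simp add: \<delta>_def)
  have minor: "\<Lambda> m i * \<Lambda> n j - \<Lambda> n i * \<Lambda> m j = \<mu> * (r $ i * s $ j - r $ j * s $ i)" for i j
    unfolding \<Lambda>_def \<mu>_def by Groebner_Basis.algebra
  have quot: "rat ((r $ i * s $ j - r $ j * s $ i) / \<delta>)" for i j
  proof -
    have "(r $ i * s $ j - r $ j * s $ i) / \<delta> = (\<Lambda> m i * \<Lambda> n j - \<Lambda> n i * \<Lambda> m j) / (\<Lambda> m k * \<Lambda> n l - \<Lambda> n k * \<Lambda> m l)"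
      unfolding minor \<delta>_def using \<mu> by simp
    also have "rat \<dots>" by (intro rat_divide rat_diff rat_mult r\<Lambda>)
    finally show ?thesis .
  qed
  \<comment> \<open>Here perfectness enters. In characteristic 2 the quadratic form
    \<open>r_k (row 1)^2 + s_k (row 2)^2\<close> is diagonal with rational coefficients
    \<open>\<Lambda> j k\<close>, so it is the square of a linear form over
    \<open>K\<close>.\<close>
  have "\<forall>j. \<exists>y. rat y \<and> y^2 = \<Lambda> j i" for i using perfect_rat_sqrt[OF perfect r\<Lambda>] by blast
  then obtain \<alpha> \<beta> where \<alpha>: "\<And>j. rat (\<alpha> j)" "\<And>j. \<alpha> j ^ 2 = \<Lambda> j k" and \<beta>: "\<And>j. rat (\<beta> j)" "\<And>j. \<beta> j ^ 2 = \<Lambda> j l"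
    by metis
  have rs: "r $ i = r $ k * \<rho> $ i + r $ l * \<sigma> $ i" "s $ i = s $ k * \<rho> $ i + s $ l * \<sigma> $ i" for i
  proof -
    have "\<delta> * \<rho> $ i = r $ i * s $ l - r $ l * s $ i" "\<delta> * \<sigma> $ i = r $ k * s $ i - r $ i * s $ k"
      using \<delta> by (simp_all add: \<rho>_def \<sigma>_def)
    then have "\<delta> * r $ i = \<delta> * (r $ k * \<rho> $ i + r $ l * \<sigma> $ i)" "\<delta> * s $ i = \<delta> * (s $ k * \<rho> $ i + s $ l * \<sigma> $ i)"
      unfolding \<delta>_def by Groebner_Basis.algebra+
    then show "r $ i = r $ k * \<rho> $ i + r $ l * \<sigma> $ i" "s $ i = s $ k * \<rho> $ i + s $ l * \<sigma> $ i" using \<delta> by simp_all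
  qed
  \<comment> \<open>Rows 3 and 4 of \<open>A\<close> are combinations of \<open>\<rho>\<close> and
    \<open>\<sigma>\<close> with constant coefficients. Collecting \<open>F1\<close> by
    \<open>\<rho>\<close> and \<open>\<sigma>\<close> turns their cofactors into the squares of the
    rows formed by \<open>\<alpha>\<close> and \<open>\<beta>\<close>.\<close>
  define Q where "Q = vec4 (\<chi> j. \<alpha> j) (\<chi> j. \<beta> j) \<rho> \<sigma>"
  have sq4: "(c1 * x1 + c2 * x2 + c3 * x3 + c4 * x4)^2 = c1^2 * x1^2 + c2^2 * x2^2 + c3^2 * x3^2 + c4^2 * x4^2"
    for c1 c2 c3 c4 x1 x2 x3 x4 :: "'k alg_closure"
    by (simp add: char_2_square_add[OF two] power_mult_distrib)
  show ?thesis
  proof (rule lin_equivI_rat[where Q = Q and k = 1])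
    show "ratv (Q $ i)" for i
      using exhaust_4[of i] \<alpha> \<beta> quot by (auto simp: Q_def ratv_def \<rho>_def \<sigma>_def)
    show "\<not> degenerate (eval_poly (ac_poly f))"
      by (rule not_degenerate_comp[OF A eq not_degenerate_std(1)])
    fix x
    have "(Q *v x) $ 1 ^ 2 = r $ k * (A *v x) $ 1 ^ 2 + s $ k * (A *v x) $ 2 ^ 2"
      "(Q *v x) $ 2 ^ 2 = r $ l * (A *v x) $ 1 ^ 2 + s $ l * (A *v x) $ 2 ^ 2"
      unfolding mult_vec_nth_4 Q_def vec4_nth vec_lambda_beta sq4 \<alpha> \<beta> \<Lambda>_def a_def[symmetric] b_def[symmetric]
      by Groebner_Basis.algebra+
    moreover have "(A *v x) $ 3 = r $ k * (Q *v x) $ 3 + r $ l * (Q *v x) $ 4"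
    proof -
      have "(A *v x) $ 3 = r $ 1 * x $ 1 + r $ 2 * x $ 2 + r $ 3 * x $ 3 + r $ 4 * x $ 4" by (simp add: mult_vec_nth_4 r_def)
      also have "\<dots> = (r $ k * \<rho> $ 1 + r $ l * \<sigma> $ 1) * x $ 1 + (r $ k * \<rho> $ 2 + r $ l * \<sigma> $ 2) * x $ 2 +
        (r $ k * \<rho> $ 3 + r $ l * \<sigma> $ 3) * x $ 3 + (r $ k * \<rho> $ 4 + r $ l * \<sigma> $ 4) * x $ 4"
        by (simp only: rs(1)[symmetric])
      also have "\<dots> = r $ k * (Q *v x) $ 3 + r $ l * (Q *v x) $ 4"
        unfolding mult_vec_nth_4 Q_def vec4_nth by Groebner_Basis.algebra
      finally show ?thesis .
    qed
    moreover have "(A *v x) $ 4 = s $ k * (Q *v x) $ 3 + s $ l * (Q *v x) $ 4"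
    proof -
      have "(A *v x) $ 4 = s $ 1 * x $ 1 + s $ 2 * x $ 2 + s $ 3 * x $ 3 + s $ 4 * x $ 4" by (simp add: mult_vec_nth_4 s_def)
      also have "\<dots> = (s $ k * \<rho> $ 1 + s $ l * \<sigma> $ 1) * x $ 1 + (s $ k * \<rho> $ 2 + s $ l * \<sigma> $ 2) * x $ 2 +
        (s $ k * \<rho> $ 3 + s $ l * \<sigma> $ 3) * x $ 3 + (s $ k * \<rho> $ 4 + s $ l * \<sigma> $ 4) * x $ 4"
        by (simp only: rs(2)[symmetric])
      also have "\<dots> = s $ k * (Q *v x) $ 3 + s $ l * (Q *v x) $ 4"
        unfolding mult_vec_nth_4 Q_def vec4_nth by Groebner_Basis.algebra
      finally show ?thesis .
    qed
    ultimately have "F1 (A *v x) = F1 (Q *v x)" unfolding F1_def by Groebner_Basis.algebra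
    then show "eval_poly (ac_poly f) x = 1 * eval_poly (ac_poly std1) (Q *v x)" by (simp add: eq)
  qed simp_all
qed

text \<open>In characteristic 2 the mixed term of the square of row 2 disappears, and the cubic
  becomes \<open>t1^2 W + n (t2^2 + \<theta> t1 t2)\<close>. Its coefficients at t1 t2 t3 and t1 t2
  t4 are \<open>\<theta>\<close> times entries of \<open>n\<close>. One of these entries is nonzero,
  so \<open>\<theta>\<close> is rational, and then so are \<open>n\<close> and
  \<open>W\<close>.\<close>

lemma twist_F3_normal:
  fixes f :: "(4, 'k::field) mpoly" and A :: "'k alg_closure ^ 4 ^ 4"
  assumes two: "(2 :: 'k alg_closure) = 0" and A: "invertible A" and eq: "\<And>x. eval_poly (ac_poly f) x = F3 (A *v x)"
    and A1: "A $ 1 = vec4 c1 0 0 0" and A2: "A $ 2 = vec4 b1 b2 0 0"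
  shows "lin_equiv std3 f"
proof -
  have c1: "c1 \<noteq> 0" using invertible_row_nonzero[OF A, of 1] A1 by (auto simp: vec4_eq_iff)
  have b2: "b2 \<noteq> 0"
  proof
    assume "b2 = 0"
    then have "(- b1) *s A $ 1 + c1 *s A $ 2 = 0" by (simp add: A1 A2 vec4_eq_iff)
    with rows_independent(2)[OF A _ this] c1 show False by simp
  qed
  define r s where "r = A $ 3" and "s = A $ 4"
  define \<theta> where "\<theta> = c1 / b2"
  define n W where "n = (\<chi> i. b2^2 * s $ i)" and "W = (\<chi> i. c1^2 * r $ i + (b1^2 + c1 * b1) * s $ i)"
  have c1\<theta>: "c1 = \<theta> * b2" and \<theta>: "\<theta> \<noteq> 0" using b2 c1 by (simp_all add: \<theta>_def)
  have F: "eval_poly (ac_poly f) x = x$1^2 * (W$1 * x$1 + W$2 * x$2 + W$3 * x$3 + W$4 * x$4) +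
    (n$1 * x$1 + n$2 * x$2 + n$3 * x$3 + n$4 * x$4) * (x$2^2 + \<theta> * x$1 * x$2)" for x
  proof -
    have "eval_poly (ac_poly f) x = x$1^2 * (W$1 * x$1 + W$2 * x$2 + W$3 * x$3 + W$4 * x$4) +
      (n$1 * x$1 + n$2 * x$2 + n$3 * x$3 + n$4 * x$4) * (x$2^2 + \<theta> * x$1 * x$2) +
      2 * (b1 * b2 * x$1 * x$2 * (s$1 * x$1 + s$2 * x$2 + s$3 * x$3 + s$4 * x$4))"
      unfolding eq F3_def mult_vec_nth_4 A1 A2 r_def[symmetric] s_def[symmetric] vec4_nth n_def W_def vec_lambda_beta c1\<theta>
      by Groebner_Basis.algebra
    then show ?thesis using two by simp
  qed
  note line = rat_line[where f = f, unfolded F]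
  have 1: "rat (n$2)" "rat (n$3)"
    using line(1,2)[of "vec4 0 1 0 0" "vec4 0 0 1 0" "n$2" "n$3" 0 0] by (simp_all add: algebra_simps)
  have 2: "rat (n$4)"
    using line(2)[of "vec4 0 1 0 0" "vec4 0 0 0 1" "n$2" "n$4" 0 0] by (simp add: algebra_simps)
  have 3: "rat (W$1)" "rat (W$2 + \<theta> * n$1)" "rat (n$1 + \<theta> * n$2)"
    using line(1,2,3)[of "vec4 1 0 0 0" "vec4 0 1 0 0" "W$1" "W$2 + \<theta> * n$1" "n$1 + \<theta> * n$2" "n$2"]
    by (simp_all add: algebra_simps power2_eq_square power3_eq_cube)
  have 4: "rat (W$3)"
    using line(2)[of "vec4 1 0 0 0" "vec4 0 0 1 0" "W$1" "W$3" 0 0] by (simp add: algebra_simps)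
  have 5: "rat (W$4)"
    using line(2)[of "vec4 1 0 0 0" "vec4 0 0 0 1" "W$1" "W$4" 0 0] by (simp add: algebra_simps)
  have 6: "rat (W$3 + n$3 * (1 + \<theta>))"
    using line(2)[of "vec4 1 1 0 0" "vec4 0 0 1 0" "W$1 + W$2 + (n$1 + n$2) * (1 + \<theta>)" "W$3 + n$3 * (1 + \<theta>)" 0 0]
    by (simp add: algebra_simps)
  have 7: "rat (W$4 + n$4 * (1 + \<theta>))"
    using line(2)[of "vec4 1 1 0 0" "vec4 0 0 0 1" "W$1 + W$2 + (n$1 + n$2) * (1 + \<theta>)" "W$4 + n$4 * (1 + \<theta>)" 0 0]
    by (simp add: algebra_simps)
  \<comment> \<open>Otherwise, of the four rows of \<open>A\<close> only row 3 would be nonzero on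
    the span of the last two unit vectors, so \<open>A\<close> would have a nontrivial kernel
    there.\<close>
  have nz: "n$3 \<noteq> 0 \<or> n$4 \<noteq> 0"
  proof (rule ccontr)
    assume "\<not> (n$3 \<noteq> 0 \<or> n$4 \<noteq> 0)"
    then have s0: "s$3 = 0" "s$4 = 0" using b2 by (simp_all add: n_def)
    have "A *v vec4 0 0 x y = vec4 0 0 (r$3 * x + r$4 * y) 0" for x y
      using s0 by (simp add: vec4_eq_iff mult_vec_nth_4 A1 A2 r_def s_def)
    then have "A *v vec4 0 0 (r$4) (- r$3) = 0" "r$3 = 0 \<Longrightarrow> A *v vec4 0 0 1 0 = 0" by (simp_all add: vec4_eq_iff)
    then have "vec4 0 0 (r$4) (- r$3) = 0" "r$3 = 0 \<Longrightarrow> vec4 0 0 1 0 = (0 :: 'k alg_closure ^ 4)"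
      using A unfolding invertible_iff_ker by blast+
    then show False by (simp add: vec4_eq_iff)
  qed
  have "rat (n$3 * \<theta>)" using rat_diff[OF rat_diff[OF 6 4] 1(2)] by (simp add: algebra_simps)
  moreover have "rat (n$4 * \<theta>)" using rat_diff[OF rat_diff[OF 7 5] 2] by (simp add: algebra_simps)
  ultimately have r\<theta>: "rat \<theta>" using nz 1(2) 2 rat_cancel_left by blast
  have n1: "rat (n$1)" using rat_diff[OF 3(3) rat_mult[OF r\<theta> 1(1)]] by simp
  have W2: "rat (W$2)" using rat_diff[OF 3(2) rat_mult[OF r\<theta> n1]] by simp
  show ?thesis
  proof (rule lin_equivI_rat[where k = 1 and
      Q = "vec4 (vec4 \<theta> 0 0 0) (vec4 0 1 0 0) (\<chi> i. W $ i / \<theta>^2) n"])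
    show "ratv (vec4 (vec4 \<theta> 0 0 0) (vec4 0 1 0 0) (\<chi> i. W $ i / \<theta>^2) n $ i)" for i
    proof -
      have "rat (n $ j)" "rat (W $ j)" for j
        using exhaust_4[of j] 1 2 3(1) 4 5 n1 W2 by auto
      moreover from this have "rat (W $ j / \<theta>^2)" for j by (intro rat_divide rat_power r\<theta>)
      ultimately show ?thesis
        using exhaust_4[of i] r\<theta> by (auto simp: ratv_def[of n] ratv_def[of "\<chi> i. W $ i / \<theta>^2"])
    qed
    show "\<not> degenerate (eval_poly (ac_poly f))"
      by (rule not_degenerate_comp[OF A eq not_degenerate_std(3)])
    show "eval_poly (ac_poly f) x = 1 * eval_poly (ac_poly std3)
        (vec4 (vec4 \<theta> 0 0 0) (vec4 0 1 0 0) (\<chi> i. W $ i / \<theta>^2) n *v x)" for x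
    proof -
      define u where "u = W$1 / \<theta>^2 * x$1 + W$2 / \<theta>^2 * x$2 + W$3 / \<theta>^2 * x$3 + W$4 / \<theta>^2 * x$4"
      have "\<theta>^2 * u = W$1 * x$1 + W$2 * x$2 + W$3 * x$3 + W$4 * x$4"
        using \<theta> by (simp add: u_def distrib_left)
      then show ?thesis
        unfolding F ac_std eval_std F3_def mult_vec_nth_4 vec4_nth vec_lambda_beta u_def[symmetric]
        by Groebner_Basis.algebra
    qed
  qed simp_all
qed

text \<open>On the plane t1 = 0 the cubic is row 4 times the square of row 2. So the squares of the
  entries of row 2 become rational when multiplied by a nonzero entry \<open>s $ j\<close>. By
  perfectness row 2 modulo t1 is rational up to the factor \<open>\<theta>\<close>, a square root of
  \<open>s $ j\<close>.\<close>

lemma twist_F3_row1: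
  fixes f :: "(4, 'k::field) mpoly" and A :: "'k alg_closure ^ 4 ^ 4"
  assumes two: "(2 :: 'k alg_closure) = 0" and perfect: "\<forall>x :: 'k. is_square x"
    and A: "invertible A" and eq: "\<And>x. eval_poly (ac_poly f) x = F3 (A *v x)"
    and A1: "A $ 1 = vec4 c1 0 0 0"
  shows "lin_equiv std3 f"
proof -
  have c1: "c1 \<noteq> 0" using invertible_row_nonzero[OF A, of 1] A1 by (auto simp: vec4_eq_iff)
  define b s where "b = A $ 2" and "s = A $ 4"
  have indep: "A $ i $ 2 \<noteq> 0 \<or> A $ i $ 3 \<noteq> 0 \<or> A $ i $ 4 \<noteq> 0" if "i \<noteq> 1" for i
  proof (rule ccontr)
    assume "\<not> ?thesis"
    then have "(- A $ i $ 1) *s A $ 1 + c1 *s A $ i = 0" by (simp add: A1 vec4_eq_iff)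
    with rows_independent(2)[OF A _ this] c1 that show False by simp
  qed
  have "(2 :: 4) \<noteq> 1" "(3 :: 4) \<noteq> 1" "(4 :: 4) \<noteq> 1" by simp_all
  then obtain j where j: "j \<noteq> 1" "s $ j \<noteq> 0" using indep[of 4] unfolding s_def by blast
  obtain \<theta> where \<theta>: "\<theta>^2 = s $ j" using alg_closed_root[of 2 "s $ j"] by auto
  with j have \<theta>0: "\<theta> \<noteq> 0" by auto
  have rb: "rat (\<theta> * b $ i)" if i: "i \<noteq> 1" for i
  proof -
    have z: "A $ 1 $ i = 0" "A $ 1 $ j = 0" using i j exhaust_4[of i] exhaust_4[of j] by (auto simp: A1)
    have "eval_poly (ac_poly f) (axis i 1 + t *s axis j 1) =
      s $ i * b $ i ^ 2 + t * (s $ j * b $ i ^ 2) + t^2 * (s $ i * b $ j ^ 2) + t^3 * (s $ j * b $ j ^ 2)" for t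
    proof -
      have "eval_poly (ac_poly f) (axis i 1 + t *s axis j 1) =
        s $ i * b $ i ^ 2 + t * (s $ j * b $ i ^ 2) + t^2 * (s $ i * b $ j ^ 2) + t^3 * (s $ j * b $ j ^ 2) +
        2 * ((s $ i + t * s $ j) * b $ i * t * b $ j)"
        unfolding eq F3_def matrix_vector_axpy vector_add_component vector_smult_component mv_axis z
          b_def[symmetric] s_def[symmetric] mult_zero_right mult_zero_left add_0_right zero_power2 by Groebner_Basis.algebra
      then show ?thesis using two by simp
    qed
    from rat_line(2)[OF _ _ this] have "rat ((\<theta> * b $ i)^2)" by (simp add: power_mult_distrib \<theta>)
    then show ?thesis by (rule perfect_char_2_rat_square[OF perfect two])
  qed
  have "ratv (vec4 0 (\<theta> * b $ 2) (\<theta> * b $ 3) (\<theta> * b $ 4))" using rb by simp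
  then obtain m where m: "vec4 0 (\<theta> * b $ 2) (\<theta> * b $ 3) (\<theta> * b $ 4) = ac_vec m" by (rule ratvE)
  have ind: "p = 0 \<and> q = 0" if pq: "p *s axis 1 1 + q *s m = 0" for p q
  proof -
    have "ac_vec (p *s axis 1 1 + q *s m) = vec4 (to_ac p) 0 0 0 + to_ac q *s vec4 0 (\<theta> * b $ 2) (\<theta> * b $ 3) (\<theta> * b $ 4)"
      unfolding m by (simp add: vec4_eq_iff axis_def)
    then have z: "vec4 (to_ac p) 0 0 0 + to_ac q *s vec4 0 (\<theta> * b $ 2) (\<theta> * b $ 3) (\<theta> * b $ 4) = 0"
      unfolding pq by (simp add: vec_eq_iff)
    then show ?thesis using indep[of 2] \<theta>0 unfolding b_def by (auto simp: vec4_eq_iff)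
  qed
  obtain R :: "'k ^ 4 ^ 4" where R: "invertible R" "R $ 1 = axis 1 1" "R $ 2 = m" by (rule invertible_rows[OF ind])
  obtain f' A' where f': "lin_equiv f f'" "invertible A'" "\<forall>x. eval_poly (ac_poly f') x = F3 (A' *v x)"
    "\<forall>i k1 k2. A $ i = k1 *s ac_vec (R $ 1) + k2 *s ac_vec (R $ 2) \<longrightarrow> A' $ i = vec4 k1 k2 0 0"
    by (rule change_coords[OF A eq R(1)])
  have ax: "ac_vec (axis 1 1 :: 'k ^ 4) = vec4 1 0 0 0" by (simp add: vec4_eq_iff axis_def)
  have "A $ 1 = c1 *s ac_vec (R $ 1) + 0 *s ac_vec (R $ 2)"
    unfolding R ax m[symmetric] A1 by (simp add: vec4_eq_iff)
  then have A'1: "A' $ 1 = vec4 c1 0 0 0" using f'(4) by blast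
  have "A $ 2 = b $ 1 *s ac_vec (R $ 1) + (1 / \<theta>) *s ac_vec (R $ 2)"
    unfolding R ax m[symmetric] using \<theta>0 by (simp add: vec4_eq_iff b_def)
  then have A'2: "A' $ 2 = vec4 (b $ 1) (1 / \<theta>) 0 0" using f'(4) by blast
  from twist_F3_normal[OF two f'(2) f'(3)[rule_format] A'1 A'2] show ?thesis
    using lin_equiv_trans lin_equiv_sym[OF f'(1)] by blast
qed

text \<open>The kernel vector is mapped to a multiple of the third unit vector, and t3 occurs in
  \<open>F3\<close> with the coefficient t1^2. Hence the linear term of the cubic in the direction
  \<open>v\<close> is \<open>\<rho>\<close> times the square of row 1, and perfectness makes row 1
  rational up to a factor.\<close>

lemma twist_F3_char_2:
  fixes f :: "(4, 'k::field) mpoly" and A :: "'k alg_closure ^ 4 ^ 4"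
  assumes two: "(2 :: 'k alg_closure) = 0" and perfect: "\<forall>x :: 'k. is_square x" and hom: "homogeneous_poly 3 f"
    and A: "invertible A" and eq: "\<And>x. eval_poly (ac_poly f) x = F3 (A *v x)"
  shows "lin_equiv std3 f"
proof -
  obtain v where v: "ratv v" "v \<noteq> 0" "(A *v v) $ 1 = 0" "(A *v v) $ 2 = 0" "(A *v v) $ 4 = 0"
    by (rule char_2_kernel[OF two hom A eq tri_F3_char_2[OF two]]) simp_all
  define \<rho> where "\<rho> = (A *v v) $ 3"
  have "\<rho> \<noteq> 0"
  proof
    assume "\<rho> = 0"
    with v(3-5) have "A *v v = 0" by (simp add: vec4_eq_iff \<rho>_def)
    with A v(2) show False unfolding invertible_iff_ker by blast
  qed
  obtain \<kappa> where \<kappa>: "\<kappa>^2 = \<rho>" using alg_closed_root[of 2 \<rho>] by auto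
  with \<open>\<rho> \<noteq> 0\<close> have \<kappa>0: "\<kappa> \<noteq> 0" by auto
  have "rat (\<kappa> * A $ 1 $ j)" for j
  proof -
    have "eval_poly (ac_poly f) (axis j 1 + t *s v) = F3 (A *v axis j 1) + t * (\<rho> * A $ 1 $ j ^ 2) + t^2 * 0 + t^3 * 0" for t
      unfolding eq F3_def matrix_vector_axpy vector_add_component vector_smult_component mv_axis v \<rho>_def[symmetric]
      by Groebner_Basis.algebra
    from rat_line(2)[OF _ v(1) this] have "rat ((\<kappa> * A $ 1 $ j)^2)" by (simp add: power_mult_distrib \<kappa>)
    then show ?thesis by (rule perfect_char_2_rat_square[OF perfect two])
  qed
  then have "ratv (\<kappa> *s A $ 1)" by (simp add: ratv_def)
  then obtain m where m: "\<kappa> *s A $ 1 = ac_vec m" by (rule ratvE)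
  have "m \<noteq> 0"
  proof
    assume "m = 0"
    then have "\<kappa> *s A $ 1 = 0" unfolding m by (simp add: vec_eq_iff)
    with \<kappa>0 invertible_row_nonzero[OF A, of 1] show False by simp
  qed
  then obtain R :: "'k ^ 4 ^ 4" where R: "invertible R" "R $ 1 = m" by (rule invertible_row)
  obtain f' A' where f': "lin_equiv f f'" "invertible A'" "\<forall>x. eval_poly (ac_poly f') x = F3 (A' *v x)"
    "\<forall>i k1 k2. A $ i = k1 *s ac_vec (R $ 1) + k2 *s ac_vec (R $ 2) \<longrightarrow> A' $ i = vec4 k1 k2 0 0"
    by (rule change_coords[OF A eq R(1)])
  have "A $ 1 = (1 / \<kappa>) *s ac_vec (R $ 1) + 0 *s ac_vec (R $ 2)"
    unfolding R m[symmetric] using \<kappa>0 by (simp add: vec4_eq_iff)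
  then have "A' $ 1 = vec4 (1 / \<kappa>) 0 0 0" using f'(4) by blast
  from twist_F3_row1[OF two perfect f'(2) f'(3)[rule_format] this] show ?thesis
    using lin_equiv_trans lin_equiv_sym[OF f'(1)] by blast
qed

theorem no_twist_std1_char_2:
  fixes f :: "(4, 'k::field) mpoly"
  assumes two: "(2 :: 'k alg_closure) = 0" and perfect: "\<forall>x :: 'k. is_square x"
    and "lin_equiv (ac_poly std1) (ac_poly f)" shows "lin_equiv std1 f"
proof -
  have "feq F1 (eval_poly (ac_poly f))" using assms(3) by (simp add: lin_equiv_iff_feq eval_std_fun)
  then obtain A where A: "invertible A" "\<forall>x. eval_poly (ac_poly f) x = F1 (A *v x)" by (rule feq_F1_absorb)
  show ?thesis by (rule twist_F1_char_2[OF two perfect A(1) A(2)[rule_format]])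
qed

theorem no_twist_std3_char_2:
  fixes f :: "(4, 'k::field) mpoly"
  assumes two: "(2 :: 'k alg_closure) = 0" and perfect: "\<forall>x :: 'k. is_square x"
    and "lin_equiv (ac_poly std3) (ac_poly f)" shows "lin_equiv std3 f"
proof -
  have "feq F3 (eval_poly (ac_poly f))" using assms(3) by (simp add: lin_equiv_iff_feq eval_std_fun)
  then obtain A where A: "invertible A" "\<forall>x. eval_poly (ac_poly f) x = F3 (A *v x)" by (rule feq_F3_absorb)
  have hom: "homogeneous_poly 3 f" by (rule homogeneous_of_std_form[OF _ assms(3)]) simp
  show ?thesis by (rule twist_F3_char_2[OF two perfect hom A(1) A(2)[rule_format]])
qed

section \<open>Characteristic different from 2\<close>

text \<open>For the conjugate rows \<open>t2 + d t1\<close> and \<open>t2 - d t1\<close>, expanding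
  the squares leaves \<open>r + s\<close> as the cofactor of \<open>a t1^2 + t2^2\<close> and
  \<open>2 d (r - s)\<close> as that of \<open>t1 t2\<close>. These are the third and fourth
  coordinates of the twist, and their coefficients are read off from the cubic.\<close>

lemma twist_F1_normal:
  fixes f :: "(4, 'k::field) mpoly" and A :: "'k alg_closure ^ 4 ^ 4"
  assumes d: "d \<noteq> 0" "d^2 = to_ac a"
    and A: "invertible A" and eq: "\<And>x. eval_poly (ac_poly f) x = F1 (A *v x)"
    and A1: "A $ 1 = vec4 d 1 0 0" and A2: "A $ 2 = vec4 (- d) 1 0 0"
  shows "lin_equiv (std1_twist a) f"
proof -
  define r s where "r = A $ 3" and "s = A $ 4"
  define n m where "n = (\<chi> i. r $ i + s $ i)" and "m = (\<chi> i. 2 * d * (r $ i - s $ i))"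
  define c where "c = to_ac a"
  have c: "d^2 = c" "rat c" "c \<noteq> 0" using d by (auto simp: c_def)
  have F: "eval_poly (ac_poly f) x = (m$1 * x$1 + m$2 * x$2 + m$3 * x$3 + m$4 * x$4) * (x$1 * x$2) +
    (n$1 * x$1 + n$2 * x$2 + n$3 * x$3 + n$4 * x$4) * (c * x$1^2 + x$2^2)" for x
    unfolding eq F1_def mult_vec_nth_4 A1 A2 r_def[symmetric] s_def[symmetric] vec4_nth n_def m_def vec_lambda_beta c(1)[symmetric]
    by Groebner_Basis.algebra
  note line = rat_line[where f = f, unfolded F]
  have 1: "rat (n$2)" "rat (n$3)"
    using line(1,2)[of "vec4 0 1 0 0" "vec4 0 0 1 0" "n$2" "n$3" 0 0] by (simp_all add: algebra_simps)
  have 2: "rat (n$4)"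
    using line(2)[of "vec4 0 1 0 0" "vec4 0 0 0 1" "n$2" "n$4" 0 0] by (simp add: algebra_simps)
  have 3: "rat (c * n$1)" "rat (m$1 + c * n$2)" "rat (n$1 + m$2)"
    using line(1,2,3)[of "vec4 1 0 0 0" "vec4 0 1 0 0" "c * n$1" "m$1 + c * n$2" "n$1 + m$2" "n$2"]
    by (simp_all add: algebra_simps power2_eq_square power3_eq_cube)
  have 4: "rat (m$3 + n$3 * (1 + c))"
    using line(2)[of "vec4 1 1 0 0" "vec4 0 0 1 0" "m$1 + m$2 + (n$1 + n$2) * (1 + c)" "m$3 + n$3 * (1 + c)" 0 0]
    by (simp add: algebra_simps)
  have 5: "rat (m$4 + n$4 * (1 + c))"
    using line(2)[of "vec4 1 1 0 0" "vec4 0 0 0 1" "m$1 + m$2 + (n$1 + n$2) * (1 + c)" "m$4 + n$4 * (1 + c)" 0 0]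
    by (simp add: algebra_simps)
  have n1: "rat (n$1)" by (rule rat_cancel_left[OF 3(1) c(2,3)])
  have m: "rat (m$1)" "rat (m$2)" "rat (m$3)" "rat (m$4)"
  proof -
    have rc: "rat (1 + c)" by (intro rat_add rat_1 c(2))
    show "rat (m$1)" using rat_diff[OF 3(2) rat_mult[OF c(2) 1(1)]] by simp
    show "rat (m$2)" using rat_diff[OF 3(3) n1] by simp
    show "rat (m$3)" using rat_diff[OF 4 rat_mult[OF 1(2) rc]] by simp
    show "rat (m$4)" using rat_diff[OF 5 rat_mult[OF 2 rc]] by simp
  qed
  show ?thesis
  proof (rule lin_equivI_rat[where k = 1 and Q = "vec4 (vec4 1 0 0 0) (vec4 0 1 0 0) m n"])
    show "ratv (vec4 (vec4 1 0 0 0) (vec4 0 1 0 0) m n $ i)" for i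
    proof -
      have "rat (n $ j)" "rat (m $ j)" for j
        using exhaust_4[of j] 1 2 n1 m by auto
      then show ?thesis using exhaust_4[of i] by (auto simp: ratv_def[of n] ratv_def[of m])
    qed
    show "\<not> degenerate (eval_poly (ac_poly f))"
      by (rule not_degenerate_comp[OF A eq not_degenerate_std(1)])
    show "eval_poly (ac_poly f) x = 1 * eval_poly (ac_poly (std1_twist a)) (vec4 (vec4 1 0 0 0) (vec4 0 1 0 0) m n *v x)" for x
      unfolding F ac_std eval_std mult_vec_nth_4 vec4_nth c_def[symmetric] by Groebner_Basis.algebra
  qed simp_all
qed

text \<open>The Hessian determinant is a constant times the squared product of rows 1 and 2.
  Expanded along rational lines through \<open>e\<close>, where both rows have the value 1, it shows
  that the sum and the product of the two rows are rational on rational vectors. So the rows are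
  \<open>n + d m\<close> and \<open>n - d m\<close> with rational forms \<open>n\<close>,
  \<open>m\<close> and rational \<open>d^2\<close>.\<close>

lemma twist_F1_based:
  fixes f :: "(4, 'k::field) mpoly"
  assumes two: "(2 :: 'k alg_closure) \<noteq> 0"
    and A: "invertible A" and eq: "\<And>x. eval_poly (ac_poly f) x = F1 (A *v x)"
    and e: "ratv e" "(A *v e) $ 1 = 1" "(A *v e) $ 2 = 1"
  shows "\<exists>a. a \<noteq> 0 \<and> lin_equiv (std1_twist a) f"
proof -
  have four: "(4 :: 'k alg_closure) \<noteq> 0" and sixteen: "(16 :: 'k alg_closure) \<noteq> 0"
    using two power_eq_0_iff[of "2 :: 'k alg_closure" 2] power_eq_0_iff[of "2 :: 'k alg_closure" 4] by simp_all
  define k where "k = det A ^ 2 * 16"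
  have k: "k \<noteq> 0" using A sixteen by (simp add: k_def invertible_det_nz)
  have sp: "rat ((A *v v) $ 1 + (A *v v) $ 2)" "rat ((A *v v) $ 1 * (A *v v) $ 2)" if v: "ratv v" for v
  proof -
    let ?b = "(A *v v) $ 1 + (A *v v) $ 2" and ?c = "(A *v v) $ 1 * (A *v v) $ 2"
    have q: "(A *v (e + t *s v)) $ 1 * (A *v (e + t *s v)) $ 2 = 1 + ?b * t + ?c * t^2" for t
      unfolding matrix_vector_axpy vector_add_component vector_smult_component e by Groebner_Basis.algebra
    note h = hessian_rational[where q = "\<lambda>p. p $ 1 * p $ 2", OF eq tri_F1 hess_linear(1) det_hess_F1 e(1) v q, folded k_def]
    have rk: "rat k" using h(1) by simp
    have rb: "rat ?b"
    proof (rule rat_cancel_left)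
      show "rat ((k * 2) * ?b)" using h(2) by (simp add: mult_ac)
    qed (use k two in \<open>auto intro: rat_mult rk\<close>)
    have "rat (?b^2 + 2 * 1 * ?c)" by (rule rat_cancel_left[OF h(3) rk k])
    from rat_diff[OF this rat_power[OF rb, of 2]] have "rat (2 * ?c)" by simp
    then show "rat ?b" "rat ?c" using rb rat_cancel_left[of 2 ?c] two by auto
  qed
  define a b where "a = A $ 1" and "b = A $ 2"
  define \<delta> where "\<delta> j = a $ j - b $ j" for j
  have sq: "rat (((A *v v) $ 1 - (A *v v) $ 2)^2)" if "ratv v" for v
  proof -
    have "((A *v v) $ 1 - (A *v v) $ 2)^2 = ((A *v v) $ 1 + (A *v v) $ 2)^2 - 4 * ((A *v v) $ 1 * (A *v v) $ 2)"
      by Groebner_Basis.algebra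
    also have "rat \<dots>" by (intro rat_diff rat_power rat_mult[OF rat_numeral] sp that)
    finally show ?thesis .
  qed
  \<comment> \<open>Polarisation of the squared difference of the two rows, which is rational as sum
    squared minus four times the product.\<close>
  have r\<delta>: "rat (\<delta> i * \<delta> j)" for i j
  proof -
    have "ratv (axis i 1 + 1 *s axis j 1)" by (auto simp: ratv_def axis_def intro: rat_add)
    from sq[OF this] have s: "rat ((\<delta> i + \<delta> j)^2)"
      unfolding matrix_vector_axpy vector_add_component vector_smult_component mv_axis by (simp add: \<delta>_def a_def b_def algebra_simps)
    have sq': "rat (\<delta> l ^ 2)" for l using sq[of "axis l 1"] by (simp add: mv_axis \<delta>_def a_def b_def)
    have "\<delta> i * \<delta> j = ((\<delta> i + \<delta> j)^2 - \<delta> i ^ 2 - \<delta> j ^ 2) / 2"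
      using two by (simp add: power2_sum)
    also have "rat \<dots>" by (intro rat_divide rat_diff rat_numeral s sq')
    finally show ?thesis .
  qed
  have rs: "rat (a $ j + b $ j)" for j using sp(1)[of "axis j 1"] by (simp add: mv_axis a_def b_def)
  obtain w where w: "\<delta> w \<noteq> 0"
  proof (rule ccontr)
    assume "\<not> thesis"
    with that have "1 *s A $ 1 + (- 1) *s A $ 2 = 0" by (auto simp: vec_eq_iff \<delta>_def a_def b_def)
    from rows_independent(1)[OF A _ this] show False by simp
  qed
  define d where "d = \<delta> w / 2"
  have d: "d \<noteq> 0" using w two by (simp add: d_def)
  have "d^2 = \<delta> w * \<delta> w / 4" by (simp add: d_def power2_eq_square)
  also have "rat \<dots>" by (intro rat_divide r\<delta> rat_numeral)
  finally obtain c where c: "d^2 = to_ac c" by (rule ratE)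
  define m n where "m = (\<chi> j. \<delta> j / \<delta> w)" and "n = (\<chi> j. (a $ j + b $ j) / 2)"
  have "rat (\<delta> j / \<delta> w)" for j
  proof -
    have "\<delta> j / \<delta> w = (\<delta> j * \<delta> w) / (\<delta> w * \<delta> w)" using w by simp
    also have "rat \<dots>" by (intro rat_divide r\<delta>)
    finally show ?thesis .
  qed
  then have "ratv m" by (simp add: ratv_def m_def)
  then obtain m' where m': "m = ac_vec m'" by (rule ratvE)
  have "ratv n" by (auto simp: ratv_def n_def intro!: rat_divide rs)
  then obtain n' where n': "n = ac_vec n'" by (rule ratvE)
  have ab: "a = d *s m + 1 *s n" "b = (- d) *s m + 1 *s n"
  proof -
    have "d * m $ j = \<delta> j / 2" for j using w by (simp add: m_def d_def)
    then have dm: "d * m $ j = (a $ j - b $ j) / 2" for j by (simp add: \<delta>_def)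
    show "a = d *s m + 1 *s n" "b = (- d) *s m + 1 *s n"
      using two by (simp_all add: vec_eq_iff dm) (simp_all add: n_def field_simps)
  qed
  have mn: "m = (1 / (2 * d)) *s a + (- 1 / (2 * d)) *s b" "n = (1 / 2) *s a + (1 / 2) *s b"
  proof -
    have dw: "2 * d = \<delta> w" using two by (simp add: d_def)
    have "m $ j = 1 / \<delta> w * a $ j + - 1 / \<delta> w * b $ j" for j
      by (simp add: m_def \<delta>_def[of j] diff_divide_distrib)
    then show "m = (1 / (2 * d)) *s a + (- 1 / (2 * d)) *s b" unfolding dw by (simp add: vec_eq_iff)
    show "n = (1 / 2) *s a + (1 / 2) *s b" by (simp add: vec_eq_iff n_def add_divide_distrib)
  qed
  have ind: "p = 0 \<and> q = 0" if pq: "p *s m' + q *s n' = 0" for p q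
  proof -
    have "ac_vec (p *s m' + q *s n') = to_ac p *s m + to_ac q *s n"
      unfolding m' n' by (simp add: vec_eq_iff)
    then have "to_ac p *s m + to_ac q *s n = 0" unfolding pq by (simp add: vec_eq_iff)
    then have z: "(to_ac p / (2 * d) + to_ac q / 2) *s A $ 1 + (to_ac q / 2 - to_ac p / (2 * d)) *s A $ 2 = 0"
      unfolding mn by (simp add: vec_eq_iff a_def b_def algebra_simps)
    have "to_ac p / (2 * d) + to_ac q / 2 = 0" "to_ac q / 2 - to_ac p / (2 * d) = 0"
      using rows_independent[OF A _ z] by simp_all
    then show ?thesis using two d by (auto simp: field_simps)
  qed
  obtain R :: "'k ^ 4 ^ 4" where R: "invertible R" "R $ 1 = m'" "R $ 2 = n'" by (rule invertible_rows[OF ind])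
  obtain f' A' where f': "lin_equiv f f'" "invertible A'" "\<forall>x. eval_poly (ac_poly f') x = F1 (A' *v x)"
    "\<forall>i k1 k2. A $ i = k1 *s ac_vec (R $ 1) + k2 *s ac_vec (R $ 2) \<longrightarrow> A' $ i = vec4 k1 k2 0 0"
    by (rule change_coords[OF A eq R(1)])
  have A'1: "A' $ 1 = vec4 d 1 0 0" and A'2: "A' $ 2 = vec4 (- d) 1 0 0"
    using f'(4) ab unfolding R m'[symmetric] n'[symmetric] a_def b_def by blast+
  have "lin_equiv (std1_twist c) f'" by (rule twist_F1_normal[OF d c f'(2) f'(3)[rule_format] A'1 A'2])
  moreover have "c \<noteq> 0" using c d by auto
  ultimately show ?thesis using lin_equiv_trans lin_equiv_sym[OF f'(1)] by blast
qed

text \<open>Two nonzero linear forms are simultaneously nonzero at some unit vector or sum of two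
  unit vectors, hence at a rational vector \<open>e\<close>.\<close>

lemma twist_F1_char_not_2:
  fixes f :: "(4, 'k::field) mpoly" and A :: "'k alg_closure ^ 4 ^ 4"
  assumes two: "(2 :: 'k alg_closure) \<noteq> 0"
    and A: "invertible A" and eq: "\<And>x. eval_poly (ac_poly f) x = F1 (A *v x)"
  shows "\<exists>a. a \<noteq> 0 \<and> lin_equiv (std1_twist a) f"
proof -
  obtain i where i: "A $ 1 $ i \<noteq> 0" using invertible_row_nonzero[OF A, of 1] by (auto simp: vec_eq_iff)
  obtain j where j: "A $ 2 $ j \<noteq> 0" using invertible_row_nonzero[OF A, of 2] by (auto simp: vec_eq_iff)
  have "\<exists>e. ratv e \<and> (A *v e) $ 1 \<noteq> 0 \<and> (A *v e) $ 2 \<noteq> 0"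
  proof (cases "A $ 2 $ i = 0 \<and> A $ 1 $ j = 0")
    case True
    have "ratv (axis i 1 + 1 *s axis j 1)" by (auto simp: ratv_def axis_def intro: rat_add)
    moreover have "(A *v (axis i 1 + 1 *s axis j 1)) $ 1 \<noteq> 0" "(A *v (axis i 1 + 1 *s axis j 1)) $ 2 \<noteq> 0"
      unfolding matrix_vector_axpy vector_add_component vector_smult_component mv_axis using True i j by simp_all
    ultimately show ?thesis by blast
  next
    case False
    with i j show ?thesis using ratv_axis[of i] ratv_axis[of j] mv_axis[of A i] mv_axis[of A j] by metis
  qed
  then obtain e where e: "ratv e" "(A *v e) $ 1 \<noteq> 0" "(A *v e) $ 2 \<noteq> 0" by blast
  define p q where "p = (A *v e) $ 1" and "q = (A *v e) $ 2"
  have pq: "p \<noteq> 0" "q \<noteq> 0" using e by (simp_all add: p_def q_def)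
  \<comment> \<open>Dividing rows 1 and 2 by their values at \<open>e\<close> is compensated in rows
    3 and 4 by the squares of these values, so \<open>F1\<close> is unchanged.\<close>
  have inv: "invertible (diag4 (1/p) (1/q) (p^2) (q^2) ** A)" using pq A by (intro invertible_diag4) auto
  show ?thesis
  proof (rule twist_F1_based[OF two inv _ e(1)])
    show "eval_poly (ac_poly f) x = F1 ((diag4 (1/p) (1/q) (p^2) (q^2) ** A) *v x)" for x
      unfolding eq diag4_mult using pq by (simp add: F1_def power_divide)
    show "(diag4 (1/p) (1/q) (p^2) (q^2) ** A *v e) $ 1 = 1" "(diag4 (1/p) (1/q) (p^2) (q^2) ** A *v e) $ 2 = 1"
      unfolding diag4_mult using pq by (simp_all add: p_def q_def)
  qed
qed

section \<open>Explicit twists and the square class of their parameter\<close>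

definition twist_mat :: "'a::field \<Rightarrow> 'a ^ 4 ^ 4" where
  "twist_mat b = vec4 (vec4 b 1 0 0) (vec4 (- b) 1 0 0) (vec4 0 0 (1 / (4 * b)) (1 / 2)) (vec4 0 0 (- 1 / (4 * b)) (1 / 2))"

text \<open>The last two rows solve \<open>r + s = t4\<close> and \<open>2 b (r - s) = t3\<close>,
  reversing the expansion used in \<open>twist_F1_normal\<close>.\<close>

lemma F1_twist_mat:
  assumes "(2 :: 'a::field) \<noteq> 0" "b \<noteq> 0"
  shows "F1 (twist_mat b *v x) = x$3 * (x$1 * x$2) + x$4 * (b^2 * x$1^2 + (x$2 :: 'a)^2)"
proof -
  define u v where "u = x$3 / (4 * b)" and "v = x$4 / 2"
  have "(4 :: 'a) \<noteq> 0" using assms(1) power_eq_0_iff[of "2 :: 'a" 2] by simp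
  then have "x$3 = 4 * b * u" "x$4 = 2 * v" using assms by (simp_all add: u_def v_def)
  moreover have "F1 (twist_mat b *v x) = (u + v) * (b * x$1 + x$2)^2 + (v - u) * (x$2 - b * x$1)^2"
    unfolding F1_def twist_mat_def mult_vec_nth_4 vec4_nth by (simp add: u_def v_def)
  ultimately show ?thesis by Groebner_Basis.algebra
qed

lemma invertible_twist_mat:
  assumes "(2 :: 'a::field) \<noteq> 0" "b \<noteq> (0 :: 'a)" shows "invertible (twist_mat b)"
  unfolding invertible_iff_ker
proof (intro allI impI)
  fix x assume "twist_mat b *v x = 0"
  then have z: "(twist_mat b *v x) $ i = 0" for i by simp
  have 1: "b * x$1 + x$2 = 0" using z[of 1] by (simp add: mult_vec_nth_4 twist_mat_def)
  have 2: "- b * x$1 + x$2 = 0" using z[of 2] by (simp add: mult_vec_nth_4 twist_mat_def)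
  define u v where "u = x$3 / (4 * b)" and "v = x$4 / 2"
  have 3: "u + v = 0" using z[of 3] by (simp add: mult_vec_nth_4 twist_mat_def u_def v_def)
  have 4: "- u + v = 0" using z[of 4] by (simp add: mult_vec_nth_4 twist_mat_def u_def v_def)
  have "(4 :: 'a) \<noteq> 0" using assms(1) power_eq_0_iff[of "2 :: 'a" 2] by simp
  moreover have "2 * x$2 = 0" "2 * (b * x$1) = 0" "2 * v = 0" "2 * u = 0"
    using 1 2 3 4 by Groebner_Basis.algebra+
  ultimately show "x = 0" using assms by (simp add: vec4_eq_iff u_def v_def)
qed

lemma std1_twist_square:
  fixes b :: "'k::field"
  assumes two: "(2 :: 'k alg_closure) \<noteq> 0" and b: "b \<noteq> 0" shows "lin_equiv std1 (std1_twist (b^2))"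
proof -
  have tb: "to_ac b \<noteq> 0" using b by simp
  have eq: "eval_poly (ac_poly (std1_twist (b^2))) x = F1 (twist_mat (to_ac b) *v x)" for x
    using F1_twist_mat[OF two tb] by simp
  show ?thesis
  proof (rule lin_equivI_rat[where Q = "twist_mat (to_ac b)" and k = 1])
    show "ratv (twist_mat (to_ac b) $ i)" for i
      using exhaust_4[of i] by (auto simp: twist_mat_def intro!: rat_intros)
    show "\<not> degenerate (eval_poly (ac_poly (std1_twist (b^2))))"
      by (rule not_degenerate_comp[OF invertible_twist_mat[OF two tb] eq not_degenerate_std(1)])
  qed (simp_all add: F1_twist_mat[OF two tb])
qed

lemma std1_twist_ac:
  fixes a :: "'k::field"
  assumes two: "(2 :: 'k alg_closure) \<noteq> 0" and a: "a \<noteq> 0"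
  shows "lin_equiv (ac_poly std1) (ac_poly (std1_twist a))"
proof -
  obtain b where b: "b^2 = to_ac a" using alg_closed_root[of 2 "to_ac a"] by auto
  with a have b0: "b \<noteq> 0" by auto
  have "feq F1 (eval_poly (ac_poly (std1_twist a)))"
    unfolding feq_def
    by (rule exI[of _ "twist_mat b"], rule exI[of _ 1]) (simp add: F1_twist_mat[OF two b0] invertible_twist_mat[OF two b0] b)
  then show ?thesis by (simp add: lin_equiv_iff_feq eval_std_fun)
qed

lemma tri_std1_twist:
  "tri (eval_poly (std1_twist (a :: 'a::field))) (axis 3 1) y z = y$1 * z$2 + y$2 * z$1"
  "tri (eval_poly (std1_twist a)) (axis 4 1) y z = 2 * (a * y$1 * z$1 + y$2 * z$2)"
  "y$1 = 0 \<Longrightarrow> y$2 = 0 \<Longrightarrow> tri (eval_poly (std1_twist a)) x y y = 0"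
  unfolding tri_def eval_std vector_add_component by (simp_all add: axis_def algebra_simps power2_eq_square)

text \<open>For \<open>F1\<close> the first two unit vectors are orthogonal with respect to every
  bilinear form \<open>tri F1 p\<close>, because no monomial contains t1 t2. Their preimages
  \<open>u\<close> and \<open>w\<close> over \<open>K\<close> have the same property for the twist,
  and the two resulting equations give \<open>a = (u2 / u1)^2\<close>.\<close>

lemma std1_twist_nonsquare:
  fixes a :: "'k::field"
  assumes two: "(2 :: 'k alg_closure) \<noteq> 0" and eq: "lin_equiv std1 (std1_twist a)" shows "is_square a"
proof -
  obtain A :: "'k ^ 4 ^ 4" and c where A: "invertible A" "c \<noteq> 0"
    "\<And>x. eval_poly (std1_twist (to_ac a)) x = to_ac c * F1 (ac_mat A *v x)"
    using eq unfolding lin_equiv_iff_ac by auto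
  obtain B where B: "\<And>x. A *v (B *v x) = x" using invertible_inverse[OF A(1)] by metis
  have tri: "tri (eval_poly (std1_twist (to_ac a))) p (ac_vec (B *v y)) (ac_vec (B *v z)) =
      to_ac c * tri F1 (ac_mat A *v p) (ac_vec y) (ac_vec z)" for p y z
    using tri_transform[of "eval_poly (std1_twist (to_ac a))" "to_ac c" F1 "ac_mat A", OF A(3)] by (simp add: ac_mat_mv B)
  define u w where "u = B *v axis 1 1" and "w = B *v axis 2 1"
  have uw: "tri (eval_poly (std1_twist (to_ac a))) p (ac_vec u) (ac_vec w) = 0" for p
    unfolding u_def w_def tri by (simp add: tri_def F1_def axis_def)
  have "to_ac (u$1 * w$2 + u$2 * w$1) = 0" using uw[of "axis 3 1"] unfolding tri_std1_twist by simp
  then have 1: "u$1 * w$2 + u$2 * w$1 = 0" unfolding to_ac_eq_0_iff .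
  have "2 * to_ac (a * u$1 * w$1 + u$2 * w$2) = 0" using uw[of "axis 4 1"] unfolding tri_std1_twist by simp
  then have "to_ac (a * u$1 * w$1 + u$2 * w$2) = 0" using two by (simp only: mult_eq_0_iff simp_thms)
  then have 2: "a * u$1 * w$1 + u$2 * w$2 = 0" unfolding to_ac_eq_0_iff .
  \<comment> \<open>With both coordinates 0, \<open>u\<close> would be isotropic for all these
    forms, whereas the first unit vector has the nonzero value 2 for the form at the third
    one.\<close>
  have "u$1 \<noteq> 0 \<or> u$2 \<noteq> 0"
  proof (rule ccontr)
    assume "\<not> ?thesis"
    then have "tri (eval_poly (std1_twist (to_ac a))) (ac_vec (B *v axis 3 1)) (ac_vec u) (ac_vec u) = 0"
      by (intro tri_std1_twist(3)) auto
    then show False using two A(2)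
      unfolding u_def tri ac_mat_mv B by (simp add: tri_def F1_def axis_def)
  qed
  moreover have "w$1 \<noteq> 0 \<or> w$2 \<noteq> 0"
  proof (rule ccontr)
    assume "\<not> ?thesis"
    then have "tri (eval_poly (std1_twist (to_ac a))) (ac_vec (B *v axis 4 1)) (ac_vec w) (ac_vec w) = 0"
      by (intro tri_std1_twist(3)) auto
    then show False using two A(2)
      unfolding w_def tri ac_mat_mv B by (simp add: tri_def F1_def axis_def)
  qed
  ultimately have nz: "u$1 \<noteq> 0" "w$1 \<noteq> 0" using 1 2 by auto
  have "w$1 * (a * u$1^2 - u$2^2) = 0" using 1 2 by Groebner_Basis.algebra
  with nz have "a = (u$2 / u$1)^2" by (simp add: power_divide field_simps)
  then show ?thesis unfolding is_nth_power_def by blast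
qed

theorem twists_std1_char_not_2:
  fixes f :: "(4, 'k::field) mpoly"
  assumes two: "(2 :: 'k alg_closure) \<noteq> 0"
  shows "is_twist std1 f \<longleftrightarrow> (\<exists>a. a \<noteq> 0 \<and> \<not> is_square a \<and> lin_equiv (std1_twist a) f)"
proof
  assume tw: "is_twist std1 f"
  then have "feq F1 (eval_poly (ac_poly f))" by (simp add: is_twist_def lin_equiv_iff_feq eval_std_fun)
  then obtain A where A: "invertible A" "\<forall>x. eval_poly (ac_poly f) x = F1 (A *v x)" by (rule feq_F1_absorb)
  obtain a where a: "a \<noteq> 0" "lin_equiv (std1_twist a) f"
    using twist_F1_char_not_2[OF two A(1) A(2)[rule_format]] by blast
  have "\<not> is_square a"
  proof
    assume "is_square a"
    then obtain b where b: "a = b^2" by (auto simp: is_nth_power_def)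
    with a(1) have "b \<noteq> 0" by auto
    from lin_equiv_trans[OF std1_twist_square[OF two this] a(2)[unfolded b]] tw show False
      by (simp add: is_twist_def)
  qed
  with a show "\<exists>a. a \<noteq> 0 \<and> \<not> is_square a \<and> lin_equiv (std1_twist a) f" by blast
next
  assume "\<exists>a. a \<noteq> 0 \<and> \<not> is_square a \<and> lin_equiv (std1_twist a) f"
  then obtain a where a: "a \<noteq> 0" "\<not> is_square a" "lin_equiv (std1_twist a) f" by blast
  have "lin_equiv (ac_poly std1) (ac_poly f)"
    by (rule lin_equiv_trans[OF std1_twist_ac[OF two a(1)] lin_equiv_ac_poly[OF a(3)]])
  moreover have "\<not> lin_equiv std1 f"
  proof
    assume "lin_equiv std1 f"
    from lin_equiv_trans[OF this lin_equiv_sym[OF a(3)]] have "is_square a" by (rule std1_twist_nonsquare[OF two])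
    with a(2) show False by blast
  qed
  ultimately show "is_twist std1 f" by (simp add: is_twist_def)
qed

theorem proposition2p1:
  shows
    "(\<forall>f :: (4, 'k::field) mpoly.
        ruled_cubic_noncone f \<longleftrightarrow>
          (\<exists>s\<in>standard_equations. lin_equiv s f \<or> is_twist s f)) \<and>
     (\<forall>s\<in>standard_equations. \<forall>s'\<in>standard_equations.
        s \<noteq> s' \<longrightarrow> \<not> lin_equiv (ac_poly s) (ac_poly (s' :: (4, 'k) mpoly))) \<and>
     (CHAR('k) = 2 \<and> (\<forall>x::'k. is_square x) \<longrightarrow>
        (\<nexists>f :: (4, 'k) mpoly. is_twist std1 f)) \<and>
     (CHAR('k) \<noteq> 2 \<longrightarrow>
        (\<forall>f :: (4, 'k) mpoly. is_twist std1 f \<longleftrightarrow>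
           (\<exists>a. a \<noteq> 0 \<and> \<not> is_square a \<and> lin_equiv (std1_twist a) f))) \<and>
     (\<nexists>f :: (4, 'k) mpoly. is_twist std2 f) \<and>
     (CHAR('k) = 2 \<and> (\<forall>x::'k. is_square x) \<longrightarrow>
        (\<nexists>f :: (4, 'k) mpoly. is_twist std3 f))"
proof (intro conjI)
  have two: "CHAR('k) = 2 \<longleftrightarrow> (2 :: 'k alg_closure) = 0"
    using CHAR_2_iff[where 'a = "'k alg_closure"] by simp
  \<comment> \<open>Being equivalent over \<open>K\<close> or a twist amounts to being equivalent
    over the closure.\<close>
  have form: "lin_equiv s f \<or> is_twist s f \<longleftrightarrow> lin_equiv (ac_poly s) (ac_poly f)" for s f :: "(4, 'k) mpoly"
    using lin_equiv_ac_poly by (auto simp: is_twist_def)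
  have std: "s \<in> {std1, std2, std3}" if "s \<in> standard_equations" for s :: "(4, 'k) mpoly"
    using that by (auto simp: standard_equations_def split: if_splits)
  show "\<forall>f :: (4, 'k) mpoly. ruled_cubic_noncone f \<longleftrightarrow> (\<exists>s\<in>standard_equations. lin_equiv s f \<or> is_twist s f)"
    unfolding form using ruled_cubic_classification std_ruled_cubic_noncone[OF std] by blast
  show "\<forall>s\<in>standard_equations. \<forall>s'\<in>standard_equations. s \<noteq> s' \<longrightarrow> \<not> lin_equiv (ac_poly s) (ac_poly (s' :: (4, 'k) mpoly))"
    using standard_equations_inequivalent by blast
  show "CHAR('k) = 2 \<and> (\<forall>x::'k. is_square x) \<longrightarrow> (\<nexists>f :: (4, 'k) mpoly. is_twist std1 f)"
    unfolding two is_twist_def using no_twist_std1_char_2 by blast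
  show "CHAR('k) \<noteq> 2 \<longrightarrow> (\<forall>f :: (4, 'k) mpoly. is_twist std1 f \<longleftrightarrow>
      (\<exists>a. a \<noteq> 0 \<and> \<not> is_square a \<and> lin_equiv (std1_twist a) f))"
    unfolding two using twists_std1_char_not_2 by blast
  show "\<nexists>f :: (4, 'k) mpoly. is_twist std2 f"
    unfolding is_twist_def using no_twist_std2 by blast
  show "CHAR('k) = 2 \<and> (\<forall>x::'k. is_square x) \<longrightarrow> (\<nexists>f :: (4, 'k) mpoly. is_twist std3 f)"
    unfolding two is_twist_def using no_twist_std3_char_2 by blast
qed

end
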